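(* Let $\Bbbk$ be a field and let $A$ be a basic, finite-dimensional $\Bbbk$-algebra which is a Nakayama algebra. Fix an element $x_S\in\mathsf{K}_0(\mathsf{mod}\,A)$ for each (isomorphism class of) simple projective module $S\in\mathsf{mod}\,A$. Then the unique morphism $\Phi\in\operatorname{End}_{\mathbb Z}(\mathsf{K}_0(\mathsf{mod}\,A))$ with $$\Phi[S]=\begin{cases}[\tau_A S] & \text{for } S\in\mathsf{mod}\,A \text{ simple and non-projective},\\ x_S & \text{for } S\in\mathsf{mod}\,A\text{ simple and projective},\end{cases}$$ is a $\tau$-map for $A$. If $A$ has no projective simple modules, then $A$ has a unique $\tau$-map.
   Context: Modules are right modules; $\mathsf{mod}\,A$ is the category of finitely generated $A$-modules, $\tau_A$ is the Auslander--Reiten translation on $\mathsf{mod}\,A$, and $[M]$ denotes the class of $M$ in the Grothendieck group $\mathsf{K}_0(\mathsf{mod}\,A)$ (which is free abelian on the classes of the simple $A$-modules). A $\tau$-map for $A$ is an endomorphism $\Phi\in\operatorname{End}_{\mathbb Z}(\mathsf{K}_0(\mathsf{mod}\,A))$ such that $\Phi[M]=[\tau_A M]$ for all non-projective indecomposable $A$-modules $M\in\mathsf{mod}\,A$. A finite-dimensional $\Bbbk$-algebra is a Nakayama algebra if its indecomposable projective and its indecomposable injective modules are uniserial. *)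

theory Defs
  imports "HOL-Algebra.Module" "HOL-Algebra.AbelCoset" "HOL-Algebra.Free_Abelian_Groups"
begin

section \<open>Modules over a possibly noncommutative ring\<close>

text \<open>
  The library locale \<open>module\<close> requires a commutative ring, but its record type can be reused.
  For a right module the term \<open>a \<odot> m\<close> denotes \<open>m a\<close>, whence the order of the factors in
  \<open>ract_assoc\<close>.  The fields \<open>mult\<close> and \<open>one\<close> of the record carry no meaning for modules.
\<close>

locale right_module = A?: ring A + M?: abelian_group M
  for A :: "('a, 'x) ring_scheme" (structure) and M :: "('a, 'm, 'y) module_scheme" (structure) +
  assumes ract_closed:
      "\<lbrakk>a \<in> carrier A; x \<in> carrier M\<rbrakk> \<Longrightarrow> a \<odot>\<^bsub>M\<^esub> x \<in> carrier M"
    and ract_l_distr: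
      "\<lbrakk>a \<in> carrier A; b \<in> carrier A; x \<in> carrier M\<rbrakk> \<Longrightarrow>
        (a \<oplus> b) \<odot>\<^bsub>M\<^esub> x = a \<odot>\<^bsub>M\<^esub> x \<oplus>\<^bsub>M\<^esub> b \<odot>\<^bsub>M\<^esub> x"
    and ract_r_distr:
      "\<lbrakk>a \<in> carrier A; x \<in> carrier M; y \<in> carrier M\<rbrakk> \<Longrightarrow>
        a \<odot>\<^bsub>M\<^esub> (x \<oplus>\<^bsub>M\<^esub> y) = a \<odot>\<^bsub>M\<^esub> x \<oplus>\<^bsub>M\<^esub> a \<odot>\<^bsub>M\<^esub> y"
    and ract_assoc:
      "\<lbrakk>a \<in> carrier A; b \<in> carrier A; x \<in> carrier M\<rbrakk> \<Longrightarrow>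
        (a \<otimes> b) \<odot>\<^bsub>M\<^esub> x = b \<odot>\<^bsub>M\<^esub> (a \<odot>\<^bsub>M\<^esub> x)"
    and ract_one:
      "x \<in> carrier M \<Longrightarrow> \<one> \<odot>\<^bsub>M\<^esub> x = x"

definition finitely_generated ::
    "('a, 'x) ring_scheme \<Rightarrow> ('a, 'm, 'y) module_scheme \<Rightarrow> bool" where
  "finitely_generated A M \<longleftrightarrow>
    (\<exists>X. finite X \<and> X \<subseteq> carrier M \<and>
      (\<forall>m\<in>carrier M. \<exists>c\<in>X \<rightarrow> carrier A. m = (\<Oplus>\<^bsub>M\<^esub>x\<in>X. c x \<odot>\<^bsub>M\<^esub> x)))"

definition module_hom ::
    "('a, 'x) ring_scheme \<Rightarrow> ('a, 'm, 'y) module_scheme \<Rightarrow> ('a, 'n, 'z) module_scheme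
      \<Rightarrow> ('m \<Rightarrow> 'n) set" where
  "module_hom A M N =
    {f \<in> carrier M \<rightarrow>\<^sub>E carrier N.
      (\<forall>x\<in>carrier M. \<forall>y\<in>carrier M. f (x \<oplus>\<^bsub>M\<^esub> y) = f x \<oplus>\<^bsub>N\<^esub> f y) \<and>
      (\<forall>a\<in>carrier A. \<forall>x\<in>carrier M. f (a \<odot>\<^bsub>M\<^esub> x) = a \<odot>\<^bsub>N\<^esub> f x)}"

definition module_iso ::
    "('a, 'x) ring_scheme \<Rightarrow> ('a, 'm, 'y) module_scheme \<Rightarrow> ('a, 'n, 'z) module_scheme \<Rightarrow> bool" where
  "module_iso A M N \<longleftrightarrow> (\<exists>f\<in>module_hom A M N. bij_betw f (carrier M) (carrier N))"

definition regular_module :: "('a, 'x) ring_scheme \<Rightarrow> ('a, 'a) module" where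
  "regular_module A =
    \<lparr>carrier = carrier A, monoid.mult = undefined, one = undefined,
     ring.zero = \<zero>\<^bsub>A\<^esub>, ring.add = (\<oplus>\<^bsub>A\<^esub>), smult = (\<lambda>a x. x \<otimes>\<^bsub>A\<^esub> a)\<rparr>"

definition quotient_module :: "('a, 'm, 'y) module_scheme \<Rightarrow> 'm set \<Rightarrow> ('a, 'm set) module" where
  "quotient_module M U =
    \<lparr>carrier = a_rcosets\<^bsub>M\<^esub> U, monoid.mult = undefined, one = undefined,
     ring.zero = U, ring.add = set_add M, smult = (\<lambda>a X. \<Union>x\<in>X. U +>\<^bsub>M\<^esub> (a \<odot>\<^bsub>M\<^esub> x))\<rparr>"

definition simple_module :: "('a, 'x) ring_scheme \<Rightarrow> ('a, 'm, 'y) module_scheme \<Rightarrow> bool" where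
  "simple_module A M \<longleftrightarrow>
    carrier M \<noteq> {\<zero>\<^bsub>M\<^esub>} \<and> (\<forall>U. submodule U A M \<longrightarrow> U = {\<zero>\<^bsub>M\<^esub>} \<or> U = carrier M)"

definition indecomposable_module :: "('a, 'x) ring_scheme \<Rightarrow> ('a, 'm, 'y) module_scheme \<Rightarrow> bool" where
  "indecomposable_module A M \<longleftrightarrow>
    carrier M \<noteq> {\<zero>\<^bsub>M\<^esub>} \<and>
    (\<forall>U V. submodule U A M \<and> submodule V A M \<and> U \<inter> V = {\<zero>\<^bsub>M\<^esub>} \<and> U <+>\<^bsub>M\<^esub> V = carrier M \<longrightarrow>
      U = {\<zero>\<^bsub>M\<^esub>} \<or> V = {\<zero>\<^bsub>M\<^esub>})"

definition uniserial_module :: "('a, 'x) ring_scheme \<Rightarrow> ('a, 'm, 'y) module_scheme \<Rightarrow> bool" where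
  "uniserial_module A M \<longleftrightarrow>
    (\<forall>U V. submodule U A M \<and> submodule V A M \<longrightarrow> U \<subseteq> V \<or> V \<subseteq> U)"

definition superfluous :: "('a, 'x) ring_scheme \<Rightarrow> ('a, 'm, 'y) module_scheme \<Rightarrow> 'm set \<Rightarrow> bool" where
  "superfluous A M U \<longleftrightarrow>
    submodule U A M \<and> (\<forall>V. submodule V A M \<and> U <+>\<^bsub>M\<^esub> V = carrier M \<longrightarrow> V = carrier M)"


section \<open>The category of finitely generated modules\<close>

text \<open>
  The objects of \<open>mod A\<close> are taken with carriers in the type \<^typ>\<open>'a list\<close>.  This is no
  restriction: an element of a finitely generated module can be encoded by a list of coefficients
  with respect to a finite generating set, so that every finitely generated module, over whatever
  carrier type, is isomorphic to one of these (lemma \<open>fg_modules_representative\<close>).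
\<close>

definition fg_modules :: "('a, 'x) ring_scheme \<Rightarrow> ('a, 'a list) module set" where
  "fg_modules A = {M. right_module A M \<and> finitely_generated A M}"

lemma fg_modules_representative:
  fixes A :: "('a, 'x) ring_scheme" and M :: "('a, 'm, 'y) module_scheme"
  assumes "right_module A M" and "finitely_generated A M"
  shows "\<exists>N\<in>fg_modules A. module_iso A M N"
proof -
  interpret right_module A M by fact
  obtain X where X: "finite X" "X \<subseteq> carrier M"
    "\<And>m. m \<in> carrier M \<Longrightarrow> \<exists>c\<in>X \<rightarrow> carrier A. m = (\<Oplus>\<^bsub>M\<^esub>x\<in>X. c x \<odot>\<^bsub>M\<^esub> x)"
    using assms(2) unfolding finitely_generated_def by blast
  obtain xs where xs: "set xs = X" using X(1) finite_list by blast
  obtain co where co: "\<And>m. m \<in> carrier M \<Longrightarrow> co m \<in> X \<rightarrow> carrier A"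
    "\<And>m. m \<in> carrier M \<Longrightarrow> m = (\<Oplus>\<^bsub>M\<^esub>x\<in>X. co m x \<odot>\<^bsub>M\<^esub> x)"
    using X(3) by metis
  define e where "e m = map (co m) xs" for m
  have inj: "inj_on e (carrier M)"
  proof (rule inj_onI)
    fix m n assume mn: "m \<in> carrier M" "n \<in> carrier M" "e m = e n"
    then have eq: "\<And>x. x \<in> X \<Longrightarrow> co m x = co n x" by (auto simp: e_def xs)
    have "(\<Oplus>\<^bsub>M\<^esub>x\<in>X. co m x \<odot>\<^bsub>M\<^esub> x) = (\<Oplus>\<^bsub>M\<^esub>x\<in>X. co n x \<odot>\<^bsub>M\<^esub> x)"
      using co(1)[OF mn(2)] X(2) by (intro M.finsum_cong') (auto simp: eq intro!: ract_closed)
    then show "m = n" using co(2)[OF mn(1)] co(2)[OF mn(2)] by simp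
  qed
  define d where "d = inv_into (carrier M) e"
  have de [simp]: "d (e m) = m" if "m \<in> carrier M" for m
    using that inj by (simp add: d_def)
  define N :: "('a, 'a list) module" where
    "N = \<lparr>carrier = e ` carrier M, monoid.mult = undefined, one = undefined,
      ring.zero = e \<zero>\<^bsub>M\<^esub>, ring.add = (\<lambda>u v. e (d u \<oplus>\<^bsub>M\<^esub> d v)), smult = (\<lambda>a u. e (a \<odot>\<^bsub>M\<^esub> d u))\<rparr>"
  have N [simp]: "carrier N = e ` carrier M" "\<zero>\<^bsub>N\<^esub> = e \<zero>\<^bsub>M\<^esub>"
    "u \<oplus>\<^bsub>N\<^esub> v = e (d u \<oplus>\<^bsub>M\<^esub> d v)" "a \<odot>\<^bsub>N\<^esub> u = e (a \<odot>\<^bsub>M\<^esub> d u)" for a u v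
    by (simp_all add: N_def)
  have abN: "abelian_group N"
  proof (rule abelian_groupI)
    fix u assume "u \<in> carrier N"
    then obtain m where m: "m \<in> carrier M" "u = e m" by auto
    show "\<exists>v\<in>carrier N. v \<oplus>\<^bsub>N\<^esub> u = \<zero>\<^bsub>N\<^esub>"
      using m by (intro bexI[of _ "e (\<ominus>\<^bsub>M\<^esub> m)"]) (auto simp: M.l_neg)
  qed (auto simp: M.a_ac)
  have rmN: "right_module A N"
    by (intro right_module.intro right_module_axioms.intro abN A.ring_axioms)
       (auto simp: ract_closed ract_l_distr ract_r_distr ract_assoc ract_one)
  have fin: "(\<Oplus>\<^bsub>N\<^esub>y\<in>e ` Y. c (d y) \<odot>\<^bsub>N\<^esub> y) = e (\<Oplus>\<^bsub>M\<^esub>x\<in>Y. c x \<odot>\<^bsub>M\<^esub> x)"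
    if "finite Y" "Y \<subseteq> carrier M" "c \<in> Y \<rightarrow> carrier A" for Y c
    using that
  proof (induction Y)
    case empty
    interpret N: abelian_group N by (rule abN)
    show ?case by simp
  next
    case (insert y Y)
    interpret N: abelian_group N by (rule abN)
    have ny: "e y \<notin> e ` Y" using insert inj by (auto dest: inj_onD)
    have cl: "(\<lambda>x. c x \<odot>\<^bsub>M\<^esub> x) \<in> Y \<rightarrow> carrier M" using insert.prems by (auto intro!: ract_closed)
    have cm: "c y \<odot>\<^bsub>M\<^esub> y \<in> carrier M" using insert.prems by (auto intro!: ract_closed)
    have clN: "(\<lambda>u. c (d u) \<odot>\<^bsub>N\<^esub> u) \<in> e ` Y \<rightarrow> carrier N"
      using insert.prems by (force intro!: ract_closed)
    have "(\<Oplus>\<^bsub>N\<^esub>u\<in>e ` insert y Y. c (d u) \<odot>\<^bsub>N\<^esub> u)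
        = (c (d (e y)) \<odot>\<^bsub>N\<^esub> e y) \<oplus>\<^bsub>N\<^esub> (\<Oplus>\<^bsub>N\<^esub>u\<in>e ` Y. c (d u) \<odot>\<^bsub>N\<^esub> u)"
      unfolding image_insert
      using insert.hyps(1) insert.prems ny clN cm by (intro N.finsum_insert) auto
    also have "\<dots> = e (c y \<odot>\<^bsub>M\<^esub> y) \<oplus>\<^bsub>N\<^esub> e (\<Oplus>\<^bsub>M\<^esub>x\<in>Y. c x \<odot>\<^bsub>M\<^esub> x)"
      using insert by (subst insert.IH) auto
    also have "\<dots> = e (\<Oplus>\<^bsub>M\<^esub>x\<in>insert y Y. c x \<odot>\<^bsub>M\<^esub> x)"
      using insert.hyps cm cl by (simp add: M.finsum_insert)
    finally show ?case .
  qed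
  have "finitely_generated A N"
    unfolding finitely_generated_def
  proof (intro exI[of _ "e ` X"] conjI ballI)
    fix u assume "u \<in> carrier N"
    then obtain m where m: "m \<in> carrier M" "u = e m" by auto
    have "u = (\<Oplus>\<^bsub>N\<^esub>y\<in>e ` X. co m (d y) \<odot>\<^bsub>N\<^esub> y)"
      using fin[OF X(1,2) co(1)[OF m(1)]] co(2)[OF m(1)] m(2) by simp
    moreover have "(\<lambda>y. co m (d y)) \<in> e ` X \<rightarrow> carrier A" using co(1)[OF m(1)] X(2) by force
    ultimately show "\<exists>c\<in>e ` X \<rightarrow> carrier A. u = (\<Oplus>\<^bsub>N\<^esub>y\<in>e ` X. c y \<odot>\<^bsub>N\<^esub> y)" by (rule bexI[of _ "\<lambda>y. co m (d y)"])
  qed (use X in auto)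
  moreover have "restrict e (carrier M) \<in> module_hom A M N"
    by (auto simp: module_hom_def ract_closed)
  moreover have "bij_betw (restrict e (carrier M)) (carrier M) (carrier N)"
    using inj by (simp add: bij_betw_def inj_on_restrict_eq)
  ultimately show ?thesis using rmN unfolding fg_modules_def module_iso_def by blast
qed

definition short_exact ::
    "('a, 'x) ring_scheme \<Rightarrow> ('a, 'l, 'u) module_scheme \<Rightarrow> ('a, 'm, 'v) module_scheme
      \<Rightarrow> ('a, 'n, 'w) module_scheme \<Rightarrow> bool" where
  "short_exact A L M N \<longleftrightarrow>
    (\<exists>f\<in>module_hom A L M. \<exists>g\<in>module_hom A M N.
      inj_on f (carrier L) \<and> f ` carrier L = a_kernel M N g \<and> g ` carrier M = carrier N)"

definition projective_module :: "('a, 'x) ring_scheme \<Rightarrow> ('a, 'm, 'y) module_scheme \<Rightarrow> bool" where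
  "projective_module A P \<longleftrightarrow>
    (\<forall>M\<in>fg_modules A. \<forall>N\<in>fg_modules A. \<forall>g\<in>module_hom A M N. \<forall>f\<in>module_hom A P N.
      g ` carrier M = carrier N \<longrightarrow> (\<exists>h\<in>module_hom A P M. \<forall>x\<in>carrier P. g (h x) = f x))"

definition injective_module :: "('a, 'x) ring_scheme \<Rightarrow> ('a, 'm, 'y) module_scheme \<Rightarrow> bool" where
  "injective_module A I \<longleftrightarrow>
    (\<forall>L\<in>fg_modules A. \<forall>M\<in>fg_modules A. \<forall>g\<in>module_hom A L M. \<forall>f\<in>module_hom A L I.
      inj_on g (carrier L) \<longrightarrow> (\<exists>h\<in>module_hom A M I. \<forall>x\<in>carrier L. h (g x) = f x))"


section \<open>Finite-dimensional, basic and Nakayama algebras\<close>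

definition finite_dim_algebra ::
    "('k, 'x) ring_scheme \<Rightarrow> ('k, 'a, 'y) module_scheme \<Rightarrow> bool" where
  "finite_dim_algebra K A \<longleftrightarrow>
    field K \<and> ring A \<and> module K A \<and>
    (\<forall>c\<in>carrier K. \<forall>x\<in>carrier A. \<forall>y\<in>carrier A.
      (c \<odot>\<^bsub>A\<^esub> x) \<otimes>\<^bsub>A\<^esub> y = c \<odot>\<^bsub>A\<^esub> (x \<otimes>\<^bsub>A\<^esub> y) \<and>
      x \<otimes>\<^bsub>A\<^esub> (c \<odot>\<^bsub>A\<^esub> y) = c \<odot>\<^bsub>A\<^esub> (x \<otimes>\<^bsub>A\<^esub> y)) \<and>
    finitely_generated K A"

text \<open>
  An algebra is basic if its regular right module is an internal direct sum of pairwise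
  nonisomorphic indecomposable right ideals.
\<close>

definition basic_algebra :: "('a, 'x) ring_scheme \<Rightarrow> bool" where
  "basic_algebra A \<longleftrightarrow>
    (\<exists>I. finite I \<and>
      (\<forall>U\<in>I. submodule U A (regular_module A) \<and>
             indecomposable_module A (regular_module A\<lparr>carrier := U\<rparr>)) \<and>
      (\<forall>a\<in>carrier A. \<exists>!u. u \<in> (\<Pi>\<^sub>E U\<in>I. U) \<and> a = (\<Oplus>\<^bsub>A\<^esub>U\<in>I. u U)) \<and>
      (\<forall>U\<in>I. \<forall>V\<in>I. U \<noteq> V \<longrightarrow>
         \<not> module_iso A (regular_module A\<lparr>carrier := U\<rparr>) (regular_module A\<lparr>carrier := V\<rparr>)))"

definition nakayama_algebra :: "('a, 'x) ring_scheme \<Rightarrow> bool" where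
  "nakayama_algebra A \<longleftrightarrow>
    (\<forall>M\<in>fg_modules A. indecomposable_module A M \<and> (projective_module A M \<or> injective_module A M) \<longrightarrow>
      uniserial_module A M)"


section \<open>The Auslander--Reiten translation\<close>

definition projective_cover ::
    "('a, 'x) ring_scheme \<Rightarrow> ('a, 'a list) module \<Rightarrow> ('a list \<Rightarrow> 'a list) \<Rightarrow> ('a, 'a list) module \<Rightarrow> bool" where
  "projective_cover A P p M \<longleftrightarrow>
    P \<in> fg_modules A \<and> projective_module A P \<and> p \<in> module_hom A P M \<and>
    p ` carrier P = carrier M \<and> superfluous A P (a_kernel P M p)"

text \<open>\<open>P1 \<rightarrow> P0 \<rightarrow> M \<rightarrow> 0\<close> with maps \<open>p1\<close> and \<open>p0\<close>.\<close>

definition min_proj_presentation ::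
    "('a, 'x) ring_scheme \<Rightarrow> ('a, 'a list) module \<Rightarrow> ('a list \<Rightarrow> 'a list) \<Rightarrow> ('a, 'a list) module
      \<Rightarrow> ('a list \<Rightarrow> 'a list) \<Rightarrow> ('a, 'a list) module \<Rightarrow> bool" where
  "min_proj_presentation A P1 p1 P0 p0 M \<longleftrightarrow>
    projective_cover A P0 p0 M \<and>
    projective_cover A P1 p1 (P0\<lparr>carrier := a_kernel P0 M p0\<rparr>)"

text \<open>
  \<open>Hom\<^sub>A(P, A)\<close> for a right module \<open>P\<close>: a left module, for which \<open>a \<odot> f\<close> denotes \<open>a f\<close>.
\<close>

definition hom_to_ring ::
    "('a, 'x) ring_scheme \<Rightarrow> ('a, 'm, 'y) module_scheme \<Rightarrow> ('a, 'm \<Rightarrow> 'a) module" where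
  "hom_to_ring A P =
    \<lparr>carrier = module_hom A P (regular_module A), monoid.mult = undefined, one = undefined,
     ring.zero = (\<lambda>p\<in>carrier P. \<zero>\<^bsub>A\<^esub>), ring.add = (\<lambda>f g. \<lambda>p\<in>carrier P. f p \<oplus>\<^bsub>A\<^esub> g p),
     smult = (\<lambda>a f. \<lambda>p\<in>carrier P. a \<otimes>\<^bsub>A\<^esub> f p)\<rparr>"

text \<open>The cokernel of \<open>Hom\<^sub>A(p1, A) : Hom\<^sub>A(P0, A) \<rightarrow> Hom\<^sub>A(P1, A)\<close>, a left module.\<close>

definition transpose_module ::
    "('a, 'x) ring_scheme \<Rightarrow> ('a, 'm, 'y) module_scheme \<Rightarrow> ('m \<Rightarrow> 'n) \<Rightarrow> ('a, 'n, 'z) module_scheme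
      \<Rightarrow> ('a, ('m \<Rightarrow> 'a) set) module" where
  "transpose_module A P1 p1 P0 =
    quotient_module (hom_to_ring A P1)
      ((\<lambda>f. compose (carrier P1) f p1) ` carrier (hom_to_ring A P0))"

text \<open>
  The dual \<open>Hom\<^sub>K(N, K)\<close> of a left module \<open>N\<close>, a right module via \<open>(f a)(n) = f (a n)\<close>; the
  field acts on \<open>N\<close> through \<open>c n = (c 1) n\<close>.
\<close>

definition dual_module ::
    "('k, 'x) ring_scheme \<Rightarrow> ('k, 'a, 'y) module_scheme \<Rightarrow> ('a, 'n, 'z) module_scheme
      \<Rightarrow> ('a, 'n \<Rightarrow> 'k) module" where
  "dual_module K A N =
    \<lparr>carrier = {f \<in> carrier N \<rightarrow>\<^sub>E carrier K.
       (\<forall>x\<in>carrier N. \<forall>y\<in>carrier N. f (x \<oplus>\<^bsub>N\<^esub> y) = f x \<oplus>\<^bsub>K\<^esub> f y) \<and>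
       (\<forall>c\<in>carrier K. \<forall>x\<in>carrier N. f ((c \<odot>\<^bsub>A\<^esub> \<one>\<^bsub>A\<^esub>) \<odot>\<^bsub>N\<^esub> x) = c \<otimes>\<^bsub>K\<^esub> f x)},
     monoid.mult = undefined, one = undefined,
     ring.zero = (\<lambda>x\<in>carrier N. \<zero>\<^bsub>K\<^esub>), ring.add = (\<lambda>f g. \<lambda>x\<in>carrier N. f x \<oplus>\<^bsub>K\<^esub> g x),
     smult = (\<lambda>a f. \<lambda>x\<in>carrier N. f (a \<odot>\<^bsub>N\<^esub> x))\<rparr>"

text \<open>
  \<open>\<tau> M = D Tr M\<close>, which is determined up to isomorphism only; the choice operator picks an object
  of \<open>mod A\<close> in this isomorphism class.
\<close>

definition ar_translate ::
    "('k, 'x) ring_scheme \<Rightarrow> ('k, 'a, 'y) module_scheme \<Rightarrow> ('a, 'a list) module \<Rightarrow> ('a, 'a list) module" where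
  "ar_translate K A M =
    (SOME T. T \<in> fg_modules A \<and>
      (\<exists>P1 p1 P0 p0. min_proj_presentation A P1 p1 P0 p0 M \<and>
        module_iso A T (dual_module K A (transpose_module A P1 p1 P0))))"


section \<open>The Grothendieck group and \<open>\<tau>\<close>-maps\<close>

definition K0_relations ::
    "('a, 'x) ring_scheme \<Rightarrow> (('a, 'a list) module \<Rightarrow>\<^sub>0 int) set" where
  "K0_relations A =
    generate (free_Abelian_group (fg_modules A))
      {frag_of M - frag_of L - frag_of N | L M N.
        L \<in> fg_modules A \<and> M \<in> fg_modules A \<and> N \<in> fg_modules A \<and> short_exact A L M N}"

definition K0 :: "('a, 'x) ring_scheme \<Rightarrow> (('a, 'a list) module \<Rightarrow>\<^sub>0 int) set monoid" where
  "K0 A = free_Abelian_group (fg_modules A) Mod K0_relations A"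

definition K0_class ::
    "('a, 'x) ring_scheme \<Rightarrow> ('a, 'a list) module \<Rightarrow> (('a, 'a list) module \<Rightarrow>\<^sub>0 int) set" where
  "K0_class A M = K0_relations A #>\<^bsub>free_Abelian_group (fg_modules A)\<^esub> frag_of M"

text \<open>Restricting to extensional functions makes equality of endomorphisms equality on the carrier.\<close>

definition K0_End ::
    "('a, 'x) ring_scheme
      \<Rightarrow> ((('a, 'a list) module \<Rightarrow>\<^sub>0 int) set \<Rightarrow> (('a, 'a list) module \<Rightarrow>\<^sub>0 int) set) set" where
  "K0_End A = hom (K0 A) (K0 A) \<inter> extensional (carrier (K0 A))"

definition tau_map ::
    "('k, 'x) ring_scheme \<Rightarrow> ('k, 'a, 'y) module_scheme
      \<Rightarrow> ((('a, 'a list) module \<Rightarrow>\<^sub>0 int) set \<Rightarrow> (('a, 'a list) module \<Rightarrow>\<^sub>0 int) set) \<Rightarrow> bool" where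
  "tau_map K A \<Phi> \<longleftrightarrow>
    \<Phi> \<in> K0_End A \<and>
    (\<forall>M\<in>fg_modules A. indecomposable_module A M \<and> \<not> projective_module A M \<longrightarrow>
      \<Phi> (K0_class A M) = K0_class A (ar_translate K A M))"

text \<open>The prescription of an endomorphism on the simple modules, where \<open>x S\<close> is \<open>x\<^sub>S\<close>.\<close>

definition prescribed_on_simples ::
    "('k, 'x) ring_scheme \<Rightarrow> ('k, 'a, 'y) module_scheme
      \<Rightarrow> (('a, 'a list) module \<Rightarrow> (('a, 'a list) module \<Rightarrow>\<^sub>0 int) set)
      \<Rightarrow> ((('a, 'a list) module \<Rightarrow>\<^sub>0 int) set \<Rightarrow> (('a, 'a list) module \<Rightarrow>\<^sub>0 int) set) \<Rightarrow> bool" where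
  "prescribed_on_simples K A x \<Phi> \<longleftrightarrow>
    (\<forall>S\<in>fg_modules A. simple_module A S \<longrightarrow>
      \<Phi> (K0_class A S) = (if projective_module A S then x S else K0_class A (ar_translate K A S)))"

end

theory Submission
  imports Defs
begin

text \<open>
  Every indecomposable module \<open>M\<close> over a Nakayama algebra is uniserial, \<open>M = P/U\<close> with \<open>P\<close> uniserial
  projective, and \<open>\<tau> M\<close> is the kernel of the map \<open>\<nu> P\<^sub>1 \<rightarrow> \<nu> P\<close> induced by a projective cover \<open>P\<^sub>1 \<rightarrow> U\<close>, where
  \<open>\<nu> = D Hom(-, A)\<close>.  If \<open>M\<close> is not simple and not projective, choose \<open>U'\<close> minimal above \<open>U\<close>; then
  \<open>0 \<rightarrow> U'/U \<rightarrow> P/U \<rightarrow> P/U' \<rightarrow> 0\<close> remains exact after applying \<open>\<tau>\<close>, because every homomorphism \<open>U'/U \<rightarrow> A\<close> extends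
  to \<open>P/U\<close>.  By induction \<open>[\<tau> M]\<close> is the sum of the classes \<open>[\<tau> S]\<close> over the composition factors \<open>S\<close>
  of \<open>M\<close>, none of which is projective.  Since the Grothendieck group is free on the simple modules,
  this is the claim.
\<close>

section \<open>Right modules over an arbitrary ring\<close>

text \<open>The translates of \<open>U'/U\<close>, \<open>P/U\<close> and \<open>P/U'\<close> are
  compared along one chain of uniserial projectives. If \<open>q\<close> maps \<open>Q\<close> onto
  \<open>U'\<close> and \<open>r\<close> maps \<open>Q2\<close> onto the preimage of
  \<open>U\<close>, then \<open>r\<close>, \<open>q r\<close> and \<open>q\<close> are minimal
  presentations of the three modules, whose translates are the kernels of \<open>\<nu> r\<close>,
  \<open>\<nu> (q r)\<close> and \<open>\<nu> q\<close>. Such kernels always form a left exact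
  sequence; only surjectivity at its end needs homomorphisms into \<open>A\<close> to extend. Two
  features of the setting shape the rest. Objects of \<open>mod A\<close> have carriers of one fixed
  type, whereas quotients, duals and Hom modules live elsewhere; most arguments therefore run in
  finite-dimensional modules on any carrier type and return by \<open>rep_iso\<close>. And
  \<open>ar_translate\<close> picks an object by choice, so its properties pass through the
  uniqueness of minimal projective presentations. Freeness of the Grothendieck group has two halves:
  homomorphisms with given values on simple classes exist by the Jordan-Hoelder theorem, and are
  unique because simple classes generate.\<close>

definition msub where
  "msub R M U \<longleftrightarrow> U \<subseteq> carrier M \<and> \<zero>\<^bsub>M\<^esub> \<in> U \<and> (\<forall>x\<in>U. \<forall>y\<in>U. x \<oplus>\<^bsub>M\<^esub> y \<in> U) \<and>
    (\<forall>a\<in>carrier R. \<forall>x\<in>U. a \<odot>\<^bsub>M\<^esub> x \<in> U)"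

text \<open>Unlike \<open>module_hom\<close>, this asks nothing of \<open>f\<close> outside the
  carrier, so composites and restrictions to submodules qualify without patching values;
  \<open>mhom_restrict\<close> leads back to \<open>module_hom\<close>.\<close>

definition mhom where
  "mhom R M N f \<longleftrightarrow> (\<forall>x\<in>carrier M. f x \<in> carrier N) \<and>
    (\<forall>x\<in>carrier M. \<forall>y\<in>carrier M. f (x \<oplus>\<^bsub>M\<^esub> y) = f x \<oplus>\<^bsub>N\<^esub> f y) \<and>
    (\<forall>a\<in>carrier R. \<forall>x\<in>carrier M. f (a \<odot>\<^bsub>M\<^esub> x) = a \<odot>\<^bsub>N\<^esub> f x)"

definition ker where
  "ker M N f = {x \<in> carrier M. f x = \<zero>\<^bsub>N\<^esub>}"

definition msum where
  "msum M U V = {x \<oplus>\<^bsub>M\<^esub> y | x y. x \<in> U \<and> y \<in> V}"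

definition mspan where
  "mspan R M X = \<Inter>{U. msub R M U \<and> X \<subseteq> U}"

text \<open>A submodule keeps the type and the operations of the ambient module and only shrinks the
  carrier, so inclusions and nested submodules need no transport maps.\<close>

abbreviation on_sub :: "('a, 'm, 'y) module_scheme \<Rightarrow> 'm set \<Rightarrow> ('a, 'm, 'y) module_scheme" where
  "on_sub M U \<equiv> M\<lparr>carrier := U\<rparr>"

lemma a_kernel_eq_ker: "a_kernel M N f = ker M N f"
  by (simp add: a_kernel_def kernel_def ker_def)

lemma set_add_eq_msum: "U <+>\<^bsub>M\<^esub> V = msum M U V"
  by (auto simp: set_add_def' msum_def)

lemma module_hom_mhom: "f \<in> module_hom R M N \<Longrightarrow> mhom R M N f"
  by (auto simp: module_hom_def mhom_def)

lemma module_hom_iff: "f \<in> module_hom R M N \<longleftrightarrow> f \<in> extensional (carrier M) \<and> mhom R M N f"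
  by (auto simp: module_hom_def mhom_def PiE_def)

section \<open>Submodules: arithmetic, intersections, sums and spans\<close>

context right_module
begin

declare ract_closed [simp]

lemma ract_zero_r [simp]: "a \<in> carrier A \<Longrightarrow> a \<odot>\<^bsub>M\<^esub> \<zero>\<^bsub>M\<^esub> = \<zero>\<^bsub>M\<^esub>"
  using ract_r_distr[of a "\<zero>\<^bsub>M\<^esub>" "\<zero>\<^bsub>M\<^esub>"]
  by (metis M.add.r_cancel_one' M.zero_closed ract_closed M.l_zero)

lemma ract_zero_l [simp]: "x \<in> carrier M \<Longrightarrow> \<zero> \<odot>\<^bsub>M\<^esub> x = \<zero>\<^bsub>M\<^esub>"
  using ract_l_distr[of \<zero> \<zero> x]
  by (metis A.l_zero A.zero_closed M.add.r_cancel_one' ract_closed)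

lemma diff_zero_iff: "x \<in> carrier M \<Longrightarrow> y \<in> carrier M \<Longrightarrow> x \<ominus>\<^bsub>M\<^esub> y = \<zero>\<^bsub>M\<^esub> \<longleftrightarrow> x = y"
proof -
  assume *: "x \<in> carrier M" "y \<in> carrier M"
  have "x \<ominus>\<^bsub>M\<^esub> y \<oplus>\<^bsub>M\<^esub> y = x" using * by (simp add: a_minus_def M.a_assoc M.l_neg)
  then show ?thesis using * by (auto simp: a_minus_def M.r_neg)
qed

lemma minus_zero [simp]: "\<ominus>\<^bsub>M\<^esub> \<zero>\<^bsub>M\<^esub> = \<zero>\<^bsub>M\<^esub>"
  by (rule M.minus_equality) auto

lemma ract_minus_one: "x \<in> carrier M \<Longrightarrow> (\<ominus> \<one>) \<odot>\<^bsub>M\<^esub> x = \<ominus>\<^bsub>M\<^esub> x"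
  using ract_l_distr[of "\<ominus> \<one>" \<one> x]
  by (metis A.add.inv_closed A.l_neg A.one_closed M.minus_equality ract_closed ract_one ract_zero_l)

lemma ract_minus_r: "a \<in> carrier A \<Longrightarrow> x \<in> carrier M \<Longrightarrow> a \<odot>\<^bsub>M\<^esub> (\<ominus>\<^bsub>M\<^esub> x) = \<ominus>\<^bsub>M\<^esub> (a \<odot>\<^bsub>M\<^esub> x)"
  using ract_r_distr[of a "\<ominus>\<^bsub>M\<^esub> x" x]
  by (metis M.add.inv_closed M.l_neg M.minus_equality ract_closed ract_zero_r)

lemma msub_minus: "msub A M U \<Longrightarrow> x \<in> U \<Longrightarrow> \<ominus>\<^bsub>M\<^esub> x \<in> U"
  unfolding msub_def using ract_minus_one by (metis A.add.inv_closed A.one_closed subsetD)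

lemma msub_diff: "msub A M U \<Longrightarrow> x \<in> U \<Longrightarrow> y \<in> U \<Longrightarrow> x \<ominus>\<^bsub>M\<^esub> y \<in> U"
  using msub_minus[of U y] unfolding msub_def a_minus_def by auto

text \<open>Closure under negation, which \<open>submodule\<close> includes, comes for free in
  \<open>msub\<close>: the negative of \<open>x\<close> is \<open>x\<close> acted on by
  \<open>\<ominus> \<one>\<close>.\<close>

lemma submodule_iff: "submodule U A M \<longleftrightarrow> msub A M U"
proof
  assume "submodule U A M"
  then interpret submodule U A M .
  show "msub A M U" using one_closed m_closed smult_closed subset unfolding msub_def by auto
next
  assume *: "msub A M U"
  have "subgroup U (add_monoid M)"
  proof (rule subgroup.intro)
    show "\<And>x. x \<in> U \<Longrightarrow> inv\<^bsub>add_monoid M\<^esub> x \<in> U" using msub_minus[OF *] by (simp add: a_inv_def)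
  qed (use * in \<open>auto simp: msub_def\<close>)
  then show "submodule U A M" using * by (auto intro!: submodule.intro submodule_axioms.intro simp: msub_def)
qed

lemma on_sub_module:
  assumes "msub A M U" shows "right_module A (on_sub M U)"
proof -
  have sub: "x \<in> U \<Longrightarrow> x \<in> carrier M" for x using assms by (auto simp: msub_def)
  have "abelian_group (on_sub M U)"
  proof (rule abelian_groupI)
    fix x assume "x \<in> carrier (on_sub M U)"
    then show "\<exists>y\<in>carrier (on_sub M U). y \<oplus>\<^bsub>on_sub M U\<^esub> x = \<zero>\<^bsub>on_sub M U\<^esub>"
      using msub_minus[OF assms] sub by (auto intro!: bexI[of _ "\<ominus>\<^bsub>M\<^esub> x"] M.l_neg)
  qed (use assms sub in \<open>auto simp: msub_def M.a_ac\<close>)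
  then show ?thesis
    using assms sub
    by (intro right_module.intro right_module_axioms.intro A.ring_axioms)
       (auto simp: msub_def ract_l_distr ract_r_distr ract_assoc ract_one)
qed

lemma msub_zero: "msub A M {\<zero>\<^bsub>M\<^esub>}"
  by (auto simp: msub_def)

lemma msub_carrier: "msub A M (carrier M)"
  by (auto simp: msub_def)

lemma msub_Int: "msub A M U \<Longrightarrow> msub A M V \<Longrightarrow> msub A M (U \<inter> V)"
  by (auto simp: msub_def)

lemma msub_msum:
  assumes "msub A M U" "msub A M V" shows "msub A M (msum M U V)"
proof -
  have c: "x \<in> carrier M" if "x \<in> U \<or> x \<in> V" for x using assms that by (auto simp: msub_def)
  show ?thesis
    unfolding msub_def
  proof (intro conjI ballI)
    show "msum M U V \<subseteq> carrier M" using c by (auto simp: msum_def)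
    show "\<zero>\<^bsub>M\<^esub> \<in> msum M U V" using assms unfolding msum_def msub_def by (force intro: M.l_zero[symmetric])
  next
    fix x y assume "x \<in> msum M U V" "y \<in> msum M U V"
    then obtain u v u' v' where *: "x = u \<oplus>\<^bsub>M\<^esub> v" "y = u' \<oplus>\<^bsub>M\<^esub> v'" "u \<in> U" "u' \<in> U" "v \<in> V" "v' \<in> V"
      by (auto simp: msum_def)
    have "x \<oplus>\<^bsub>M\<^esub> y = (u \<oplus>\<^bsub>M\<^esub> u') \<oplus>\<^bsub>M\<^esub> (v \<oplus>\<^bsub>M\<^esub> v')" using * c by (simp add: M.a_ac)
    then show "x \<oplus>\<^bsub>M\<^esub> y \<in> msum M U V" using * assms unfolding msum_def msub_def by blast
  next
    fix a x assume "a \<in> carrier A" "x \<in> msum M U V"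
    then obtain u v where *: "x = u \<oplus>\<^bsub>M\<^esub> v" "u \<in> U" "v \<in> V" by (auto simp: msum_def)
    have "a \<odot>\<^bsub>M\<^esub> x = a \<odot>\<^bsub>M\<^esub> u \<oplus>\<^bsub>M\<^esub> a \<odot>\<^bsub>M\<^esub> v" using * c \<open>a \<in> carrier A\<close> by (simp add: ract_r_distr)
    then show "a \<odot>\<^bsub>M\<^esub> x \<in> msum M U V" using * assms \<open>a \<in> carrier A\<close> unfolding msum_def msub_def by blast
  qed
qed

lemma msum_upper1: "msub A M U \<Longrightarrow> msub A M V \<Longrightarrow> U \<subseteq> msum M U V"
proof
  fix x assume "msub A M U" "msub A M V" "x \<in> U"
  then have "x = x \<oplus>\<^bsub>M\<^esub> \<zero>\<^bsub>M\<^esub>" "\<zero>\<^bsub>M\<^esub> \<in> V" by (auto simp: msub_def)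
  then show "x \<in> msum M U V" using \<open>x \<in> U\<close> unfolding msum_def by blast
qed

lemma msum_commute: "U \<subseteq> carrier M \<Longrightarrow> V \<subseteq> carrier M \<Longrightarrow> msum M U V = msum M V U"
  unfolding msum_def using M.a_comm by (metis (no_types, opaque_lifting) subsetD)

lemma msum_upper2: "msub A M U \<Longrightarrow> msub A M V \<Longrightarrow> V \<subseteq> msum M U V"
  using msum_upper1[of V U] msum_commute[of U V] by (simp add: msub_def)

lemma msum_least: "msub A M W \<Longrightarrow> U \<subseteq> W \<Longrightarrow> V \<subseteq> W \<Longrightarrow> msum M U V \<subseteq> W"
  unfolding msum_def msub_def by blast

lemma mspan_msub: "X \<subseteq> carrier M \<Longrightarrow> msub A M (mspan A M X)"
  unfolding mspan_def using msub_carrier by (auto simp: msub_def)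

end

lemma mspan_incl: "X \<subseteq> mspan R M X"
  by (auto simp: mspan_def)

lemma mspan_least: "msub R M U \<Longrightarrow> X \<subseteq> U \<Longrightarrow> mspan R M X \<subseteq> U"
  by (auto simp: mspan_def)

lemma mspan_mono: "X \<subseteq> Y \<Longrightarrow> mspan R M X \<subseteq> mspan R M Y"
  by (auto simp: mspan_def)

lemma msub_on_sub: "msub R M U \<Longrightarrow> msub R (on_sub M U) W \<longleftrightarrow> W \<subseteq> U \<and> msub R M W"
  by (auto simp: msub_def)

lemma mspan_on_sub:
  assumes "right_module R M" "msub R M U" "X \<subseteq> U" shows "mspan R (on_sub M U) X = mspan R M X"
proof
  have "msub R M (mspan R M X)"
    using right_module.mspan_msub[OF assms(1), of X] assms(2,3) unfolding msub_def[of R M U] by blast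
  then show "mspan R (on_sub M U) X \<subseteq> mspan R M X"
    using assms(2) mspan_least[OF assms(2,3)] by (intro mspan_least) (auto simp: msub_on_sub mspan_incl)
  interpret N: right_module R "on_sub M U" using right_module.on_sub_module assms by blast
  show "mspan R M X \<subseteq> mspan R (on_sub M U) X"
    using N.mspan_msub[of X] assms(3) by (intro mspan_least) (simp_all add: msub_on_sub[OF assms(2)] mspan_incl)
qed

section \<open>Homomorphisms of right modules, their kernels and images\<close>

lemma mhomD:
  assumes "mhom R M N f"
  shows "\<And>x. x \<in> carrier M \<Longrightarrow> f x \<in> carrier N"
    "\<And>x y. x \<in> carrier M \<Longrightarrow> y \<in> carrier M \<Longrightarrow> f (x \<oplus>\<^bsub>M\<^esub> y) = f x \<oplus>\<^bsub>N\<^esub> f y"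
    "\<And>a x. a \<in> carrier R \<Longrightarrow> x \<in> carrier M \<Longrightarrow> f (a \<odot>\<^bsub>M\<^esub> x) = a \<odot>\<^bsub>N\<^esub> f x"
  using assms by (auto simp: mhom_def)

lemma mhom_cong: "right_module R M \<Longrightarrow> (\<And>x. x \<in> carrier M \<Longrightarrow> f x = g x) \<Longrightarrow> mhom R M N f \<longleftrightarrow> mhom R M N g"
  by (simp add: mhom_def right_module.ract_closed abelian_monoid.a_closed
      abelian_group.axioms(1)[OF right_module.axioms(2)])

lemma mhom_restrict:
  "right_module R M \<Longrightarrow> mhom R M N f \<Longrightarrow> restrict f (carrier M) \<in> module_hom R M N"
  unfolding module_hom_iff using mhom_cong[of R M f "restrict f (carrier M)" N] by simp

lemma mhom_comp: "mhom R L M f \<Longrightarrow> mhom R M N g \<Longrightarrow> mhom R L N (\<lambda>x. g (f x))"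
  by (auto simp: mhom_def)

lemma mhom_id: "mhom R M M (\<lambda>x. x)"
  by (auto simp: mhom_def)

lemma mhom_incl: "msub R M U \<Longrightarrow> mhom R (on_sub M U) M (\<lambda>x. x)"
  by (auto simp: mhom_def msub_def)

lemma mhom_on_dom: "mhom R M N f \<Longrightarrow> msub R M U \<Longrightarrow> mhom R (on_sub M U) N f"
  by (auto simp: mhom_def msub_def subset_iff)

lemma mhom_on_cod: "mhom R M N f \<Longrightarrow> f ` carrier M \<subseteq> V \<Longrightarrow> mhom R M (on_sub N V) f"
  by (auto simp: mhom_def)

lemma mhom_cod_incl: "mhom R M (on_sub N V) f \<Longrightarrow> V \<subseteq> carrier N \<Longrightarrow> mhom R M N f"
  by (auto simp: mhom_def)

locale mod_pair = M: right_module R M + N: right_module R N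
  for R :: "('a, 'x) ring_scheme" and M :: "('a, 'm, 'y) module_scheme"
    and N :: "('a, 'n, 'z) module_scheme"

locale mod_hom = mod_pair R M N
  for R :: "('a, 'x) ring_scheme" and M :: "('a, 'm, 'y) module_scheme"
    and N :: "('a, 'n, 'z) module_scheme" +
  fixes f assumes hom: "mhom R M N f"
begin

lemmas closed [simp] = mhomD(1)[OF hom]
lemmas add [simp] = mhomD(2)[OF hom]
lemmas act [simp] = mhomD(3)[OF hom]

lemma zero [simp]: "f \<zero>\<^bsub>M\<^esub> = \<zero>\<^bsub>N\<^esub>"
  using act[of "\<zero>\<^bsub>R\<^esub>" "\<zero>\<^bsub>M\<^esub>"] by simp

lemma minus [simp]: "x \<in> carrier M \<Longrightarrow> f (\<ominus>\<^bsub>M\<^esub> x) = \<ominus>\<^bsub>N\<^esub> f x"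
  using act[of "\<ominus>\<^bsub>R\<^esub> \<one>\<^bsub>R\<^esub>" x] by (simp add: M.ract_minus_one N.ract_minus_one)

lemma diff [simp]: "x \<in> carrier M \<Longrightarrow> y \<in> carrier M \<Longrightarrow> f (x \<ominus>\<^bsub>M\<^esub> y) = f x \<ominus>\<^bsub>N\<^esub> f y"
  by (simp add: a_minus_def)

lemma msub_image:
  assumes "msub R M U" shows "msub R N (f ` U)"
proof -
  have c: "\<And>x. x \<in> U \<Longrightarrow> x \<in> carrier M" using assms by (auto simp: msub_def)
  show ?thesis
    unfolding msub_def
  proof (intro conjI ballI)
    show "f ` U \<subseteq> carrier N" using c by auto
    show "\<zero>\<^bsub>N\<^esub> \<in> f ` U" using assms zero unfolding msub_def by (metis image_eqI)
  next
    fix x y assume "x \<in> f ` U" "y \<in> f ` U"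
    then obtain u v where *: "u \<in> U" "v \<in> U" "x = f u" "y = f v" by auto
    then have "x \<oplus>\<^bsub>N\<^esub> y = f (u \<oplus>\<^bsub>M\<^esub> v)" using c by simp
    then show "x \<oplus>\<^bsub>N\<^esub> y \<in> f ` U" using * assms unfolding msub_def by blast
  next
    fix a x assume "a \<in> carrier R" "x \<in> f ` U"
    then obtain u where *: "u \<in> U" "x = f u" by auto
    then have "a \<odot>\<^bsub>N\<^esub> x = f (a \<odot>\<^bsub>M\<^esub> u)" using c \<open>a \<in> carrier R\<close> by simp
    then show "a \<odot>\<^bsub>N\<^esub> x \<in> f ` U" using * assms \<open>a \<in> carrier R\<close> unfolding msub_def by blast
  qed
qed

lemma msub_range: "msub R N (f ` carrier M)"
  by (rule msub_image[OF M.msub_carrier])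

lemma msub_preimage:
  assumes "msub R N V" shows "msub R M {x \<in> carrier M. f x \<in> V}"
  using assms by (auto simp: msub_def)

lemma msub_ker: "msub R M (ker M N f)"
  using msub_preimage[OF N.msub_zero] by (simp add: ker_def)

lemma diff_in_ker: "x \<in> carrier M \<Longrightarrow> y \<in> carrier M \<Longrightarrow> f x = f y \<Longrightarrow> x \<ominus>\<^bsub>M\<^esub> y \<in> ker M N f"
  by (simp add: ker_def) (simp add: a_minus_def N.M.r_neg)

lemma inj_iff: "inj_on f (carrier M) \<longleftrightarrow> ker M N f \<subseteq> {\<zero>\<^bsub>M\<^esub>}"
proof
  assume "inj_on f (carrier M)"
  then show "ker M N f \<subseteq> {\<zero>\<^bsub>M\<^esub>}" unfolding ker_def
    by (metis (mono_tags, lifting) M.M.zero_closed inj_onD insertCI mem_Collect_eq subsetI zero)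
next
  assume *: "ker M N f \<subseteq> {\<zero>\<^bsub>M\<^esub>}"
  show "inj_on f (carrier M)"
  proof (rule inj_onI)
    fix x y assume xy: "x \<in> carrier M" "y \<in> carrier M" "f x = f y"
    then have "x \<ominus>\<^bsub>M\<^esub> y = \<zero>\<^bsub>M\<^esub>" using diff_in_ker * by blast
    then show "x = y" using xy M.diff_zero_iff[OF xy(1,2)] by simp
  qed
qed

lemma hom_inv:
  assumes "inj_on f (carrier M)"
  shows "mhom R (on_sub N (f ` carrier M)) M (inv_into (carrier M) f)"
proof -
  have [simp]: "inv_into (carrier M) f (f x) = x" if "x \<in> carrier M" for x using assms that by simp
  have "inv_into (carrier M) f (f x \<oplus>\<^bsub>N\<^esub> f y) = x \<oplus>\<^bsub>M\<^esub> y" if "x \<in> carrier M" "y \<in> carrier M" for x y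
    using that by (simp flip: add)
  moreover have "inv_into (carrier M) f (a \<odot>\<^bsub>N\<^esub> f x) = a \<odot>\<^bsub>M\<^esub> x" if "x \<in> carrier M" "a \<in> carrier R" for a x
    using that by (simp flip: act)
  ultimately show ?thesis by (auto simp: mhom_def)
qed

lemma image_mspan:
  assumes "X \<subseteq> carrier M" shows "f ` mspan R M X = mspan R N (f ` X)"
proof
  have "f ` X \<subseteq> carrier N" using assms by auto
  note 1 = msub_preimage[OF N.mspan_msub[OF this]]
  then show "f ` mspan R M X \<subseteq> mspan R N (f ` X)"
    using mspan_least[OF 1, of X] assms mspan_incl[of "f ` X" R N] by auto
  show "mspan R N (f ` X) \<subseteq> f ` mspan R M X"
    using assms by (intro mspan_least msub_image M.mspan_msub image_mono mspan_incl)
qed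

end

lemma mod_homI: "right_module R M \<Longrightarrow> right_module R N \<Longrightarrow> mhom R M N f \<Longrightarrow> mod_hom R M N f"
  by (simp add: mod_hom_def mod_hom_axioms_def mod_pair_def)

text \<open>The homomorphism theorem without a quotient: \<open>h\<close> evaluates \<open>f\<close>
  at a chosen preimage under \<open>g\<close>, and the kernel inclusion makes the value independent
  of the choice. It serves over \<open>A\<close> and, for functionals, over
  \<open>K\<close>.\<close>

lemma mhom_factor:
  assumes "mod_hom R L M g" "mod_hom R L N f" "g ` carrier L = carrier M" "ker L M g \<subseteq> ker L N f"
  obtains h where "mhom R M N h" "\<And>x. x \<in> carrier L \<Longrightarrow> h (g x) = f x"
proof -
  interpret g: mod_hom R L M g by fact
  interpret f: mod_hom R L N f by fact
  have eq: "f x = f y" if "x \<in> carrier L" "y \<in> carrier L" "g x = g y" for x y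
  proof -
    have "f x \<ominus>\<^bsub>N\<^esub> f y = \<zero>\<^bsub>N\<^esub>"
      using g.diff_in_ker[OF that] assms(4) that by (auto simp: ker_def)
    then show ?thesis using that f.N.diff_zero_iff[of "f x" "f y"] by simp
  qed
  define h where "h = (\<lambda>y. f (inv_into (carrier L) g y))"
  have h: "h (g x) = f x" if "x \<in> carrier L" for x
    unfolding h_def using that by (intro eq) (auto simp: inv_into_into f_inv_into_f)
  have "mhom R M N h"
    unfolding mhom_def assms(3)[symmetric]
    by (auto simp: h simp flip: g.add g.act)
  then show ?thesis using h that by blast
qed

subsection \<open>Quotients\<close>

context right_module
begin

context
  fixes U assumes U: "msub A M U"
begin

lemma abelian_subgroup_msub: "abelian_subgroup U M"
proof (rule abelian_subgroupI3)
  interpret submodule U A M using U submodule_iff by simp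
  show "additive_subgroup U M" by (rule additive_subgroup.intro) (rule subgroup_axioms)
qed (rule M.abelian_group_axioms)

interpretation U: abelian_subgroup U M by (rule abelian_subgroup_msub)

lemma coset_eq_iff:
  assumes "x \<in> carrier M" "y \<in> carrier M"
  shows "U +>\<^bsub>M\<^esub> x = U +>\<^bsub>M\<^esub> y \<longleftrightarrow> x \<ominus>\<^bsub>M\<^esub> y \<in> U"
proof -
  have "x \<in> U +>\<^bsub>M\<^esub> y \<longleftrightarrow> x \<ominus>\<^bsub>M\<^esub> y \<in> U" using U.a_rcos_module[of y x] assms by (simp add: a_minus_def)
  moreover have "x \<in> U +>\<^bsub>M\<^esub> x" using assms by (intro U.a_rcos_self)
  moreover have "x \<in> U +>\<^bsub>M\<^esub> y \<Longrightarrow> U +>\<^bsub>M\<^esub> y = U +>\<^bsub>M\<^esub> x" using assms by (intro U.a_repr_independence')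
  ultimately show ?thesis by auto
qed

lemma quotient_carrier: "carrier (quotient_module M U) = (\<lambda>x. U +>\<^bsub>M\<^esub> x) ` carrier M"
  by (auto simp: quotient_module_def A_RCOSETS_def')

lemma quotient_zero: "\<zero>\<^bsub>quotient_module M U\<^esub> = U +>\<^bsub>M\<^esub> \<zero>\<^bsub>M\<^esub>"
proof -
  have "U +>\<^bsub>M\<^esub> \<zero>\<^bsub>M\<^esub> = U" 
    using U by (force simp: a_r_coset_def' msub_def)
  then show ?thesis by (simp add: quotient_module_def)
qed

lemma quotient_add:
  "x \<in> carrier M \<Longrightarrow> y \<in> carrier M \<Longrightarrow>
    (U +>\<^bsub>M\<^esub> x) \<oplus>\<^bsub>quotient_module M U\<^esub> (U +>\<^bsub>M\<^esub> y) = U +>\<^bsub>M\<^esub> (x \<oplus>\<^bsub>M\<^esub> y)"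
  by (simp add: quotient_module_def U.a_rcos_sum)

lemma quotient_act:
  assumes "a \<in> carrier A" "x \<in> carrier M"
  shows "a \<odot>\<^bsub>quotient_module M U\<^esub> (U +>\<^bsub>M\<^esub> x) = U +>\<^bsub>M\<^esub> (a \<odot>\<^bsub>M\<^esub> x)"
proof -
  have "U +>\<^bsub>M\<^esub> (a \<odot>\<^bsub>M\<^esub> y) = U +>\<^bsub>M\<^esub> (a \<odot>\<^bsub>M\<^esub> x)" if y: "y \<in> U +>\<^bsub>M\<^esub> x" for y
  proof -
    have yc: "y \<in> carrier M" using y assms U by (auto simp: a_r_coset_def' msub_def)
    have "y \<ominus>\<^bsub>M\<^esub> x \<in> U" using U.a_rcos_module[OF assms(2) yc] y by (simp add: a_minus_def)
    then have "a \<odot>\<^bsub>M\<^esub> (y \<ominus>\<^bsub>M\<^esub> x) \<in> U" using U assms by (auto simp: msub_def)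
    then have "(a \<odot>\<^bsub>M\<^esub> y) \<ominus>\<^bsub>M\<^esub> (a \<odot>\<^bsub>M\<^esub> x) \<in> U"
      using assms yc by (simp add: a_minus_def ract_r_distr ract_minus_r)
    then show ?thesis using assms yc by (subst coset_eq_iff) auto
  qed
  moreover have "x \<in> U +>\<^bsub>M\<^esub> x" using assms U.a_rcos_self by simp
  ultimately have "(\<Union>y\<in>U +>\<^bsub>M\<^esub> x. U +>\<^bsub>M\<^esub> (a \<odot>\<^bsub>M\<^esub> y)) = U +>\<^bsub>M\<^esub> (a \<odot>\<^bsub>M\<^esub> x)" by blast
  then show ?thesis by (simp add: quotient_module_def)
qed

lemma quotient_right_module: "right_module A (quotient_module M U)"
proof -
  let ?Q = "quotient_module M U"
  note [simp] = quotient_carrier quotient_zero quotient_add quotient_act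
  have "abelian_group ?Q"
  proof (rule abelian_groupI)
    fix x assume "x \<in> carrier ?Q"
    then obtain y where "y \<in> carrier M" "x = U +>\<^bsub>M\<^esub> y" by auto
    then show "\<exists>y\<in>carrier ?Q. y \<oplus>\<^bsub>?Q\<^esub> x = \<zero>\<^bsub>?Q\<^esub>"
      by (intro bexI[of _ "U +>\<^bsub>M\<^esub> (\<ominus>\<^bsub>M\<^esub> y)"]) (auto simp: M.l_neg)
  qed (auto simp: M.a_ac)
  then show ?thesis
    by (intro right_module.intro right_module_axioms.intro A.ring_axioms)
       (auto simp: ract_l_distr ract_r_distr ract_assoc ract_one)
qed

lemma quotient_hom: "mhom A M (quotient_module M U) (\<lambda>x. U +>\<^bsub>M\<^esub> x)"
  by (auto simp: mhom_def quotient_carrier quotient_add quotient_act)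

lemma quotient_ker: "ker M (quotient_module M U) (\<lambda>x. U +>\<^bsub>M\<^esub> x) = U"
proof -
  have "x \<in> carrier M \<Longrightarrow> U +>\<^bsub>M\<^esub> x = U +>\<^bsub>M\<^esub> \<zero>\<^bsub>M\<^esub> \<longleftrightarrow> x \<in> U" for x
    by (subst coset_eq_iff) (auto simp: a_minus_def minus_zero)
  then show ?thesis using U by (auto simp: ker_def quotient_zero msub_def)
qed

end
end

section \<open>Finite-dimensional vector spaces\<close>

text \<open>Stated for a subset \<open>U\<close>, so that a submodule can be measured inside the
  ambient module.\<close>

definition fin_gen where
  "fin_gen R M U \<longleftrightarrow> (\<exists>X. finite X \<and> X \<subseteq> carrier M \<and> mspan R M X = U)"

text \<open>Dimension as the least size of a spanning set. Bases never enter: the proof needs only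
  that it strictly increases along proper inclusions and does not grow under linear images, and both
  are statements about spanning sets.\<close>

definition vdim where
  "vdim R M U = (LEAST n. \<exists>X. finite X \<and> X \<subseteq> carrier M \<and> mspan R M X = U \<and> card X = n)"

text \<open>The sum of \<open>U\<close> and the line through \<open>v\<close>, phrased so that
  membership hands over a coefficient. Spans grow through it by one generator at a time
  (\<open>mspan_insert\<close>).\<close>

definition adjoin where
  "adjoin R M U v = {y \<in> carrier M. \<exists>c\<in>carrier R. y \<ominus>\<^bsub>M\<^esub> c \<odot>\<^bsub>M\<^esub> v \<in> U}"

lemma regular_module_simps [simp]:
  "carrier (regular_module R) = carrier R" "\<zero>\<^bsub>regular_module R\<^esub> = \<zero>\<^bsub>R\<^esub>"
  "x \<oplus>\<^bsub>regular_module R\<^esub> y = x \<oplus>\<^bsub>R\<^esub> y" "a \<odot>\<^bsub>regular_module R\<^esub> x = x \<otimes>\<^bsub>R\<^esub> a"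
  by (simp_all add: regular_module_def)

lemma regular_right_module:
  assumes "ring R" shows "right_module R (regular_module R)"
proof -
  interpret ring R by fact
  have "abelian_group (regular_module R)"
    by (rule abelian_groupI) (auto simp: a_ac intro!: bexI[of _ "\<ominus>\<^bsub>R\<^esub> _"] l_neg)
  then show ?thesis
    by (intro right_module.intro right_module_axioms.intro assms) (auto simp: l_distr r_distr m_assoc)
qed

context right_module
begin

lemma diff_diff_cancel:
  "\<lbrakk>x \<in> carrier M; y \<in> carrier M; z \<in> carrier M\<rbrakk> \<Longrightarrow>
    (y \<ominus>\<^bsub>M\<^esub> x) \<ominus>\<^bsub>M\<^esub> (z \<ominus>\<^bsub>M\<^esub> x) = y \<ominus>\<^bsub>M\<^esub> z"
proof -
  assume *: "x \<in> carrier M" "y \<in> carrier M" "z \<in> carrier M"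
  have "(y \<ominus>\<^bsub>M\<^esub> x) \<ominus>\<^bsub>M\<^esub> (z \<ominus>\<^bsub>M\<^esub> x) = (y \<oplus>\<^bsub>M\<^esub> \<ominus>\<^bsub>M\<^esub> x) \<oplus>\<^bsub>M\<^esub> (\<ominus>\<^bsub>M\<^esub> z \<oplus>\<^bsub>M\<^esub> x)"
    using * by (simp add: a_minus_def M.minus_add M.minus_minus)
  also have "\<dots> = (y \<oplus>\<^bsub>M\<^esub> \<ominus>\<^bsub>M\<^esub> z) \<oplus>\<^bsub>M\<^esub> (\<ominus>\<^bsub>M\<^esub> x \<oplus>\<^bsub>M\<^esub> x)" using * by (simp only: M.a_ac M.a_inv_closed M.a_closed)
  finally show ?thesis using * by (simp add: M.l_neg a_minus_def)
qed

lemma diff_diff_cancel_left: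
  "\<lbrakk>x \<in> carrier M; y \<in> carrier M; z \<in> carrier M\<rbrakk> \<Longrightarrow>
    (x \<ominus>\<^bsub>M\<^esub> y) \<ominus>\<^bsub>M\<^esub> (x \<ominus>\<^bsub>M\<^esub> z) = z \<ominus>\<^bsub>M\<^esub> y"
proof -
  assume *: "x \<in> carrier M" "y \<in> carrier M" "z \<in> carrier M"
  have "(x \<ominus>\<^bsub>M\<^esub> y) \<ominus>\<^bsub>M\<^esub> (x \<ominus>\<^bsub>M\<^esub> z) = (x \<oplus>\<^bsub>M\<^esub> \<ominus>\<^bsub>M\<^esub> y) \<oplus>\<^bsub>M\<^esub> (\<ominus>\<^bsub>M\<^esub> x \<oplus>\<^bsub>M\<^esub> z)"
    using * by (simp add: a_minus_def M.minus_add M.minus_minus)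
  also have "\<dots> = (z \<oplus>\<^bsub>M\<^esub> \<ominus>\<^bsub>M\<^esub> y) \<oplus>\<^bsub>M\<^esub> (\<ominus>\<^bsub>M\<^esub> x \<oplus>\<^bsub>M\<^esub> x)" using * by (simp only: M.a_ac M.a_inv_closed M.a_closed)
  finally show ?thesis using * by (simp add: M.l_neg a_minus_def)
qed

lemma diff_add_cancel: "x \<in> carrier M \<Longrightarrow> y \<in> carrier M \<Longrightarrow> (x \<ominus>\<^bsub>M\<^esub> y) \<oplus>\<^bsub>M\<^esub> y = x"
  by (simp add: a_minus_def M.a_assoc M.l_neg)

lemma add_diff_add:
  "\<lbrakk>x \<in> carrier M; y \<in> carrier M; z \<in> carrier M; w \<in> carrier M\<rbrakk> \<Longrightarrow>
    (x \<oplus>\<^bsub>M\<^esub> y) \<ominus>\<^bsub>M\<^esub> (z \<oplus>\<^bsub>M\<^esub> w) = (x \<ominus>\<^bsub>M\<^esub> z) \<oplus>\<^bsub>M\<^esub> (y \<ominus>\<^bsub>M\<^esub> w)"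
  by (simp add: a_minus_def M.minus_add M.a_ac)

lemma diff_zero [simp]: "x \<in> carrier M \<Longrightarrow> x \<ominus>\<^bsub>M\<^esub> \<zero>\<^bsub>M\<^esub> = x"
  by (simp add: a_minus_def)

lemma diff_self [simp]: "x \<in> carrier M \<Longrightarrow> x \<ominus>\<^bsub>M\<^esub> x = \<zero>\<^bsub>M\<^esub>"
  by (simp add: diff_zero_iff)

lemma ract_diff: "\<lbrakk>a \<in> carrier A; x \<in> carrier M; y \<in> carrier M\<rbrakk> \<Longrightarrow>
    a \<odot>\<^bsub>M\<^esub> (x \<ominus>\<^bsub>M\<^esub> y) = a \<odot>\<^bsub>M\<^esub> x \<ominus>\<^bsub>M\<^esub> a \<odot>\<^bsub>M\<^esub> y"
  by (simp add: a_minus_def ract_r_distr ract_minus_r)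

lemma ract_minus_l: "\<lbrakk>a \<in> carrier A; x \<in> carrier M\<rbrakk> \<Longrightarrow> (\<ominus> a) \<odot>\<^bsub>M\<^esub> x = \<ominus>\<^bsub>M\<^esub> (a \<odot>\<^bsub>M\<^esub> x)"
  using ract_l_distr[of "\<ominus> a" a x]
  by (metis A.add.inv_closed A.l_neg M.minus_equality ract_closed ract_zero_l)

lemma ract_diff_l: "\<lbrakk>a \<in> carrier A; b \<in> carrier A; x \<in> carrier M\<rbrakk> \<Longrightarrow>
    (a \<ominus> b) \<odot>\<^bsub>M\<^esub> x = a \<odot>\<^bsub>M\<^esub> x \<ominus>\<^bsub>M\<^esub> b \<odot>\<^bsub>M\<^esub> x"
  by (simp add: a_minus_def ract_l_distr ract_minus_l)

lemma msub_mem: "msub A M U \<Longrightarrow> x \<in> U \<Longrightarrow> x \<in> carrier M"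
  by (auto simp: msub_def)

lemma msub_add_iff: "msub A M U \<Longrightarrow> x \<in> U \<Longrightarrow> y \<in> carrier M \<Longrightarrow> x \<oplus>\<^bsub>M\<^esub> y \<in> U \<longleftrightarrow> y \<in> U"
proof
  assume *: "msub A M U" "x \<in> U" "y \<in> carrier M" "x \<oplus>\<^bsub>M\<^esub> y \<in> U"
  have "(x \<oplus>\<^bsub>M\<^esub> y) \<ominus>\<^bsub>M\<^esub> x = y"
    using * msub_mem[of U x] by (simp add: a_minus_def M.a_comm[of x y] M.a_assoc M.r_neg)
  then show "y \<in> U" using msub_diff[OF *(1,4,2)] by simp
qed (auto simp: msub_def)

end

section \<open>Subspaces, spans and dimension over a field\<close>

locale vec = K?: field K + right_module K V
  for K :: "('k, 'x) ring_scheme" (structure) and V :: "('k, 'v, 'y) module_scheme" (structure)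
begin

lemma adjoin_msub:
  assumes U: "msub K V U" and v: "v \<in> carrier V"
  shows "msub K V (adjoin K V U v)" "U \<subseteq> adjoin K V U v" "v \<in> adjoin K V U v"
proof -
  show "U \<subseteq> adjoin K V U v" using U v unfolding adjoin_def
    by (auto simp: msub_def subset_iff intro!: bexI[of _ \<zero>])
  then have z: "\<zero>\<^bsub>V\<^esub> \<in> adjoin K V U v" using U by (auto simp: msub_def)
  show "v \<in> adjoin K V U v" using U v unfolding adjoin_def
    by (auto simp: msub_def ract_one intro!: bexI[of _ \<one>])
  show "msub K V (adjoin K V U v)"
    unfolding msub_def
  proof (intro conjI ballI z)
    show "adjoin K V U v \<subseteq> carrier V" by (auto simp: adjoin_def)
  next
    fix x y assume "x \<in> adjoin K V U v" "y \<in> adjoin K V U v"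
    then obtain c d where *: "x \<in> carrier V" "y \<in> carrier V" "c \<in> carrier K" "d \<in> carrier K"
      "x \<ominus>\<^bsub>V\<^esub> c \<odot>\<^bsub>V\<^esub> v \<in> U" "y \<ominus>\<^bsub>V\<^esub> d \<odot>\<^bsub>V\<^esub> v \<in> U" by (auto simp: adjoin_def)
    then have "(x \<oplus>\<^bsub>V\<^esub> y) \<ominus>\<^bsub>V\<^esub> (c \<oplus> d) \<odot>\<^bsub>V\<^esub> v \<in> U"
      using U v by (auto simp: ract_l_distr add_diff_add msub_def)
    then show "x \<oplus>\<^bsub>V\<^esub> y \<in> adjoin K V U v" using * by (auto simp: adjoin_def)
  next
    fix a x assume "a \<in> carrier K" "x \<in> adjoin K V U v"
    then obtain c where *: "x \<in> carrier V" "c \<in> carrier K" "x \<ominus>\<^bsub>V\<^esub> c \<odot>\<^bsub>V\<^esub> v \<in> U"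
      by (auto simp: adjoin_def)
    then have "a \<odot>\<^bsub>V\<^esub> (x \<ominus>\<^bsub>V\<^esub> c \<odot>\<^bsub>V\<^esub> v) \<in> U" using U \<open>a \<in> carrier K\<close> by (auto simp: msub_def)
    then have "a \<odot>\<^bsub>V\<^esub> x \<ominus>\<^bsub>V\<^esub> (c \<otimes> a) \<odot>\<^bsub>V\<^esub> v \<in> U"
      using * v \<open>a \<in> carrier K\<close> by (simp add: ract_diff ract_assoc)
    then show "a \<odot>\<^bsub>V\<^esub> x \<in> adjoin K V U v" using * \<open>a \<in> carrier K\<close> by (auto simp: adjoin_def)
  qed
qed

lemma adjoin_least:
  assumes "msub K V W" "U \<subseteq> W" "v \<in> W" shows "adjoin K V U v \<subseteq> W"
proof
  fix y assume "y \<in> adjoin K V U v"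
  then obtain c where *: "y \<in> carrier V" "c \<in> carrier K" "y \<ominus>\<^bsub>V\<^esub> c \<odot>\<^bsub>V\<^esub> v \<in> U"
    by (auto simp: adjoin_def)
  have "v \<in> carrier V" using assms msub_mem by blast
  then have "(y \<ominus>\<^bsub>V\<^esub> c \<odot>\<^bsub>V\<^esub> v) \<oplus>\<^bsub>V\<^esub> c \<odot>\<^bsub>V\<^esub> v = y" using * by (simp add: diff_add_cancel)
  moreover have "(y \<ominus>\<^bsub>V\<^esub> c \<odot>\<^bsub>V\<^esub> v) \<oplus>\<^bsub>V\<^esub> c \<odot>\<^bsub>V\<^esub> v \<in> W" using * assms unfolding msub_def by blast
  ultimately show "y \<in> W" by simp
qed

lemma mspan_insert:
  assumes "X \<subseteq> carrier V" "v \<in> carrier V"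
  shows "mspan K V (insert v X) = adjoin K V (mspan K V X) v"
proof
  note S = mspan_msub[OF assms(1)]
  show "mspan K V (insert v X) \<subseteq> adjoin K V (mspan K V X) v"
    using adjoin_msub[OF S assms(2)] mspan_incl[of X K V] by (intro mspan_least) auto
  have "insert v X \<subseteq> carrier V" using assms by auto
  then show "adjoin K V (mspan K V X) v \<subseteq> mspan K V (insert v X)"
    using mspan_incl[of "insert v X" K V]
    by (intro adjoin_least mspan_msub mspan_mono) auto
qed

lemma mspan_empty: "mspan K V {} = {\<zero>\<^bsub>V\<^esub>}"
  using mspan_least[OF msub_zero, of "{}"] mspan_msub[of "{}"] by (auto simp: msub_def)

lemma mspan_eq_self: "msub K V U \<Longrightarrow> mspan K V U = U"
  using mspan_least[of K V U U] mspan_incl[of U K V] by auto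

lemma coordinate_nonzero:
  assumes U: "msub K V U" and "w \<in> carrier V" "w \<notin> U" "c \<in> carrier K" "v \<in> carrier V"
    "w \<ominus>\<^bsub>V\<^esub> c \<odot>\<^bsub>V\<^esub> v \<in> U"
  shows "c \<noteq> \<zero>"
  using assms by auto

lemma ract_inv: "c \<in> carrier K \<Longrightarrow> c \<noteq> \<zero> \<Longrightarrow> v \<in> carrier V \<Longrightarrow> inv c \<odot>\<^bsub>V\<^esub> (c \<odot>\<^bsub>V\<^esub> v) = v"
  by (simp add: field_Units ract_one flip: ract_assoc)

lemma adjoin_mem_scaled:
  assumes U: "msub K V U" and "c \<in> carrier K" "c \<noteq> \<zero>" "v \<in> carrier V" "c \<odot>\<^bsub>V\<^esub> v \<in> U"
  shows "v \<in> U"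
proof -
  have "inv c \<in> carrier K" using assms by (simp add: field_Units)
  then have "inv c \<odot>\<^bsub>V\<^esub> (c \<odot>\<^bsub>V\<^esub> v) \<in> U" using assms unfolding msub_def by blast
  then show ?thesis using assms by (simp add: ract_inv)
qed

lemma msub_diff_swap:
  assumes "msub K V U" "x \<in> U" "y \<in> carrier V" "x \<ominus>\<^bsub>V\<^esub> y \<in> U" shows "y \<in> U"
proof -
  have "x \<ominus>\<^bsub>V\<^esub> (x \<ominus>\<^bsub>V\<^esub> y) = y"
    using assms msub_mem[of U x] diff_diff_cancel_left[of x "\<zero>\<^bsub>V\<^esub>" y] by simp
  then show ?thesis using msub_diff[OF assms(1,2,4)] by simp
qed

text \<open>The substitute for the exchange lemma. With \<open>?S\<close> the span before
  \<open>v\<close> is inserted, induction spans \<open>W \<inter> ?S\<close>, and \<open>W\<close>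
  exceeds this by at most one vector \<open>w\<close>, which takes the place of \<open>v\<close>.
  Counting generators also yields the strict inequality.\<close>

lemma subspace_span:
  assumes "finite X" "X \<subseteq> carrier V" "msub K V W" "W \<subseteq> mspan K V X"
  shows "\<exists>Y. finite Y \<and> Y \<subseteq> carrier V \<and> mspan K V Y = W \<and> card Y \<le> card X \<and>
    (W \<noteq> mspan K V X \<longrightarrow> card Y < card X)"
  using assms
proof (induction X arbitrary: W rule: finite_induct)
  case empty
  then have "W = {\<zero>\<^bsub>V\<^esub>}" by (auto simp: mspan_empty msub_def)
  then show ?case by (auto simp: mspan_empty intro!: exI[of _ "{}"])
next
  case (insert v X)
  let ?S = "mspan K V X"
  have vX: "v \<in> carrier V" "X \<subseteq> carrier V" using insert.prems by auto
  note S = mspan_msub[OF vX(2)]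
  have sp: "mspan K V (insert v X) = adjoin K V ?S v" using vX by (intro mspan_insert)
  have W0: "msub K V (W \<inter> ?S)" using insert.prems S msub_Int by blast
  obtain Y where Y: "finite Y" "Y \<subseteq> carrier V" "mspan K V Y = W \<inter> ?S" "card Y \<le> card X"
    "W \<inter> ?S \<noteq> ?S \<Longrightarrow> card Y < card X"
    using insert.IH[OF vX(2) W0] by auto
  show ?case
  proof (cases "W \<subseteq> ?S")
    case True
    then have "mspan K V Y = W" using Y by auto
    then show ?thesis using Y insert.hyps by (intro exI[of _ Y]) auto
  next
    case False
    then obtain w where w: "w \<in> W" "w \<notin> ?S" by auto
    have wc: "w \<in> carrier V" using w insert.prems msub_mem by blast
    obtain c where c: "c \<in> carrier K" "w \<ominus>\<^bsub>V\<^esub> c \<odot>\<^bsub>V\<^esub> v \<in> ?S"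
      using w insert.prems sp unfolding adjoin_def by auto
    have c0: "c \<noteq> \<zero>" using coordinate_nonzero[OF S wc w(2) c(1) vX(1) c(2)] .
    have "W \<subseteq> adjoin K V (W \<inter> ?S) w"
    proof
      fix y assume y: "y \<in> W"
      have yc: "y \<in> carrier V" using y insert.prems msub_mem by blast
      obtain d where d: "d \<in> carrier K" "y \<ominus>\<^bsub>V\<^esub> d \<odot>\<^bsub>V\<^esub> v \<in> ?S"
        using y insert.prems sp unfolding adjoin_def by auto
      \<comment> \<open>The ratio of the \<open>v\<close>-coefficients of \<open>y\<close> and
        \<open>w\<close>: subtracting \<open>e\<close> times \<open>w\<close> removes
        \<open>v\<close> from \<open>y\<close> modulo \<open>?S\<close>.\<close>
      define e where "e = inv c \<otimes> d"
      have ic: "inv c \<in> carrier K" using c c0 by (simp add: field_Units)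
      have e: "e \<in> carrier K" "c \<otimes> e = d" using c c0 d ic
        by (auto simp: e_def field_Units simp flip: m_assoc)
      have "e \<odot>\<^bsub>V\<^esub> (w \<ominus>\<^bsub>V\<^esub> c \<odot>\<^bsub>V\<^esub> v) \<in> ?S" using S c e by (auto simp: msub_def)
      then have "e \<odot>\<^bsub>V\<^esub> w \<ominus>\<^bsub>V\<^esub> d \<odot>\<^bsub>V\<^esub> v \<in> ?S"
        using wc vX c e by (simp add: ract_diff flip: ract_assoc)
      then have "(y \<ominus>\<^bsub>V\<^esub> d \<odot>\<^bsub>V\<^esub> v) \<ominus>\<^bsub>V\<^esub> (e \<odot>\<^bsub>V\<^esub> w \<ominus>\<^bsub>V\<^esub> d \<odot>\<^bsub>V\<^esub> v) \<in> ?S"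
        using msub_diff[OF S d(2)] by blast
      then have "y \<ominus>\<^bsub>V\<^esub> e \<odot>\<^bsub>V\<^esub> w \<in> ?S" using yc wc vX d e by (simp add: diff_diff_cancel)
      moreover have "y \<ominus>\<^bsub>V\<^esub> e \<odot>\<^bsub>V\<^esub> w \<in> W"
        using insert.prems(2) y w e by (intro msub_diff) (auto simp: msub_def)
      ultimately show "y \<in> adjoin K V (W \<inter> ?S) w" using yc e by (auto simp: adjoin_def)
    qed
    then have "W = adjoin K V (W \<inter> ?S) w"
      using adjoin_least[of W "W \<inter> ?S" w] insert.prems w by auto
    then have 1: "mspan K V (insert w Y) = W" using mspan_insert[OF Y(2) wc] Y(3) by simp
    have 2: "card (insert w Y) \<le> Suc (card Y)" using Y(1) by (simp add: card_insert_if)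
    have 3: "card (insert w Y) < card (insert v X)" if ne: "W \<noteq> mspan K V (insert v X)"
    proof -
      \<comment> \<open>Otherwise \<open>W\<close> contains \<open>?S\<close> and \<open>w\<close>,
        hence a nonzero multiple of \<open>v\<close>, hence the whole span.\<close>
      have "W \<inter> ?S \<noteq> ?S"
      proof
        assume "W \<inter> ?S = ?S"
        then have SW: "?S \<subseteq> W" by auto
        then have "c \<odot>\<^bsub>V\<^esub> v \<in> W"
          using msub_diff_swap[OF insert.prems(2) w(1) ract_closed[OF c(1) vX(1)]] c(2) by blast
        then have "v \<in> W" using adjoin_mem_scaled insert.prems(2) c c0 vX by blast
        then have "adjoin K V ?S v \<subseteq> W" using SW insert.prems by (intro adjoin_least)
        then show False using ne sp insert.prems by auto
      qed
      then show ?thesis using Y(5) 2 insert.hyps by simp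
    qed
    show ?thesis using 1 2 3 Y insert.hyps wc by (intro exI[of _ "insert w Y"]) auto
  qed
qed

lemma vdim_witness:
  assumes "fin_gen K V U"
  obtains X where "finite X" "X \<subseteq> carrier V" "mspan K V X = U" "card X = vdim K V U"
proof -
  obtain X where X: "finite X" "X \<subseteq> carrier V" "mspan K V X = U" using assms by (auto simp: fin_gen_def)
  have "\<exists>X. finite X \<and> X \<subseteq> carrier V \<and> mspan K V X = U \<and> card X = vdim K V U"
    unfolding vdim_def by (rule LeastI_ex) (use X in blast)
  then show ?thesis using that by blast
qed

lemma vdim_le: "finite X \<Longrightarrow> X \<subseteq> carrier V \<Longrightarrow> mspan K V X = U \<Longrightarrow> vdim K V U \<le> card X"
  unfolding vdim_def by (rule Least_le) blast

lemma vdim_mono: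
  assumes "fin_gen K V U" "msub K V W" "W \<subseteq> U"
  shows "fin_gen K V W" "vdim K V W \<le> vdim K V U" "W \<noteq> U \<Longrightarrow> vdim K V W < vdim K V U"
proof -
  obtain X where X: "finite X" "X \<subseteq> carrier V" "mspan K V X = U" "card X = vdim K V U"
    using vdim_witness[OF assms(1)] by blast
  obtain Y where Y: "finite Y" "Y \<subseteq> carrier V" "mspan K V Y = W" "card Y \<le> card X"
    "W \<noteq> U \<Longrightarrow> card Y < card X"
    using subspace_span[OF X(1,2) assms(2)] X(3) assms(3) by auto
  show "fin_gen K V W" using Y by (auto simp: fin_gen_def)
  show "vdim K V W \<le> vdim K V U" using vdim_le[OF Y(1-3)] Y(4) X(4) by simp
  show "W \<noteq> U \<Longrightarrow> vdim K V W < vdim K V U" using vdim_le[OF Y(1-3)] Y(5) X(4) by simp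
qed

text \<open>The coefficient of \<open>v\<close> modulo \<open>U\<close> is unique, because two
  different ones would put a nonzero multiple of \<open>v\<close>, and so \<open>v\<close> itself,
  into \<open>U\<close>. Uniqueness makes the coefficient a linear functional.\<close>

lemma coordinate:
  assumes U: "msub K V U" and v: "v \<in> carrier V" "v \<notin> U"
  obtains l where "mhom K (on_sub V (adjoin K V U v)) (regular_module K) l"
    "\<And>u. u \<in> U \<Longrightarrow> l u = \<zero>" "l v = \<one>"
    "\<And>y. y \<in> adjoin K V U v \<Longrightarrow> y \<ominus>\<^bsub>V\<^esub> l y \<odot>\<^bsub>V\<^esub> v \<in> U"
proof -
  let ?P = "\<lambda>y c. c \<in> carrier K \<and> y \<ominus>\<^bsub>V\<^esub> c \<odot>\<^bsub>V\<^esub> v \<in> U"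
  have uniq: "c = d" if "?P y c" "?P y d" "y \<in> carrier V" for c d y
  proof (rule ccontr)
    assume "c \<noteq> d"
    have "(d \<ominus> c) \<oplus> c = d" using that by (simp add: a_minus_def K.a_assoc K.l_neg)
    then have 0: "d \<ominus> c \<noteq> \<zero>" using that \<open>c \<noteq> d\<close> by auto
    have "(y \<ominus>\<^bsub>V\<^esub> c \<odot>\<^bsub>V\<^esub> v) \<ominus>\<^bsub>V\<^esub> (y \<ominus>\<^bsub>V\<^esub> d \<odot>\<^bsub>V\<^esub> v) = d \<odot>\<^bsub>V\<^esub> v \<ominus>\<^bsub>V\<^esub> c \<odot>\<^bsub>V\<^esub> v"
      using that v by (simp add: diff_diff_cancel_left)
    then have "(d \<ominus> c) \<odot>\<^bsub>V\<^esub> v \<in> U" using msub_diff[OF U, of "y \<ominus>\<^bsub>V\<^esub> c \<odot>\<^bsub>V\<^esub> v" "y \<ominus>\<^bsub>V\<^esub> d \<odot>\<^bsub>V\<^esub> v"] that v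
      by (simp add: ract_diff_l)
    then show False using adjoin_mem_scaled[OF U _ 0 v(1)] v that by auto
  qed
  define l where "l y = (THE c. ?P y c)" for y
  have l: "l y = c" if "?P y c" "y \<in> carrier V" for y c
    unfolding l_def using that uniq by (intro the_equality) auto
  have ex: "y \<in> carrier V \<and> ?P y (l y)" if "y \<in> adjoin K V U v" for y
    using that l unfolding adjoin_def by fastforce
  have "mhom K (on_sub V (adjoin K V U v)) (regular_module K) l"
    unfolding mhom_def
  proof (intro conjI ballI)
    fix x assume "x \<in> carrier (on_sub V (adjoin K V U v))"
    then show "l x \<in> carrier (regular_module K)" using ex by simp
  next
    fix x y assume "x \<in> carrier (on_sub V (adjoin K V U v))" "y \<in> carrier (on_sub V (adjoin K V U v))"
    then have *: "x \<in> carrier V \<and> ?P x (l x)" "y \<in> carrier V \<and> ?P y (l y)" using ex by auto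
    then have "?P (x \<oplus>\<^bsub>V\<^esub> y) (l x \<oplus> l y)" using U v by (auto simp: ract_l_distr add_diff_add msub_def)
    then have "l (x \<oplus>\<^bsub>V\<^esub> y) = l x \<oplus> l y" using * by (intro l) auto
    then show "l (x \<oplus>\<^bsub>on_sub V (adjoin K V U v)\<^esub> y) = l x \<oplus>\<^bsub>regular_module K\<^esub> l y" by simp
  next
    fix a x assume a: "a \<in> carrier K" and "x \<in> carrier (on_sub V (adjoin K V U v))"
    then have *: "x \<in> carrier V \<and> ?P x (l x)" using ex by auto
    then have "a \<odot>\<^bsub>V\<^esub> (x \<ominus>\<^bsub>V\<^esub> l x \<odot>\<^bsub>V\<^esub> v) \<in> U" using U a by (auto simp: msub_def)
    then have "?P (a \<odot>\<^bsub>V\<^esub> x) (l x \<otimes> a)" using * a v by (simp add: ract_diff ract_assoc)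
    then have "l (a \<odot>\<^bsub>V\<^esub> x) = l x \<otimes> a" using * a by (intro l) auto
    then show "l (a \<odot>\<^bsub>on_sub V (adjoin K V U v)\<^esub> x) = a \<odot>\<^bsub>regular_module K\<^esub> l x" by simp
  qed
  moreover have "l u = \<zero>" if "u \<in> U" for u using that msub_mem[OF U that] v by (intro l) auto
  moreover have "l v = \<one>" using v U by (intro l) (auto simp: ract_one msub_def)
  ultimately show ?thesis using that ex by blast
qed

text \<open>A complement without a basis: start from the identity on \<open>W\<close> and enlarge
  the domain by the generators of \<open>V\<close> one after the other.\<close>

lemma retraction:
  assumes "fin_gen K V (carrier V)" and W: "msub K V W"
  obtains r where "mhom K V V r" "r ` carrier V \<subseteq> W" "\<And>x. x \<in> W \<Longrightarrow> r x = x"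
proof -
  obtain X where X: "finite X" "X \<subseteq> carrier V" "mspan K V X = carrier V"
    using assms by (auto simp: fin_gen_def)
  have Wc: "W \<subseteq> carrier V" using W by (auto simp: msub_def)
  have "\<exists>r. mhom K (on_sub V (mspan K V (X \<union> W))) V r \<and> r ` mspan K V (X \<union> W) \<subseteq> W \<and> (\<forall>x\<in>W. r x = x)"
    using X(1,2)
  proof (induction X rule: finite_induct)
    case empty
    then show ?case using W Wc by (intro exI[of _ "\<lambda>x. x"]) (auto simp: mspan_eq_self mhom_def)
  next
    case (insert v X)
    let ?U = "mspan K V (X \<union> W)"
    have U: "msub K V ?U" using insert.prems Wc by (intro mspan_msub) auto
    have v: "v \<in> carrier V" using insert.prems by auto
    have WU: "W \<subseteq> ?U" using mspan_incl[of "X \<union> W" K V] by auto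
    obtain r where r0: "mhom K (on_sub V ?U) V r" "r ` ?U \<subseteq> W" "\<forall>x\<in>W. r x = x"
      using insert by auto
    have r: "mhom K (on_sub V ?U) V r" "\<And>x. x \<in> ?U \<Longrightarrow> r x \<in> W" "\<And>x. x \<in> W \<Longrightarrow> r x = x"
      using r0 by blast+
    have sp: "mspan K V (insert v X \<union> W) = adjoin K V ?U v"
      using mspan_insert[of "X \<union> W" v] insert.prems Wc by auto
    show ?case
    proof (cases "v \<in> ?U")
      case True
      then have "adjoin K V ?U v = ?U" using adjoin_least[OF U, of ?U v] adjoin_msub[OF U v] by auto
      then show ?thesis using r sp by (intro exI[of _ r]) auto
    next
      case False
      obtain l where l: "mhom K (on_sub V (adjoin K V ?U v)) (regular_module K) l"
        "\<And>u. u \<in> ?U \<Longrightarrow> l u = \<zero>" "l v = \<one>"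
        "\<And>y. y \<in> adjoin K V ?U v \<Longrightarrow> y \<ominus>\<^bsub>V\<^esub> l y \<odot>\<^bsub>V\<^esub> v \<in> ?U"
        using coordinate[OF U v False] by blast
      have ac: "y \<in> carrier V" "l y \<in> carrier K" if "y \<in> adjoin K V ?U v" for y
        using that mhomD(1)[OF l(1)] by (auto simp: adjoin_def)
      \<comment> \<open>The extension of \<open>r\<close> that sends the new generator
        \<open>v\<close> to zero.\<close>
      define r' where "r' y = r (y \<ominus>\<^bsub>V\<^esub> l y \<odot>\<^bsub>V\<^esub> v)" for y
      have "mhom K (on_sub V (adjoin K V ?U v)) V r'"
        unfolding mhom_def
      proof (intro conjI ballI)
        fix x assume "x \<in> carrier (on_sub V (adjoin K V ?U v))"
        then show "r' x \<in> carrier V" using l(4) r(2) Wc by (auto simp: r'_def)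
      next
        fix x y assume "x \<in> carrier (on_sub V (adjoin K V ?U v))" "y \<in> carrier (on_sub V (adjoin K V ?U v))"
        then have *: "x \<in> adjoin K V ?U v" "y \<in> adjoin K V ?U v" by auto
        have "(x \<oplus>\<^bsub>V\<^esub> y) \<ominus>\<^bsub>V\<^esub> l (x \<oplus>\<^bsub>V\<^esub> y) \<odot>\<^bsub>V\<^esub> v
            = (x \<ominus>\<^bsub>V\<^esub> l x \<odot>\<^bsub>V\<^esub> v) \<oplus>\<^bsub>V\<^esub> (y \<ominus>\<^bsub>V\<^esub> l y \<odot>\<^bsub>V\<^esub> v)"
          using mhomD(2)[OF l(1), of x y] * ac v by (simp add: ract_l_distr add_diff_add)
        then show "r' (x \<oplus>\<^bsub>on_sub V (adjoin K V ?U v)\<^esub> y) = r' x \<oplus>\<^bsub>V\<^esub> r' y"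
          using mhomD(2)[OF r(1)] l(4) * by (simp add: r'_def)
      next
        fix a x assume a: "a \<in> carrier K" and "x \<in> carrier (on_sub V (adjoin K V ?U v))"
        then have *: "x \<in> adjoin K V ?U v" by auto
        have "a \<odot>\<^bsub>V\<^esub> x \<ominus>\<^bsub>V\<^esub> l (a \<odot>\<^bsub>V\<^esub> x) \<odot>\<^bsub>V\<^esub> v = a \<odot>\<^bsub>V\<^esub> (x \<ominus>\<^bsub>V\<^esub> l x \<odot>\<^bsub>V\<^esub> v)"
          using mhomD(3)[OF l(1), of a x] * ac[OF *] v a by (simp add: ract_diff ract_assoc)
        then show "r' (a \<odot>\<^bsub>on_sub V (adjoin K V ?U v)\<^esub> x) = a \<odot>\<^bsub>V\<^esub> r' x"
          using mhomD(3)[OF r(1)] l(4) * a by (simp add: r'_def)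
      qed
      moreover have "r' x = x" if "x \<in> W" for x
        using that l(2)[of x] WU r(3) v Wc by (auto simp: r'_def subset_iff)
      moreover have "r' ` adjoin K V ?U v \<subseteq> W" using l(4) r(2) by (auto simp: r'_def)
      ultimately show ?thesis using sp by (intro exI[of _ r']) auto
    qed
  qed
  moreover have "mspan K V (X \<union> W) = carrier V"
    using mspan_mono[of X "X \<union> W" K V] mspan_least[OF msub_carrier, of "X \<union> W"] X Wc by auto
  ultimately show ?thesis using that by auto
qed

lemma extend_hom:
  assumes "fin_gen K V (carrier V)" "msub K V W" "mhom K (on_sub V W) N f"
  obtains g where "mhom K V N g" "\<And>x. x \<in> W \<Longrightarrow> g x = f x"
proof -
  obtain r where r: "mhom K V V r" "r ` carrier V \<subseteq> W" "\<And>x. x \<in> W \<Longrightarrow> r x = x"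
    using retraction[OF assms(1,2)] by blast
  have "mhom K V N (\<lambda>x. f (r x))" using mhom_comp[OF mhom_on_cod[OF r(1,2)] assms(3)] .
  then show ?thesis using that r(3) by auto
qed

lemma separating_functional:
  assumes "fin_gen K V (carrier V)" "msub K V U" "v \<in> carrier V" "v \<notin> U"
  obtains l where "mhom K V (regular_module K) l" "\<And>u. u \<in> U \<Longrightarrow> l u = \<zero>" "l v = \<one>"
proof -
  obtain l where l: "mhom K (on_sub V (adjoin K V U v)) (regular_module K) l"
    "\<And>u. u \<in> U \<Longrightarrow> l u = \<zero>" "l v = \<one>" using coordinate[OF assms(2-4)] by blast
  note A = adjoin_msub[OF assms(2,3)]
  obtain g where g: "mhom K V (regular_module K) g" "\<And>x. x \<in> adjoin K V U v \<Longrightarrow> g x = l x"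
    using extend_hom[OF assms(1) A(1) l(1)] by blast
  show ?thesis using that[of g] g l A by (auto simp: subset_iff)
qed

text \<open>Each generator outside the span of its predecessors contributes one functional, zero on
  that span and \<open>\<one>\<close> at the generator, which detects its coefficient.\<close>

lemma finite_separating_set:
  assumes "fin_gen K V (carrier V)"
  obtains L where "finite L" "\<And>l. l \<in> L \<Longrightarrow> mhom K V (regular_module K) l"
    "\<And>u. u \<in> carrier V \<Longrightarrow> (\<And>l. l \<in> L \<Longrightarrow> l u = \<zero>) \<Longrightarrow> u = \<zero>\<^bsub>V\<^esub>"
proof -
  obtain X where X: "finite X" "X \<subseteq> carrier V" "mspan K V X = carrier V"
    using assms by (auto simp: fin_gen_def)
  have "\<exists>L. finite L \<and> (\<forall>l\<in>L. mhom K V (regular_module K) l) \<and>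
    (\<forall>u\<in>mspan K V X. (\<forall>l\<in>L. l u = \<zero>) \<longrightarrow> u = \<zero>\<^bsub>V\<^esub>)"
    using X(1,2)
  proof (induction X rule: finite_induct)
    case empty then show ?case by (auto simp: mspan_empty)
  next
    case (insert v X)
    then obtain L where L: "finite L" "\<forall>l\<in>L. mhom K V (regular_module K) l"
      "\<And>u. u \<in> mspan K V X \<Longrightarrow> (\<forall>l\<in>L. l u = \<zero>) \<Longrightarrow> u = \<zero>\<^bsub>V\<^esub>" by auto
    let ?U = "mspan K V X"
    have v: "v \<in> carrier V" and U: "msub K V ?U" using insert.prems by (auto intro: mspan_msub)
    have sp: "mspan K V (insert v X) = adjoin K V ?U v" using insert.prems by (intro mspan_insert) auto
    show ?case
    proof (cases "v \<in> ?U")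
      case True
      then have "adjoin K V ?U v = ?U" using adjoin_least[OF U, of ?U v] adjoin_msub[OF U v] by auto
      then show ?thesis using L sp by (intro exI[of _ L]) auto
    next
      case False
      obtain g where g: "mhom K V (regular_module K) g" "\<And>u. u \<in> ?U \<Longrightarrow> g u = \<zero>" "g v = \<one>"
        using separating_functional[OF assms U v False] by blast
      interpret g: mod_hom K V "regular_module K" g
        by (intro mod_homI g regular_right_module ring_axioms right_module_axioms)
      have "u = \<zero>\<^bsub>V\<^esub>" if u: "u \<in> adjoin K V ?U v" and 0: "\<forall>l\<in>insert g L. l u = \<zero>" for u
      proof -
        obtain c where c: "u \<in> carrier V" "c \<in> carrier K" "u \<ominus>\<^bsub>V\<^esub> c \<odot>\<^bsub>V\<^esub> v \<in> ?U"
          using u by (auto simp: adjoin_def)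
        have "g ((u \<ominus>\<^bsub>V\<^esub> c \<odot>\<^bsub>V\<^esub> v) \<oplus>\<^bsub>V\<^esub> c \<odot>\<^bsub>V\<^esub> v) = c"
          using c g v by (subst g.add) auto
        then have "c = \<zero>" using c v 0 by (simp add: diff_add_cancel)
        then have "u \<in> ?U" using c v by simp
        then show ?thesis using L 0 by auto
      qed
      then show ?thesis using L g sp by (intro exI[of _ "insert g L"]) auto
    qed
  qed
  then show ?thesis using that X(3) by auto
qed

text \<open>Made for spaces of functions, where no generators are in sight. Cutting \<open>U\<close>
  with the kernel of one functional costs at most one generator, and when all functionals are spent
  only zero remains.\<close>

lemma fin_gen_of_separating:
  assumes "finite L" "\<And>l. l \<in> L \<Longrightarrow> mhom K V (regular_module K) l" "msub K V U"
    "\<And>u. u \<in> U \<Longrightarrow> (\<And>l. l \<in> L \<Longrightarrow> l u = \<zero>) \<Longrightarrow> u = \<zero>\<^bsub>V\<^esub>"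
  shows "fin_gen K V U"
  using assms
proof (induction L arbitrary: U rule: finite_induct)
  case empty
  then have "U = {\<zero>\<^bsub>V\<^esub>}" by (auto simp: msub_def)
  then show ?case using mspan_empty by (auto simp: fin_gen_def)
next
  case (insert g L)
  interpret g: mod_hom K V "regular_module K" g
    by (intro mod_homI insert.prems regular_right_module ring_axioms right_module_axioms) auto
  define W where "W = U \<inter> ker V (regular_module K) g"
  have W: "msub K V W" unfolding W_def using insert.prems g.msub_ker msub_Int by blast
  have fW: "fin_gen K V W"
    using insert.prems W by (intro insert.IH) (auto simp: W_def ker_def)
  then obtain X where X: "finite X" "X \<subseteq> carrier V" "mspan K V X = W" by (auto simp: fin_gen_def)
  show ?case
  proof (cases "U \<subseteq> ker V (regular_module K) g")
    case True
    then show ?thesis using fW by (simp add: W_def inf_absorb1)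
  next
    case False
    then obtain v where v: "v \<in> U" "g v \<noteq> \<zero>" "v \<in> carrier V" using msub_mem[OF insert.prems(2)] by (auto simp: ker_def)
    have "U \<subseteq> adjoin K V W v"
    proof
      fix y assume y: "y \<in> U"
      have yc: "y \<in> carrier V" using y msub_mem insert.prems by blast
      \<comment> \<open>Chosen so that \<open>g\<close> vanishes on \<open>y\<close> minus
        \<open>c\<close> times \<open>v\<close>.\<close>
      define c where "c = inv (g v) \<otimes> g y"
      have gc: "g v \<in> carrier K" "g y \<in> carrier K" using g.closed v yc by auto
      have c: "c \<in> carrier K" "g v \<otimes> c = g y" unfolding c_def
        using gc v field_Units by (auto simp flip: m_assoc)
      have "y \<ominus>\<^bsub>V\<^esub> c \<odot>\<^bsub>V\<^esub> v \<in> U"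
        using insert.prems(2) y v c by (intro msub_diff) (auto simp: msub_def)
      moreover have "g (y \<ominus>\<^bsub>V\<^esub> c \<odot>\<^bsub>V\<^esub> v) = \<zero>" using yc v c gc by (simp add: g.N.diff_self[simplified])
      ultimately have "y \<ominus>\<^bsub>V\<^esub> c \<odot>\<^bsub>V\<^esub> v \<in> W" using yc v c by (auto simp: W_def ker_def)
      then show "y \<in> adjoin K V W v" using yc c by (auto simp: adjoin_def)
    qed
    then have "U = adjoin K V W v"
      using adjoin_least[OF insert.prems(2), of W v] v by (auto simp: W_def)
    then have "mspan K V (insert v X) = U" using mspan_insert[OF X(2) v(3)] X by simp
    then show ?thesis using X v by (auto simp: fin_gen_def intro!: exI[of _ "insert v X"])
  qed
qed

end

lemma vdim_image:
  assumes "vec K V" "vec K W" "mhom K V W f" "fin_gen K V U"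
  shows "fin_gen K W (f ` U)" "vdim K W (f ` U) \<le> vdim K V U"
proof -
  interpret V: vec K V by fact
  interpret W: vec K W by fact
  interpret mod_hom K V W f
    by (intro mod_homI assms V.right_module_axioms W.right_module_axioms)
  obtain X where X: "finite X" "X \<subseteq> carrier V" "mspan K V X = U" "card X = vdim K V U"
    using V.vdim_witness[OF assms(4)] by blast
  have *: "finite (f ` X)" "f ` X \<subseteq> carrier W" "mspan K W (f ` X) = f ` U"
    using X image_mspan[OF X(2)] closed by auto
  then show "fin_gen K W (f ` U)" by (auto simp: fin_gen_def)
  show "vdim K W (f ` U) \<le> vdim K V U"
    using W.vdim_le[OF *] card_image_le[OF X(1), of f] X(4) by simp
qed

section \<open>Modules over a finite-dimensional algebra\<close>

definition restrict_scalars ::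
    "('k \<Rightarrow> 'a) \<Rightarrow> ('a, 'm, 'y) module_scheme \<Rightarrow> ('k, 'm) module" where
  "restrict_scalars h M =
    \<lparr>carrier = carrier M, monoid.mult = undefined, one = undefined,
     ring.zero = \<zero>\<^bsub>M\<^esub>, ring.add = (\<oplus>\<^bsub>M\<^esub>), smult = (\<lambda>c x. h c \<odot>\<^bsub>M\<^esub> x)\<rparr>"

lemma restrict_scalars_simps [simp]:
  "carrier (restrict_scalars h M) = carrier M" "\<zero>\<^bsub>restrict_scalars h M\<^esub> = \<zero>\<^bsub>M\<^esub>"
  "x \<oplus>\<^bsub>restrict_scalars h M\<^esub> y = x \<oplus>\<^bsub>M\<^esub> y" "c \<odot>\<^bsub>restrict_scalars h M\<^esub> x = h c \<odot>\<^bsub>M\<^esub> x"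
  by (simp_all add: restrict_scalars_def)

lemma restrict_scalars_right_module:
  assumes "right_module R M" "ring K" "h \<in> ring_hom K R"
  shows "right_module K (restrict_scalars h M)"
proof -
  interpret right_module R M by fact
  have "abelian_group (restrict_scalars h M)"
  proof (rule abelian_groupI)
    fix x assume "x \<in> carrier (restrict_scalars h M)"
    then show "\<exists>y\<in>carrier (restrict_scalars h M). y \<oplus>\<^bsub>restrict_scalars h M\<^esub> x = \<zero>\<^bsub>restrict_scalars h M\<^esub>"
      by (auto intro!: bexI[of _ "\<ominus>\<^bsub>M\<^esub> x"] M.l_neg)
  qed (auto simp: M.a_ac)
  then show ?thesis
    using assms(3) ring_hom_closed[OF assms(3)]
    by (intro right_module.intro right_module_axioms.intro assms)
       (auto simp: ring_hom_add ring_hom_mult ring_hom_one ract_l_distr ract_r_distr ract_assoc ract_one)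
qed

text \<open>Left modules are treated as right modules over the opposite ring.\<close>

definition opp :: "('a, 'x) ring_scheme \<Rightarrow> ('a, 'x) ring_scheme" where
  "opp R = R\<lparr>monoid.mult := (\<lambda>x y. y \<otimes>\<^bsub>R\<^esub> x)\<rparr>"

lemma opp_simps [simp]:
  "carrier (opp R) = carrier R" "\<zero>\<^bsub>opp R\<^esub> = \<zero>\<^bsub>R\<^esub>" "\<one>\<^bsub>opp R\<^esub> = \<one>\<^bsub>R\<^esub>"
  "x \<oplus>\<^bsub>opp R\<^esub> y = x \<oplus>\<^bsub>R\<^esub> y" "x \<otimes>\<^bsub>opp R\<^esub> y = y \<otimes>\<^bsub>R\<^esub> x"
  by (simp_all add: opp_def)

lemma opp_ring: assumes "ring R" shows "ring (opp R)"
proof -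
  interpret ring R by fact
  have "abelian_group (opp R)"
    by (rule abelian_groupI) (auto simp: a_ac intro!: bexI[of _ "\<ominus>\<^bsub>R\<^esub> _"] l_neg)
  moreover have "monoid (opp R)" by (rule monoidI) (auto simp: m_assoc)
  ultimately show ?thesis by (rule ringI) (auto simp: l_distr r_distr)
qed

definition left_regular :: "('a, 'x) ring_scheme \<Rightarrow> ('a, 'a) module" where
  "left_regular A = regular_module (opp A)"

lemma left_regular_simps [simp]:
  "carrier (left_regular A) = carrier A" "\<zero>\<^bsub>left_regular A\<^esub> = \<zero>\<^bsub>A\<^esub>"
  "x \<oplus>\<^bsub>left_regular A\<^esub> y = x \<oplus>\<^bsub>A\<^esub> y" "a \<odot>\<^bsub>left_regular A\<^esub> x = a \<otimes>\<^bsub>A\<^esub> x"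
  by (simp_all add: left_regular_def)

context right_module
begin

lemma finsum_in_msub:
  assumes "msub A M U" "finite X" "X \<subseteq> U" "c \<in> X \<rightarrow> carrier A"
  shows "(\<Oplus>\<^bsub>M\<^esub>x\<in>X. c x \<odot>\<^bsub>M\<^esub> x) \<in> U"
  using assms(2-)
proof (induction X rule: finite_induct)
  case empty
  then show ?case using assms(1) by (simp add: msub_def)
next
  case (insert x X)
  have "x \<in> carrier M" "X \<subseteq> carrier M" "c x \<in> carrier A" using insert.prems assms(1) by (auto simp: msub_def)
  moreover then have "(\<lambda>x. c x \<odot>\<^bsub>M\<^esub> x) \<in> X \<rightarrow> carrier M" using insert.prems by (auto intro!: ract_closed)
  ultimately have "(\<Oplus>\<^bsub>M\<^esub>x\<in>insert x X. c x \<odot>\<^bsub>M\<^esub> x) = c x \<odot>\<^bsub>M\<^esub> x \<oplus>\<^bsub>M\<^esub> (\<Oplus>\<^bsub>M\<^esub>x\<in>X. c x \<odot>\<^bsub>M\<^esub> x)"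
    using insert.hyps by (intro M.finsum_insert) auto
  moreover have "(\<Oplus>\<^bsub>M\<^esub>x\<in>X. c x \<odot>\<^bsub>M\<^esub> x) \<in> U" using insert by auto
  moreover have "c x \<odot>\<^bsub>M\<^esub> x \<in> U" using insert.prems assms(1) \<open>c x \<in> carrier A\<close> by (auto simp: msub_def)
  ultimately show ?case using assms(1) by (auto simp: msub_def)
qed

lemma finitely_generated_fin_gen:
  assumes "finitely_generated A M" shows "fin_gen A M (carrier M)"
proof -
  obtain X where X: "finite X" "X \<subseteq> carrier M"
    "\<And>m. m \<in> carrier M \<Longrightarrow> \<exists>c\<in>X \<rightarrow> carrier A. m = (\<Oplus>\<^bsub>M\<^esub>x\<in>X. c x \<odot>\<^bsub>M\<^esub> x)"
    using assms by (auto simp: finitely_generated_def)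
  have "m \<in> mspan A M X" if "m \<in> carrier M" for m
    using X(3)[OF that] finsum_in_msub[OF mspan_msub[OF X(2)] X(1) mspan_incl] by auto
  moreover have "mspan A M X \<subseteq> carrier M" using mspan_msub[OF X(2)] by (simp add: msub_def)
  ultimately show ?thesis using X by (auto simp: fin_gen_def)
qed

lemma combination_add:
  assumes "finite X" "X \<subseteq> carrier M" "c \<in> X \<rightarrow> carrier A" "d \<in> X \<rightarrow> carrier A"
  shows "(\<Oplus>\<^bsub>M\<^esub>x\<in>X. c x \<odot>\<^bsub>M\<^esub> x) \<oplus>\<^bsub>M\<^esub> (\<Oplus>\<^bsub>M\<^esub>x\<in>X. d x \<odot>\<^bsub>M\<^esub> x)
    = (\<Oplus>\<^bsub>M\<^esub>x\<in>X. (c x \<oplus> d x) \<odot>\<^bsub>M\<^esub> x)"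
proof -
  have cl: "\<And>x. x \<in> X \<Longrightarrow> x \<in> carrier M \<and> c x \<in> carrier A \<and> d x \<in> carrier A"
    using assms by auto
  have "(\<Oplus>\<^bsub>M\<^esub>x\<in>X. (c x \<oplus> d x) \<odot>\<^bsub>M\<^esub> x) = (\<Oplus>\<^bsub>M\<^esub>x\<in>X. c x \<odot>\<^bsub>M\<^esub> x \<oplus>\<^bsub>M\<^esub> d x \<odot>\<^bsub>M\<^esub> x)"
    using cl by (intro M.finsum_cong') (auto simp: ract_l_distr)
  then show ?thesis using cl by (subst M.finsum_addf[symmetric]) auto
qed

lemma combination_act:
  assumes "finite X" "X \<subseteq> carrier M" "c \<in> X \<rightarrow> carrier A" "a \<in> carrier A"
  shows "a \<odot>\<^bsub>M\<^esub> (\<Oplus>\<^bsub>M\<^esub>x\<in>X. c x \<odot>\<^bsub>M\<^esub> x) = (\<Oplus>\<^bsub>M\<^esub>x\<in>X. (c x \<otimes> a) \<odot>\<^bsub>M\<^esub> x)"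
  using assms(1-3)
proof (induction X rule: finite_induct)
  case empty
  then show ?case using assms by simp
next
  case (insert y X)
  have cl: "x \<in> carrier M" "c x \<in> carrier A" if "x \<in> insert y X" for x using insert.prems that by auto
  have s: "(\<Oplus>\<^bsub>M\<^esub>x\<in>insert y X. d x \<odot>\<^bsub>M\<^esub> x) = d y \<odot>\<^bsub>M\<^esub> y \<oplus>\<^bsub>M\<^esub> (\<Oplus>\<^bsub>M\<^esub>x\<in>X. d x \<odot>\<^bsub>M\<^esub> x)"
    if "\<And>x. x \<in> insert y X \<Longrightarrow> d x \<in> carrier A" for d
    using insert.hyps cl that by (intro M.finsum_insert) auto
  have f: "(\<Oplus>\<^bsub>M\<^esub>x\<in>X. c x \<odot>\<^bsub>M\<^esub> x) \<in> carrier M" using cl by (intro M.finsum_closed) auto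
  show ?case
    using insert cl assms(4) f by (subst (1 2) s) (auto simp: ract_r_distr ract_assoc)
qed

text \<open>Linear combinations of a finite set form a submodule, hence exhaust its span; this
  reconciles \<open>finitely_generated\<close>, stated with sums, with \<open>fin_gen\<close>,
  stated with spans.\<close>

lemma combination_msub:
  assumes "finite X" "X \<subseteq> carrier M"
  defines "F \<equiv> {\<Oplus>\<^bsub>M\<^esub>x\<in>X. c x \<odot>\<^bsub>M\<^esub> x | c. c \<in> X \<rightarrow> carrier A}"
  shows "msub A M F" "X \<subseteq> F"
proof -
  show X: "X \<subseteq> F"
  proof
    fix x assume x: "x \<in> X"
    let ?c = "\<lambda>y. if x = y then \<one> else \<zero>"
    have "(\<Oplus>\<^bsub>M\<^esub>y\<in>X. ?c y \<odot>\<^bsub>M\<^esub> y) = (\<Oplus>\<^bsub>M\<^esub>y\<in>X. if x = y then y else \<zero>\<^bsub>M\<^esub>)"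
      using assms(2) by (intro M.finsum_cong') (auto simp: ract_one)
    also have "\<dots> = x" using x assms by (intro M.add.finprod_singleton) auto
    finally show "x \<in> F" unfolding F_def by (intro CollectI exI[of _ ?c]) auto
  qed
  show "msub A M F"
    unfolding msub_def
  proof (intro conjI ballI)
    show "F \<subseteq> carrier M" using assms(2) unfolding F_def by (auto intro!: M.finsum_closed ract_closed)
  next
    have "(\<Oplus>\<^bsub>M\<^esub>x\<in>X. \<zero> \<odot>\<^bsub>M\<^esub> x) = \<zero>\<^bsub>M\<^esub>" using assms(2) by (intro M.add.finprod_one_eqI) auto
    then show "\<zero>\<^bsub>M\<^esub> \<in> F" unfolding F_def by (intro CollectI exI[of _ "\<lambda>_. \<zero>"]) auto
  next
    fix x y assume "x \<in> F" "y \<in> F"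
    then obtain c d where cd: "c \<in> X \<rightarrow> carrier A" "x = (\<Oplus>\<^bsub>M\<^esub>x\<in>X. c x \<odot>\<^bsub>M\<^esub> x)"
      "d \<in> X \<rightarrow> carrier A" "y = (\<Oplus>\<^bsub>M\<^esub>x\<in>X. d x \<odot>\<^bsub>M\<^esub> x)" unfolding F_def by auto
    then have "x \<oplus>\<^bsub>M\<^esub> y = (\<Oplus>\<^bsub>M\<^esub>x\<in>X. (c x \<oplus> d x) \<odot>\<^bsub>M\<^esub> x)" using assms by (simp add: combination_add)
    then show "x \<oplus>\<^bsub>M\<^esub> y \<in> F" using cd unfolding F_def by (intro CollectI exI[of _ "\<lambda>x. c x \<oplus> d x"]) auto
  next
    fix a x assume a: "a \<in> carrier A" and "x \<in> F"
    then obtain c where c: "c \<in> X \<rightarrow> carrier A" "x = (\<Oplus>\<^bsub>M\<^esub>x\<in>X. c x \<odot>\<^bsub>M\<^esub> x)" unfolding F_def by auto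
    then have "a \<odot>\<^bsub>M\<^esub> x = (\<Oplus>\<^bsub>M\<^esub>x\<in>X. (c x \<otimes> a) \<odot>\<^bsub>M\<^esub> x)" using assms a by (simp add: combination_act)
    then show "a \<odot>\<^bsub>M\<^esub> x \<in> F" using c a unfolding F_def by (intro CollectI exI[of _ "\<lambda>x. c x \<otimes> a"]) auto
  qed
qed

lemma fin_gen_finitely_generated:
  assumes "fin_gen A M (carrier M)" shows "finitely_generated A M"
proof -
  obtain X where X: "finite X" "X \<subseteq> carrier M" "mspan A M X = carrier M"
    using assms by (auto simp: fin_gen_def)
  have "carrier M \<subseteq> {\<Oplus>\<^bsub>M\<^esub>x\<in>X. c x \<odot>\<^bsub>M\<^esub> x | c. c \<in> X \<rightarrow> carrier A}"
    using mspan_least[OF combination_msub[OF X(1,2)]] X(3) by simp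
  then show ?thesis unfolding finitely_generated_def using X(1,2) by (intro exI[of _ X]) blast
qed

end

section \<open>Finite-dimensional modules over a finite-dimensional algebra\<close>

locale fdalg =
  fixes K :: "('k, 'c) ring_scheme" and A :: "('k, 'a, 'd) module_scheme"
  assumes fda: "finite_dim_algebra K A"
begin

definition scalar where "scalar c = c \<odot>\<^bsub>A\<^esub> \<one>\<^bsub>A\<^esub>"

abbreviation kv where "kv M \<equiv> restrict_scalars scalar M"

lemma K_field: "field K" and A_ring: "ring A" and KA_module: "module K A"
  using fda by (auto simp: finite_dim_algebra_def)

sublocale K: field K by (rule K_field)
sublocale A: ring A by (rule A_ring)
sublocale KA: module K A by (rule KA_module)

lemma smult_mult_left: "\<lbrakk>c \<in> carrier K; x \<in> carrier A; y \<in> carrier A\<rbrakk> \<Longrightarrow>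
    (c \<odot>\<^bsub>A\<^esub> x) \<otimes>\<^bsub>A\<^esub> y = c \<odot>\<^bsub>A\<^esub> (x \<otimes>\<^bsub>A\<^esub> y)"
  and smult_mult_right: "\<lbrakk>c \<in> carrier K; x \<in> carrier A; y \<in> carrier A\<rbrakk> \<Longrightarrow>
    x \<otimes>\<^bsub>A\<^esub> (c \<odot>\<^bsub>A\<^esub> y) = c \<odot>\<^bsub>A\<^esub> (x \<otimes>\<^bsub>A\<^esub> y)"
  using fda by (auto simp: finite_dim_algebra_def)

lemma scalar_closed [simp]: "c \<in> carrier K \<Longrightarrow> scalar c \<in> carrier A"
  by (simp add: scalar_def KA.smult_closed)

lemma scalar_mult_left: "c \<in> carrier K \<Longrightarrow> x \<in> carrier A \<Longrightarrow> scalar c \<otimes>\<^bsub>A\<^esub> x = c \<odot>\<^bsub>A\<^esub> x"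
  by (simp add: scalar_def smult_mult_left)

lemma scalar_mult_right: "c \<in> carrier K \<Longrightarrow> x \<in> carrier A \<Longrightarrow> x \<otimes>\<^bsub>A\<^esub> scalar c = c \<odot>\<^bsub>A\<^esub> x"
  by (simp add: scalar_def smult_mult_right)

lemma scalar_central: "c \<in> carrier K \<Longrightarrow> x \<in> carrier A \<Longrightarrow> x \<otimes>\<^bsub>A\<^esub> scalar c = scalar c \<otimes>\<^bsub>A\<^esub> x"
  by (simp add: scalar_mult_left scalar_mult_right)

lemma scalar_hom: "scalar \<in> ring_hom K A"
  by (rule ring_hom_memI)
     (auto simp: scalar_mult_left, auto simp: scalar_def KA.smult_assoc1 KA.smult_l_distr KA.smult_one)

text \<open>Scalars are central, so left and right modules become vector spaces along the same map
  and \<open>kv\<close> serves both.\<close>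

lemma scalar_hom_opp: "scalar \<in> ring_hom K (opp A)"
proof (rule ring_hom_memI)
  fix c d assume *: "c \<in> carrier K" "d \<in> carrier K"
  then have "scalar (c \<otimes>\<^bsub>K\<^esub> d) = scalar c \<otimes>\<^bsub>A\<^esub> scalar d" by (rule ring_hom_mult[OF scalar_hom])
  also have "\<dots> = scalar d \<otimes>\<^bsub>A\<^esub> scalar c" using * by (intro scalar_central) auto
  finally show "scalar (c \<otimes>\<^bsub>K\<^esub> d) = scalar c \<otimes>\<^bsub>opp A\<^esub> scalar d" by simp
qed (use scalar_hom in \<open>auto simp: ring_hom_add ring_hom_one\<close>)

lemma vec_kv: assumes "right_module A M" shows "vec K (kv M)"
proof -
  interpret right_module K "kv M"
    by (rule restrict_scalars_right_module[OF assms K.ring_axioms scalar_hom])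
  show ?thesis ..
qed

lemma vec_kv_opp: assumes "right_module (opp A) M" shows "vec K (kv M)"
proof -
  interpret right_module K "kv M"
    by (rule restrict_scalars_right_module[OF assms K.ring_axioms scalar_hom_opp])
  show ?thesis ..
qed

lemma msub_kv: "msub A M U \<Longrightarrow> msub K (kv M) U"
  by (auto simp: msub_def)

lemma mhom_kv: "mhom A M N f \<Longrightarrow> mhom K (kv M) (kv N) f"
  by (auto simp: mhom_def)

lemma kv_on_sub: "kv (on_sub M U) = on_sub (kv M) U"
  by (simp add: restrict_scalars_def)

lemma A_regular: "right_module A (regular_module A)"
  by (rule regular_right_module) (rule A.ring_axioms)

lemma K_regular: "right_module K (regular_module K)"
  by (rule regular_right_module) (rule K.ring_axioms)

text \<open>Membership in \<open>mod A\<close> on an arbitrary carrier type, since quotients, duals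
  and Hom modules do not live on lists. Finite dimension over \<open>K\<close> replaces finite
  generation over \<open>A\<close> because it passes to submodules at once;
  \<open>fg_modules_iff\<close> states the agreement on lists.\<close>

definition fmod where
  "fmod M \<longleftrightarrow> right_module A M \<and> fin_gen K (kv M) (carrier M)"

definition dm where
  "dm M = vdim K (kv M) (carrier M)"

lemma fmod_right_module: "fmod M \<Longrightarrow> right_module A M"
  by (simp add: fmod_def)

text \<open>\<open>scalar c\<close> acts on the regular module exactly as \<open>c\<close> acts on
  the algebra, so both have the same subspaces and spans.\<close>

lemma KA_fin_gen: "fin_gen K (kv (regular_module A)) (carrier A)"
proof -
  interpret KA': right_module K A
    by (intro right_module.intro right_module_axioms.intro K.ring_axioms A.abelian_group_axioms)
       (auto simp: KA.smult_l_distr KA.smult_r_distr KA.smult_one K.m_comm simp flip: KA.smult_assoc1)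
  have "finitely_generated K A" using fda by (simp add: finite_dim_algebra_def)
  then obtain X where X: "finite X" "X \<subseteq> carrier A" "mspan K A X = carrier A"
    using KA'.finitely_generated_fin_gen by (auto simp: fin_gen_def)
  have "msub K (kv (regular_module A)) U \<longleftrightarrow> msub K A U" for U
    by (auto simp: msub_def scalar_mult_right subset_iff)
  then show ?thesis using X unfolding fin_gen_def mspan_def by auto
qed

lemma fmod_regular: "fmod (regular_module A)"
  using KA_fin_gen A_regular by (simp add: fmod_def)

text \<open>Products of vector space generators of \<open>A\<close> with module generators of
  \<open>M\<close> span a subspace that is stable under \<open>A\<close> and contains the module
  generators, so it is all of \<open>M\<close>.\<close>

lemma fmod_of_fin_gen:
  assumes "right_module A M" "fin_gen A M (carrier M)" shows "fmod M"
proof -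
  interpret right_module A M by fact
  interpret V: vec K "kv M" by (rule vec_kv) fact
  interpret R: right_module A "regular_module A" by (rule A_regular)
  interpret RV: vec K "kv (regular_module A)" by (rule vec_kv) (rule A_regular)
  obtain X where X: "finite X" "X \<subseteq> carrier M" "mspan A M X = carrier M"
    using assms by (auto simp: fin_gen_def)
  obtain B where B: "finite B" "B \<subseteq> carrier A" "mspan K (kv (regular_module A)) B = carrier A"
    using KA_fin_gen by (auto simp: fin_gen_def)
  define S where "S = (\<lambda>(b, x). b \<odot>\<^bsub>M\<^esub> x) ` (B \<times> X)"
  let ?S = "mspan K (kv M) S"
  have S: "finite S" "S \<subseteq> carrier (kv M)" using X B by (auto simp: S_def subset_iff)
  note sp = V.mspan_msub[OF S(2)]
  \<comment> \<open>The action on a fixed \<open>x\<close> is linear in the ring element, so it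
    suffices to check the vector space generators of \<open>A\<close>.\<close>
  have inS: "a \<odot>\<^bsub>M\<^esub> x \<in> ?S" if x: "x \<in> X" and a: "a \<in> carrier A" for a x
  proof -
    interpret f: mod_hom K "kv (regular_module A)" "kv M" "\<lambda>a. a \<odot>\<^bsub>M\<^esub> x"
      using x X(2)
      by (intro mod_homI V.right_module_axioms RV.right_module_axioms)
         (auto simp: mhom_def ract_l_distr ract_assoc subset_iff)
    have "B \<subseteq> {a \<in> carrier A. a \<odot>\<^bsub>M\<^esub> x \<in> ?S}"
      using B(2) x mspan_incl[of S K "kv M"] by (auto simp: S_def)
    then have "carrier A \<subseteq> {a \<in> carrier A. a \<odot>\<^bsub>M\<^esub> x \<in> ?S}"
      using mspan_least[OF f.msub_preimage[OF sp], of B] B(3) by simp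
    then show ?thesis using a by auto
  qed
  have SA: "a \<odot>\<^bsub>M\<^esub> y \<in> ?S" if a: "a \<in> carrier A" and y: "y \<in> ?S" for a y
  proof -
    interpret f: mod_hom K "kv M" "kv M" "\<lambda>y. a \<odot>\<^bsub>M\<^esub> y"
      using a
      by (intro mod_homI V.right_module_axioms)
         (auto simp: mhom_def ract_r_distr scalar_central simp flip: ract_assoc)
    have "a \<odot>\<^bsub>M\<^esub> (b \<odot>\<^bsub>M\<^esub> x) \<in> ?S" if "b \<in> B" "x \<in> X" for b x
      using inS[OF that(2), of "b \<otimes>\<^bsub>A\<^esub> a"] that a X(2) B(2) by (auto simp: ract_assoc subset_iff)
    then have "S \<subseteq> {y \<in> carrier M. a \<odot>\<^bsub>M\<^esub> y \<in> ?S}" using S by (auto simp: S_def)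
    then have "?S \<subseteq> {y \<in> carrier M. a \<odot>\<^bsub>M\<^esub> y \<in> ?S}"
      using mspan_least[OF f.msub_preimage[OF sp], of S] by simp
    then show ?thesis using y by auto
  qed
  have "msub A M ?S" using sp SA by (auto simp: msub_def)
  moreover have "X \<subseteq> ?S"
  proof
    fix x assume "x \<in> X"
    then show "x \<in> ?S" using inS[of x "\<one>\<^bsub>A\<^esub>"] X(2) by (auto simp: ract_one)
  qed
  ultimately have "carrier M \<subseteq> ?S" using mspan_least[of A M ?S X] X(3) by simp
  then have "?S = carrier M" using sp by (auto simp: msub_def)
  then show ?thesis using S assms(1) by (auto simp: fmod_def fin_gen_def)
qed

lemma fin_gen_of_fmod:
  assumes "fmod M" shows "fin_gen A M (carrier M)"
proof -
  interpret right_module A M using assms by (rule fmod_right_module)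
  obtain X where X: "finite X" "X \<subseteq> carrier M" "mspan K (kv M) X = carrier M"
    using assms by (auto simp: fmod_def fin_gen_def)
  have "carrier M \<subseteq> mspan A M X"
    using mspan_least[OF msub_kv[OF mspan_msub[OF X(2)]] mspan_incl] X(3) by simp
  then show ?thesis using X mspan_msub[OF X(2)] by (auto simp: fin_gen_def msub_def)
qed

lemma fg_modules_iff: "M \<in> fg_modules A \<longleftrightarrow> fmod M"
  using right_module.finitely_generated_fin_gen right_module.fin_gen_finitely_generated
    fmod_of_fin_gen fin_gen_of_fmod fmod_right_module
  unfolding fg_modules_def by blast

lemma fmod_representative:
  assumes "fmod M"
  obtains N f where "N \<in> fg_modules A" "mhom A M N f" "bij_betw f (carrier M) (carrier N)"
proof -
  interpret right_module A M using assms by (rule fmod_right_module)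
  have "finitely_generated A M" using fin_gen_finitely_generated fin_gen_of_fmod assms by blast
  then obtain N where "N \<in> fg_modules A" "module_iso A M N"
    using fg_modules_representative right_module_axioms by blast
  then show ?thesis using that module_hom_mhom unfolding module_iso_def by blast
qed

text \<open>Generators of \<open>W\<close> lie in \<open>W\<close>, hence in \<open>U\<close>, so
  both ambient modules admit the same spanning sets.\<close>

lemma vdim_on_sub:
  assumes "right_module A M" "msub A M U" "W \<subseteq> U"
  shows "vdim K (kv (on_sub M U)) W = vdim K (kv M) W"
    "fin_gen K (kv (on_sub M U)) W \<longleftrightarrow> fin_gen K (kv M) W"
proof -
  interpret V: vec K "kv M" by (rule vec_kv) fact
  have UM: "U \<subseteq> carrier M" using assms(2) by (simp add: msub_def)
  have eq: "(X \<subseteq> carrier (kv (on_sub M U)) \<and> mspan K (kv (on_sub M U)) X = W) =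
    (X \<subseteq> carrier (kv M) \<and> mspan K (kv M) X = W)" (is "?l = ?r") for X
  proof
    assume ?l
    then show ?r using mspan_on_sub[OF V.right_module_axioms msub_kv[OF assms(2)], of X] UM
      by (auto simp: kv_on_sub)
  next
    assume r: ?r
    then have "X \<subseteq> U" using assms(3) mspan_incl[of X K "kv M"] by blast
    then show ?l using mspan_on_sub[OF V.right_module_axioms msub_kv[OF assms(2)], of X] r
      by (simp add: kv_on_sub)
  qed
  then show "fin_gen K (kv (on_sub M U)) W \<longleftrightarrow> fin_gen K (kv M) W"
    unfolding fin_gen_def by (intro ex_cong1) (rule conj_cong[OF refl])
  have "(finite X \<and> X \<subseteq> carrier (kv (on_sub M U)) \<and> mspan K (kv (on_sub M U)) X = W \<and> card X = n) =
    (finite X \<and> X \<subseteq> carrier (kv M) \<and> mspan K (kv M) X = W \<and> card X = n)" for X n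
    using eq[of X] by blast
  then show "vdim K (kv (on_sub M U)) W = vdim K (kv M) W"
    unfolding vdim_def by (simp only:)
qed

lemma fmod_on_sub:
  assumes "fmod M" "msub A M U" shows "fmod (on_sub M U)"
proof -
  interpret right_module A M using assms by (simp add: fmod_def)
  interpret V: vec K "kv M" by (rule vec_kv) (rule right_module_axioms)
  have "fin_gen K (kv M) U"
    using assms V.vdim_mono(1)[OF _ msub_kv[OF assms(2)]] by (auto simp: fmod_def msub_def)
  then show ?thesis
    using vdim_on_sub(2)[OF right_module_axioms assms(2), of U] on_sub_module[OF assms(2)] by (simp add: fmod_def)
qed

text \<open>Strictness makes the dimension over \<open>K\<close> the measure for inductions on
  modules and for extremal choices among submodules.\<close>

lemma dm_on_sub_le:
  assumes "fmod M" "msub A M U" "msub A M W" "W \<subseteq> U"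
  shows "dm (on_sub M W) \<le> dm (on_sub M U)" "W \<noteq> U \<Longrightarrow> dm (on_sub M W) < dm (on_sub M U)"
proof -
  interpret right_module A M using assms by (simp add: fmod_def)
  interpret V: vec K "kv M" by (rule vec_kv) (rule right_module_axioms)
  have "fin_gen K (kv M) U"
    using assms V.vdim_mono(1)[OF _ msub_kv[OF assms(2)]] by (auto simp: fmod_def msub_def)
  from V.vdim_mono(2,3)[OF this msub_kv[OF assms(3)] assms(4)]
  show "dm (on_sub M W) \<le> dm (on_sub M U)" "W \<noteq> U \<Longrightarrow> dm (on_sub M W) < dm (on_sub M U)"
    using vdim_on_sub(1)[OF right_module_axioms assms(2), of U]
      vdim_on_sub(1)[OF right_module_axioms assms(3), of W] by (simp_all add: dm_def)
qed

lemma dm_sub: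
  assumes "fmod M" "msub A M U"
  shows "dm (on_sub M U) \<le> dm M" "U \<noteq> carrier M \<Longrightarrow> dm (on_sub M U) < dm M"
proof -
  interpret right_module A M using assms by (simp add: fmod_def)
  have "U \<subseteq> carrier M" using assms(2) by (simp add: msub_def)
  from dm_on_sub_le[OF assms(1) msub_carrier assms(2) this]
  show "dm (on_sub M U) \<le> dm M" "U \<noteq> carrier M \<Longrightarrow> dm (on_sub M U) < dm M"
    by (simp_all add: dm_def restrict_scalars_def)
qed

lemma dm_surj:
  assumes "fmod M" "right_module A N" "mhom A M N f" "f ` carrier M = carrier N"
  shows "fmod N" "dm N \<le> dm M"
  using vdim_image[OF vec_kv vec_kv mhom_kv, of M N f "carrier M"] assms
  by (auto simp: fmod_def dm_def)

lemma image_fmod: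
  assumes "fmod M" "right_module A N" "mhom A M N f"
  shows "fmod (on_sub N (f ` carrier M))" "dm (on_sub N (f ` carrier M)) \<le> dm M"
proof -
  interpret mod_hom A M N f using assms by (intro mod_homI) (simp_all add: fmod_def)
  have "right_module A (on_sub N (f ` carrier M))" by (rule N.on_sub_module) (rule msub_range)
  then show "fmod (on_sub N (f ` carrier M))" "dm (on_sub N (f ` carrier M)) \<le> dm M"
    using dm_surj[OF assms(1), of "on_sub N (f ` carrier M)" f] mhom_on_cod[OF assms(3)] by auto
qed

lemma dm_inj_image:
  assumes "fmod M" "right_module A N" "mhom A M N f" "inj_on f (carrier M)"
  shows "dm (on_sub N (f ` carrier M)) = dm M"
proof (rule antisym)
  interpret mod_hom A M N f using assms by (intro mod_homI) (simp_all add: fmod_def)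
  note im = image_fmod[OF assms(1-3)]
  show "dm (on_sub N (f ` carrier M)) \<le> dm M" by (rule im(2))
  show "dm M \<le> dm (on_sub N (f ` carrier M))"
    using dm_surj(2)[OF im(1) M.right_module_axioms hom_inv[OF assms(4)]] assms(4) by simp
qed

end

section \<open>Isomorphisms, direct sums and uniserial modules\<close>

lemma msumI: "x \<in> U \<Longrightarrow> y \<in> V \<Longrightarrow> x \<oplus>\<^bsub>M\<^esub> y \<in> msum M U V"
  by (auto simp: msum_def)

lemma (in right_module) uniserial_iff:
  "uniserial_module A M \<longleftrightarrow> (\<forall>U V. msub A M U \<and> msub A M V \<longrightarrow> U \<subseteq> V \<or> V \<subseteq> U)"
  by (simp add: uniserial_module_def submodule_iff)

lemma (in right_module) indecomposable_iff:
  "indecomposable_module A M \<longleftrightarrow> carrier M \<noteq> {\<zero>\<^bsub>M\<^esub>} \<and>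
    (\<forall>U V. msub A M U \<and> msub A M V \<and> U \<inter> V = {\<zero>\<^bsub>M\<^esub>} \<and> msum M U V = carrier M \<longrightarrow>
      U = {\<zero>\<^bsub>M\<^esub>} \<or> V = {\<zero>\<^bsub>M\<^esub>})"
  by (simp add: indecomposable_module_def submodule_iff set_add_eq_msum)

lemma (in right_module) simple_iff:
  "simple_module A M \<longleftrightarrow> carrier M \<noteq> {\<zero>\<^bsub>M\<^esub>} \<and>
    (\<forall>U. msub A M U \<longrightarrow> U = {\<zero>\<^bsub>M\<^esub>} \<or> U = carrier M)"
  by (simp add: simple_module_def submodule_iff)

lemma (in right_module) superfluous_iff:
  "superfluous A M U \<longleftrightarrow> msub A M U \<and> (\<forall>V. msub A M V \<and> msum M U V = carrier M \<longrightarrow> V = carrier M)"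
  by (simp add: superfluous_def submodule_iff set_add_eq_msum)

lemma (in right_module) uniserial_indecomposable:
  assumes "uniserial_module A M" "carrier M \<noteq> {\<zero>\<^bsub>M\<^esub>}" shows "indecomposable_module A M"
  unfolding indecomposable_iff
proof (intro conjI allI impI)
  fix U V assume *: "msub A M U \<and> msub A M V \<and> U \<inter> V = {\<zero>\<^bsub>M\<^esub>} \<and> msum M U V = carrier M"
  then have "U \<subseteq> V \<or> V \<subseteq> U" using assms(1) by (simp add: uniserial_iff)
  then show "U = {\<zero>\<^bsub>M\<^esub>} \<or> V = {\<zero>\<^bsub>M\<^esub>}" using * by (auto simp: Int_absorb1 Int_absorb2)
qed (rule assms(2))

lemma (in right_module) simple_uniserial:
  "simple_module A M \<Longrightarrow> uniserial_module A M"
  unfolding simple_iff uniserial_iff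
proof (intro allI impI)
  fix U V assume *: "carrier M \<noteq> {\<zero>\<^bsub>M\<^esub>} \<and> (\<forall>U. msub A M U \<longrightarrow> U = {\<zero>\<^bsub>M\<^esub>} \<or> U = carrier M)"
    "msub A M U \<and> msub A M V"
  then have "U = {\<zero>\<^bsub>M\<^esub>} \<or> U = carrier M" "\<zero>\<^bsub>M\<^esub> \<in> V" "V \<subseteq> carrier M" by (auto simp: msub_def)
  then show "U \<subseteq> V \<or> V \<subseteq> U" by auto
qed

lemma (in right_module) uniserial_on_sub:
  assumes "uniserial_module A M" "msub A M U" shows "uniserial_module A (on_sub M U)"
proof -
  interpret U: right_module A "on_sub M U" by (rule on_sub_module[OF assms(2)])
  show ?thesis using assms(1) unfolding U.uniserial_iff uniserial_iff msub_on_sub[OF assms(2)] by blast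
qed

text \<open>A submodule of the image is the image of its preimage, and preimages are
  comparable.\<close>

lemma (in mod_hom) uniserial_image:
  assumes "uniserial_module R M" shows "uniserial_module R (on_sub N (f ` carrier M))"
proof -
  interpret I: right_module R "on_sub N (f ` carrier M)" using N.on_sub_module msub_range by blast
  have *: "f ` {x \<in> carrier M. f x \<in> U} = U" if "U \<subseteq> f ` carrier M" for U using that by auto
  have "U \<subseteq> V \<or> V \<subseteq> U" if "U \<subseteq> f ` carrier M" "msub R N U" "V \<subseteq> f ` carrier M" "msub R N V" for U V
  proof -
    let ?p = "\<lambda>U. {x \<in> carrier M. f x \<in> U}"
    have "?p U \<subseteq> ?p V \<or> ?p V \<subseteq> ?p U"
      using assms msub_preimage[OF that(2)] msub_preimage[OF that(4)] unfolding M.uniserial_iff by blast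
    then have "f ` ?p U \<subseteq> f ` ?p V \<or> f ` ?p V \<subseteq> f ` ?p U" by (blast intro: image_mono)
    then show ?thesis unfolding *[OF that(1)] *[OF that(3)] .
  qed
  then show ?thesis unfolding I.uniserial_iff msub_on_sub[OF msub_range] by blast
qed

lemma (in mod_hom) uniserial_surj:
  assumes "uniserial_module R M" "f ` carrier M = carrier N" shows "uniserial_module R N"
proof -
  interpret I: right_module R "on_sub N (f ` carrier M)" using N.on_sub_module msub_range by blast
  have "\<forall>U V. msub R (on_sub N (f ` carrier M)) U \<and> msub R (on_sub N (f ` carrier M)) V \<longrightarrow> U \<subseteq> V \<or> V \<subseteq> U"
    using uniserial_image[OF assms(1)] by (simp only: I.uniserial_iff)
  moreover have "msub R (on_sub N (carrier N)) U \<longleftrightarrow> msub R N U" for U by (simp add: msub_def)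
  ultimately show ?thesis unfolding N.uniserial_iff assms(2) by simp
qed

section \<open>Isomorphisms with explicit inverses\<close>

locale mod_iso = mod_hom R M N f + inv: mod_hom R N M g
  for R :: "('a, 'x) ring_scheme" and M :: "('a, 'm, 'y) module_scheme"
    and N :: "('a, 'n, 'z) module_scheme" and f g +
  assumes gf [simp]: "x \<in> carrier M \<Longrightarrow> g (f x) = x"
    and fg [simp]: "y \<in> carrier N \<Longrightarrow> f (g y) = y"
begin

lemma surj: "f ` carrier M = carrier N"
proof
  show "carrier N \<subseteq> f ` carrier M"
  proof
    fix y assume "y \<in> carrier N"
    then show "y \<in> f ` carrier M" using imageI[of "g y" "carrier M" f] by simp
  qed
qed auto

lemma inj: "inj_on f (carrier M)"
  by (rule inj_on_inverseI[of _ g]) simp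

lemma bij: "bij_betw f (carrier M) (carrier N)"
  by (simp add: bij_betw_def surj inj)

lemma image_zero_iff:
  assumes "msub R M U" shows "f ` U = {\<zero>\<^bsub>N\<^esub>} \<longleftrightarrow> U = {\<zero>\<^bsub>M\<^esub>}"
proof
  assume *: "f ` U = {\<zero>\<^bsub>N\<^esub>}"
  have "x = \<zero>\<^bsub>M\<^esub>" if x: "x \<in> U" for x
  proof -
    have "f x = \<zero>\<^bsub>N\<^esub>" using * imageI[OF x, of f] by simp
    then show ?thesis using gf[OF M.msub_mem[OF assms x]] by simp
  qed
  then show "U = {\<zero>\<^bsub>M\<^esub>}" using assms by (auto simp: msub_def)
qed auto

lemma zero_iff: "carrier N = {\<zero>\<^bsub>N\<^esub>} \<longleftrightarrow> carrier M = {\<zero>\<^bsub>M\<^esub>}"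
  using image_zero_iff[OF M.msub_carrier] surj by simp

lemma msub_corr: "msub R N V \<Longrightarrow> \<exists>U. msub R M U \<and> V = f ` U"
proof -
  assume V: "msub R N V"
  have "V \<subseteq> carrier N" using V by (simp add: msub_def)
  then have "f ` g ` V = V" by (simp add: image_image subset_iff cong: image_cong)
  then show ?thesis using inv.msub_image[OF V] by (intro exI[of _ "g ` V"]) simp
qed

lemma indecomposable_iso:
  assumes "indecomposable_module R M" shows "indecomposable_module R N"
  unfolding N.indecomposable_iff
proof (intro conjI allI impI)
  show "carrier N \<noteq> {\<zero>\<^bsub>N\<^esub>}" using assms zero_iff by (simp add: M.indecomposable_iff)
  fix U V assume *: "msub R N U \<and> msub R N V \<and> U \<inter> V = {\<zero>\<^bsub>N\<^esub>} \<and> msum N U V = carrier N"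
  then obtain U' V' where U: "msub R M U'" "U = f ` U'" and V: "msub R M V'" "V = f ` V'"
    using msub_corr by metis
  have c: "U' \<subseteq> carrier M" "V' \<subseteq> carrier M" using U V by (auto simp: msub_def)
  have "f ` (U' \<inter> V') = {\<zero>\<^bsub>N\<^esub>}" using * U V c inj by (simp add: inj_on_image_Int)
  then have 1: "U' \<inter> V' = {\<zero>\<^bsub>M\<^esub>}" using image_zero_iff[OF M.msub_Int[OF U(1) V(1)]] by simp
  have "carrier M \<subseteq> msum M U' V'"
  proof
    fix x assume x: "x \<in> carrier M"
    then have "f x \<in> msum N U V" using * by simp
    then obtain u v where uv: "u \<in> U'" "v \<in> V'" "f x = f u \<oplus>\<^bsub>N\<^esub> f v" by (auto simp: msum_def U V)
    moreover have "u \<in> carrier M" "v \<in> carrier M" using uv c by auto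
    ultimately have "f x = f (u \<oplus>\<^bsub>M\<^esub> v)" by simp
    then have "g (f x) = g (f (u \<oplus>\<^bsub>M\<^esub> v))" by simp
    moreover have "u \<oplus>\<^bsub>M\<^esub> v \<in> carrier M" using uv c by auto
    ultimately have "x = u \<oplus>\<^bsub>M\<^esub> v" using x by (simp only: gf)
    then show "x \<in> msum M U' V'" using uv by (auto simp: msum_def)
  qed
  then have 2: "msum M U' V' = carrier M" using M.msub_msum[OF U(1) V(1)] by (auto simp: msub_def)
  have "U' = {\<zero>\<^bsub>M\<^esub>} \<or> V' = {\<zero>\<^bsub>M\<^esub>}" using assms 1 2 U(1) V(1) unfolding M.indecomposable_iff by blast
  then show "U = {\<zero>\<^bsub>N\<^esub>} \<or> V = {\<zero>\<^bsub>N\<^esub>}" unfolding U(2) V(2) by auto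
qed

end

lemma mod_isoI:
  assumes "right_module R M" "right_module R N" "mhom R M N f" "bij_betw f (carrier M) (carrier N)"
  shows "mod_iso R M N f (inv_into (carrier M) f)"
proof -
  interpret mod_hom R M N f using assms by (intro mod_homI)
  have b: "inj_on f (carrier M)" "f ` carrier M = carrier N" using assms by (auto simp: bij_betw_def)
  have "mhom R N M (inv_into (carrier M) f)" using hom_inv[OF b(1)] b(2) by simp
  then show ?thesis
    using assms b by (intro mod_iso.intro mod_iso_axioms.intro mod_homI) (auto simp: f_inv_into_f)
qed

lemma (in mod_iso) sym: "mod_iso R N M g f"
  by (intro mod_iso.intro mod_iso_axioms.intro inv.mod_hom_axioms mod_hom_axioms) auto

lemma (in mod_iso) module_iso: "module_iso R M N"
  unfolding module_iso_def using bij mhom_restrict[OF M.right_module_axioms hom]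
  by (intro bexI[of _ "restrict f (carrier M)"]) (auto simp: bij_betw_def inj_on_restrict_eq)

lemma mod_iso_trans:
  assumes "mod_iso R L M f g" "mod_iso R M N f' g'"
  shows "mod_iso R L N (\<lambda>x. f' (f x)) (\<lambda>x. g (g' x))"
proof -
  interpret a: mod_iso R L M f g by fact
  interpret b: mod_iso R M N f' g' by fact
  show ?thesis
    by (intro mod_iso.intro mod_iso_axioms.intro mod_homI a.M.right_module_axioms
        b.N.right_module_axioms mhom_comp[OF a.hom b.hom] mhom_comp[OF b.inv.hom a.inv.hom]) auto
qed

lemma module_iso_mod_iso:
  assumes "module_iso R M N" "right_module R M" "right_module R N"
  obtains f g where "mod_iso R M N f g"
proof -
  obtain f where "f \<in> module_hom R M N" "bij_betw f (carrier M) (carrier N)"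
    using assms(1) by (auto simp: module_iso_def)
  then show ?thesis using that[OF mod_isoI[OF assms(2,3) module_hom_mhom]] by blast
qed

text \<open>The component of \<open>x\<close> in \<open>U\<close> is the only \<open>u\<close> with
  \<open>x \<ominus> u\<close> in \<open>V\<close>; uniqueness makes the chosen component additive
  and \<open>A\<close>-linear.\<close>

lemma (in right_module) direct_sum_projection:
  assumes U: "msub A M U" and V: "msub A M V" and 0: "U \<inter> V = {\<zero>\<^bsub>M\<^esub>}" and s: "msum M U V = carrier M"
  obtains p where "mhom A M M p" "p ` carrier M \<subseteq> U" "\<And>x. x \<in> U \<Longrightarrow> p x = x"
    "\<And>x. x \<in> V \<Longrightarrow> p x = \<zero>\<^bsub>M\<^esub>" "\<And>x. x \<in> carrier M \<Longrightarrow> x \<ominus>\<^bsub>M\<^esub> p x \<in> V"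
proof -
  have uniq: "u = u'" if "u \<in> U" "u' \<in> U" "x \<ominus>\<^bsub>M\<^esub> u \<in> V" "x \<ominus>\<^bsub>M\<^esub> u' \<in> V" "x \<in> carrier M" for u u' x
  proof -
    have c: "u \<in> carrier M" "u' \<in> carrier M" using that U msub_mem by blast+
    have "(x \<ominus>\<^bsub>M\<^esub> u') \<ominus>\<^bsub>M\<^esub> (x \<ominus>\<^bsub>M\<^esub> u) = u \<ominus>\<^bsub>M\<^esub> u'" using that c by (simp add: diff_diff_cancel_left)
    then have "u \<ominus>\<^bsub>M\<^esub> u' \<in> U \<inter> V" using msub_diff[OF V that(4,3)] msub_diff[OF U that(1,2)] by simp
    then have "u \<ominus>\<^bsub>M\<^esub> u' = \<zero>\<^bsub>M\<^esub>" using 0 by auto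
    then show ?thesis using c diff_zero_iff by blast
  qed
  have ex: "\<exists>u. u \<in> U \<and> x \<ominus>\<^bsub>M\<^esub> u \<in> V" if "x \<in> carrier M" for x
  proof -
    have "x \<in> msum M U V" using s that by simp
    then obtain u v where uv: "u \<in> U" "v \<in> V" "x = u \<oplus>\<^bsub>M\<^esub> v" by (auto simp: msum_def)
    have "u \<in> carrier M" "v \<in> carrier M" using uv U V msub_mem by blast+
    then have "x \<ominus>\<^bsub>M\<^esub> u = v" using uv by (simp add: a_minus_def M.a_comm[of u v] M.a_assoc M.r_neg)
    then show ?thesis using uv by auto
  qed
  define p where "p x = (SOME u. u \<in> U \<and> x \<ominus>\<^bsub>M\<^esub> u \<in> V)" for x
  have p: "p x \<in> U" "x \<ominus>\<^bsub>M\<^esub> p x \<in> V" "p x \<in> carrier M" if "x \<in> carrier M" for x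
    using someI_ex[OF ex[OF that]] msub_mem[OF U] unfolding p_def by auto
  have p_eq: "p x = u" if "u \<in> U" "x \<ominus>\<^bsub>M\<^esub> u \<in> V" "x \<in> carrier M" for x u
    using uniq[OF p(1) that(1) p(2) that(2)] that by auto
  have "mhom A M M p"
    unfolding mhom_def
  proof (intro conjI ballI)
    fix x y assume xy: "x \<in> carrier M" "y \<in> carrier M"
    then have "(x \<oplus>\<^bsub>M\<^esub> y) \<ominus>\<^bsub>M\<^esub> (p x \<oplus>\<^bsub>M\<^esub> p y) = (x \<ominus>\<^bsub>M\<^esub> p x) \<oplus>\<^bsub>M\<^esub> (y \<ominus>\<^bsub>M\<^esub> p y)"
      using p(3) by (simp add: add_diff_add)
    then show "p (x \<oplus>\<^bsub>M\<^esub> y) = p x \<oplus>\<^bsub>M\<^esub> p y"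
      using xy p(1,2) U V by (intro p_eq) (auto simp: msub_def)
  next
    fix a x assume a: "a \<in> carrier A" "x \<in> carrier M"
    then have "a \<odot>\<^bsub>M\<^esub> x \<ominus>\<^bsub>M\<^esub> a \<odot>\<^bsub>M\<^esub> p x = a \<odot>\<^bsub>M\<^esub> (x \<ominus>\<^bsub>M\<^esub> p x)" using p(3) by (simp add: ract_diff)
    then show "p (a \<odot>\<^bsub>M\<^esub> x) = a \<odot>\<^bsub>M\<^esub> p x"
      using a p(1,2) U V by (intro p_eq) (auto simp: msub_def)
  qed (use p in auto)
  moreover have "p x = x" if "x \<in> U" for x
    using that msub_mem[OF U that] V by (intro p_eq) (auto simp: msub_def)
  moreover have "p x = \<zero>\<^bsub>M\<^esub>" if "x \<in> V" for x
    using that msub_mem[OF V that] U by (intro p_eq) (auto simp: msub_def)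
  ultimately show ?thesis using that p by blast
qed

text \<open>An element of \<open>Y\<close> of the form \<open>z \<oplus> v\<close> with
  \<open>z\<close> in \<open>Z\<close> and \<open>v\<close> in \<open>V\<close> has \<open>v\<close>
  in \<open>U\<close>, as \<open>U\<close> contains \<open>Y\<close> and \<open>Z\<close>; hence
  \<open>v\<close> is zero and the element lies in \<open>Y \<inter> Z\<close>.\<close>

lemma (in right_module) refine_direct_sum:
  assumes U: "msub A M U" and V: "msub A M V" and 0: "U \<inter> V = {\<zero>\<^bsub>M\<^esub>}" and s: "msum M U V = carrier M"
    and Y: "msub A M Y" and Z: "msub A M Z" and YZ: "Y \<inter> Z = {\<zero>\<^bsub>M\<^esub>}" "msum M Y Z = U"
  shows "Y \<inter> msum M Z V = {\<zero>\<^bsub>M\<^esub>}" "msum M Y (msum M Z V) = carrier M"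
proof -
  have YU: "Y \<subseteq> U" "Z \<subseteq> U" using msum_upper1[OF Y Z] msum_upper2[OF Y Z] YZ by auto
  have ZV: "msub A M (msum M Z V)" using msub_msum Z V by blast
  have "x = \<zero>\<^bsub>M\<^esub>" if x: "x \<in> Y" "x \<in> msum M Z V" for x
  proof -
    obtain z v where zv: "z \<in> Z" "v \<in> V" "x = z \<oplus>\<^bsub>M\<^esub> v" using x by (auto simp: msum_def)
    have "v \<in> U" using msub_add_iff[OF U, of z v] zv x YU msub_mem[OF V] by auto
    then have "v = \<zero>\<^bsub>M\<^esub>" using zv 0 by auto
    then have "x = z" using zv msub_mem[OF Z] by auto
    then show ?thesis using zv x YZ by auto
  qed
  then show "Y \<inter> msum M Z V = {\<zero>\<^bsub>M\<^esub>}" using Y ZV by (auto simp: msub_def)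
  let ?T = "msum M Y (msum M Z V)"
  have T: "msub A M ?T" using msub_msum Y ZV by blast
  have "Y \<subseteq> ?T" "msum M Z V \<subseteq> ?T" using msum_upper1[OF Y ZV] msum_upper2[OF Y ZV] .
  moreover have "Z \<subseteq> msum M Z V" "V \<subseteq> msum M Z V" using msum_upper1[OF Z V] msum_upper2[OF Z V] .
  ultimately have "U \<subseteq> ?T" "V \<subseteq> ?T" using msum_least[OF T, of Y Z] YZ(2) by auto
  then show "?T = carrier M" using msum_least[OF T, of U V] s T by (auto simp: msub_def)
qed

text \<open>A section \<open>s\<close> writes \<open>x\<close> as the sum of
  \<open>x \<ominus> s (f x)\<close>, which \<open>f\<close> kills, and
  \<open>s (f x)\<close>.\<close>

lemma split_direct_sum:
  assumes "mod_hom R M N f" "mod_hom R N M s" "\<And>y. y \<in> carrier N \<Longrightarrow> f (s y) = y"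
  shows "ker M N f \<inter> s ` carrier N = {\<zero>\<^bsub>M\<^esub>}" "msum M (ker M N f) (s ` carrier N) = carrier M"
proof -
  interpret f: mod_hom R M N f by fact
  interpret s: mod_hom R N M s by fact
  show "ker M N f \<inter> s ` carrier N = {\<zero>\<^bsub>M\<^esub>}"
  proof
    show "{\<zero>\<^bsub>M\<^esub>} \<subseteq> ker M N f \<inter> s ` carrier N" using f.msub_ker s.msub_range by (simp add: msub_def)
    show "ker M N f \<inter> s ` carrier N \<subseteq> {\<zero>\<^bsub>M\<^esub>}"
    proof
      fix x assume "x \<in> ker M N f \<inter> s ` carrier N"
      then obtain y where y: "y \<in> carrier N" "x = s y" "f (s y) = \<zero>\<^bsub>N\<^esub>" by (auto simp: ker_def)
      then have "y = \<zero>\<^bsub>N\<^esub>" using assms(3)[OF y(1)] by simp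
      then show "x \<in> {\<zero>\<^bsub>M\<^esub>}" using y(2) s.zero by simp
    qed
  qed
  have "x \<in> msum M (ker M N f) (s ` carrier N)" if x: "x \<in> carrier M" for x
  proof -
    have "x \<ominus>\<^bsub>M\<^esub> s (f x) \<in> ker M N f" using x assms(3) by (intro f.diff_in_ker) auto
    moreover have "(x \<ominus>\<^bsub>M\<^esub> s (f x)) \<oplus>\<^bsub>M\<^esub> s (f x) = x" using x by (intro f.M.diff_add_cancel) auto
    moreover have "s (f x) \<in> s ` carrier N" using x by simp
    ultimately show ?thesis using msumI[of "x \<ominus>\<^bsub>M\<^esub> s (f x)" _ "s (f x)" _ M] by simp
  qed
  moreover have "msum M (ker M N f) (s ` carrier N) \<subseteq> carrier M"
    using f.M.msub_msum[OF f.msub_ker s.msub_range] by (simp add: msub_def)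
  ultimately show "msum M (ker M N f) (s ` carrier N) = carrier M" by auto
qed

section \<open>Duality\<close>

context fdalg
begin

lemma dual_carrier_iff:
  "f \<in> carrier (dual_module K A N) \<longleftrightarrow>
    f \<in> extensional (carrier N) \<and> mhom K (kv N) (regular_module K) f"
proof -
  have "f \<in> carrier (dual_module K A N) \<longleftrightarrow> f \<in> extensional (carrier N) \<and> (\<forall>x\<in>carrier N. f x \<in> carrier K) \<and>
    (\<forall>x\<in>carrier N. \<forall>y\<in>carrier N. f (x \<oplus>\<^bsub>N\<^esub> y) = f x \<oplus>\<^bsub>K\<^esub> f y) \<and>
    (\<forall>c\<in>carrier K. \<forall>x\<in>carrier N. f (scalar c \<odot>\<^bsub>N\<^esub> x) = c \<otimes>\<^bsub>K\<^esub> f x)"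
    by (auto simp: dual_module_def scalar_def PiE_def Pi_def)
  also have "\<dots> \<longleftrightarrow> f \<in> extensional (carrier N) \<and> mhom K (kv N) (regular_module K) f"
    by (auto simp: mhom_def K.m_comm)
  finally show ?thesis .
qed

lemma dual_simps [simp]:
  "\<zero>\<^bsub>dual_module K A N\<^esub> = (\<lambda>x\<in>carrier N. \<zero>\<^bsub>K\<^esub>)"
  "f \<oplus>\<^bsub>dual_module K A N\<^esub> g = (\<lambda>x\<in>carrier N. f x \<oplus>\<^bsub>K\<^esub> g x)"
  "a \<odot>\<^bsub>dual_module K A N\<^esub> f = (\<lambda>x\<in>carrier N. f (a \<odot>\<^bsub>N\<^esub> x))"
  by (simp_all add: dual_module_def)

lemma dual_eqI:
  "\<lbrakk>f \<in> carrier (dual_module K A N); g \<in> carrier (dual_module K A N); \<And>x. x \<in> carrier N \<Longrightarrow> f x = g x\<rbrakk>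
    \<Longrightarrow> f = g"
  using extensionalityI[of f "carrier N" g] by (simp add: dual_carrier_iff)

context
  fixes N :: "('a, 'n, 'z) module_scheme"
  assumes N: "right_module (opp A) N"
begin

interpretation N: right_module "opp A" N by (rule N)
interpretation NV: vec K "kv N" by (rule vec_kv_opp) (rule N)

lemma dualD:
  assumes "f \<in> carrier (dual_module K A N)"
  shows "\<And>x. x \<in> carrier N \<Longrightarrow> f x \<in> carrier K"
    "\<And>x y. x \<in> carrier N \<Longrightarrow> y \<in> carrier N \<Longrightarrow> f (x \<oplus>\<^bsub>N\<^esub> y) = f x \<oplus>\<^bsub>K\<^esub> f y"
    "\<And>c x. c \<in> carrier K \<Longrightarrow> x \<in> carrier N \<Longrightarrow> f (scalar c \<odot>\<^bsub>N\<^esub> x) = c \<otimes>\<^bsub>K\<^esub> f x"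
    "f \<zero>\<^bsub>N\<^esub> = \<zero>\<^bsub>K\<^esub>"
proof -
  interpret f: mod_hom K "kv N" "regular_module K" f
    using assms by (intro mod_homI NV.right_module_axioms K_regular) (simp add: dual_carrier_iff)
  show "\<And>x. x \<in> carrier N \<Longrightarrow> f x \<in> carrier K"
    "\<And>x y. x \<in> carrier N \<Longrightarrow> y \<in> carrier N \<Longrightarrow> f (x \<oplus>\<^bsub>N\<^esub> y) = f x \<oplus>\<^bsub>K\<^esub> f y"
    "\<And>c x. c \<in> carrier K \<Longrightarrow> x \<in> carrier N \<Longrightarrow> f (scalar c \<odot>\<^bsub>N\<^esub> x) = c \<otimes>\<^bsub>K\<^esub> f x"
    "f \<zero>\<^bsub>N\<^esub> = \<zero>\<^bsub>K\<^esub>"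
    using f.closed f.add f.act f.zero by (auto simp: K.m_comm)
qed

lemma dualI:
  assumes "\<And>x. x \<in> carrier N \<Longrightarrow> f x \<in> carrier K"
    "\<And>x y. x \<in> carrier N \<Longrightarrow> y \<in> carrier N \<Longrightarrow> f (x \<oplus>\<^bsub>N\<^esub> y) = f x \<oplus>\<^bsub>K\<^esub> f y"
    "\<And>c x. c \<in> carrier K \<Longrightarrow> x \<in> carrier N \<Longrightarrow> f (scalar c \<odot>\<^bsub>N\<^esub> x) = c \<otimes>\<^bsub>K\<^esub> f x"
  shows "restrict f (carrier N) \<in> carrier (dual_module K A N)"
  using assms by (auto simp: dual_carrier_iff mhom_def K.m_comm)

lemma dual_right_module: "right_module A (dual_module K A N)"
proof -
  let ?D = "dual_module K A N"
  have ab: "abelian_group ?D"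
  proof (rule abelian_groupI)
    fix f g assume "f \<in> carrier ?D" "g \<in> carrier ?D"
    note f = dualD[OF this(1)] and g = dualD[OF this(2)]
    show "f \<oplus>\<^bsub>?D\<^esub> g \<in> carrier ?D"
      unfolding dual_simps using f g by (intro dualI) (auto simp: K.a_ac K.r_distr)
  next
    show "\<zero>\<^bsub>?D\<^esub> \<in> carrier ?D" unfolding dual_simps by (intro dualI) auto
  next
    fix f assume fc: "f \<in> carrier ?D"
    note f = dualD[OF fc]
    have m: "(\<lambda>x\<in>carrier N. \<ominus>\<^bsub>K\<^esub> f x) \<in> carrier ?D"
      using f by (intro dualI) (auto simp: K.minus_add K.r_minus)
    show "\<exists>g\<in>carrier ?D. g \<oplus>\<^bsub>?D\<^esub> f = \<zero>\<^bsub>?D\<^esub>"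
      using f by (intro bexI[OF _ m]) (auto intro!: ext simp: K.l_neg restrict_def)
    show "\<zero>\<^bsub>?D\<^esub> \<oplus>\<^bsub>?D\<^esub> f = f"
      using f fc by (intro extensionalityI[of _ "carrier N"]) (auto simp: dual_carrier_iff)
  next
    fix f g h assume "f \<in> carrier ?D" "g \<in> carrier ?D" "h \<in> carrier ?D"
    note fgh = this[THEN dualD(1)]
    show "f \<oplus>\<^bsub>?D\<^esub> g \<oplus>\<^bsub>?D\<^esub> h = f \<oplus>\<^bsub>?D\<^esub> (g \<oplus>\<^bsub>?D\<^esub> h)" using fgh by (auto simp: K.a_assoc intro!: restrict_ext)
    show "f \<oplus>\<^bsub>?D\<^esub> g = g \<oplus>\<^bsub>?D\<^esub> f" using fgh by (auto simp: K.a_comm intro!: restrict_ext)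
  qed
  show ?thesis
  proof (intro right_module.intro right_module_axioms.intro ab A.ring_axioms)
    fix a f assume a: "a \<in> carrier A" and "f \<in> carrier ?D"
    note f = dualD[OF this(2)]
    \<comment> \<open>Scalars commute with \<open>a\<close>, so the translate of a functional by
      \<open>a\<close> stays \<open>K\<close>-linear.\<close>
    have "a \<odot>\<^bsub>N\<^esub> (scalar c \<odot>\<^bsub>N\<^esub> x) = scalar c \<odot>\<^bsub>N\<^esub> (a \<odot>\<^bsub>N\<^esub> x)" if "c \<in> carrier K" "x \<in> carrier N" for c x
      using that a N.ract_assoc[of "scalar c" a x] N.ract_assoc[of a "scalar c" x]
      by (simp add: scalar_central)
    then show "a \<odot>\<^bsub>?D\<^esub> f \<in> carrier ?D"
      unfolding dual_simps using f a by (intro dualI) (auto simp: N.ract_r_distr)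
  next
    fix a b f assume ab: "a \<in> carrier A" "b \<in> carrier A" and "f \<in> carrier ?D"
    note f = dualD[OF this(3)]
    show "(a \<oplus>\<^bsub>A\<^esub> b) \<odot>\<^bsub>?D\<^esub> f = a \<odot>\<^bsub>?D\<^esub> f \<oplus>\<^bsub>?D\<^esub> b \<odot>\<^bsub>?D\<^esub> f"
      using N.ract_l_distr[of a b] ab f by (auto intro!: restrict_ext)
    show "(a \<otimes>\<^bsub>A\<^esub> b) \<odot>\<^bsub>?D\<^esub> f = b \<odot>\<^bsub>?D\<^esub> (a \<odot>\<^bsub>?D\<^esub> f)"
      using N.ract_assoc[of b a] N.ract_closed ab f by (auto intro!: restrict_ext)
  next
    fix a f g assume "a \<in> carrier A" "f \<in> carrier ?D" "g \<in> carrier ?D"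
    then show "a \<odot>\<^bsub>?D\<^esub> (f \<oplus>\<^bsub>?D\<^esub> g) = a \<odot>\<^bsub>?D\<^esub> f \<oplus>\<^bsub>?D\<^esub> a \<odot>\<^bsub>?D\<^esub> g"
      using N.ract_closed by (auto intro!: restrict_ext)
  next
    fix f assume f: "f \<in> carrier ?D"
    then show "\<one>\<^bsub>A\<^esub> \<odot>\<^bsub>?D\<^esub> f = f"
      using N.ract_one by (intro extensionalityI[of _ "carrier N"]) (auto simp: dual_carrier_iff)
  qed
qed

text \<open>Evaluations at finitely many generators of \<open>N\<close> separate functionals, so
  \<open>fin_gen_of_separating\<close> applies to the dual.\<close>

lemma dual_fmod:
  assumes "fin_gen K (kv N) (carrier N)" shows "fmod (dual_module K A N)"
proof -
  let ?D = "dual_module K A N"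
  obtain X where X: "finite X" "X \<subseteq> carrier N" "mspan K (kv N) X = carrier N"
    using assms by (auto simp: fin_gen_def)
  interpret D: vec K "kv ?D" by (rule vec_kv) (rule dual_right_module)
  have "fin_gen K (kv ?D) (carrier (kv ?D))"
  proof (rule D.fin_gen_of_separating)
    show "finite ((\<lambda>x f. f x) ` X)" using X by simp
    show "msub K (kv ?D) (carrier (kv ?D))" by (rule D.msub_carrier)
  next
    fix l assume "l \<in> (\<lambda>x (f :: 'n \<Rightarrow> 'k). f x) ` X"
    then obtain x where x: "x \<in> carrier N" "l = (\<lambda>f. f x)" using X by auto
    have "f x \<in> carrier K" if "f \<in> carrier ?D" for f using that x dualD by blast
    then show "mhom K (kv ?D) (regular_module K) l"
      using x dualD(3) by (auto simp: mhom_def K.m_comm)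
  next
    fix u assume u: "u \<in> carrier (kv ?D)" and 0: "\<And>l. l \<in> (\<lambda>x f. f x) ` X \<Longrightarrow> l u = \<zero>\<^bsub>K\<^esub>"
    have uD: "u \<in> carrier ?D" using u by simp
    interpret u: mod_hom K "kv N" "regular_module K" u
      using uD by (intro mod_homI NV.right_module_axioms K_regular) (simp add: dual_carrier_iff)
    have "X \<subseteq> ker (kv N) (regular_module K) u" using 0 X by (auto simp: ker_def)
    then have "carrier N \<subseteq> ker (kv N) (regular_module K) u" using mspan_least[OF u.msub_ker, of X] X(3) by simp
    then have "u x = \<zero>\<^bsub>K\<^esub>" if "x \<in> carrier N" for x using that by (auto simp: ker_def)
    then show "u = \<zero>\<^bsub>kv ?D\<^esub>"
      using uD by (intro extensionalityI[of _ "carrier N"]) (auto simp: dual_carrier_iff)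
  qed
  then show ?thesis using dual_right_module by (simp add: fmod_def)
qed

end

section \<open>The left module of homomorphisms into \<open>A\<close>\<close>

lemma left_regular_module: "right_module (opp A) (left_regular A)"
  unfolding left_regular_def by (rule regular_right_module) (rule opp_ring, rule A.ring_axioms)

lemma hom_to_ring_simps [simp]:
  "carrier (hom_to_ring A P) = module_hom A P (regular_module A)"
  "\<zero>\<^bsub>hom_to_ring A P\<^esub> = (\<lambda>p\<in>carrier P. \<zero>\<^bsub>A\<^esub>)"
  "f \<oplus>\<^bsub>hom_to_ring A P\<^esub> g = (\<lambda>p\<in>carrier P. f p \<oplus>\<^bsub>A\<^esub> g p)"
  "a \<odot>\<^bsub>hom_to_ring A P\<^esub> f = (\<lambda>p\<in>carrier P. a \<otimes>\<^bsub>A\<^esub> f p)"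
  by (simp_all add: hom_to_ring_def)

lemma hom_to_ringD:
  assumes "f \<in> module_hom A P (regular_module A)"
  shows "\<And>x. x \<in> carrier P \<Longrightarrow> f x \<in> carrier A"
    "\<And>x y. x \<in> carrier P \<Longrightarrow> y \<in> carrier P \<Longrightarrow> f (x \<oplus>\<^bsub>P\<^esub> y) = f x \<oplus>\<^bsub>A\<^esub> f y"
    "\<And>a x. a \<in> carrier A \<Longrightarrow> x \<in> carrier P \<Longrightarrow> f (a \<odot>\<^bsub>P\<^esub> x) = f x \<otimes>\<^bsub>A\<^esub> a"
    "f \<in> extensional (carrier P)"
  using assms by (auto simp: module_hom_iff mhom_def)

lemma hom_to_ringI:
  assumes "right_module A P" "\<And>x. x \<in> carrier P \<Longrightarrow> f x \<in> carrier A"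
    "\<And>x y. x \<in> carrier P \<Longrightarrow> y \<in> carrier P \<Longrightarrow> f (x \<oplus>\<^bsub>P\<^esub> y) = f x \<oplus>\<^bsub>A\<^esub> f y"
    "\<And>a x. a \<in> carrier A \<Longrightarrow> x \<in> carrier P \<Longrightarrow> f (a \<odot>\<^bsub>P\<^esub> x) = f x \<otimes>\<^bsub>A\<^esub> a"
  shows "restrict f (carrier P) \<in> module_hom A P (regular_module A)"
  using assms by (intro mhom_restrict) (auto simp: mhom_def)

lemma hom_to_ring_left_module:
  assumes P: "right_module A P" shows "right_module (opp A) (hom_to_ring A P)"
proof -
  interpret P: right_module A P by (rule P)
  let ?H = "hom_to_ring A P"
  have ab: "abelian_group ?H"
  proof (rule abelian_groupI)
    fix f g assume "f \<in> carrier ?H" "g \<in> carrier ?H"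
    then have "f \<in> module_hom A P (regular_module A)" "g \<in> module_hom A P (regular_module A)" by simp_all
    note f = hom_to_ringD[OF this(1)] and g = hom_to_ringD[OF this(2)]
    show "f \<oplus>\<^bsub>?H\<^esub> g \<in> carrier ?H"
      unfolding hom_to_ring_simps using f g by (intro hom_to_ringI P) (auto simp: A.a_ac A.l_distr)
  next
    show "\<zero>\<^bsub>?H\<^esub> \<in> carrier ?H" unfolding hom_to_ring_simps by (intro hom_to_ringI P) auto
  next
    fix f assume "f \<in> carrier ?H"
    then have "f \<in> module_hom A P (regular_module A)" by simp
    note f = hom_to_ringD[OF this]
    have m: "(\<lambda>x\<in>carrier P. \<ominus>\<^bsub>A\<^esub> f x) \<in> carrier ?H"
      unfolding hom_to_ring_simps using f by (intro hom_to_ringI P) (auto simp: A.minus_add A.l_minus)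
    show "\<exists>g\<in>carrier ?H. g \<oplus>\<^bsub>?H\<^esub> f = \<zero>\<^bsub>?H\<^esub>"
      using f by (intro bexI[OF _ m]) (auto intro!: ext simp: A.l_neg restrict_def)
    show "\<zero>\<^bsub>?H\<^esub> \<oplus>\<^bsub>?H\<^esub> f = f"
      using f by (intro extensionalityI[of _ "carrier P"]) auto
  next
    fix f g h assume "f \<in> carrier ?H" "g \<in> carrier ?H" "h \<in> carrier ?H"
    then have "f \<in> module_hom A P (regular_module A)" "g \<in> module_hom A P (regular_module A)"
      "h \<in> module_hom A P (regular_module A)" by simp_all
    note fgh = this[THEN hom_to_ringD(1)]
    show "f \<oplus>\<^bsub>?H\<^esub> g \<oplus>\<^bsub>?H\<^esub> h = f \<oplus>\<^bsub>?H\<^esub> (g \<oplus>\<^bsub>?H\<^esub> h)" using fgh by (auto simp: A.a_assoc intro!: restrict_ext)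
    show "f \<oplus>\<^bsub>?H\<^esub> g = g \<oplus>\<^bsub>?H\<^esub> f" using fgh by (auto simp: A.a_comm intro!: restrict_ext)
  qed
  show ?thesis
  proof (intro right_module.intro right_module_axioms.intro ab opp_ring A.ring_axioms)
    fix a f assume a: "a \<in> carrier (opp A)" and "f \<in> carrier ?H"
    then have "f \<in> module_hom A P (regular_module A)" by simp
    note f = hom_to_ringD[OF this]
    show "a \<odot>\<^bsub>?H\<^esub> f \<in> carrier ?H"
      unfolding hom_to_ring_simps using f a by (intro hom_to_ringI P) (auto simp: A.r_distr A.m_assoc)
  next
    fix a b f assume ab: "a \<in> carrier (opp A)" "b \<in> carrier (opp A)" and "f \<in> carrier ?H"
    then have "f \<in> module_hom A P (regular_module A)" by simp
    note f = hom_to_ringD[OF this]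
    show "(a \<oplus>\<^bsub>opp A\<^esub> b) \<odot>\<^bsub>?H\<^esub> f = a \<odot>\<^bsub>?H\<^esub> f \<oplus>\<^bsub>?H\<^esub> b \<odot>\<^bsub>?H\<^esub> f"
      "(a \<otimes>\<^bsub>opp A\<^esub> b) \<odot>\<^bsub>?H\<^esub> f = b \<odot>\<^bsub>?H\<^esub> (a \<odot>\<^bsub>?H\<^esub> f)"
      using ab f by (auto intro!: restrict_ext simp: A.l_distr A.m_assoc)
  next
    fix a f g assume "a \<in> carrier (opp A)" "f \<in> carrier ?H" "g \<in> carrier ?H"
    moreover then have "f \<in> module_hom A P (regular_module A)" "g \<in> module_hom A P (regular_module A)" by simp_all
    note this[THEN hom_to_ringD(1)]
    ultimately show "a \<odot>\<^bsub>?H\<^esub> (f \<oplus>\<^bsub>?H\<^esub> g) = a \<odot>\<^bsub>?H\<^esub> f \<oplus>\<^bsub>?H\<^esub> a \<odot>\<^bsub>?H\<^esub> g"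
      by (auto intro!: restrict_ext simp: A.r_distr)
  next
    fix f assume "f \<in> carrier ?H"
    then have "f \<in> module_hom A P (regular_module A)" by simp
    note f = hom_to_ringD[OF this]
    show "\<one>\<^bsub>opp A\<^esub> \<odot>\<^bsub>?H\<^esub> f = f"
      using f by (intro extensionalityI[of _ "carrier P"]) auto
  qed
qed

text \<open>A homomorphism is determined by its values at the generators \<open>X\<close> of
  \<open>P\<close>, and these values by finitely many functionals on \<open>A\<close>; the
  combinations \<open>f \<mapsto> l (f x)\<close> therefore separate homomorphisms.\<close>

lemma hom_to_ring_fin_gen:
  assumes "fmod P" shows "fin_gen K (kv (hom_to_ring A P)) (carrier (hom_to_ring A P))"
proof -
  interpret P: right_module A P using assms by (simp add: fmod_def)
  let ?H = "hom_to_ring A P"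
  interpret H: vec K "kv ?H" by (rule vec_kv_opp) (rule hom_to_ring_left_module, rule P.right_module_axioms)
  interpret R: vec K "kv (regular_module A)" by (rule vec_kv) (rule A_regular)
  obtain X where X: "finite X" "X \<subseteq> carrier P" "mspan A P X = carrier P"
    using fin_gen_of_fmod[OF assms] by (auto simp: fin_gen_def)
  have fgA: "fin_gen K (kv (regular_module A)) (carrier (kv (regular_module A)))" using KA_fin_gen by simp
  obtain L where L: "finite L" "\<And>l. l \<in> L \<Longrightarrow> mhom K (kv (regular_module A)) (regular_module K) l"
    "\<And>u. u \<in> carrier A \<Longrightarrow> (\<And>l. l \<in> L \<Longrightarrow> l u = \<zero>\<^bsub>K\<^esub>) \<Longrightarrow> u = \<zero>\<^bsub>A\<^esub>"
    using R.finite_separating_set[OF fgA] by auto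
  have "fin_gen K (kv ?H) (carrier (kv ?H))"
  proof (rule H.fin_gen_of_separating)
    show "finite ((\<lambda>(x, l) f. l (f x)) ` (X \<times> L))" using X L by simp
    show "msub K (kv ?H) (carrier (kv ?H))" by (rule H.msub_carrier)
  next
    fix m assume "m \<in> (\<lambda>(x, l) (f :: _ \<Rightarrow> 'a). l (f x)) ` (X \<times> L)"
    then obtain x l where x: "x \<in> carrier P" "l \<in> L" "m = (\<lambda>f. l (f x))" using X by auto
    note l = mhomD[OF L(2)[OF x(2)], simplified]
    have "f x \<in> carrier A" if "f \<in> module_hom A P (regular_module A)" for f using hom_to_ringD(1)[OF that] x by blast
    then show "mhom K (kv ?H) (regular_module K) m"
      using x l by (auto simp: mhom_def simp flip: scalar_central)
  next
    fix u assume u: "u \<in> carrier (kv ?H)"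
      and 0: "\<And>m. m \<in> (\<lambda>(x, l) f. l (f x)) ` (X \<times> L) \<Longrightarrow> m u = \<zero>\<^bsub>K\<^esub>"
    have uH: "u \<in> module_hom A P (regular_module A)" using u by simp
    interpret u: mod_hom A P "regular_module A" u
      using uH by (intro mod_homI P.right_module_axioms A_regular module_hom_mhom)
    have "u x = \<zero>\<^bsub>A\<^esub>" if "x \<in> X" for x
    proof (rule L(3))
      show "u x \<in> carrier A" using u.closed that X by auto
      show "l (u x) = \<zero>\<^bsub>K\<^esub>" if "l \<in> L" for l using 0[of "\<lambda>f. l (f x)"] that \<open>x \<in> X\<close> by force
    qed
    then have "X \<subseteq> ker P (regular_module A) u" using X by (auto simp: ker_def)
    then have "carrier P \<subseteq> ker P (regular_module A) u" using mspan_least[OF u.msub_ker, of X] X(3) by simp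
    then have "u x = \<zero>\<^bsub>A\<^esub>" if "x \<in> carrier P" for x using that by (auto simp: ker_def)
    then show "u = \<zero>\<^bsub>kv ?H\<^esub>"
      using hom_to_ringD(4)[OF uH] by (intro extensionalityI[of _ "carrier P"]) auto
  qed
  then show ?thesis by simp
qed

end

section \<open>Projective and injective modules\<close>

context fdalg
begin

section \<open>Projectivity and lifting\<close>

lemma rep_iso:
  assumes "fmod M"
  obtains N f g where "N \<in> fg_modules A" "mod_iso A M N f g"
proof -
  obtain N f where N: "N \<in> fg_modules A" "mhom A M N f" "bij_betw f (carrier M) (carrier N)"
    using fmod_representative[OF assms] .
  have "right_module A M" "right_module A N" using assms N(1) by (auto simp: fg_modules_iff fmod_def)
  then show ?thesis using that N mod_isoI by blast
qed

lemma projectiveI: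
  assumes "right_module A P"
    "\<And>M N g f. \<lbrakk>M \<in> fg_modules A; N \<in> fg_modules A; mhom A M N g; mhom A P N f; g ` carrier M = carrier N\<rbrakk>
      \<Longrightarrow> \<exists>h. mhom A P M h \<and> (\<forall>x\<in>carrier P. g (h x) = f x)"
  shows "projective_module A P"
  unfolding projective_module_def
proof (intro ballI impI)
  fix M N g f assume *: "M \<in> fg_modules A" "N \<in> fg_modules A" "g \<in> module_hom A M N" "f \<in> module_hom A P N"
    "g ` carrier M = carrier N"
  then obtain h where h: "mhom A P M h" "\<forall>x\<in>carrier P. g (h x) = f x"
    using assms(2)[OF *(1,2) module_hom_mhom[OF *(3)] module_hom_mhom[OF *(4)] *(5)] by blast
  then show "\<exists>h\<in>module_hom A P M. \<forall>x\<in>carrier P. g (h x) = f x"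
    using mhom_restrict[OF assms(1) h(1)] by (intro bexI[of _ "restrict h (carrier P)"]) auto
qed

lemma projectiveD:
  assumes "projective_module A P" "right_module A P" "M \<in> fg_modules A" "N \<in> fg_modules A"
    "mhom A M N g" "mhom A P N f" "g ` carrier M = carrier N"
  obtains h where "mhom A P M h" "\<And>x. x \<in> carrier P \<Longrightarrow> g (h x) = f x"
proof -
  have M: "right_module A M" using assms(3) by (simp add: fg_modules_iff fmod_def)
  have "\<exists>h\<in>module_hom A P M. \<forall>x\<in>carrier P. restrict g (carrier M) (h x) = restrict f (carrier P) x"
    using assms(1,3,4) mhom_restrict[OF M assms(5)] mhom_restrict[OF assms(2,6)] assms(7)
    unfolding projective_module_def by (metis image_restrict_eq)
  then obtain h where h: "h \<in> module_hom A P M"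
    "\<And>x. x \<in> carrier P \<Longrightarrow> restrict g (carrier M) (h x) = restrict f (carrier P) x" by blast
  note h' = module_hom_mhom[OF h(1)]
  have "g (h x) = f x" if "x \<in> carrier P" for x
    using h(2)[OF that] mhomD(1)[OF h' that] that by simp
  then show ?thesis using that h' by blast
qed

text \<open>\<open>projective_module\<close> lifts only along surjections between objects of
  \<open>fg_modules\<close>. Passing from \<open>M\<close> and from the image of \<open>g\<close> to
  representatives frees the carrier types and relaxes surjectivity to an inclusion of
  images.\<close>

lemma projective_lift:
  assumes P: "projective_module A P" "right_module A P" and M: "fmod M" and N: "fmod N"
    and g: "mhom A M N g" and f: "mhom A P N f" and im: "f ` carrier P \<subseteq> g ` carrier M"
  obtains h where "mhom A P M h" "\<And>x. x \<in> carrier P \<Longrightarrow> g (h x) = f x"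
proof -
  have N': "right_module A N" using N by (simp add: fmod_def)
  obtain M1 u u' where M1: "M1 \<in> fg_modules A" "mod_iso A M M1 u u'" using rep_iso[OF M] .
  obtain N1 v v' where N1: "N1 \<in> fg_modules A" "mod_iso A (on_sub N (g ` carrier M)) N1 v v'"
    using rep_iso[OF image_fmod(1)[OF M N' g]] .
  interpret u: mod_iso A M M1 u u' by fact
  interpret v: mod_iso A "on_sub N (g ` carrier M)" N1 v v' by fact
  have 1: "mhom A M1 N1 (\<lambda>x. v (g (u' x)))"
    using mhom_comp[OF u.inv.hom mhom_comp[OF mhom_on_cod[OF g subset_refl] v.hom]] .
  have 2: "mhom A P N1 (\<lambda>x. v (f x))" using mhom_comp[OF mhom_on_cod[OF f im] v.hom] .
  have "(\<lambda>x. v (g (u' x))) ` carrier M1 = v ` g ` u' ` carrier M1" by (simp add: image_image)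
  also have "u' ` carrier M1 = carrier M" by (rule mod_iso.surj[OF u.sym])
  also have "v ` g ` carrier M = carrier N1" using v.surj by simp
  finally obtain h where h: "mhom A P M1 h" "\<And>x. x \<in> carrier P \<Longrightarrow> v (g (u' (h x))) = v (f x)"
    using projectiveD[OF P M1(1) N1(1) 1 2] by blast
  have "g (u' (h x)) = f x" if "x \<in> carrier P" for x
  proof (rule inj_onD[OF v.inj h(2)[OF that]])
    show "g (u' (h x)) \<in> carrier (on_sub N (g ` carrier M))" using mhomD(1)[OF h(1) that] by simp
    show "f x \<in> carrier (on_sub N (g ` carrier M))" using im that by auto
  qed
  then show ?thesis using that mhom_comp[OF h(1) u.inv.hom] by blast
qed

lemma projective_iso:
  assumes "mod_iso A M N f g" "projective_module A M" shows "projective_module A N"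
proof -
  interpret mod_iso A M N f g by fact
  show ?thesis
  proof (rule projectiveI[OF N.right_module_axioms])
    fix M1 N1 a b assume *: "M1 \<in> fg_modules A" "N1 \<in> fg_modules A" "mhom A M1 N1 a" "mhom A N N1 b"
      "a ` carrier M1 = carrier N1"
    obtain h where h: "mhom A M M1 h" "\<And>x. x \<in> carrier M \<Longrightarrow> a (h x) = b (f x)"
      using projectiveD[OF assms(2) M.right_module_axioms *(1,2,3) mhom_comp[OF hom *(4)] *(5)] by blast
    then show "\<exists>h. mhom A N M1 h \<and> (\<forall>x\<in>carrier N. a (h x) = b x)"
      using mhom_comp[OF inv.hom h(1)] by (intro exI[of _ "\<lambda>x. h (g x)"]) simp
  qed
qed

text \<open>Lift after projecting onto \<open>U\<close>, then restrict the lift to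
  \<open>U\<close>.\<close>

lemma projective_summand:
  assumes P: "projective_module A P" "right_module A P"
    and UV: "msub A P U" "msub A P V" "U \<inter> V = {\<zero>\<^bsub>P\<^esub>}" "msum P U V = carrier P"
  shows "projective_module A (on_sub P U)"
proof -
  interpret P: right_module A P by fact
  obtain p where p: "mhom A P P p" "p ` carrier P \<subseteq> U" "\<And>x. x \<in> U \<Longrightarrow> p x = x"
    "\<And>x. x \<in> V \<Longrightarrow> p x = \<zero>\<^bsub>P\<^esub>" "\<And>x. x \<in> carrier P \<Longrightarrow> x \<ominus>\<^bsub>P\<^esub> p x \<in> V"
    by (rule P.direct_sum_projection[OF UV]) (rule that)
  have p': "mhom A P (on_sub P U) p" using mhom_on_cod[OF p(1,2)] .
  show ?thesis
  proof (rule projectiveI[OF P.on_sub_module[OF UV(1)]])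
    fix M N a b assume *: "M \<in> fg_modules A" "N \<in> fg_modules A" "mhom A M N a" "mhom A (on_sub P U) N b"
      "a ` carrier M = carrier N"
    obtain h where h: "mhom A P M h" "\<And>x. x \<in> carrier P \<Longrightarrow> a (h x) = b (p x)"
      using projectiveD[OF P *(1,2,3) mhom_comp[OF p' *(4)] *(5)] by blast
    then show "\<exists>h. mhom A (on_sub P U) M h \<and> (\<forall>x\<in>carrier (on_sub P U). a (h x) = b x)"
      using mhom_on_dom[OF h(1) UV(1)] p(3) P.msub_mem[OF UV(1)] by auto
  qed
qed

lemma cyclic_hom:
  assumes "right_module A M" "m \<in> carrier M"
  shows "mhom A (regular_module A) M (\<lambda>a. a \<odot>\<^bsub>M\<^esub> m)"
proof -
  interpret right_module A M by fact
  show ?thesis using assms by (auto simp: mhom_def ract_l_distr ract_assoc)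
qed

text \<open>Sending the unit to any preimage of its image under \<open>f\<close> defines a
  lift.\<close>

lemma regular_projective: "projective_module A (regular_module A)"
proof (rule projectiveI[OF A_regular])
  fix M N g f assume *: "M \<in> fg_modules A" "N \<in> fg_modules A" "mhom A M N g"
    "mhom A (regular_module A) N f" "g ` carrier M = carrier N"
  have M: "right_module A M" using *(1) by (simp add: fg_modules_iff fmod_def)
  have "f \<one>\<^bsub>A\<^esub> \<in> g ` carrier M" using mhomD(1)[OF *(4), of "\<one>\<^bsub>A\<^esub>"] *(5) by simp
  then obtain m where m: "m \<in> carrier M" "g m = f \<one>\<^bsub>A\<^esub>" by auto
  have "g (a \<odot>\<^bsub>M\<^esub> m) = f a" if "a \<in> carrier A" for a
    using mhomD(3)[OF *(3) that m(1)] m(2) mhomD(3)[OF *(4) that, of "\<one>\<^bsub>A\<^esub>"] that by simp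
  then show "\<exists>h. mhom A (regular_module A) M h \<and> (\<forall>x\<in>carrier (regular_module A). g (h x) = f x)"
    using cyclic_hom[OF M m(1)] by (intro exI[of _ "\<lambda>a. a \<odot>\<^bsub>M\<^esub> m"]) simp
qed

section \<open>Injectivity and extension\<close>

lemma injectiveI:
  assumes "\<And>L M g f. \<lbrakk>L \<in> fg_modules A; M \<in> fg_modules A; mhom A L M g; mhom A L I f; inj_on g (carrier L)\<rbrakk>
      \<Longrightarrow> \<exists>h. mhom A M I h \<and> (\<forall>x\<in>carrier L. h (g x) = f x)"
  shows "injective_module A I"
  unfolding injective_module_def
proof (intro ballI impI)
  fix L M g f assume *: "L \<in> fg_modules A" "M \<in> fg_modules A" "g \<in> module_hom A L M" "f \<in> module_hom A L I"
    "inj_on g (carrier L)"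
  have M: "right_module A M" using *(2) by (simp add: fg_modules_iff fmod_def)
  obtain h where h: "mhom A M I h" "\<forall>x\<in>carrier L. h (g x) = f x"
    using assms[OF *(1,2) module_hom_mhom[OF *(3)] module_hom_mhom[OF *(4)] *(5)] by blast
  then show "\<exists>h\<in>module_hom A M I. \<forall>x\<in>carrier L. h (g x) = f x"
    using mhom_restrict[OF M h(1)] mhomD(1)[OF module_hom_mhom[OF *(3)]]
    by (intro bexI[of _ "restrict h (carrier M)"]) auto
qed

lemma injectiveD:
  assumes "injective_module A I" "L \<in> fg_modules A" "M \<in> fg_modules A"
    "mhom A L M g" "mhom A L I f" "inj_on g (carrier L)"
  obtains h where "mhom A M I h" "\<And>x. x \<in> carrier L \<Longrightarrow> h (g x) = f x"
proof -
  have L: "right_module A L" using assms(2) by (simp add: fg_modules_iff fmod_def)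
  have "\<exists>h\<in>module_hom A M I. \<forall>x\<in>carrier L. h (restrict g (carrier L) x) = restrict f (carrier L) x"
    using assms(1-3) mhom_restrict[OF L assms(4)] mhom_restrict[OF L assms(5)] assms(6)
    unfolding injective_module_def by (metis inj_on_restrict_eq)
  then obtain h where h: "h \<in> module_hom A M I"
    "\<And>x. x \<in> carrier L \<Longrightarrow> h (restrict g (carrier L) x) = restrict f (carrier L) x" by blast
  have "h (g x) = f x" if "x \<in> carrier L" for x using h(2)[OF that] that by simp
  then show ?thesis using that module_hom_mhom[OF h(1)] by blast
qed

text \<open>Dual to \<open>projective_lift\<close>: \<open>g\<close> may fail to be injective as
  long as it kills no more than \<open>f\<close> does, for then \<open>f\<close> factors through the
  image of \<open>g\<close>, whose inclusion into \<open>M\<close> is injective.\<close>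

lemma injective_extend:
  assumes I: "injective_module A I" "right_module A I" and L: "fmod L" and M: "fmod M"
    and g: "mhom A L M g" and f: "mhom A L I f" and k: "ker L M g \<subseteq> ker L I f"
  obtains h where "mhom A M I h" "\<And>x. x \<in> carrier L \<Longrightarrow> h (g x) = f x"
proof -
  have L': "right_module A L" and M': "right_module A M" using L M by (simp_all add: fmod_def)
  interpret g: mod_hom A L M g by (intro mod_homI L' M' g)
  interpret f: mod_hom A L I f by (intro mod_homI L' I f)
  let ?G = "on_sub M (g ` carrier L)"
  have G: "right_module A ?G" using M' g.msub_range right_module.on_sub_module by blast
  have gG: "mod_hom A L ?G g" by (intro mod_homI L' G mhom_on_cod g) auto
  obtain f' where f': "mhom A ?G I f'" "\<And>x. x \<in> carrier L \<Longrightarrow> f' (g x) = f x"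
    using mhom_factor[OF gG f.mod_hom_axioms] k by (auto simp: ker_def)
  obtain M1 u u' where M1: "M1 \<in> fg_modules A" "mod_iso A M M1 u u'" using rep_iso[OF M] .
  obtain L1 v v' where L1: "L1 \<in> fg_modules A" "mod_iso A ?G L1 v v'"
    using rep_iso[OF image_fmod(1)[OF L M' g]] .
  interpret u: mod_iso A M M1 u u' by fact
  interpret v: mod_iso A ?G L1 v v' by fact
  have v'c: "v' y \<in> carrier M" if "y \<in> carrier L1" for y
    using v.inv.closed[OF that] g.closed by auto
  have 1: "mhom A L1 M1 (\<lambda>x. u (v' x))"
    using mhom_comp[OF v.inv.hom mhom_comp[OF mhom_incl[OF g.msub_range] u.hom]] .
  have 2: "mhom A L1 I (\<lambda>x. f' (v' x))" using mhom_comp[OF v.inv.hom f'(1)] .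
  have 3: "inj_on (\<lambda>x. u (v' x)) (carrier L1)"
  proof (rule inj_onI)
    fix x y assume *: "x \<in> carrier L1" "y \<in> carrier L1" "u (v' x) = u (v' y)"
    then have "v' x = v' y" using inj_onD[OF u.inj *(3)] v'c by blast
    then have "v (v' x) = v (v' y)" by simp
    then show "x = y" using * by simp
  qed
  obtain h where h: "mhom A M1 I h" "\<And>x. x \<in> carrier L1 \<Longrightarrow> h (u (v' x)) = f' (v' x)"
    using injectiveD[OF I(1) L1(1) M1(1) 1 2 3] by blast
  have "h (u (g x)) = f x" if "x \<in> carrier L" for x
    using h(2)[of "v (g x)"] v.closed[of "g x"] v.gf[of "g x"] that f'(2) by simp
  then show ?thesis using that mhom_comp[OF u.hom h(1)] by blast
qed

lemma injective_iso:
  assumes "mod_iso A M N f g" "injective_module A M" shows "injective_module A N"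
proof -
  interpret mod_iso A M N f g by fact
  show ?thesis
  proof (rule injectiveI)
    fix L1 M1 a b assume *: "L1 \<in> fg_modules A" "M1 \<in> fg_modules A" "mhom A L1 M1 a" "mhom A L1 N b"
      "inj_on a (carrier L1)"
    obtain h where h: "mhom A M1 M h" "\<And>x. x \<in> carrier L1 \<Longrightarrow> h (a x) = g (b x)"
      using injectiveD[OF assms(2) *(1,2,3) mhom_comp[OF *(4) inv.hom] *(5)] by blast
    then show "\<exists>h. mhom A M1 N h \<and> (\<forall>x\<in>carrier L1. h (a x) = b x)"
      using mhom_comp[OF h(1) hom] mhomD(1)[OF *(4)] by (intro exI[of _ "\<lambda>x. f (h x)"]) simp
  qed
qed

lemma injective_summand:
  assumes I: "injective_module A I" "right_module A I"
    and UV: "msub A I U" "msub A I V" "U \<inter> V = {\<zero>\<^bsub>I\<^esub>}" "msum I U V = carrier I"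
  shows "injective_module A (on_sub I U)"
proof -
  interpret I: right_module A I by fact
  obtain p where p: "mhom A I I p" "p ` carrier I \<subseteq> U" "\<And>x. x \<in> U \<Longrightarrow> p x = x"
    "\<And>x. x \<in> V \<Longrightarrow> p x = \<zero>\<^bsub>I\<^esub>" "\<And>x. x \<in> carrier I \<Longrightarrow> x \<ominus>\<^bsub>I\<^esub> p x \<in> V"
    by (rule I.direct_sum_projection[OF UV]) (rule that)
  have p': "mhom A I (on_sub I U) p" using mhom_on_cod[OF p(1,2)] .
  show ?thesis
  proof (rule injectiveI)
    fix L M a b assume *: "L \<in> fg_modules A" "M \<in> fg_modules A" "mhom A L M a" "mhom A L (on_sub I U) b"
      "inj_on a (carrier L)"
    have b: "mhom A L I b" using mhom_cod_incl[OF *(4)] UV(1) by (simp add: msub_def)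
    obtain h where h: "mhom A M I h" "\<And>x. x \<in> carrier L \<Longrightarrow> h (a x) = b x"
      using injectiveD[OF I(1) *(1,2,3) b *(5)] by blast
    then show "\<exists>h. mhom A M (on_sub I U) h \<and> (\<forall>x\<in>carrier L. h (a x) = b x)"
      using mhom_comp[OF h(1) p'] p(3) mhomD(1)[OF *(4)] by (intro exI[of _ "\<lambda>x. p (h x)"]) simp
  qed
qed

text \<open>The module \<open>D(A)\<close>. It plays for injectives the part that the regular module
  plays for projectives: the injective modules used later are, up to isomorphism, summands of
  it.\<close>

definition dual_regular where "dual_regular = dual_module K A (left_regular A)"

lemma left_regular_fin_gen: "fin_gen K (kv (left_regular A)) (carrier (left_regular A))"
proof -
  have "msub K (kv (left_regular A)) U \<longleftrightarrow> msub K (kv (regular_module A)) U" for U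
    by (auto simp: msub_def scalar_central subset_iff)
  then show ?thesis using KA_fin_gen unfolding fin_gen_def mspan_def by simp
qed

lemma dual_regular_fmod: "fmod dual_regular"
  unfolding dual_regular_def using left_regular_module left_regular_fin_gen by (rule dual_fmod)

text \<open>One direction of the identification of homomorphisms \<open>M \<rightarrow> D(A)\<close>
  with functionals on \<open>M\<close>; the inverse evaluates at the unit of
  \<open>A\<close>.\<close>

lemma functional_hom:
  assumes M: "right_module A M" and l: "mhom K (kv M) (regular_module K) l"
  shows "mhom A M dual_regular (\<lambda>m. \<lambda>a\<in>carrier A. l (a \<odot>\<^bsub>M\<^esub> m))"
proof -
  interpret right_module A M by fact
  note l' = mhomD[OF l, simplified]
  have "(\<lambda>a\<in>carrier A. l (a \<odot>\<^bsub>M\<^esub> m)) \<in> carrier dual_regular" if m: "m \<in> carrier M" for m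
  proof -
    have "l ((scalar c \<otimes>\<^bsub>A\<^esub> a) \<odot>\<^bsub>M\<^esub> m) = c \<otimes>\<^bsub>K\<^esub> l (a \<odot>\<^bsub>M\<^esub> m)" if "c \<in> carrier K" "a \<in> carrier A" for c a
    proof -
      have "(scalar c \<otimes>\<^bsub>A\<^esub> a) \<odot>\<^bsub>M\<^esub> m = scalar c \<odot>\<^bsub>M\<^esub> (a \<odot>\<^bsub>M\<^esub> m)"
        using that m by (simp add: ract_assoc flip: scalar_central)
      then show ?thesis using l' that m by (simp add: K.m_comm)
    qed
    then show ?thesis
      using dualI[OF left_regular_module, of "\<lambda>a. l (a \<odot>\<^bsub>M\<^esub> m)"] l' m
      unfolding dual_regular_def by (simp add: ract_l_distr)
  qed
  then show ?thesis
    unfolding mhom_def using l'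
    by (auto simp: dual_regular_def ract_r_distr ract_assoc intro!: restrict_ext)
qed

text \<open>A homomorphism \<open>f\<close> into \<open>D(A)\<close> is recovered from the
  functional that evaluates \<open>f x\<close> at the unit. Functionals extend from subspaces over
  the field, and \<open>functional_hom\<close> turns the extension back into an
  \<open>A\<close>-homomorphism.\<close>

lemma dual_regular_injective: "injective_module A dual_regular"
proof (rule injectiveI)
  fix L M g f assume *: "L \<in> fg_modules A" "M \<in> fg_modules A" "mhom A L M g" "mhom A L dual_regular f"
    "inj_on g (carrier L)"
  have fm: "fmod M" "right_module A M" "right_module A L" using * by (auto simp: fg_modules_iff fmod_def)
  interpret g: mod_hom A L M g by (intro mod_homI fm *)
  interpret V: vec K "kv M" by (rule vec_kv) fact
  interpret VL: vec K "kv L" by (rule vec_kv) fact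
  have fd: "f x \<in> carrier (dual_module K A (left_regular A))" if "x \<in> carrier L" for x
    using mhomD(1)[OF *(4) that] by (simp add: dual_regular_def)
  note fD = dualD[OF left_regular_module fd, simplified]
  have f_act: "f (a \<odot>\<^bsub>L\<^esub> x) b = f x (a \<otimes>\<^bsub>A\<^esub> b)" if "x \<in> carrier L" "a \<in> carrier A" "b \<in> carrier A" for a x b
    using mhomD(3)[OF *(4) that(2,1)] that by (simp add: dual_regular_def)
  have f_add: "f (x \<oplus>\<^bsub>L\<^esub> y) b = f x b \<oplus>\<^bsub>K\<^esub> f y b" if "x \<in> carrier L" "y \<in> carrier L" "b \<in> carrier A" for x y b
    using mhomD(2)[OF *(4) that(1,2)] that by (simp add: dual_regular_def)
  have f1: "mhom K (kv L) (regular_module K) (\<lambda>x. f x \<one>\<^bsub>A\<^esub>)"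
    using fD f_act f_add by (auto simp: mhom_def K.m_comm)
      (metis A.one_closed A.r_one K.m_comm scalar_closed)
  interpret f1: mod_hom K "kv L" "regular_module K" "\<lambda>x. f x \<one>\<^bsub>A\<^esub>"
    by (intro mod_homI VL.right_module_axioms K_regular f1)
  let ?G = "on_sub (kv M) (g ` carrier L)"
  have gr: "msub K (kv M) (g ` carrier L)" using msub_kv[OF g.msub_range] .
  have gG: "mod_hom K (kv L) ?G g"
    by (intro mod_homI VL.right_module_axioms V.on_sub_module gr mhom_on_cod mhom_kv *) simp
  have "ker (kv L) ?G g \<subseteq> {\<zero>\<^bsub>L\<^esub>}" using g.inj_iff *(5) by (simp add: ker_def)
  then have "ker (kv L) ?G g \<subseteq> ker (kv L) (regular_module K) (\<lambda>x. f x \<one>\<^bsub>A\<^esub>)"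
    using f1.zero by (auto simp: ker_def)
  then obtain l where l: "mhom K ?G (regular_module K) l" "\<And>x. x \<in> carrier L \<Longrightarrow> l (g x) = f x \<one>\<^bsub>A\<^esub>"
    using mhom_factor[OF gG f1.mod_hom_axioms] by auto
  have "fin_gen K (kv M) (carrier (kv M))" using fm(1) by (simp add: fmod_def)
  then obtain l' where l': "mhom K (kv M) (regular_module K) l'" "\<And>x. x \<in> g ` carrier L \<Longrightarrow> l' x = l x"
    using V.extend_hom[OF _ gr l(1)] by blast
  let ?h = "\<lambda>m. \<lambda>a\<in>carrier A. l' (a \<odot>\<^bsub>M\<^esub> m)"
  have "?h (g x) = f x" if x: "x \<in> carrier L" for x
  proof (rule dual_eqI[OF _ fd[OF x]])
    show "?h (g x) \<in> carrier (dual_module K A (left_regular A))"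
      using mhomD(1)[OF functional_hom[OF fm(2) l'(1)], of "g x"] x by (simp add: dual_regular_def)
    fix a assume "a \<in> carrier (left_regular A)"
    then have a: "a \<in> carrier A" by simp
    have "l' (g (a \<odot>\<^bsub>L\<^esub> x)) = f x a"
      using l'(2)[OF imageI, of "a \<odot>\<^bsub>L\<^esub> x"] l(2)[of "a \<odot>\<^bsub>L\<^esub> x"] x a f_act[of x a "\<one>\<^bsub>A\<^esub>"] by simp
    then show "?h (g x) a = f x a" using x a by simp
  qed
  then show "\<exists>h. mhom A M dual_regular h \<and> (\<forall>x\<in>carrier L. h (g x) = f x)"
    using functional_hom[OF fm(2) l'(1)] by (intro exI[of _ ?h]) blast
qed

end

section \<open>Nakayama algebras\<close>

context fdalg
begin

section \<open>Extremal submodules and indecomposable summands\<close>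

lemma minimal_msub:
  assumes "fmod M" "Q (U0 :: 'm set)" "\<And>U. Q U \<Longrightarrow> msub A M U"
  obtains U where "Q U" "\<And>V. Q V \<Longrightarrow> V \<subseteq> U \<Longrightarrow> V = U"
proof -
  obtain U where U: "Q U" "\<And>V. Q V \<Longrightarrow> dm (on_sub M U) \<le> dm (on_sub M V)"
    using ex_has_least_nat[of Q U0 "\<lambda>U. dm (on_sub M U)"] assms(2) by blast
  have "V = U" if "Q V" "V \<subseteq> U" for V
    using dm_on_sub_le(2)[OF assms(1) assms(3)[OF U(1)] assms(3)[OF that(1)] that(2)] U(2)[OF that(1)]
    by (meson leD)
  then show ?thesis using that U by blast
qed

text \<open>Maximality is in dimension rather than inclusion, so that submodules that are not nested
  can be compared with the chosen one.\<close>

lemma maximal_msub: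
  assumes "fmod M" "Q (U0 :: 'm set)" "\<And>U. Q U \<Longrightarrow> msub A M U"
  obtains U where "Q U" "\<And>V. Q V \<Longrightarrow> dm (on_sub M V) \<le> dm (on_sub M U)"
proof -
  have "\<forall>U. Q U \<longrightarrow> dm (on_sub M U) < Suc (dm M)"
    using dm_sub(1)[OF assms(1)] assms(3) by (simp add: less_Suc_eq_le)
  then show ?thesis
    using ex_has_greatest_nat[of Q U0 "\<lambda>U. dm (on_sub M U)" "Suc (dm M)"] assms(2) that less_imp_le by blast
qed

lemma minimal_submodule:
  assumes "fmod M" "carrier M \<noteq> {\<zero>\<^bsub>M\<^esub>}"
  obtains S where "msub A M S" "S \<noteq> {\<zero>\<^bsub>M\<^esub>}" "\<And>T. msub A M T \<Longrightarrow> T \<subseteq> S \<Longrightarrow> T = {\<zero>\<^bsub>M\<^esub>} \<or> T = S"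
proof -
  interpret right_module A M using assms by (simp add: fmod_def)
  obtain S where "msub A M S \<and> S \<noteq> {\<zero>\<^bsub>M\<^esub>}"
    "\<And>V. msub A M V \<and> V \<noteq> {\<zero>\<^bsub>M\<^esub>} \<Longrightarrow> V \<subseteq> S \<Longrightarrow> V = S"
    using minimal_msub[OF assms(1), of "\<lambda>S. msub A M S \<and> S \<noteq> {\<zero>\<^bsub>M\<^esub>}" "carrier M"]
      msub_carrier assms(2) by blast
  then show ?thesis using that[of S] by blast
qed

text \<open>A summand minimal with \<open>Q\<close> is indecomposable: if it split, one part would
  inherit \<open>Q\<close> and, being again a summand of \<open>M\<close>, contradict minimality. It
  is applied to \<open>A\<close> and \<open>D(A)\<close> with three properties: mapping onto a given
  module, receiving an embedding of one, and receiving a homomorphism that does not extend.\<close>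

lemma indecomposable_summand:
  assumes M: "fmod M" and Q: "Q (carrier M)" "\<not> Q {\<zero>\<^bsub>M\<^esub>}"
    and split: "\<And>U Y Z. \<lbrakk>Q U; msub A M U; msub A M Y; msub A M Z; Y \<inter> Z = {\<zero>\<^bsub>M\<^esub>}; msum M Y Z = U\<rbrakk> \<Longrightarrow> Q Y \<or> Q Z"
  shows "\<exists>U V. msub A M U \<and> msub A M V \<and> U \<inter> V = {\<zero>\<^bsub>M\<^esub>} \<and> msum M U V = carrier M \<and>
    Q U \<and> indecomposable_module A (on_sub M U)"
proof -
  interpret right_module A M using M by (simp add: fmod_def)
  let ?c = "\<lambda>U V. msub A M V \<and> U \<inter> V = {\<zero>\<^bsub>M\<^esub>} \<and> msum M U V = carrier M"
  let ?P = "\<lambda>U. msub A M U \<and> Q U \<and> (\<exists>V. ?c U V)"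
  have "msum M (carrier M) {\<zero>\<^bsub>M\<^esub>} = carrier M"
    using msum_upper1[OF msub_carrier msub_zero] msub_msum[OF msub_carrier msub_zero] by (auto simp: msub_def)
  then have "?P (carrier M)" using msub_carrier msub_zero Q by (intro conjI exI[of _ "{\<zero>\<^bsub>M\<^esub>}"]) auto
  then obtain U where U: "?P U" and min: "\<And>V. ?P V \<Longrightarrow> V \<subseteq> U \<Longrightarrow> V = U"
    using minimal_msub[OF M, of ?P "carrier M"] by blast
  then obtain V where V: "?c U V" by blast
  have Um: "msub A M U" using U by blast
  interpret U: right_module A "on_sub M U" by (rule on_sub_module[OF Um])
  \<comment> \<open>A part \<open>Y\<close> of \<open>U\<close> has the complement
    \<open>msum M Z V\<close> in \<open>M\<close>, so if it satisfies \<open>Q\<close> it equals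
    \<open>U\<close> by minimality.\<close>
  have main: "Y = U" if Y: "msub A M Y" "Q Y" and Z: "msub A M Z" and YZ: "Y \<inter> Z = {\<zero>\<^bsub>M\<^esub>}" "msum M Y Z = U" for Y Z
  proof (rule min)
    show "Y \<subseteq> U" using msum_upper1[OF Y(1) Z] YZ(2) by simp
    have "msub A M (msum M Z V)" using msub_msum Z V by blast
    then have "?c Y (msum M Z V)"
      using refine_direct_sum[OF Um _ _ _ Y(1) Z YZ, of V] V by blast
    then show "?P Y" using Y by blast
  qed
  have "indecomposable_module A (on_sub M U)"
    unfolding U.indecomposable_iff
  proof (intro conjI allI impI)
    show "carrier (on_sub M U) \<noteq> {\<zero>\<^bsub>on_sub M U\<^esub>}" using U Q(2) by auto
  next
    fix Y Z assume "msub A (on_sub M U) Y \<and> msub A (on_sub M U) Z \<and> Y \<inter> Z = {\<zero>\<^bsub>on_sub M U\<^esub>} \<and>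
      msum (on_sub M U) Y Z = carrier (on_sub M U)"
    then have *: "msub A M Y" "msub A M Z" "Y \<inter> Z = {\<zero>\<^bsub>M\<^esub>}" "msum M Y Z = U"
      using Um by (auto simp: msub_on_sub msum_def)
    have "Y \<subseteq> U" "Z \<subseteq> U" using msum_upper1[OF *(1,2)] msum_upper2[OF *(1,2)] *(4) by auto
    have "Z \<inter> Y = {\<zero>\<^bsub>M\<^esub>}" "msum M Z Y = U"
      using * msum_commute[of Y Z] by (auto simp: msub_def)
    then have "Y = U \<or> Z = U" using split[OF _ Um *] U main[OF *(1) _ *(2-4)] main[OF *(2) _ *(1)] by blast
    then show "Y = {\<zero>\<^bsub>on_sub M U\<^esub>} \<or> Z = {\<zero>\<^bsub>on_sub M U\<^esub>}"
      using *(3) \<open>Y \<subseteq> U\<close> \<open>Z \<subseteq> U\<close> by auto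
  qed
  then show ?thesis using Um U V by blast
qed

end

section \<open>Uniserial modules over a Nakayama algebra\<close>

locale nakayama = fdalg +
  assumes nakayama: "nakayama_algebra A"
begin

lemma nakayama_uniserial:
  assumes "fmod M" "indecomposable_module A M" "projective_module A M \<or> injective_module A M"
  shows "uniserial_module A M"
proof -
  obtain N f g where N: "N \<in> fg_modules A" "mod_iso A M N f g" using rep_iso[OF assms(1)] .
  interpret mod_iso A M N f g by fact
  have "projective_module A N \<or> injective_module A N" using assms(3) projective_iso[OF N(2)] injective_iso[OF N(2)] by blast
  then have "uniserial_module A N"
    using nakayama N(1) indecomposable_iso[OF assms(2)] by (simp add: nakayama_algebra_def)
  then show ?thesis using inv.uniserial_surj mod_iso.surj[OF sym] by blast
qed

text \<open>A cyclic submodule of largest dimension is everything: an element outside it generates,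
  by comparability, a strictly larger cyclic submodule.\<close>

lemma uniserial_cyclic:
  assumes "fmod M" "uniserial_module A M"
  obtains m where "m \<in> carrier M" "(\<lambda>a. a \<odot>\<^bsub>M\<^esub> m) ` carrier A = carrier M"
proof -
  interpret right_module A M using assms by (simp add: fmod_def)
  let ?C = "\<lambda>m. (\<lambda>a. a \<odot>\<^bsub>M\<^esub> m) ` carrier A"
  have C: "msub A M (?C m)" "m \<in> ?C m" if "m \<in> carrier M" for m
  proof -
    interpret c: mod_hom A "regular_module A" M "\<lambda>a. a \<odot>\<^bsub>M\<^esub> m"
      by (intro mod_homI A_regular right_module_axioms cyclic_hom that)
    show "msub A M (?C m)" using c.msub_range by simp
    show "m \<in> ?C m" using ract_one[OF that] by (intro image_eqI[of _ _ "\<one>\<^bsub>A\<^esub>"]) auto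
  qed
  let ?Q = "\<lambda>U. \<exists>m\<in>carrier M. U = ?C m"
  obtain U where U: "?Q U" "\<And>V. ?Q V \<Longrightarrow> dm (on_sub M V) \<le> dm (on_sub M U)"
    using maximal_msub[OF assms(1), of ?Q "?C \<zero>\<^bsub>M\<^esub>"] C(1) M.zero_closed by blast
  then obtain m where m: "m \<in> carrier M" "U = ?C m" by blast
  have "y \<in> ?C m" if y: "y \<in> carrier M" for y
  proof (rule ccontr)
    assume n: "y \<notin> ?C m"
    then have "\<not> ?C y \<subseteq> ?C m" using C(2)[OF y] by blast
    then have le: "?C m \<subseteq> ?C y" using assms(2) C(1)[OF y] C(1)[OF m(1)] unfolding uniserial_iff by blast
    moreover have "?C m \<noteq> ?C y" using n C(2)[OF y] by blast
    ultimately have "dm (on_sub M (?C m)) < dm (on_sub M (?C y))"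
      using dm_on_sub_le(2)[OF assms(1) C(1)[OF y] C(1)[OF m(1)]] by blast
    moreover have "dm (on_sub M (?C y)) \<le> dm (on_sub M (?C m))" using U(2)[of "?C y"] y m(2) by blast
    ultimately show False by simp
  qed
  moreover have "?C m \<subseteq> carrier M" using C(1)[OF m(1)] by (simp add: msub_def)
  ultimately show ?thesis using that m(1) by blast
qed

text \<open>\<open>M\<close> is cyclic, hence an image of \<open>A\<close>. When a summand of
  \<open>A\<close> that maps onto \<open>M\<close> splits, the images of its parts are comparable
  and have sum \<open>M\<close>, so one part still maps onto \<open>M\<close>. An indecomposable
  such summand is projective, hence uniserial.\<close>

lemma uniserial_projective_surj:
  assumes "fmod M" "uniserial_module A M" "carrier M \<noteq> {\<zero>\<^bsub>M\<^esub>}"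
  obtains P p where "P \<in> fg_modules A" "projective_module A P" "uniserial_module A P"
    "mhom A P M p" "p ` carrier P = carrier M"
proof -
  interpret right_module A M using assms by (simp add: fmod_def)
  obtain m where m: "m \<in> carrier M" "(\<lambda>a. a \<odot>\<^bsub>M\<^esub> m) ` carrier A = carrier M"
    using uniserial_cyclic[OF assms(1,2)] .
  define f where "f = (\<lambda>a. a \<odot>\<^bsub>M\<^esub> m)"
  let ?R = "regular_module A"
  interpret f: mod_hom A ?R M f
    unfolding f_def by (intro mod_homI A_regular right_module_axioms cyclic_hom m)
  let ?Q = "\<lambda>U. f ` U = carrier M"
  have "?Q (carrier ?R)" using m by (simp add: f_def)
  moreover have "\<not> ?Q {\<zero>\<^bsub>?R\<^esub>}" using assms(3) f.zero by simp
  moreover have "?Q Y \<or> ?Q Z" if "?Q U" "msub A ?R U" and Y: "msub A ?R Y" and Z: "msub A ?R Z"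
    and "Y \<inter> Z = {\<zero>\<^bsub>?R\<^esub>}" "msum ?R Y Z = U" for U Y Z
  proof -
    have sub: "carrier M \<subseteq> W" if W: "msub A M W" "f ` Y \<subseteq> W" "f ` Z \<subseteq> W" for W
    proof
      fix x assume "x \<in> carrier M"
      then obtain u where u: "u \<in> U" "x = f u" using \<open>?Q U\<close> by blast
      then obtain y z where yz: "y \<in> Y" "z \<in> Z" "u = y \<oplus>\<^bsub>?R\<^esub> z" using \<open>msum ?R Y Z = U\<close> by (auto simp: msum_def)
      then have "y \<in> carrier ?R" "z \<in> carrier ?R" using Y Z by (auto simp: msub_def)
      then have "x = f y \<oplus>\<^bsub>M\<^esub> f z" using u yz f.add by blast
      then show "x \<in> W" using W yz unfolding msub_def by blast
    qed
    note fY = f.msub_image[OF Y] and fZ = f.msub_image[OF Z]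
    have "f ` Y \<subseteq> f ` Z \<or> f ` Z \<subseteq> f ` Y" using assms(2) fY fZ unfolding uniserial_iff by blast
    then show ?thesis using sub[OF fY] sub[OF fZ] fY fZ unfolding msub_def by blast
  qed
  ultimately have "\<exists>U V. msub A ?R U \<and> msub A ?R V \<and> U \<inter> V = {\<zero>\<^bsub>?R\<^esub>} \<and> msum ?R U V = carrier ?R \<and>
    ?Q U \<and> indecomposable_module A (on_sub ?R U)"
    by (rule indecomposable_summand[OF fmod_regular, of ?Q])
  then obtain U V where UV: "msub A ?R U" "msub A ?R V" "U \<inter> V = {\<zero>\<^bsub>?R\<^esub>}" "msum ?R U V = carrier ?R"
    and U: "?Q U" "indecomposable_module A (on_sub ?R U)"
    by (elim exE conjE) (rule that)
  have pU: "projective_module A (on_sub ?R U)" using projective_summand[OF regular_projective A_regular UV] .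
  have fU: "fmod (on_sub ?R U)" using fmod_on_sub[OF fmod_regular UV(1)] .
  have uU: "uniserial_module A (on_sub ?R U)" using nakayama_uniserial[OF fU U(2)] pU by blast
  obtain P u v where P: "P \<in> fg_modules A" "mod_iso A (on_sub ?R U) P u v" using rep_iso[OF fU] .
  interpret u: mod_iso A "on_sub ?R U" P u v by fact
  have "mhom A P M (\<lambda>x. f (v x))" using mhom_comp[OF u.inv.hom mhom_on_dom[OF f.hom UV(1)]] .
  moreover have "(\<lambda>x. f (v x)) ` carrier P = f ` v ` carrier P" by (simp add: image_image)
  then have "(\<lambda>x. f (v x)) ` carrier P = carrier M" using mod_iso.surj[OF u.sym] U(1) by simp
  moreover have "uniserial_module A P" using u.uniserial_surj[OF uU u.surj] .
  ultimately show ?thesis using that P(1) projective_iso[OF P(2) pU] by blast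
qed

text \<open>\<open>N\<close> embeds into \<open>D(A)\<close> through a functional that does not
  vanish on a minimal submodule \<open>S\<close>. When a summand of \<open>D(A)\<close> that
  receives an embedding splits, the kernels of the two components are comparable and meet in zero,
  so one component is still injective. An indecomposable such summand is injective, hence
  uniserial.\<close>

lemma uniserial_injective_embedding:
  assumes "fmod N" "uniserial_module A N" "carrier N \<noteq> {\<zero>\<^bsub>N\<^esub>}"
  obtains I i where "I \<in> fg_modules A" "injective_module A I" "uniserial_module A I"
    "mhom A N I i" "inj_on i (carrier N)"
proof -
  interpret right_module A N using assms by (simp add: fmod_def)
  interpret V: vec K "kv N" by (rule vec_kv) (rule right_module_axioms)
  let ?D = "dual_regular"
  have D: "right_module A ?D" using dual_regular_fmod by (simp add: fmod_def)
  interpret D: right_module A ?D by (rule D)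
  obtain S where S: "msub A N S" "S \<noteq> {\<zero>\<^bsub>N\<^esub>}" "\<And>T. msub A N T \<Longrightarrow> T \<subseteq> S \<Longrightarrow> T = {\<zero>\<^bsub>N\<^esub>} \<or> T = S"
    using minimal_submodule[OF assms(1,3)] by blast
  obtain s where s: "s \<in> S" "s \<noteq> \<zero>\<^bsub>N\<^esub>" "s \<in> carrier N" using S(1,2) by (auto simp: msub_def)
  have fin: "fin_gen K (kv N) (carrier (kv N))" using assms(1) by (simp add: fmod_def)
  obtain l where l: "mhom K (kv N) (regular_module K) l" "l s = \<one>\<^bsub>K\<^esub>"
    using V.separating_functional[OF fin V.msub_zero, of s] s by auto
  define i0 where "i0 = (\<lambda>m. \<lambda>a\<in>carrier A. l (a \<odot>\<^bsub>N\<^esub> m))"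
  interpret i0: mod_hom A N ?D i0
    unfolding i0_def by (intro mod_homI D right_module_axioms functional_hom l)
  \<comment> \<open>A nonzero kernel is comparable with the minimal submodule \<open>S\<close>,
    hence contains \<open>s\<close>, where \<open>l\<close> takes the value
    \<open>\<one>\<close>.\<close>
  have i0_inj: "inj_on i0 (carrier N)"
    unfolding i0.inj_iff
  proof (rule ccontr)
    assume "\<not> ker N ?D i0 \<subseteq> {\<zero>\<^bsub>N\<^esub>}"
    then have k: "ker N ?D i0 \<noteq> {\<zero>\<^bsub>N\<^esub>}" by auto
    have "S \<subseteq> ker N ?D i0 \<or> ker N ?D i0 \<subseteq> S" using assms(2) i0.msub_ker S(1) unfolding uniserial_iff by simp
    then have "S \<subseteq> ker N ?D i0" using S(3)[OF i0.msub_ker] k by auto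
    then have "i0 s = \<zero>\<^bsub>?D\<^esub>" using s by (auto simp: ker_def)
    then have "i0 s \<one>\<^bsub>A\<^esub> = \<zero>\<^bsub>K\<^esub>" by (simp add: dual_regular_def)
    then show False using l(2) s(3) by (simp add: i0_def ract_one)
  qed
  let ?Q = "\<lambda>U. \<exists>i. mhom A N ?D i \<and> inj_on i (carrier N) \<and> i ` carrier N \<subseteq> U"
  have "?Q (carrier ?D)" using i0.hom i0_inj by (intro exI[of _ i0]) auto
  moreover have "\<not> ?Q {\<zero>\<^bsub>?D\<^esub>}"
  proof
    assume "?Q {\<zero>\<^bsub>?D\<^esub>}"
    then obtain i where i: "inj_on i (carrier N)" "i ` carrier N \<subseteq> {\<zero>\<^bsub>?D\<^esub>}" by blast
    have "x = \<zero>\<^bsub>N\<^esub>" if "x \<in> carrier N" for x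
    proof (rule inj_onD[OF i(1) _ that M.zero_closed])
      have "i x \<in> {\<zero>\<^bsub>?D\<^esub>}" "i \<zero>\<^bsub>N\<^esub> \<in> {\<zero>\<^bsub>?D\<^esub>}" using i(2) that M.zero_closed by blast+
      then show "i x = i \<zero>\<^bsub>N\<^esub>" by simp
    qed
    then show False using assms(3) by auto
  qed
  moreover have "?Q Y \<or> ?Q Z" if "?Q U" and U: "msub A ?D U" and Y: "msub A ?D Y" and Z: "msub A ?D Z"
    and YZ: "Y \<inter> Z = {\<zero>\<^bsub>?D\<^esub>}" "msum ?D Y Z = U" for U Y Z
  proof -
    obtain i where i: "mhom A N ?D i" "inj_on i (carrier N)" "i ` carrier N \<subseteq> U" using \<open>?Q U\<close> by blast
    interpret U: right_module A "on_sub ?D U" by (rule D.on_sub_module[OF U])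
    have YU: "Y \<subseteq> U" "Z \<subseteq> U" using D.msum_upper1[OF Y Z] D.msum_upper2[OF Y Z] YZ(2) by auto
    have *: "msub A (on_sub ?D U) Y" "msub A (on_sub ?D U) Z" "Y \<inter> Z = {\<zero>\<^bsub>on_sub ?D U\<^esub>}"
      "msum (on_sub ?D U) Y Z = carrier (on_sub ?D U)"
      using Y Z YU YZ U by (simp_all add: msub_on_sub msum_def)
    obtain p where p: "mhom A (on_sub ?D U) (on_sub ?D U) p" "p ` carrier (on_sub ?D U) \<subseteq> Y"
      "\<And>x. x \<in> Y \<Longrightarrow> p x = x" "\<And>x. x \<in> Z \<Longrightarrow> p x = \<zero>\<^bsub>on_sub ?D U\<^esub>"
      "\<And>x. x \<in> carrier (on_sub ?D U) \<Longrightarrow> x \<ominus>\<^bsub>on_sub ?D U\<^esub> p x \<in> Z"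
      by (rule U.direct_sum_projection[OF *]) (rule that)
    have iU: "i x \<in> carrier (on_sub ?D U)" if "x \<in> carrier N" for x using i(3) that by auto
    note pU = mhomD[OF p(1)]
    \<comment> \<open>The complementary projection: \<open>i\<close> is the sum of its components
      under \<open>p\<close> and \<open>q\<close>, so it vanishes where both do.\<close>
    define q where "q x = x \<ominus>\<^bsub>on_sub ?D U\<^esub> p x" for x
    have q: "mhom A (on_sub ?D U) (on_sub ?D U) q"
      unfolding mhom_def q_def using pU U.M.minus_closed U.add_diff_add U.ract_diff by simp
    have UD: "U \<subseteq> carrier ?D" using U by (simp add: msub_def)
    have hp: "mhom A N (on_sub ?D U) (\<lambda>x. p (i x))" and hq: "mhom A N (on_sub ?D U) (\<lambda>x. q (i x))"
      using mhom_comp[OF mhom_on_cod[OF i(1,3)] p(1)] mhom_comp[OF mhom_on_cod[OF i(1,3)] q] .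
    interpret hp: mod_hom A N "on_sub ?D U" "\<lambda>x. p (i x)"
      by (intro mod_homI right_module_axioms U.right_module_axioms hp)
    interpret hq: mod_hom A N "on_sub ?D U" "\<lambda>x. q (i x)"
      by (intro mod_homI right_module_axioms U.right_module_axioms hq)
    have i00: "x = \<zero>\<^bsub>N\<^esub>" if "x \<in> carrier N" "p (i x) = \<zero>\<^bsub>?D\<^esub>" "q (i x) = \<zero>\<^bsub>?D\<^esub>" for x
    proof -
      have "i x \<ominus>\<^bsub>on_sub ?D U\<^esub> p (i x) = \<zero>\<^bsub>on_sub ?D U\<^esub>" using that(3) by (simp add: q_def)
      then have "i x = p (i x)" using U.diff_zero_iff[OF iU[OF that(1)] pU(1)[OF iU[OF that(1)]]] by simp
      then have "i x = \<zero>\<^bsub>?D\<^esub>" using that(2) by simp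
      moreover have "i \<zero>\<^bsub>N\<^esub> = \<zero>\<^bsub>?D\<^esub>"
        using mod_hom.zero[OF mod_homI[OF right_module_axioms D i(1)]] .
      ultimately show ?thesis using inj_onD[OF i(2), of x "\<zero>\<^bsub>N\<^esub>"] that(1) by simp
    qed
    have "ker N (on_sub ?D U) (\<lambda>x. p (i x)) \<subseteq> ker N (on_sub ?D U) (\<lambda>x. q (i x)) \<or>
      ker N (on_sub ?D U) (\<lambda>x. q (i x)) \<subseteq> ker N (on_sub ?D U) (\<lambda>x. p (i x))"
      using assms(2) hp.msub_ker hq.msub_ker unfolding uniserial_iff by blast
    then show ?thesis
    proof
      assume "ker N (on_sub ?D U) (\<lambda>x. p (i x)) \<subseteq> ker N (on_sub ?D U) (\<lambda>x. q (i x))"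
      then have "ker N (on_sub ?D U) (\<lambda>x. p (i x)) \<subseteq> {\<zero>\<^bsub>N\<^esub>}" using i00 by (auto simp: ker_def)
      then have "inj_on (\<lambda>x. p (i x)) (carrier N)" using hp.inj_iff by blast
      moreover have "(\<lambda>x. p (i x)) ` carrier N \<subseteq> Y" using p(2) iU by blast
      ultimately show ?thesis using mhom_cod_incl[OF hp UD] by blast
    next
      assume "ker N (on_sub ?D U) (\<lambda>x. q (i x)) \<subseteq> ker N (on_sub ?D U) (\<lambda>x. p (i x))"
      then have "ker N (on_sub ?D U) (\<lambda>x. q (i x)) \<subseteq> {\<zero>\<^bsub>N\<^esub>}" using i00 by (auto simp: ker_def)
      then have "inj_on (\<lambda>x. q (i x)) (carrier N)" using hq.inj_iff by blast
      moreover have "(\<lambda>x. q (i x)) ` carrier N \<subseteq> Z" using p(5) iU by (auto simp: q_def)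
      ultimately show ?thesis using mhom_cod_incl[OF hq UD] by blast
    qed
  qed
  ultimately have "\<exists>U V. msub A ?D U \<and> msub A ?D V \<and> U \<inter> V = {\<zero>\<^bsub>?D\<^esub>} \<and> msum ?D U V = carrier ?D \<and>
    ?Q U \<and> indecomposable_module A (on_sub ?D U)"
    by (rule indecomposable_summand[OF dual_regular_fmod, of ?Q])
  then obtain U V where UV: "msub A ?D U" "msub A ?D V" "U \<inter> V = {\<zero>\<^bsub>?D\<^esub>}" "msum ?D U V = carrier ?D"
    and U: "?Q U" "indecomposable_module A (on_sub ?D U)"
    by blast
  have pU: "injective_module A (on_sub ?D U)" using injective_summand[OF dual_regular_injective D UV] .
  have fU: "fmod (on_sub ?D U)" using fmod_on_sub[OF dual_regular_fmod UV(1)] .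
  have uU: "uniserial_module A (on_sub ?D U)" using nakayama_uniserial[OF fU U(2)] pU by blast
  obtain I u v where I: "I \<in> fg_modules A" "mod_iso A (on_sub ?D U) I u v" using rep_iso[OF fU] .
  interpret u: mod_iso A "on_sub ?D U" I u v by fact
  obtain i where i: "mhom A N ?D i" "inj_on i (carrier N)" "i ` carrier N \<subseteq> U" using U(1) by blast
  have "mhom A N I (\<lambda>x. u (i x))" using mhom_comp[OF mhom_on_cod[OF i(1,3)] u.hom] .
  moreover have "inj_on (\<lambda>x. u (i x)) (carrier N)"
    using comp_inj_on[OF i(2) inj_on_subset[OF u.inj]] i(3) by (simp add: comp_def)
  moreover have "uniserial_module A I" using u.uniserial_surj[OF uU u.surj] .
  ultimately show ?thesis using that I(1) injective_iso[OF I(2) pU] by blast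
qed

text \<open>A uniserial submodule of maximal dimension splits off: extend an embedding of it into a uniserial
  injective module to the whole module; the image is uniserial, and lifting a projective cover of
  it produces a uniserial submodule which by maximality is not larger.\<close>

theorem indecomposable_uniserial:
  assumes M: "fmod M" and ind: "indecomposable_module A M"
  shows "uniserial_module A M"
proof -
  interpret right_module A M using M by (simp add: fmod_def)
  have nz: "carrier M \<noteq> {\<zero>\<^bsub>M\<^esub>}" using ind by (simp add: indecomposable_iff)
  obtain S where S: "msub A M S" "S \<noteq> {\<zero>\<^bsub>M\<^esub>}" "\<And>T. msub A M T \<Longrightarrow> T \<subseteq> S \<Longrightarrow> T = {\<zero>\<^bsub>M\<^esub>} \<or> T = S"
    using minimal_submodule[OF M nz] by blast
  let ?Q = "\<lambda>U. msub A M U \<and> U \<noteq> {\<zero>\<^bsub>M\<^esub>} \<and> uniserial_module A (on_sub M U)"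
  interpret S: right_module A "on_sub M S" by (rule on_sub_module[OF S(1)])
  have "simple_module A (on_sub M S)" using S unfolding S.simple_iff msub_on_sub[OF S(1)] by simp
  then have "?Q S" using S S.simple_uniserial by blast
  then obtain U where U: "?Q U" and max: "\<And>V. ?Q V \<Longrightarrow> dm (on_sub M V) \<le> dm (on_sub M U)"
    using maximal_msub[OF M, of ?Q S] by blast
  have Um: "msub A M U" using U by blast
  have fU: "fmod (on_sub M U)" using fmod_on_sub[OF M Um] .
  obtain I i where I: "I \<in> fg_modules A" "injective_module A I" "uniserial_module A I"
    "mhom A (on_sub M U) I i" "inj_on i (carrier (on_sub M U))"
    using uniserial_injective_embedding[OF fU] U by auto
  have fI: "fmod I" "right_module A I" using I(1) by (auto simp: fg_modules_iff fmod_def)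
  have kz: "ker (on_sub M U) M (\<lambda>x. x) \<subseteq> ker (on_sub M U) I i"
    using mod_hom.zero[OF mod_homI[OF on_sub_module[OF Um] fI(2) I(4)]] Um by (auto simp: ker_def msub_def)
  obtain F where F: "mhom A M I F" "\<And>x. x \<in> U \<Longrightarrow> F x = i x"
    using injective_extend[OF I(2) fI(2) fU M mhom_incl[OF Um] I(4) kz] by auto
  interpret F: mod_hom A M I F by (intro mod_homI right_module_axioms fI F)
  interpret I: right_module A I by (rule fI(2))
  let ?J = "F ` carrier M"
  have Jm: "msub A I ?J" by (rule F.msub_range)
  have FU: "F ` U = i ` carrier (on_sub M U)" using F(2) by simp
  have injU: "inj_on F U" using I(5) F(2) inj_on_cong[of U F i] by simp
  have Jf: "fmod (on_sub I ?J)" using fmod_on_sub[OF fI(1) Jm] .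
  have UJ: "F ` U \<subseteq> ?J" using Um by (auto simp: msub_def)
  have "?J \<noteq> {\<zero>\<^bsub>I\<^esub>}"
  proof
    assume J0: "?J = {\<zero>\<^bsub>I\<^esub>}"
    have "x = \<zero>\<^bsub>M\<^esub>" if "x \<in> U" for x
      using inj_onD[OF injU, of x "\<zero>\<^bsub>M\<^esub>"] UJ J0 that Um by (auto simp: msub_def)
    then show False using U by (auto simp: msub_def)
  qed
  then have "carrier (on_sub I ?J) \<noteq> {\<zero>\<^bsub>on_sub I ?J\<^esub>}" by simp
  then obtain P p where P: "P \<in> fg_modules A" "projective_module A P" "uniserial_module A P"
    "mhom A P (on_sub I ?J) p" "p ` carrier P = carrier (on_sub I ?J)"
    using uniserial_projective_surj[OF Jf F.N.uniserial_on_sub[OF I(3) Jm]] by blast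
  have fP: "fmod P" "right_module A P" using P(1) by (auto simp: fg_modules_iff fmod_def)
  have pI: "mhom A P I p" using mhom_cod_incl[OF P(4)] Jm by (simp add: msub_def)
  obtain h where h: "mhom A P M h" "\<And>x. x \<in> carrier P \<Longrightarrow> F (h x) = p x"
    using projective_lift[OF P(2) fP(2) M fI(1) F(1) pI] P(5) by auto
  interpret h: mod_hom A P M h by (intro mod_homI right_module_axioms fP h)
  have Fh: "F ` h ` carrier P = ?J" using h(2) P(5) by (simp add: image_image)
  let ?W = "h ` carrier P"
  have W: "?Q ?W"
  proof (intro conjI)
    show "msub A M ?W" by (rule h.msub_range)
    show "uniserial_module A (on_sub M ?W)" by (rule h.uniserial_image[OF P(3)])
    show "?W \<noteq> {\<zero>\<^bsub>M\<^esub>}"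
    proof
      assume "?W = {\<zero>\<^bsub>M\<^esub>}"
      then have "F ` ?W = {\<zero>\<^bsub>I\<^esub>}" using F.zero by simp
      then show False using Fh \<open>?J \<noteq> {\<zero>\<^bsub>I\<^esub>}\<close> by simp
    qed
  qed
  \<comment> \<open>\<open>?W\<close> maps onto \<open>?J\<close>, and \<open>U\<close> embeds into
    \<open>?J\<close> with dimension at least that of \<open>?W\<close>; the dimensions therefore
    agree and \<open>F\<close> maps \<open>U\<close> onto \<open>?J\<close>.\<close>
  have "dm (on_sub I ?J) \<le> dm (on_sub M ?W)"
    using image_fmod(2)[OF fmod_on_sub[OF M h.msub_range] fI(2) mhom_on_dom[OF F(1) h.msub_range]] Fh by simp
  also have "\<dots> \<le> dm (on_sub M U)" using max[OF W] .
  also have "\<dots> = dm (on_sub I (F ` U))" using dm_inj_image[OF fU fI(2) I(4,5)] FU by simp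
  finally have "F ` U = ?J"
    using dm_on_sub_le(2)[OF fI(1) Jm F.msub_image[OF Um] UJ] by fastforce
  \<comment> \<open>\<open>F\<close> is injective on \<open>U\<close> and maps \<open>U\<close> onto
    its whole image, so its kernel is a complement of \<open>U\<close>.\<close>
  have ker_U: "ker M I F \<inter> U = {\<zero>\<^bsub>M\<^esub>}"
  proof
    show "{\<zero>\<^bsub>M\<^esub>} \<subseteq> ker M I F \<inter> U" using F.msub_ker Um by (simp add: msub_def)
    show "ker M I F \<inter> U \<subseteq> {\<zero>\<^bsub>M\<^esub>}"
      using inj_onD[OF injU, of _ "\<zero>\<^bsub>M\<^esub>"] Um by (auto simp: ker_def msub_def)
  qed
  have "x \<in> msum M (ker M I F) U" if x: "x \<in> carrier M" for x
  proof -
    have "F x \<in> F ` U" using x \<open>F ` U = ?J\<close> by simp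
    then obtain u where u: "u \<in> U" "F x = F u" by auto
    have uc: "u \<in> carrier M" using u msub_mem[OF Um] by blast
    have "x \<ominus>\<^bsub>M\<^esub> u \<in> ker M I F" using F.diff_in_ker[OF x uc u(2)] .
    then have "(x \<ominus>\<^bsub>M\<^esub> u) \<oplus>\<^bsub>M\<^esub> u \<in> msum M (ker M I F) U" using u(1) by (rule msumI)
    then show ?thesis using diff_add_cancel[OF x uc] by simp
  qed
  moreover have "msum M (ker M I F) U \<subseteq> carrier M" using msub_msum[OF F.msub_ker Um] by (simp add: msub_def)
  ultimately have sum: "msum M (ker M I F) U = carrier M" by blast
  have "ker M I F = {\<zero>\<^bsub>M\<^esub>}" using ind ker_U sum F.msub_ker U unfolding indecomposable_iff by blast
  then have "carrier M \<subseteq> U" using msum_least[OF Um, of "ker M I F" U] sum Um by (auto simp: msub_def)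
  then have "U = carrier M" using Um by (auto simp: msub_def)
  then show ?thesis using U by simp
qed

lemma uniserial_superfluous:
  assumes P: "right_module A P" and M: "right_module A M" and "uniserial_module A P"
    and "mhom A P M p" "p ` carrier P = carrier M" "carrier M \<noteq> {\<zero>\<^bsub>M\<^esub>}"
  shows "superfluous A P (ker P M p)"
proof -
  interpret mod_hom A P M p by (intro mod_homI assms)
  have "V = carrier P" if V: "msub A P V" "msum P (ker P M p) V = carrier P" for V
  proof -
    have "ker P M p \<subseteq> V \<or> V \<subseteq> ker P M p" using assms(3) msub_ker V(1) unfolding M.uniserial_iff by blast
    then show ?thesis
    proof
      assume "ker P M p \<subseteq> V"
      then show ?thesis using M.msum_least[OF V(1), of "ker P M p" V] V by (auto simp: msub_def)
    next
      assume "V \<subseteq> ker P M p"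
      then have "carrier P \<subseteq> ker P M p" using M.msum_least[OF msub_ker, of "ker P M p" V] V(2) by auto
      then have "p ` carrier P \<subseteq> {\<zero>\<^bsub>M\<^esub>}" by (auto simp: ker_def)
      then have "carrier M \<subseteq> {\<zero>\<^bsub>M\<^esub>}" using assms(5) by simp
      then show ?thesis using assms(6) by auto
    qed
  qed
  then show ?thesis using msub_ker unfolding M.superfluous_iff by blast
qed

end

section \<open>Short exact sequences\<close>

lemma short_exactI:
  assumes "right_module R L" "right_module R M" "mhom R L M f" "mhom R M N g"
    "inj_on f (carrier L)" "f ` carrier L = ker M N g" "g ` carrier M = carrier N"
  shows "short_exact R L M N"
proof -
  let ?f = "restrict f (carrier L)" and ?g = "restrict g (carrier M)"
  have "?f \<in> module_hom R L M" "?g \<in> module_hom R M N" using assms by (auto intro: mhom_restrict)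
  moreover have "inj_on ?f (carrier L)" "?g ` carrier M = carrier N" using assms by (simp_all add: inj_on_restrict_eq)
  moreover have "?f ` carrier L = a_kernel M N ?g" using assms(6) by (auto simp: a_kernel_eq_ker ker_def)
  ultimately show ?thesis unfolding short_exact_def by blast
qed

lemma short_exactE:
  assumes "short_exact R L M N"
  obtains f g where "mhom R L M f" "mhom R M N g" "inj_on f (carrier L)"
    "f ` carrier L = ker M N g" "g ` carrier M = carrier N"
proof -
  obtain f g where "f \<in> module_hom R L M" "g \<in> module_hom R M N" "inj_on f (carrier L)"
    "f ` carrier L = ker M N g" "g ` carrier M = carrier N"
    using assms unfolding short_exact_def a_kernel_eq_ker by blast
  then show ?thesis using that[of f g] by (simp add: module_hom_mhom)
qed

lemma short_exact_iso:
  assumes "short_exact R L M N" "mod_iso R L L' a a'" "mod_iso R M M' b b'" "mod_iso R N N' c c'"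
  shows "short_exact R L' M' N'"
proof -
  interpret a: mod_iso R L L' a a' by fact
  interpret b: mod_iso R M M' b b' by fact
  interpret c: mod_iso R N N' c c' by fact
  obtain f g where fg: "mhom R L M f" "mhom R M N g" "inj_on f (carrier L)"
    "f ` carrier L = ker M N g" "g ` carrier M = carrier N" using short_exactE[OF assms(1)] .
  note f = mhomD[OF fg(1)] and g = mhomD[OF fg(2)]
  show ?thesis
  proof (rule short_exactI[OF a.N.right_module_axioms b.N.right_module_axioms])
    show "mhom R L' M' (\<lambda>x. b (f (a' x)))" using mhom_comp[OF a.inv.hom mhom_comp[OF fg(1) b.hom]] .
    show "mhom R M' N' (\<lambda>x. c (g (b' x)))" using mhom_comp[OF b.inv.hom mhom_comp[OF fg(2) c.hom]] .
    show "inj_on (\<lambda>x. b (f (a' x))) (carrier L')"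
    proof (rule inj_onI)
      fix x y assume xy: "x \<in> carrier L'" "y \<in> carrier L'" "b (f (a' x)) = b (f (a' y))"
      then have "f (a' x) = f (a' y)" using inj_onD[OF b.inj xy(3)] f(1) by simp
      then have "a' x = a' y" using inj_onD[OF fg(3)] xy by simp
      then have "a (a' x) = a (a' y)" by simp
      then show "x = y" using xy by simp
    qed
    have "(\<lambda>x. c (g (b' x))) ` carrier M' = c ` g ` b' ` carrier M'" by (simp add: image_image)
    then show "(\<lambda>x. c (g (b' x))) ` carrier M' = carrier N'"
      using mod_iso.surj[OF b.sym] fg(5) c.surj by simp
    have "(\<lambda>x. b (f (a' x))) ` carrier L' = b ` f ` a' ` carrier L'" by (simp add: image_image)
    also have "\<dots> = b ` ker M N g" using mod_iso.surj[OF a.sym] fg(4) by simp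
    also have "\<dots> = ker M' N' (\<lambda>x. c (g (b' x)))"
    proof
      show "b ` ker M N g \<subseteq> ker M' N' (\<lambda>x. c (g (b' x)))" by (auto simp: ker_def)
      show "ker M' N' (\<lambda>x. c (g (b' x))) \<subseteq> b ` ker M N g"
      proof
        fix y assume "y \<in> ker M' N' (\<lambda>x. c (g (b' x)))"
        then have y: "y \<in> carrier M'" "c (g (b' y)) = c \<zero>\<^bsub>N\<^esub>" by (simp_all add: ker_def)
        then have "g (b' y) = \<zero>\<^bsub>N\<^esub>" using inj_onD[OF c.inj y(2)] g(1) by simp
        then have "b' y \<in> ker M N g" using y by (simp add: ker_def)
        then show "y \<in> b ` ker M N g" using y b.fg by (metis image_eqI)
      qed
    qed
    finally show "(\<lambda>x. b (f (a' x))) ` carrier L' = ker M' N' (\<lambda>x. c (g (b' x)))" .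
  qed
qed

lemma mod_iso_on_sub:
  assumes "mod_iso R M N f g" "msub R M U" "msub R N V" "f ` U \<subseteq> V" "g ` V \<subseteq> U"
  shows "mod_iso R (on_sub M U) (on_sub N V) f g"
proof -
  interpret mod_iso R M N f g by fact
  have "mhom R (on_sub M U) (on_sub N V) f" "mhom R (on_sub N V) (on_sub M U) g"
    using mhom_on_cod[OF mhom_on_dom[OF hom assms(2)]] mhom_on_cod[OF mhom_on_dom[OF inv.hom assms(3)]] assms(4,5)
    by auto
  then show ?thesis
    using M.msub_mem[OF assms(2)] N.msub_mem[OF assms(3)]
    by (intro mod_iso.intro mod_iso_axioms.intro mod_homI M.on_sub_module N.on_sub_module assms(2,3)) auto
qed

section \<open>The Auslander-Reiten translation\<close>

context fdalg
begin

section \<open>Uniqueness of projective covers and of minimal presentations\<close>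

lemma projective_coverD:
  assumes "projective_cover A P p M"
  shows "P \<in> fg_modules A" "projective_module A P" "mhom A P M p" "p ` carrier P = carrier M"
    "superfluous A P (ker P M p)" "fmod P" "right_module A P"
  using assms module_hom_mhom unfolding projective_cover_def a_kernel_eq_ker fg_modules_iff fmod_def by blast+

lemma projective_cover_unique:
  assumes P: "projective_cover A P p M" and P': "projective_cover A P' p' M'" and "fmod M'" "mod_iso A M M' u u'"
  obtains h h' where "mod_iso A P P' h h'" "\<And>x. x \<in> carrier P \<Longrightarrow> p' (h x) = u (p x)"
proof -
  note P = projective_coverD[OF P] and P' = projective_coverD[OF P']
  interpret u: mod_iso A M M' u u' by fact
  interpret p: mod_hom A P M p by (intro mod_homI P u.M.right_module_axioms)
  interpret p': mod_hom A P' M' p' by (intro mod_homI P' u.N.right_module_axioms)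
  have up: "mhom A P M' (\<lambda>x. u (p x))" using mhom_comp[OF P(3) u.hom] .
  have "(\<lambda>x. u (p x)) ` carrier P \<subseteq> p' ` carrier P'" using P'(4) by auto
  then obtain h where h: "mhom A P P' h" "\<And>x. x \<in> carrier P \<Longrightarrow> p' (h x) = u (p x)"
    using projective_lift[OF P(2,7) P'(6) assms(3) P'(3) up] by blast
  interpret h: mod_hom A P P' h by (intro mod_homI P P' h)
  \<comment> \<open>Modulo the kernel of \<open>p'\<close>, every \<open>y\<close> comes from
    \<open>P\<close>.\<close>
  have "y \<in> msum P' (ker P' M' p') (h ` carrier P)" if y: "y \<in> carrier P'" for y
  proof -
    have "p ` carrier P = carrier M" by (rule P(4))
    then have "u' (p' y) \<in> p ` carrier P" using y by simp
    then obtain x where x: "x \<in> carrier P" "p x = u' (p' y)" by auto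
    then have "p' y = p' (h x)" using h(2)[OF x(1)] y by simp
    then have "y \<ominus>\<^bsub>P'\<^esub> h x \<in> ker P' M' p'" using p'.diff_in_ker[OF y h.closed[OF x(1)]] by simp
    then have "(y \<ominus>\<^bsub>P'\<^esub> h x) \<oplus>\<^bsub>P'\<^esub> h x \<in> msum P' (ker P' M' p') (h ` carrier P)"
      using x(1) by (intro msumI) auto
    then show ?thesis using p'.M.diff_add_cancel[OF y h.closed[OF x(1)]] by simp
  qed
  moreover have "msum P' (ker P' M' p') (h ` carrier P) \<subseteq> carrier P'"
    using p'.M.msub_msum[OF p'.msub_ker h.msub_range] by (simp add: msub_def)
  ultimately have "msum P' (ker P' M' p') (h ` carrier P) = carrier P'" by blast
  then have hs: "h ` carrier P = carrier P'" using P'(5) h.msub_range unfolding p'.M.superfluous_iff by blast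
  obtain s where s: "mhom A P' P s" "\<And>y. y \<in> carrier P' \<Longrightarrow> h (s y) = y"
    using projective_lift[OF P'(2,7) P(6) P'(6) h(1) mhom_id] hs by auto
  interpret s: mod_hom A P' P s by (intro mod_homI P P' s)
  note sp = split_direct_sum[OF h.mod_hom_axioms s.mod_hom_axioms s(2)]
  have kk: "ker P P' h \<subseteq> ker P M p"
  proof
    fix x assume "x \<in> ker P P' h"
    then have x: "x \<in> carrier P" "h x = \<zero>\<^bsub>P'\<^esub>" by (auto simp: ker_def)
    then have "u (p x) = u \<zero>\<^bsub>M\<^esub>" using h(2)[OF x(1)] by simp
    then have "p x = \<zero>\<^bsub>M\<^esub>" using inj_onD[OF u.inj, of "p x" "\<zero>\<^bsub>M\<^esub>"] x(1) by simp
    then show "x \<in> ker P M p" using x by (simp add: ker_def)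
  qed
  \<comment> \<open>The kernel of \<open>h\<close> lies in that of \<open>p\<close>, so the kernel
    of \<open>p\<close> and the image of \<open>s\<close> together already generate
    \<open>P\<close>.\<close>
  let ?T = "msum P (ker P M p) (s ` carrier P')"
  have T: "msub A P ?T" using p.M.msub_msum[OF p.msub_ker s.msub_range] .
  have "ker P P' h \<subseteq> ?T" "s ` carrier P' \<subseteq> ?T"
    using kk p.M.msum_upper1[OF p.msub_ker s.msub_range] p.M.msum_upper2[OF p.msub_ker s.msub_range] by auto
  then have "carrier P \<subseteq> ?T" using p.M.msum_least[OF T, of "ker P P' h" "s ` carrier P'"] sp(2) by simp
  then have "?T = carrier P" using T by (auto simp: msub_def)
  then have "s ` carrier P' = carrier P" using P(5) s.msub_range unfolding p.M.superfluous_iff by blast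
  then have "ker P P' h \<subseteq> {\<zero>\<^bsub>P\<^esub>}" using sp(1) by (auto simp: ker_def)
  then have "inj_on h (carrier P)" using h.inj_iff by blast
  then have "mod_iso A P P' h (inv_into (carrier P) h)"
    using hs by (intro mod_isoI P P' h) (simp add: bij_betw_def)
  then show ?thesis using that h(2) by blast
qed

text \<open>The isomorphism between the covers \<open>P0\<close> and \<open>P0'\<close> restricts to
  the kernels, of which \<open>P1\<close> and \<open>P1'\<close> are covers in turn. The commuting
  square is what the Nakayama functor needs.\<close>

lemma min_proj_presentation_unique:
  assumes "min_proj_presentation A P1 p1 P0 p0 M" "min_proj_presentation A P1' p1' P0' p0' M'"
    and "fmod M'" "mod_iso A M M' u u'"
  obtains h0 h0' h1 h1' where "mod_iso A P0 P0' h0 h0'" "mod_iso A P1 P1' h1 h1'"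
    "\<And>x. x \<in> carrier P1 \<Longrightarrow> p1' (h1 x) = h0 (p1 x)"
proof -
  have c: "projective_cover A P0 p0 M" "projective_cover A P1 p1 (on_sub P0 (ker P0 M p0))"
    "projective_cover A P0' p0' M'" "projective_cover A P1' p1' (on_sub P0' (ker P0' M' p0'))"
    using assms(1,2) by (auto simp: min_proj_presentation_def a_kernel_eq_ker)
  note c0 = projective_coverD[OF c(1)] and c0' = projective_coverD[OF c(3)]
  interpret u: mod_iso A M M' u u' by fact
  interpret p0: mod_hom A P0 M p0 by (intro mod_homI c0 u.M.right_module_axioms)
  interpret p0': mod_hom A P0' M' p0' by (intro mod_homI c0' u.N.right_module_axioms)
  obtain h0 h0' where h0: "mod_iso A P0 P0' h0 h0'" "\<And>x. x \<in> carrier P0 \<Longrightarrow> p0' (h0 x) = u (p0 x)"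
    using projective_cover_unique[OF c(1,3) assms(3,4)] by blast
  interpret h0: mod_iso A P0 P0' h0 h0' by fact
  have "h0 ` ker P0 M p0 \<subseteq> ker P0' M' p0'" using h0(2) by (auto simp: ker_def)
  moreover have "h0' ` ker P0' M' p0' \<subseteq> ker P0 M p0"
  proof
    fix x assume "x \<in> h0' ` ker P0' M' p0'"
    then obtain y where y: "y \<in> carrier P0'" "p0' y = \<zero>\<^bsub>M'\<^esub>" "x = h0' y" by (auto simp: ker_def)
    then have "u (p0 x) = u \<zero>\<^bsub>M\<^esub>" using h0(2)[of x] by simp
    then have "p0 x = \<zero>\<^bsub>M\<^esub>" using inj_onD[OF u.inj, of "p0 x" "\<zero>\<^bsub>M\<^esub>"] y by simp
    then show "x \<in> ker P0 M p0" using y by (simp add: ker_def)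
  qed
  ultimately have k: "mod_iso A (on_sub P0 (ker P0 M p0)) (on_sub P0' (ker P0' M' p0')) h0 h0'"
    by (intro mod_iso_on_sub h0(1) p0.msub_ker p0'.msub_ker)
  obtain h1 h1' where "mod_iso A P1 P1' h1 h1'" "\<And>x. x \<in> carrier P1 \<Longrightarrow> p1' (h1 x) = h0 (p1 x)"
    using projective_cover_unique[OF c(2,4) fmod_on_sub[OF c0'(6) p0'.msub_ker] k] by blast
  then show ?thesis using that h0(1) by blast
qed

text \<open>The Nakayama functor \<open>D Hom(-, A)\<close> on objects and on homomorphisms; \<open>\<tau> M\<close> is the kernel of the map that it
  induces from a minimal projective presentation.\<close>

definition nu where "nu P = dual_module K A (hom_to_ring A P)"

definition nu_map :: "('a, 'q, 'y) module_scheme \<Rightarrow> ('a, 'p, 'z) module_scheme \<Rightarrow> ('q \<Rightarrow> 'p)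
    \<Rightarrow> (('q \<Rightarrow> 'a) \<Rightarrow> 'k) \<Rightarrow> ('p \<Rightarrow> 'a) \<Rightarrow> 'k" where
  "nu_map Q P g l = (\<lambda>f\<in>module_hom A P (regular_module A). l (compose (carrier Q) f g))"

definition tau_of where
  "tau_of P1 p1 P0 = on_sub (nu P1) (ker (nu P1) (nu P0) (nu_map P1 P0 p1))"

section \<open>Functoriality of the Nakayama functor\<close>

lemma nu_right_module: "right_module A P \<Longrightarrow> right_module A (nu P)"
  unfolding nu_def by (intro dual_right_module hom_to_ring_left_module)

lemma nu_fmod: "fmod P \<Longrightarrow> fmod (nu P)"
  unfolding nu_def by (intro dual_fmod hom_to_ring_left_module hom_to_ring_fin_gen) (simp_all add: fmod_def)

lemma compose_hom:
  assumes "right_module A Q" "mhom A Q P g" "f \<in> module_hom A P (regular_module A)"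
  shows "compose (carrier Q) f g \<in> module_hom A Q (regular_module A)"
  using mhom_restrict[OF assms(1) mhom_comp[OF assms(2) module_hom_mhom[OF assms(3)]]]
  by (simp add: compose_def)

lemma precompose_hom:
  assumes "right_module A Q" "right_module A P" "mhom A Q P g"
  shows "mhom (opp A) (hom_to_ring A P) (hom_to_ring A Q) (\<lambda>f. compose (carrier Q) f g)"
  using assms mhomD(1)[OF assms(3)] compose_hom[OF assms(1,3)]
  by (auto simp: mhom_def compose_def intro!: restrict_ext)

lemma nu_map_hom:
  assumes Q: "right_module A Q" and P: "right_module A P" and g: "mhom A Q P g"
  shows "mhom A (nu Q) (nu P) (nu_map Q P g)"
proof -
  note HQ = hom_to_ring_left_module[OF Q] and HP = hom_to_ring_left_module[OF P]
  interpret c: mod_hom "opp A" "hom_to_ring A P" "hom_to_ring A Q" "\<lambda>f. compose (carrier Q) f g"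
    by (intro mod_homI HQ HP precompose_hom Q P g)
  have cl: "nu_map Q P g l \<in> carrier (nu P)" if l: "l \<in> carrier (nu Q)" for l
  proof -
    note l' = dualD[OF HQ l[unfolded nu_def]]
    show ?thesis
      unfolding nu_def nu_map_def hom_to_ring_simps(1)[symmetric]
    proof (rule dualI[OF HP])
      fix x assume x: "x \<in> carrier (hom_to_ring A P)"
      show "l (compose (carrier Q) x g) \<in> carrier K" using l'(1) c.closed[OF x] by blast
    next
      fix x y assume xy: "x \<in> carrier (hom_to_ring A P)" "y \<in> carrier (hom_to_ring A P)"
      show "l (compose (carrier Q) (x \<oplus>\<^bsub>hom_to_ring A P\<^esub> y) g) = l (compose (carrier Q) x g) \<oplus>\<^bsub>K\<^esub> l (compose (carrier Q) y g)"
        unfolding c.add[OF xy] by (rule l'(2)[OF c.closed[OF xy(1)] c.closed[OF xy(2)]])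
    next
      fix d x assume dx: "d \<in> carrier K" "x \<in> carrier (hom_to_ring A P)"
      have "scalar d \<in> carrier (opp A)" using dx by simp
      from c.act[OF this dx(2)]
      show "l (compose (carrier Q) (scalar d \<odot>\<^bsub>hom_to_ring A P\<^esub> x) g) = d \<otimes>\<^bsub>K\<^esub> l (compose (carrier Q) x g)"
        using l'(3)[OF dx(1) c.closed[OF dx(2)]] by (simp only:)
    qed
  qed
  show ?thesis
    unfolding mhom_def
  proof (intro conjI ballI)
    fix l m assume "l \<in> carrier (nu Q)" "m \<in> carrier (nu Q)"
    show "nu_map Q P g (l \<oplus>\<^bsub>nu Q\<^esub> m) = nu_map Q P g l \<oplus>\<^bsub>nu P\<^esub> nu_map Q P g m"
      using compose_hom[OF Q g] by (auto simp: nu_def nu_map_def intro!: restrict_ext)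
  next
    fix a l assume a: "a \<in> carrier A" "l \<in> carrier (nu Q)"
    have "compose (carrier Q) (\<lambda>p\<in>carrier P. a \<otimes>\<^bsub>A\<^esub> f p) g = (\<lambda>p\<in>carrier Q. a \<otimes>\<^bsub>A\<^esub> compose (carrier Q) f g p)"
      for f using mhomD(1)[OF g] by (auto simp: compose_def intro!: restrict_ext)
    moreover have "(\<lambda>p\<in>carrier P. a \<otimes>\<^bsub>A\<^esub> f p) \<in> module_hom A P (regular_module A)"
      if "f \<in> module_hom A P (regular_module A)" for f
      using right_module.ract_closed[OF HP, of a f] a that by simp
    ultimately show "nu_map Q P g (a \<odot>\<^bsub>nu Q\<^esub> l) = a \<odot>\<^bsub>nu P\<^esub> nu_map Q P g l"
      using compose_hom[OF Q g] by (auto simp: nu_def nu_map_def intro!: restrict_ext)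
  qed (rule cl)
qed

lemma nu_map_mod_hom:
  assumes "right_module A Q" "right_module A P" "mhom A Q P g"
  shows "mod_hom A (nu Q) (nu P) (nu_map Q P g)"
  using assms by (intro mod_homI nu_right_module nu_map_hom)

lemma nu_map_comp:
  assumes "mhom A L M g" "mhom A M N f" "right_module A M"
  shows "nu_map M N f (nu_map L M g l) = nu_map L N (\<lambda>x. f (g x)) l"
proof -
  have "compose (carrier L) (compose (carrier M) h f) g = compose (carrier L) h (\<lambda>x. f (g x))" for h :: "_ \<Rightarrow> 'a"
    using mhomD(1)[OF assms(1)] by (auto simp: compose_def intro!: restrict_ext)
  then show ?thesis
    using compose_hom[OF assms(3,2)] by (auto simp: nu_map_def intro!: restrict_ext)
qed

lemma nu_map_cong: "(\<And>x. x \<in> carrier Q \<Longrightarrow> f x = g x) \<Longrightarrow> nu_map Q P f = nu_map Q P g"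
  by (auto simp: nu_map_def compose_def cong: restrict_cong intro!: ext)

lemma nu_map_id:
  assumes "l \<in> carrier (nu P)" shows "nu_map P P (\<lambda>x. x) l = l"
proof -
  have "compose (carrier P) f (\<lambda>x. x) = f" if "f \<in> module_hom A P (regular_module A)" for f
    using that by (auto simp: compose_def module_hom_iff extensional_def intro!: ext)
  then show ?thesis
    using assms by (auto simp: nu_def nu_map_def dual_carrier_iff extensional_def intro!: ext)
qed

lemma nu_map_iso:
  assumes "mod_iso A P Q f g" shows "mod_iso A (nu P) (nu Q) (nu_map P Q f) (nu_map Q P g)"
proof -
  interpret mod_iso A P Q f g by fact
  have "nu_map Q P g (nu_map P Q f l) = l" if "l \<in> carrier (nu P)" for l
    using nu_map_comp[OF hom inv.hom N.right_module_axioms, of l] nu_map_id[OF that]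
      nu_map_cong[of P "\<lambda>x. g (f x)" "\<lambda>x. x" P] by simp
  moreover have "nu_map P Q f (nu_map Q P g l) = l" if "l \<in> carrier (nu Q)" for l
    using nu_map_comp[OF inv.hom hom M.right_module_axioms, of l] nu_map_id[OF that]
      nu_map_cong[of Q "\<lambda>x. f (g x)" "\<lambda>x. x" Q] by simp
  ultimately show ?thesis
    by (intro mod_iso.intro mod_iso_axioms.intro nu_map_mod_hom hom inv.hom M.right_module_axioms N.right_module_axioms)
qed

lemma tau_of_fmod:
  assumes "fmod P1" "right_module A P0" "mhom A P1 P0 p1" shows "fmod (tau_of P1 p1 P0)"
  unfolding tau_of_def
  using assms nu_map_mod_hom[of P1 P0 p1] by (intro fmod_on_sub nu_fmod mod_hom.msub_ker) (simp_all add: fmod_def)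

text \<open>Functoriality turns the commuting square of presentations into one between their images
  under \<nu>, and its vertical isomorphisms restrict to the kernels of the horizontal maps.\<close>

lemma tau_of_iso:
  assumes "mod_iso A P0 P0' h0 h0'" "mod_iso A P1 P1' h1 h1'" "mhom A P1 P0 p1" "mhom A P1' P0' p1'"
    "\<And>x. x \<in> carrier P1 \<Longrightarrow> p1' (h1 x) = h0 (p1 x)"
  shows "mod_iso A (tau_of P1 p1 P0) (tau_of P1' p1' P0') (nu_map P1 P1' h1) (nu_map P1' P1 h1')"
proof -
  interpret h0: mod_iso A P0 P0' h0 h0' by fact
  interpret h1: mod_iso A P1 P1' h1 h1' by fact
  note rm = h0.M.right_module_axioms h0.N.right_module_axioms h1.M.right_module_axioms h1.N.right_module_axioms
  interpret n1: mod_iso A "nu P1" "nu P1'" "nu_map P1 P1' h1" "nu_map P1' P1 h1'" by (rule nu_map_iso) fact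
  interpret n0: mod_iso A "nu P0" "nu P0'" "nu_map P0 P0' h0" "nu_map P0' P0 h0'" by (rule nu_map_iso) fact
  interpret p: mod_hom A "nu P1" "nu P0" "nu_map P1 P0 p1" by (intro nu_map_mod_hom rm assms)
  interpret p': mod_hom A "nu P1'" "nu P0'" "nu_map P1' P0' p1'" by (intro nu_map_mod_hom rm assms)
  have sq: "nu_map P1' P0' p1' (nu_map P1 P1' h1 l) = nu_map P0 P0' h0 (nu_map P1 P0 p1 l)" for l
    using nu_map_comp[OF h1.hom assms(4) rm(4)] nu_map_comp[OF assms(3) h0.hom rm(1)]
      nu_map_cong[of P1 "\<lambda>x. p1' (h1 x)" "\<lambda>x. h0 (p1 x)" P0'] assms(5) by simp
  have "nu_map P1 P1' h1 ` ker (nu P1) (nu P0) (nu_map P1 P0 p1) \<subseteq> ker (nu P1') (nu P0') (nu_map P1' P0' p1')"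
    using sq n0.zero by (auto simp: ker_def)
  moreover have "nu_map P1' P1 h1' ` ker (nu P1') (nu P0') (nu_map P1' P0' p1') \<subseteq> ker (nu P1) (nu P0) (nu_map P1 P0 p1)"
  proof
    fix x assume "x \<in> nu_map P1' P1 h1' ` ker (nu P1') (nu P0') (nu_map P1' P0' p1')"
    then obtain y where y: "y \<in> carrier (nu P1')" "nu_map P1' P0' p1' y = \<zero>\<^bsub>nu P0'\<^esub>" "x = nu_map P1' P1 h1' y"
      by (auto simp: ker_def)
    then have xc: "x \<in> carrier (nu P1)" by simp
    have "nu_map P0 P0' h0 (nu_map P1 P0 p1 x) = nu_map P0 P0' h0 \<zero>\<^bsub>nu P0\<^esub>"
      using sq[of x] y by simp
    then have "nu_map P1 P0 p1 x = \<zero>\<^bsub>nu P0\<^esub>"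
      using inj_onD[OF n0.inj, of "nu_map P1 P0 p1 x" "\<zero>\<^bsub>nu P0\<^esub>"] p.closed[OF xc] by simp
    then show "x \<in> ker (nu P1) (nu P0) (nu_map P1 P0 p1)" using xc by (simp add: ker_def)
  qed
  ultimately show ?thesis
    unfolding tau_of_def by (intro mod_iso_on_sub n1.mod_iso_axioms p.msub_ker p'.msub_ker)
qed

text \<open>The dual of a quotient is the annihilator \<open>W\<close> of \<open>U\<close>:
  composing with the coset map lands in \<open>W\<close>, and a functional killing \<open>U\<close>
  factors through the cosets by \<open>mhom_factor\<close> over \<open>K\<close>.\<close>

lemma dual_quotient_iso:
  fixes N :: "('a, 'n, 'z) module_scheme"
  assumes N: "right_module (opp A) N" and U: "msub (opp A) N U"
  defines "W \<equiv> {l \<in> carrier (dual_module K A N). \<forall>u\<in>U. l u = \<zero>\<^bsub>K\<^esub>}"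
  assumes W: "msub A (dual_module K A N) W"
  shows "\<exists>f g. mod_iso A (dual_module K A (quotient_module N U)) (on_sub (dual_module K A N) W) f g"
proof -
  interpret N: right_module "opp A" N by (rule N)
  let ?Q = "quotient_module N U" and ?D = "dual_module K A N"
  let ?q = "\<lambda>x. U +>\<^bsub>N\<^esub> x"
  have Q: "right_module (opp A) ?Q" by (rule N.quotient_right_module[OF U])
  interpret q: mod_hom "opp A" N ?Q ?q by (intro mod_homI N Q N.quotient_hom U)
  have qs: "?q ` carrier N = carrier ?Q" by (simp add: N.quotient_carrier[OF U])
  have rm: "right_module A (dual_module K A ?Q)" "right_module A ?D" "right_module A (on_sub ?D W)"
    using dual_right_module[OF Q] dual_right_module[OF N] right_module.on_sub_module[OF dual_right_module[OF N] W] by auto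
  have qU: "?q u = \<zero>\<^bsub>?Q\<^esub>" if "u \<in> U" for u
    using that N.quotient_ker[OF U] by (auto simp: ker_def)
  define f :: "('n set \<Rightarrow> 'k) \<Rightarrow> 'n \<Rightarrow> 'k" where "f = (\<lambda>l. \<lambda>x\<in>carrier N. l (?q x))"
  have fW: "f l \<in> W" if l: "l \<in> carrier (dual_module K A ?Q)" for l
  proof -
    note l' = dualD[OF Q l]
    have "f l \<in> carrier ?D"
      unfolding f_def
    proof (rule dualI[OF N])
      fix x assume x: "x \<in> carrier N"
      show "l (?q x) \<in> carrier K" using l'(1) q.closed[OF x] by blast
    next
      fix x y assume xy: "x \<in> carrier N" "y \<in> carrier N"
      show "l (?q (x \<oplus>\<^bsub>N\<^esub> y)) = l (?q x) \<oplus>\<^bsub>K\<^esub> l (?q y)"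
        unfolding q.add[OF xy] by (rule l'(2)[OF q.closed[OF xy(1)] q.closed[OF xy(2)]])
    next
      fix d x assume dx: "d \<in> carrier K" "x \<in> carrier N"
      have "scalar d \<in> carrier (opp A)" using dx by simp
      from q.act[OF this dx(2)] show "l (?q (scalar d \<odot>\<^bsub>N\<^esub> x)) = d \<otimes>\<^bsub>K\<^esub> l (?q x)"
        using l'(3)[OF dx(1) q.closed[OF dx(2)]] by (simp only:)
    qed
    moreover have "f l u = \<zero>\<^bsub>K\<^esub>" if "u \<in> U" for u
      using that qU[OF that] l'(4) N.msub_mem[OF U that] by (simp add: f_def)
    ultimately show ?thesis by (simp add: W_def)
  qed
  have "mhom A (dual_module K A ?Q) (on_sub ?D W) f"
    unfolding mhom_def
  proof (intro conjI ballI)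
    fix a l assume "a \<in> carrier A" "l \<in> carrier (dual_module K A ?Q)"
    then show "f (a \<odot>\<^bsub>dual_module K A ?Q\<^esub> l) = a \<odot>\<^bsub>on_sub ?D W\<^esub> f l"
      using q.closed N.quotient_act[OF U] N.ract_closed by (auto simp: f_def intro!: restrict_ext)
  qed (use fW q.closed in \<open>auto simp: f_def intro!: restrict_ext\<close>)
  moreover have "bij_betw f (carrier (dual_module K A ?Q)) (carrier (on_sub ?D W))"
    unfolding bij_betw_def
  proof
    show "inj_on f (carrier (dual_module K A ?Q))"
    proof (rule inj_onI)
      fix l m assume lm: "l \<in> carrier (dual_module K A ?Q)" "m \<in> carrier (dual_module K A ?Q)" "f l = f m"
      show "l = m"
      proof (rule dual_eqI[OF lm(1,2)])
        fix y assume "y \<in> carrier ?Q"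
        then obtain x where "x \<in> carrier N" "y = ?q x" using qs by auto
        then show "l y = m y" using fun_cong[OF lm(3), of x] by (simp add: f_def)
      qed
    qed
    show "f ` carrier (dual_module K A ?Q) = carrier (on_sub ?D W)"
    proof
      show "f ` carrier (dual_module K A ?Q) \<subseteq> carrier (on_sub ?D W)" using fW by auto
      show "carrier (on_sub ?D W) \<subseteq> f ` carrier (dual_module K A ?Q)"
      proof
        fix l assume "l \<in> carrier (on_sub ?D W)"
        then have l: "l \<in> carrier ?D" "\<And>u. u \<in> U \<Longrightarrow> l u = \<zero>\<^bsub>K\<^esub>" by (auto simp: W_def)
        interpret VN: vec K "kv N" by (rule vec_kv_opp) (rule N)
        interpret VQ: vec K "kv ?Q" by (rule vec_kv_opp) (rule Q)
        have qh: "mhom K (kv N) (kv ?Q) ?q" using q.hom by (auto simp: mhom_def)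
        have lh: "mhom K (kv N) (regular_module K) l" using l(1) by (simp add: dual_carrier_iff)
        have mh: "mod_hom K (kv N) (kv ?Q) ?q" "mod_hom K (kv N) (regular_module K) l"
          by (intro mod_homI VN.right_module_axioms VQ.right_module_axioms K_regular qh lh)+
        have sur: "?q ` carrier (kv N) = carrier (kv ?Q)" using qs by simp
        have kk: "ker (kv N) (kv ?Q) ?q \<subseteq> ker (kv N) (regular_module K) l"
          using N.quotient_ker[OF U] l(2) by (auto simp: ker_def)
        obtain m where m: "mhom K (kv ?Q) (regular_module K) m" "\<And>x. x \<in> carrier N \<Longrightarrow> m (?q x) = l x"
          using mhom_factor[OF mh sur kk] by auto
        let ?m = "restrict m (carrier ?Q)"
        have "mhom K (kv ?Q) (regular_module K) ?m"
          by (rule iffD1[OF mhom_cong[OF VQ.right_module_axioms] m(1)]) simp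
        then have mD: "?m \<in> carrier (dual_module K A ?Q)" by (simp add: dual_carrier_iff)
        have "f ?m = l"
        proof (rule dual_eqI[OF _ l(1)])
          show "f ?m \<in> carrier ?D" using fW[OF mD] by (simp add: W_def)
          fix x assume "x \<in> carrier N"
          then show "f ?m x = l x" using m(2) q.closed by (simp add: f_def)
        qed
        then show "l \<in> f ` carrier (dual_module K A ?Q)" using mD by blast
      qed
    qed
  qed
  ultimately show ?thesis using mod_isoI[OF rm(1,3)] by blast
qed

text \<open>The transpose is the cokernel of precomposition with \<open>p1\<close>, so its dual
  consists of the functionals that annihilate every composite \<open>f p1\<close>, which is the
  kernel of \<open>nu_map\<close>.\<close>

lemma dual_transpose_iso:
  assumes P1: "right_module A P1" and P0: "right_module A P0" and p1: "mhom A P1 P0 p1"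
  shows "\<exists>f g. mod_iso A (dual_module K A (transpose_module A P1 p1 P0)) (tau_of P1 p1 P0) f g"
proof -
  let ?N = "hom_to_ring A P1" and ?U = "(\<lambda>f. compose (carrier P1) f p1) ` carrier (hom_to_ring A P0)"
  let ?W = "{l \<in> carrier (dual_module K A ?N). \<forall>u\<in>?U. l u = \<zero>\<^bsub>K\<^esub>}"
  note HP = hom_to_ring_left_module[OF P1] hom_to_ring_left_module[OF P0]
  interpret c: mod_hom "opp A" "hom_to_ring A P0" ?N "\<lambda>f. compose (carrier P1) f p1"
    by (intro mod_homI HP precompose_hom P1 P0 p1)
  interpret n: mod_hom A "nu P1" "nu P0" "nu_map P1 P0 p1" by (intro nu_map_mod_hom P1 P0 p1)
  have zero: "nu_map P1 P0 p1 l = \<zero>\<^bsub>nu P0\<^esub> \<longleftrightarrow> (\<forall>f\<in>module_hom A P0 (regular_module A). l (compose (carrier P1) f p1) = \<zero>\<^bsub>K\<^esub>)" for l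
    unfolding nu_map_def nu_def dual_simps(1) hom_to_ring_simps(1) by (auto simp: fun_eq_iff restrict_def)
  have W: "ker (nu P1) (nu P0) (nu_map P1 P0 p1) = ?W"
    unfolding ker_def zero by (auto simp: nu_def)
  have "msub A (dual_module K A ?N) ?W" using n.msub_ker unfolding W by (simp add: nu_def)
  from dual_quotient_iso[OF HP(1) c.msub_range this]
  show ?thesis unfolding tau_of_def W transpose_module_def by (simp add: nu_def)
qed

text \<open>Makes the choice in \<open>ar_translate\<close> harmless: whichever minimal presentation
  is at hand, the chosen object is isomorphic to the kernel computed from it. The given presentation
  also shows that the choice is made from a nonempty collection.\<close>

lemma ar_translate_spec:
  assumes M: "M \<in> fg_modules A" and pr: "min_proj_presentation A P1 p1 P0 p0 M"
  shows "ar_translate K A M \<in> fg_modules A"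
    "\<exists>f g. mod_iso A (ar_translate K A M) (tau_of P1 p1 P0) f g"
proof -
  let ?Q = "\<lambda>T. T \<in> fg_modules A \<and> (\<exists>P1 p1 P0 p0. min_proj_presentation A P1 p1 P0 p0 M \<and>
        module_iso A T (dual_module K A (transpose_module A P1 p1 P0)))"
  have fM: "fmod M" using M by (simp add: fg_modules_iff)
  then have rM: "right_module A M" by (rule fmod_right_module)
  have D: "fmod P1 \<and> right_module A P1 \<and> right_module A P0 \<and> mhom A P1 P0 p1"
    if "min_proj_presentation A P1 p1 P0 p0 M" for P1 p1 P0 p0
  proof -
    have c: "projective_cover A P0 p0 M" "projective_cover A P1 p1 (on_sub P0 (ker P0 M p0))"
      using that by (auto simp: min_proj_presentation_def a_kernel_eq_ker)
    note c0 = projective_coverD[OF c(1)] and c1 = projective_coverD[OF c(2)]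
    have "msub A P0 (ker P0 M p0)" using mod_hom.msub_ker[OF mod_homI[OF c0(7) rM c0(3)]] .
    then show ?thesis using c0 c1 mhom_cod_incl[OF c1(3)] by (simp add: msub_def)
  qed
  note d = D[OF pr]
  obtain T f g where T: "T \<in> fg_modules A" "mod_iso A (tau_of P1 p1 P0) T f g"
    using rep_iso[OF tau_of_fmod, of P1 P0 p1] d by blast
  obtain f' g' where dt: "mod_iso A (dual_module K A (transpose_module A P1 p1 P0)) (tau_of P1 p1 P0) f' g'"
    using dual_transpose_iso d by blast
  have "module_iso A T (dual_module K A (transpose_module A P1 p1 P0))"
    using mod_iso.module_iso[OF mod_iso_trans[OF mod_iso.sym[OF T(2)] mod_iso.sym[OF dt]]] .
  then have "?Q T" using T(1) pr by blast
  then have "?Q (ar_translate K A M)" unfolding ar_translate_def by (rule someI[of ?Q])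
  \<comment> \<open>The chosen object may come from another presentation; uniqueness leads back to
    the given one.\<close>
  then obtain P1' p1' P0' p0' where tf: "ar_translate K A M \<in> fg_modules A"
    and pr': "min_proj_presentation A P1' p1' P0' p0' M"
    and iso: "module_iso A (ar_translate K A M) (dual_module K A (transpose_module A P1' p1' P0'))" by blast
  show "ar_translate K A M \<in> fg_modules A" by (rule tf)
  note d' = D[OF pr']
  obtain f1 g1 where dt': "mod_iso A (dual_module K A (transpose_module A P1' p1' P0')) (tau_of P1' p1' P0') f1 g1"
    using dual_transpose_iso d' by blast
  interpret dt': mod_iso A "dual_module K A (transpose_module A P1' p1' P0')" "tau_of P1' p1' P0'" f1 g1 by (rule dt')
  have tr: "right_module A (ar_translate K A M)" using tf by (simp add: fg_modules_iff fmod_def)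
  obtain a b where ab: "mod_iso A (ar_translate K A M) (dual_module K A (transpose_module A P1' p1' P0')) a b"
    using module_iso_mod_iso[OF iso tr dt'.M.right_module_axioms] .
  have "mod_iso A M M (\<lambda>x. x) (\<lambda>x. x)"
    by (intro mod_iso.intro mod_iso_axioms.intro mod_homI rM mhom_id) auto
  then obtain h0 h0' h1 h1' where h: "mod_iso A P0' P0 h0 h0'" "mod_iso A P1' P1 h1 h1'"
    "\<And>x. x \<in> carrier P1' \<Longrightarrow> p1 (h1 x) = h0 (p1' x)"
    using min_proj_presentation_unique[OF pr' pr fM] by blast
  have "mhom A P1' P0' p1'" "mhom A P1 P0 p1" using d d' by auto
  note ti = tau_of_iso[OF h(1,2) this h(3)]
  show "\<exists>f g. mod_iso A (ar_translate K A M) (tau_of P1 p1 P0) f g"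
    using mod_iso_trans[OF ab mod_iso_trans[OF dt' ti]] by blast
qed

text \<open>Functoriality gives kernels of \<open>\<nu> r\<close>, \<open>\<nu> (q r)\<close> and
  \<open>\<nu> q\<close> and a left exact sequence between them. For surjectivity, an element of the
  last kernel is a functional \<open>m\<close> on homomorphisms \<open>Q \<rightarrow> A\<close>
  that has to be written as \<open>l\<close> composed with precomposition by \<open>r\<close>; the
  hypothesis \<open>ext\<close> says precisely that \<open>m\<close> vanishes where this composite
  must.\<close>

lemma tau_of_short_exact:
  assumes Q2: "fmod Q2" and Q: "right_module A Q" and P: "right_module A P"
    and r: "mhom A Q2 Q r" and q: "mhom A Q P q"
    and ext: "\<And>h. h \<in> module_hom A Q (regular_module A) \<Longrightarrow> (\<And>x. x \<in> carrier Q2 \<Longrightarrow> h (r x) = \<zero>\<^bsub>A\<^esub>) \<Longrightarrow>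
      \<exists>k\<in>module_hom A P (regular_module A). \<forall>x\<in>carrier Q. k (q x) = h x"
  shows "short_exact A (tau_of Q2 r Q) (tau_of Q2 (\<lambda>x. q (r x)) P) (tau_of Q q P)"
proof -
  have Q2': "right_module A Q2" using Q2 by (simp add: fmod_def)
  have qr: "mhom A Q2 P (\<lambda>x. q (r x))" using mhom_comp[OF r q] .
  interpret nr: mod_hom A "nu Q2" "nu Q" "nu_map Q2 Q r" by (intro nu_map_mod_hom Q2' Q r)
  interpret nq: mod_hom A "nu Q" "nu P" "nu_map Q P q" by (intro nu_map_mod_hom Q P q)
  interpret nqr: mod_hom A "nu Q2" "nu P" "nu_map Q2 P (\<lambda>x. q (r x))" by (intro nu_map_mod_hom Q2' P qr)
  have comp: "nu_map Q P q (nu_map Q2 Q r l) = nu_map Q2 P (\<lambda>x. q (r x)) l" for l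
    by (rule nu_map_comp[OF r q Q])
  have kk: "ker (nu Q2) (nu Q) (nu_map Q2 Q r) \<subseteq> ker (nu Q2) (nu P) (nu_map Q2 P (\<lambda>x. q (r x)))"
    using comp nq.zero by (auto simp: ker_def simp flip: comp)
  have img: "nu_map Q2 Q r ` ker (nu Q2) (nu P) (nu_map Q2 P (\<lambda>x. q (r x))) \<subseteq> ker (nu Q) (nu P) (nu_map Q P q)"
    using comp by (auto simp: ker_def)
  have "\<exists>l\<in>ker (nu Q2) (nu P) (nu_map Q2 P (\<lambda>x. q (r x))). nu_map Q2 Q r l = m"
    if m: "m \<in> ker (nu Q) (nu P) (nu_map Q P q)" for m
  proof -
    have mQ: "m \<in> carrier (nu Q)" using m by (simp add: ker_def)
    have m0: "m (compose (carrier Q) k q) = \<zero>\<^bsub>K\<^esub>" if k: "k \<in> module_hom A P (regular_module A)" for k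
    proof -
      have "nu_map Q P q m k = \<zero>\<^bsub>nu P\<^esub> k" using m by (simp add: ker_def)
      then show ?thesis using k by (simp add: nu_map_def nu_def)
    qed
    let ?H = "hom_to_ring A Q" and ?H2 = "hom_to_ring A Q2"
    let ?c = "\<lambda>h. compose (carrier Q2) h r"
    note HQ = hom_to_ring_left_module[OF Q] hom_to_ring_left_module[OF Q2']
    interpret VH: vec K "kv ?H" by (rule vec_kv_opp) (rule HQ)
    interpret VH2: vec K "kv ?H2" by (rule vec_kv_opp) (rule HQ)
    have c: "mhom K (kv ?H) (kv ?H2) ?c"
      using precompose_hom[OF Q2' Q r] by (auto simp: mhom_def)
    interpret c: mod_hom K "kv ?H" "kv ?H2" ?c by (intro mod_homI VH.right_module_axioms VH2.right_module_axioms c)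
    have mh: "mhom K (kv ?H) (regular_module K) m" using mQ by (simp add: nu_def dual_carrier_iff)
    let ?G = "on_sub (kv ?H2) (?c ` carrier (kv ?H))"
    have gm: "mod_hom K (kv ?H) ?G ?c" "mod_hom K (kv ?H) (regular_module K) m"
      by (intro mod_homI VH.right_module_axioms VH2.on_sub_module c.msub_range mhom_on_cod c mh K_regular subset_refl)+
    have sur: "?c ` carrier (kv ?H) = carrier ?G" by simp
    \<comment> \<open>If \<open>h r\<close> vanishes, then \<open>ext\<close> writes
      \<open>h\<close> as \<open>k q\<close>, and \<open>m\<close> is zero there because it lies in
      the kernel of \<open>nu_map Q P q\<close>.\<close>
    have kz: "ker (kv ?H) ?G ?c \<subseteq> ker (kv ?H) (regular_module K) m"
    proof
      fix h assume "h \<in> ker (kv ?H) ?G ?c"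
      then have h: "h \<in> module_hom A Q (regular_module A)" "?c h = (\<lambda>p\<in>carrier Q2. \<zero>\<^bsub>A\<^esub>)"
        by (simp_all add: ker_def)
      have "h (r x) = \<zero>\<^bsub>A\<^esub>" if "x \<in> carrier Q2" for x
        using fun_cong[OF h(2), of x] that by (simp add: compose_def)
      then obtain k where k: "k \<in> module_hom A P (regular_module A)" "\<forall>x\<in>carrier Q. k (q x) = h x"
        using ext[OF h(1)] by blast
      have "compose (carrier Q) k q = h"
        using k(2) h(1) by (auto simp: compose_def module_hom_iff extensional_def intro!: ext)
      then have "m h = \<zero>\<^bsub>K\<^esub>" using m0[OF k(1)] by simp
      then show "h \<in> ker (kv ?H) (regular_module K) m" using h(1) by (simp add: ker_def)
    qed
    obtain l0 where l0: "mhom K ?G (regular_module K) l0" "\<And>h. h \<in> carrier (kv ?H) \<Longrightarrow> l0 (?c h) = m h"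
      using mhom_factor[OF gm sur kz] by blast
    have fin: "fin_gen K (kv ?H2) (carrier (kv ?H2))" using hom_to_ring_fin_gen[OF Q2] by simp
    \<comment> \<open>So far the functional lives on the image of precomposition with
      \<open>r\<close>; over the field it extends to all of \<open>?H2\<close>.\<close>
    obtain l1 where l1: "mhom K (kv ?H2) (regular_module K) l1" "\<And>x. x \<in> ?c ` carrier (kv ?H) \<Longrightarrow> l1 x = l0 x"
      using VH2.extend_hom[OF fin c.msub_range l0(1)] by blast
    let ?l = "restrict l1 (carrier ?H2)"
    have "mhom K (kv ?H2) (regular_module K) ?l"
      by (rule iffD1[OF mhom_cong[OF VH2.right_module_axioms] l1(1)]) simp
    then have lQ: "?l \<in> carrier (nu Q2)" by (simp add: nu_def dual_carrier_iff)
    have "nu_map Q2 Q r ?l = m"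
      unfolding nu_map_def
    proof (rule extensionalityI[of _ "module_hom A Q (regular_module A)"])
      show "m \<in> extensional (module_hom A Q (regular_module A))" using mQ by (simp add: nu_def dual_carrier_iff)
      fix h assume h: "h \<in> module_hom A Q (regular_module A)"
      have "l1 (?c h) = m h" using l1(2)[OF imageI, of h] l0(2)[of h] h by simp
      then show "(\<lambda>f\<in>module_hom A Q (regular_module A). ?l (compose (carrier Q2) f r)) h = m h"
        using h compose_hom[OF Q2' r h] by simp
    qed simp
    moreover have "?l \<in> ker (nu Q2) (nu P) (nu_map Q2 P (\<lambda>x. q (r x)))"
      using lQ comp[of ?l] m \<open>nu_map Q2 Q r ?l = m\<close> by (simp add: ker_def)
    ultimately show ?thesis by blast
  qed
  then have im: "nu_map Q2 Q r ` ker (nu Q2) (nu P) (nu_map Q2 P (\<lambda>x. q (r x))) = ker (nu Q) (nu P) (nu_map Q P q)"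
    using img by blast
  show ?thesis
  proof (rule short_exactI[of A _ _ "\<lambda>x. x" _ "nu_map Q2 Q r"])
    show "right_module A (tau_of Q2 r Q)" "right_module A (tau_of Q2 (\<lambda>x. q (r x)) P)"
      unfolding tau_of_def by (rule nr.M.on_sub_module[OF nr.msub_ker], rule nr.M.on_sub_module[OF nqr.msub_ker])
    show "mhom A (tau_of Q2 r Q) (tau_of Q2 (\<lambda>x. q (r x)) P) (\<lambda>x. x)"
      unfolding tau_of_def using kk by (auto simp: mhom_def)
    show "mhom A (tau_of Q2 (\<lambda>x. q (r x)) P) (tau_of Q q P) (nu_map Q2 Q r)"
      unfolding tau_of_def using im by (intro mhom_on_cod mhom_on_dom[OF nr.hom nqr.msub_ker]) simp
    show "(\<lambda>x. x) ` carrier (tau_of Q2 r Q) = ker (tau_of Q2 (\<lambda>x. q (r x)) P) (tau_of Q q P) (nu_map Q2 Q r)"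
      unfolding tau_of_def using kk by (auto simp: ker_def)
    show "nu_map Q2 Q r ` carrier (tau_of Q2 (\<lambda>x. q (r x)) P) = carrier (tau_of Q q P)"
      unfolding tau_of_def using im by simp
  qed simp
qed

end

section \<open>Almost split sequences over Nakayama algebras\<close>

context fdalg
begin

text \<open>Cosets have the wrong type for \<open>fg_modules\<close>, hence the passage to a
  representative; the quotient is remembered only through a surjection and its kernel.\<close>

lemma quotient_rep:
  assumes P: "fmod P" and U: "msub A P U"
  obtains N f where "N \<in> fg_modules A" "mhom A P N f" "f ` carrier P = carrier N" "ker P N f = U"
proof -
  interpret P: right_module A P using P by (rule fmod_right_module)
  let ?Q = "quotient_module P U"
  have Q: "right_module A ?Q" by (rule P.quotient_right_module[OF U])
  have s: "(\<lambda>x. U +>\<^bsub>P\<^esub> x) ` carrier P = carrier ?Q" using P.quotient_carrier[OF U] by simp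
  have fQ: "fmod ?Q" using dm_surj(1)[OF P Q P.quotient_hom[OF U] s] .
  obtain N u u' where N: "N \<in> fg_modules A" "mod_iso A ?Q N u u'" using rep_iso[OF fQ] .
  interpret u: mod_iso A ?Q N u u' by fact
  have h: "mhom A P N (\<lambda>x. u (U +>\<^bsub>P\<^esub> x))" using mhom_comp[OF P.quotient_hom[OF U] u.hom] .
  have "(\<lambda>x. u (U +>\<^bsub>P\<^esub> x)) ` carrier P = u ` (\<lambda>x. U +>\<^bsub>P\<^esub> x) ` carrier P" by (simp add: image_image)
  then have 1: "(\<lambda>x. u (U +>\<^bsub>P\<^esub> x)) ` carrier P = carrier N" using s u.surj by simp
  have "u y = \<zero>\<^bsub>N\<^esub> \<longleftrightarrow> y = \<zero>\<^bsub>?Q\<^esub>" if "y \<in> carrier ?Q" for y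
    using inj_onD[OF u.inj, of y "\<zero>\<^bsub>?Q\<^esub>"] that by auto
  then have "ker P N (\<lambda>x. u (U +>\<^bsub>P\<^esub> x)) = ker P ?Q (\<lambda>x. U +>\<^bsub>P\<^esub> x)"
    using s by (auto simp: ker_def)
  then show ?thesis using that[OF N(1) h 1] P.quotient_ker[OF U] by simp
qed

lemma hom_add:
  assumes "right_module A P" "right_module A N" "mhom A P N f" "mhom A P N g"
  shows "mhom A P N (\<lambda>x. f x \<oplus>\<^bsub>N\<^esub> g x)"
proof -
  interpret N: right_module A N by fact
  note f = mhomD[OF assms(3)] and g = mhomD[OF assms(4)]
  show ?thesis
    unfolding mhom_def
  proof (intro conjI ballI)
    fix x y assume xy: "x \<in> carrier P" "y \<in> carrier P"
    then show "f (x \<oplus>\<^bsub>P\<^esub> y) \<oplus>\<^bsub>N\<^esub> g (x \<oplus>\<^bsub>P\<^esub> y) = (f x \<oplus>\<^bsub>N\<^esub> g x) \<oplus>\<^bsub>N\<^esub> (f y \<oplus>\<^bsub>N\<^esub> g y)"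
      using f(1)[OF xy(1)] f(1)[OF xy(2)] g(1)[OF xy(1)] g(1)[OF xy(2)]
      by (simp add: f(2)[OF xy] g(2)[OF xy] N.M.a_ac)
  qed (use f g N.ract_r_distr in auto)
qed

text \<open>A section of \<open>p\<close> would have an image meeting the kernel in zero; in a
  uniserial module one of the two is then zero, but neither is.\<close>

lemma uniserial_not_projective:
  assumes P: "fmod P" "uniserial_module A P" and M: "fmod M" and p: "mhom A P M p" "p ` carrier P = carrier M"
    and k: "ker P M p \<noteq> {\<zero>\<^bsub>P\<^esub>}" and nz: "carrier M \<noteq> {\<zero>\<^bsub>M\<^esub>}"
  shows "\<not> projective_module A M"
proof
  assume pr: "projective_module A M"
  have rm: "right_module A P" "right_module A M" using P M by (simp_all add: fmod_def)
  interpret p: mod_hom A P M p by (intro mod_homI rm p)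
  obtain s where s: "mhom A M P s" "\<And>y. y \<in> carrier M \<Longrightarrow> p (s y) = y"
    using projective_lift[OF pr rm(2) P(1) M p(1) mhom_id] p(2) by auto
  interpret s: mod_hom A M P s by (intro mod_homI rm s)
  have "ker P M p \<inter> s ` carrier M = {\<zero>\<^bsub>P\<^esub>}"
    using split_direct_sum(1)[OF p.mod_hom_axioms s.mod_hom_axioms s(2)] .
  moreover have "ker P M p \<subseteq> s ` carrier M \<or> s ` carrier M \<subseteq> ker P M p"
    using P(2) p.msub_ker s.msub_range unfolding p.M.uniserial_iff by blast
  ultimately have "s ` carrier M \<subseteq> {\<zero>\<^bsub>P\<^esub>}" using k by blast
  then have "y = \<zero>\<^bsub>M\<^esub>" if "y \<in> carrier M" for y using s(2)[OF that] that p.zero by auto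
  then show False using nz by auto
qed

lemma injective_ker_iso:
  assumes "right_module A P" "right_module A M" "mhom A P M p" "p ` carrier P = carrier M" "ker P M p = {\<zero>\<^bsub>P\<^esub>}"
  shows "mod_iso A P M p (inv_into (carrier P) p)"
proof -
  interpret p: mod_hom A P M p by (intro mod_homI assms)
  have "inj_on p (carrier P)" using p.inj_iff assms(5) by simp
  then show ?thesis using assms by (intro mod_isoI) (simp_all add: bij_betw_def)
qed

lemma surj_simple:
  assumes P: "right_module A P" "right_module A M" and p: "mhom A P M p" "p ` carrier P = carrier M"
    and "ker P M p \<noteq> carrier P"
    and max: "\<And>W. msub A P W \<Longrightarrow> ker P M p \<subseteq> W \<Longrightarrow> W = ker P M p \<or> W = carrier P"
  shows "simple_module A M"
proof -
  interpret p: mod_hom A P M p by (intro mod_homI P p)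
  have "carrier M \<noteq> {\<zero>\<^bsub>M\<^esub>}"
  proof
    assume "carrier M = {\<zero>\<^bsub>M\<^esub>}"
    then have "p x = \<zero>\<^bsub>M\<^esub>" if "x \<in> carrier P" for x using p.closed[OF that] by simp
    then show False using assms(5) by (auto simp: ker_def)
  qed
  moreover have "V = {\<zero>\<^bsub>M\<^esub>} \<or> V = carrier M" if V: "msub A M V" for V
  proof -
    let ?W = "{x \<in> carrier P. p x \<in> V}"
    have VM: "V \<subseteq> carrier M" "\<zero>\<^bsub>M\<^esub> \<in> V" using V by (auto simp: msub_def)
    have pW: "p ` ?W = V"
    proof
      show "V \<subseteq> p ` ?W"
      proof
        fix v assume v: "v \<in> V"
        then have "v \<in> p ` carrier P" using VM p(2) by blast
        then show "v \<in> p ` ?W" using v by blast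
      qed
    qed auto
    have "ker P M p \<subseteq> ?W" using VM by (auto simp: ker_def)
    then have "?W = ker P M p \<or> ?W = carrier P" using max[OF p.msub_preimage[OF V]] by blast
    then show ?thesis
    proof
      assume "?W = ker P M p"
      then have "V = p ` ker P M p" using pW by simp
      then have "V \<subseteq> {\<zero>\<^bsub>M\<^esub>}" by (auto simp: ker_def)
      then show ?thesis using VM by blast
    next
      assume "?W = carrier P"
      then have "V = p ` carrier P" using pW by simp
      then show ?thesis using p(2) by blast
    qed
  qed
  ultimately show ?thesis unfolding p.N.simple_iff by blast
qed

end

context nakayama
begin

text \<open>It suffices to extend homomorphisms whose values lie in an indecomposable summand \<open>V\<close> of \<open>A\<close>.  Both \<open>P/U\<close> and \<open>V\<close>
  embed into the same uniserial injective module \<open>I\<close>, compatibly on the simple module \<open>U'/U\<close>.  If the image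
  of \<open>P\<close> in \<open>I\<close> is contained in that of \<open>V\<close>, the inclusion is the wanted extension; otherwise the
  projective module \<open>V\<close> would lift to a submodule of \<open>P\<close> having zero intersection with \<open>U\<close>.\<close>

lemma extend_to_regular:
  assumes P: "P \<in> fg_modules A" "projective_module A P" "uniserial_module A P"
    and U: "msub A P U" "U \<noteq> {\<zero>\<^bsub>P\<^esub>}" and U': "msub A P U'" "U \<subseteq> U'" "U \<noteq> carrier P"
    and min: "\<And>W. msub A P W \<Longrightarrow> U \<subseteq> W \<Longrightarrow> W \<subseteq> U' \<Longrightarrow> W = U \<or> W = U'"
    and h: "mhom A (on_sub P U') (regular_module A) h" "\<And>x. x \<in> U \<Longrightarrow> h x = \<zero>\<^bsub>A\<^esub>"
  shows "\<exists>k. mhom A P (regular_module A) k \<and> (\<forall>x\<in>U'. k x = h x)"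
proof (rule ccontr)
  assume bad: "\<not> ?thesis"
  let ?R = "regular_module A"
  have fP: "fmod P" "right_module A P" using P(1) by (auto simp: fg_modules_iff fmod_def)
  interpret P: right_module A P by (rule fP)
  interpret R: right_module A ?R by (rule A_regular)
  interpret PU': right_module A "on_sub P U'" by (rule P.on_sub_module[OF U'(1)])
  let ?Q = "\<lambda>V. \<exists>h. mhom A (on_sub P U') ?R h \<and> h ` U' \<subseteq> V \<and> (\<forall>x\<in>U. h x = \<zero>\<^bsub>?R\<^esub>) \<and>
    \<not> (\<exists>k. mhom A P ?R k \<and> (\<forall>x\<in>U'. k x = h x))"
  have "h ` U' \<subseteq> carrier ?R" using mhomD(1)[OF h(1)] by auto
  then have "?Q (carrier ?R)" using h bad by (intro exI[of _ h]) auto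
  moreover have "\<not> ?Q {\<zero>\<^bsub>?R\<^esub>}"
  proof
    assume "?Q {\<zero>\<^bsub>?R\<^esub>}"
    then obtain h where h: "h ` U' \<subseteq> {\<zero>\<^bsub>?R\<^esub>}" "\<not> (\<exists>k. mhom A P ?R k \<and> (\<forall>x\<in>U'. k x = h x))" by blast
    have "mhom A P ?R (\<lambda>x. \<zero>\<^bsub>?R\<^esub>)" by (simp add: mhom_def)
    moreover have "\<forall>x\<in>U'. \<zero>\<^bsub>?R\<^esub> = h x" using h(1) by auto
    ultimately show False using h(2) by blast
  qed
  \<comment> \<open>If both components of \<open>h\<close> extended to \<open>P\<close>, so would
    their sum \<open>h\<close>; hence failure to extend passes to one of the summands.\<close>
  moreover have "?Q Y \<or> ?Q Z" if "?Q V" and V: "msub A ?R V" and Y: "msub A ?R Y" and Z: "msub A ?R Z"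
    and YZ: "Y \<inter> Z = {\<zero>\<^bsub>?R\<^esub>}" "msum ?R Y Z = V" for V Y Z
  proof (rule ccontr)
    assume n: "\<not> (?Q Y \<or> ?Q Z)"
    obtain h where h: "mhom A (on_sub P U') ?R h" "h ` U' \<subseteq> V" "\<And>x. x \<in> U \<Longrightarrow> h x = \<zero>\<^bsub>?R\<^esub>"
      and bad: "\<not> (\<exists>k. mhom A P ?R k \<and> (\<forall>x\<in>U'. k x = h x))" using \<open>?Q V\<close> by blast
    interpret V: right_module A "on_sub ?R V" by (rule R.on_sub_module[OF V])
    have YV: "Y \<subseteq> V" "Z \<subseteq> V" using R.msum_upper1[OF Y Z] R.msum_upper2[OF Y Z] YZ(2) by auto
    have *: "msub A (on_sub ?R V) Y" "msub A (on_sub ?R V) Z" "Y \<inter> Z = {\<zero>\<^bsub>on_sub ?R V\<^esub>}"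
      "msum (on_sub ?R V) Y Z = carrier (on_sub ?R V)"
      using Y Z YV YZ V by (simp_all add: msub_on_sub msum_def)
    obtain p where p: "mhom A (on_sub ?R V) (on_sub ?R V) p" "p ` carrier (on_sub ?R V) \<subseteq> Y"
      "\<And>x. x \<in> Y \<Longrightarrow> p x = x" "\<And>x. x \<in> Z \<Longrightarrow> p x = \<zero>\<^bsub>on_sub ?R V\<^esub>"
      "\<And>x. x \<in> carrier (on_sub ?R V) \<Longrightarrow> x \<ominus>\<^bsub>on_sub ?R V\<^esub> p x \<in> Z"
      by (rule V.direct_sum_projection[OF *]) (rule that)
    note pV = mhomD[OF p(1)]
    define q where "q x = x \<ominus>\<^bsub>on_sub ?R V\<^esub> p x" for x
    have q: "mhom A (on_sub ?R V) (on_sub ?R V) q"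
      unfolding mhom_def q_def using pV V.M.minus_closed V.add_diff_add V.ract_diff by simp
    have VR: "V \<subseteq> carrier ?R" using V by (simp add: msub_def)
    have hV: "mhom A (on_sub P U') (on_sub ?R V) h" using mhom_on_cod[OF h(1), of V] h(2) by simp
    note hc = mhomD(1)[OF hV]
    have p0: "p \<zero>\<^bsub>?R\<^esub> = \<zero>\<^bsub>?R\<^esub>" and q0: "q \<zero>\<^bsub>?R\<^esub> = \<zero>\<^bsub>?R\<^esub>"
      using mod_hom.zero[OF mod_homI[OF V.right_module_axioms V.right_module_axioms p(1)]]
        mod_hom.zero[OF mod_homI[OF V.right_module_axioms V.right_module_axioms q]] by simp_all
    have "\<exists>k. mhom A P ?R k \<and> (\<forall>x\<in>U'. k x = p (h x))"
    proof (rule ccontr)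
      assume c: "\<not> ?thesis"
      have "mhom A (on_sub P U') ?R (\<lambda>x. p (h x))" using mhom_cod_incl[OF mhom_comp[OF hV p(1)] VR] .
      moreover have "(\<lambda>x. p (h x)) ` U' \<subseteq> Y" using p(2) hc by auto
      moreover have "\<forall>x\<in>U. p (h x) = \<zero>\<^bsub>?R\<^esub>" using h(3) p0 by simp
      ultimately have "?Q Y" using c by blast
      then show False using n by blast
    qed
    then obtain k1 where k1: "mhom A P ?R k1" "\<And>x. x \<in> U' \<Longrightarrow> k1 x = p (h x)" by blast
    have "\<exists>k. mhom A P ?R k \<and> (\<forall>x\<in>U'. k x = q (h x))"
    proof (rule ccontr)
      assume c: "\<not> ?thesis"
      have "mhom A (on_sub P U') ?R (\<lambda>x. q (h x))" using mhom_cod_incl[OF mhom_comp[OF hV q] VR] .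
      moreover have "(\<lambda>x. q (h x)) ` U' \<subseteq> Z" using p(5) hc by (auto simp: q_def)
      moreover have "\<forall>x\<in>U. q (h x) = \<zero>\<^bsub>?R\<^esub>" using h(3) q0 by simp
      ultimately have "?Q Z" using c by blast
      then show False using n by blast
    qed
    then obtain k2 where k2: "mhom A P ?R k2" "\<And>x. x \<in> U' \<Longrightarrow> k2 x = q (h x)" by blast
    have "mhom A P ?R (\<lambda>x. k2 x \<oplus>\<^bsub>?R\<^esub> k1 x)" by (rule hom_add[OF fP(2) A_regular k2(1) k1(1)])
    moreover have "k2 x \<oplus>\<^bsub>?R\<^esub> k1 x = h x" if x: "x \<in> U'" for x
    proof -
      have hx: "h x \<in> carrier (on_sub ?R V)" using hc x by simp
      have "q (h x) \<oplus>\<^bsub>on_sub ?R V\<^esub> p (h x) = h x" unfolding q_def by (rule V.diff_add_cancel[OF hx pV(1)[OF hx]])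
      then show ?thesis using k1(2)[OF x] k2(2)[OF x] by simp
    qed
    ultimately show False using bad by blast
  qed
  ultimately have "\<exists>V W. msub A ?R V \<and> msub A ?R W \<and> V \<inter> W = {\<zero>\<^bsub>?R\<^esub>} \<and> msum ?R V W = carrier ?R \<and>
    ?Q V \<and> indecomposable_module A (on_sub ?R V)"
    by (rule indecomposable_summand[OF fmod_regular, of ?Q])
  then obtain V W where VW: "msub A ?R V" "msub A ?R W" "V \<inter> W = {\<zero>\<^bsub>?R\<^esub>}" "msum ?R V W = carrier ?R"
    and QV: "?Q V" and iV: "indecomposable_module A (on_sub ?R V)" by blast
  obtain h where h: "mhom A (on_sub P U') ?R h" "h ` U' \<subseteq> V" "\<And>x. x \<in> U \<Longrightarrow> h x = \<zero>\<^bsub>?R\<^esub>"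
    and bad: "\<not> (\<exists>k. mhom A P ?R k \<and> (\<forall>x\<in>U'. k x = h x))" using QV by blast
  let ?V = "on_sub ?R V"
  have pV: "projective_module A ?V" using projective_summand[OF regular_projective A_regular VW] .
  have fV: "fmod ?V" using fmod_on_sub[OF fmod_regular VW(1)] .
  have uV: "uniserial_module A ?V" using nakayama_uniserial[OF fV iV] pV by blast
  interpret V: right_module A ?V by (rule R.on_sub_module[OF VW(1)])
  have VR: "V \<subseteq> carrier ?R" using VW(1) by (simp add: msub_def)
  have hV: "mhom A (on_sub P U') ?V h" using mhom_on_cod[OF h(1), of V] h(2) by simp
  interpret h: mod_hom A "on_sub P U'" ?V h by (intro mod_homI PU'.right_module_axioms V.right_module_axioms hV)
  have hne: "\<exists>x\<in>U'. h x \<noteq> \<zero>\<^bsub>?R\<^esub>"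
  proof (rule ccontr)
    assume "\<not> ?thesis"
    then have "\<forall>x\<in>U'. \<zero>\<^bsub>?R\<^esub> = h x" by auto
    moreover have "mhom A P ?R (\<lambda>x. \<zero>\<^bsub>?R\<^esub>)" by (simp add: mhom_def)
    ultimately show False using bad by blast
  qed
  have kh: "msub A P (ker (on_sub P U') ?V h)" "ker (on_sub P U') ?V h \<subseteq> U'"
    using h.msub_ker unfolding msub_on_sub[OF U'(1)] by auto
  have "U \<subseteq> ker (on_sub P U') ?V h" using h(3) U'(2) by (auto simp: ker_def)
  moreover have "ker (on_sub P U') ?V h \<noteq> U'" using hne by (auto simp: ker_def)
  \<comment> \<open>\<open>U'\<close> is minimal above \<open>U\<close> and \<open>h\<close> does
    not vanish on it, so the kernel of \<open>h\<close> is exactly \<open>U\<close>.\<close>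
  ultimately have kerh: "ker (on_sub P U') ?V h = U" using min[OF kh(1) _ kh(2)] by blast
  obtain M p where M: "M \<in> fg_modules A" "mhom A P M p" "p ` carrier P = carrier M" "ker P M p = U"
    using quotient_rep[OF fP(1) U(1)] .
  have fM: "fmod M" "right_module A M" using M(1) by (auto simp: fg_modules_iff fmod_def)
  interpret p: mod_hom A P M p by (intro mod_homI fP fM M)
  have uM: "uniserial_module A M" using p.uniserial_surj[OF P(3) M(3)] .
  have nzM: "carrier M \<noteq> {\<zero>\<^bsub>M\<^esub>}"
  proof
    assume "carrier M = {\<zero>\<^bsub>M\<^esub>}"
    then have "p x = \<zero>\<^bsub>M\<^esub>" if "x \<in> carrier P" for x using p.closed[OF that] by simp
    then show False using M(4) U'(3) by (auto simp: ker_def)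
  qed
  obtain I i where I: "I \<in> fg_modules A" "injective_module A I" "uniserial_module A I"
    "mhom A M I i" "inj_on i (carrier M)"
    using uniserial_injective_embedding[OF fM(1) uM nzM] .
  have fI: "fmod I" "right_module A I" using I(1) by (auto simp: fg_modules_iff fmod_def)
  interpret i: mod_hom A M I i by (intro mod_homI fM fI I)
  have ip: "mhom A P I (\<lambda>x. i (p x))" using mhom_comp[OF M(2) I(4)] .
  interpret ip: mod_hom A P I "\<lambda>x. i (p x)" by (intro mod_homI fP fI ip)
  have ip0: "i (p x) = \<zero>\<^bsub>I\<^esub> \<longleftrightarrow> x \<in> U" if x: "x \<in> carrier P" for x
  proof -
    have "i (p x) = \<zero>\<^bsub>I\<^esub> \<longleftrightarrow> p x = \<zero>\<^bsub>M\<^esub>"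
      using inj_onD[OF I(5), of "p x" "\<zero>\<^bsub>M\<^esub>"] x by auto
    then show ?thesis using M(4) x by (auto simp: ker_def)
  qed
  \<comment> \<open>On \<open>U'\<close> both \<open>h\<close> and the map to \<open>I\<close> have
    kernel \<open>U\<close>, so injectivity of \<open>I\<close> yields \<open>g\<close> on
    \<open>V\<close> with \<open>g h = i p\<close> on \<open>U'\<close>.\<close>
  have "ker (on_sub P U') ?V h \<subseteq> ker (on_sub P U') I (\<lambda>x. i (p x))"
    unfolding kerh using ip0 U'(2) P.msub_mem[OF U(1)] by (auto simp: ker_def)
  then obtain g where g: "mhom A ?V I g" "\<And>x. x \<in> carrier (on_sub P U') \<Longrightarrow> g (h x) = i (p x)"
    using injective_extend[OF I(2) fI(2) fmod_on_sub[OF fP(1) U'(1)] fV hV mhom_on_dom[OF ip U'(1)]] by blast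
  interpret g: mod_hom A ?V I g by (intro mod_homI V.right_module_axioms fI g)
  have U'P: "x \<in> carrier P" if "x \<in> U'" for x using P.msub_mem[OF U'(1) that] .
  have kg: "ker ?V I g \<inter> h ` U' \<subseteq> {\<zero>\<^bsub>?R\<^esub>}"
  proof
    fix v assume "v \<in> ker ?V I g \<inter> h ` U'"
    then obtain x where x: "x \<in> U'" "v = h x" "g (h x) = \<zero>\<^bsub>I\<^esub>" by (auto simp: ker_def)
    then have "i (p x) = \<zero>\<^bsub>I\<^esub>" using g(2)[of x] by simp
    then have "x \<in> U" using ip0[OF U'P[OF x(1)]] by simp
    then show "v \<in> {\<zero>\<^bsub>?R\<^esub>}" using h(3) x by simp
  qed
  \<comment> \<open>\<open>g\<close> is injective on the nonzero submodule \<open>h(U')\<close> of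
    the uniserial module \<open>V\<close>, which leaves no room for a kernel.\<close>
  have "ker ?V I g \<subseteq> h ` U' \<or> h ` U' \<subseteq> ker ?V I g"
    using uV g.msub_ker h.msub_range unfolding V.uniserial_iff by simp
  then have "ker ?V I g \<subseteq> {\<zero>\<^bsub>?V\<^esub>}" using kg hne by auto
  then have g_inj: "inj_on g (carrier ?V)" using g.inj_iff by blast
  have "(\<lambda>x. i (p x)) ` carrier P \<subseteq> g ` carrier ?V \<or> g ` carrier ?V \<subseteq> (\<lambda>x. i (p x)) ` carrier P"
    using I(3) ip.msub_range g.msub_range unfolding right_module.uniserial_iff[OF fI(2)] by blast
  then show False
  proof
    assume "(\<lambda>x. i (p x)) ` carrier P \<subseteq> g ` carrier ?V"
    then obtain k where k: "mhom A P ?V k" "\<And>x. x \<in> carrier P \<Longrightarrow> g (k x) = i (p x)"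
      using projective_lift[OF P(2) fP(2) fV fI(1) g(1) ip] by blast
    have "k x = h x" if x: "x \<in> U'" for x
      using inj_onD[OF g_inj, of "k x" "h x"] k(2)[OF U'P[OF x]] g(2)[of x] x
        mhomD(1)[OF k(1) U'P[OF x]] h.closed[of x] by simp
    then show False using bad mhom_cod_incl[OF k(1) VR] by blast
  next
    assume "g ` carrier ?V \<subseteq> (\<lambda>x. i (p x)) ` carrier P"
    then obtain s where s: "mhom A ?V P s" "\<And>v. v \<in> carrier ?V \<Longrightarrow> i (p (s v)) = g v"
      using projective_lift[OF pV V.right_module_axioms fP(1) fI(1) ip g(1)] by blast
    interpret s: mod_hom A ?V P s by (intro mod_homI V.right_module_axioms fP s)
    \<comment> \<open>Being \<open>g\<close> modulo \<open>U\<close>, the lift \<open>s\<close>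
      sends no nonzero element into \<open>U\<close>; comparability of its image with
      \<open>U\<close> then makes \<open>U\<close> or \<open>V\<close> zero.\<close>
    have sU: "v = \<zero>\<^bsub>?R\<^esub>" if v: "v \<in> carrier ?V" "s v \<in> U" for v
    proof -
      have "g v = \<zero>\<^bsub>I\<^esub>" using ip0[OF s.closed[OF v(1)]] v(2) s(2)[OF v(1)] by simp
      then have "g v = g \<zero>\<^bsub>?V\<^esub>" using g.zero by (simp only:)
      then show ?thesis using inj_onD[OF g_inj, of v "\<zero>\<^bsub>?V\<^esub>"] v(1) V.M.zero_closed by simp
    qed
    have "U \<subseteq> s ` carrier ?V \<or> s ` carrier ?V \<subseteq> U" using P(3) U(1) s.msub_range unfolding P.uniserial_iff by blast
    then show False
    proof
      assume "U \<subseteq> s ` carrier ?V"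
      then have "u = \<zero>\<^bsub>P\<^esub>" if "u \<in> U" for u using that sU s.zero by (auto simp: subset_iff image_iff)
      then show False using U by (auto simp: msub_def)
    next
      assume "s ` carrier ?V \<subseteq> U"
      then have "v = \<zero>\<^bsub>?R\<^esub>" if "v \<in> V" for v using sU[of v] that by auto
      then show False using hne h(2) by blast
    qed
  qed
qed

lemma uniserial_presentation:
  assumes P: "P \<in> fg_modules A" "projective_module A P" "uniserial_module A P"
    and M: "M \<in> fg_modules A" and p: "mhom A P M p" "p ` carrier P = carrier M" "ker P M p \<noteq> {\<zero>\<^bsub>P\<^esub>}"
    and nz: "carrier M \<noteq> {\<zero>\<^bsub>M\<^esub>}"
    and Q: "Q \<in> fg_modules A" "projective_module A Q" "uniserial_module A Q"
    and q: "mhom A Q P q" "q ` carrier Q = ker P M p"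
  shows "min_proj_presentation A Q (restrict q (carrier Q)) P (restrict p (carrier P)) M"
proof -
  have fm: "right_module A P" "right_module A M" "right_module A Q"
    using P(1) M Q(1) by (auto simp: fg_modules_iff fmod_def)
  interpret p: mod_hom A P M p by (intro mod_homI fm p)
  let ?p = "restrict p (carrier P)" and ?q = "restrict q (carrier Q)"
  have k: "ker P M ?p = ker P M p" by (auto simp: ker_def)
  let ?K = "on_sub P (ker P M p)"
  have K: "right_module A ?K" by (rule p.M.on_sub_module[OF p.msub_ker])
  have qK: "mhom A Q ?K q" using mhom_on_cod[OF q(1)] q(2) by simp
  have p': "?p \<in> module_hom A P M" using mhom_restrict[OF fm(1) p(1)] .
  have q': "?q \<in> module_hom A Q ?K" using mhom_restrict[OF fm(3) qK] .
  have ps: "?p ` carrier P = carrier M" and qs: "?q ` carrier Q = carrier ?K" using p(2) q(2) by simp_all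
  have "superfluous A P (ker P M ?p)"
    by (rule uniserial_superfluous[OF fm(1,2) P(3) module_hom_mhom[OF p'] ps nz])
  moreover have "superfluous A Q (ker Q ?K ?q)"
    using p(3) by (intro uniserial_superfluous[OF fm(3) K Q(3) module_hom_mhom[OF q'] qs]) simp
  ultimately show ?thesis
    unfolding min_proj_presentation_def projective_cover_def a_kernel_eq_ker k
    using P Q p' q' ps qs by simp
qed

lemma tau_of_restrict: "tau_of P1 (restrict p (carrier P1)) P0 = tau_of P1 p P0"
  using nu_map_cong[of P1 "restrict p (carrier P1)" p P0] by (simp add: tau_of_def)

lemma uniserial_submodule_cover:
  assumes P: "P \<in> fg_modules A" "uniserial_module A P" and U: "msub A P U" "U \<noteq> {\<zero>\<^bsub>P\<^esub>}"
  obtains Q q where "Q \<in> fg_modules A" "projective_module A Q" "uniserial_module A Q"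
    "mhom A Q P q" "q ` carrier Q = U"
proof -
  have fP: "fmod P" "right_module A P" using P(1) by (auto simp: fg_modules_iff fmod_def)
  interpret P: right_module A P by (rule fP)
  have nz: "carrier (on_sub P U) \<noteq> {\<zero>\<^bsub>on_sub P U\<^esub>}" using U by simp
  obtain Q q where Q: "Q \<in> fg_modules A" "projective_module A Q" "uniserial_module A Q"
    "mhom A Q (on_sub P U) q" "q ` carrier Q = carrier (on_sub P U)"
    using uniserial_projective_surj[OF fmod_on_sub[OF fP(1) U(1)] P.uniserial_on_sub[OF P(2) U(1)] nz] .
  have "mhom A Q P q" using mhom_cod_incl[OF Q(4)] U(1) by (simp add: msub_def)
  then show ?thesis using that Q by simp
qed

text \<open>A projective surjection with zero kernel would make \<open>M\<close> projective; the
  nonzero kernel, a submodule of a uniserial module, has a uniserial projective cover of its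
  own.\<close>

lemma ar_translate_fg:
  assumes M: "M \<in> fg_modules A" "uniserial_module A M" "\<not> projective_module A M" "carrier M \<noteq> {\<zero>\<^bsub>M\<^esub>}"
  shows "\<exists>P1 p1 P0 p0. min_proj_presentation A P1 p1 P0 p0 M"
    and "\<exists>P p. P \<in> fg_modules A \<and> projective_module A P \<and> uniserial_module A P \<and> mhom A P M p \<and>
      p ` carrier P = carrier M \<and> ker P M p \<noteq> {\<zero>\<^bsub>P\<^esub>}"
proof -
  have fM: "fmod M" "right_module A M" using M(1) by (auto simp: fg_modules_iff fmod_def)
  obtain P p where P: "P \<in> fg_modules A" "projective_module A P" "uniserial_module A P"
    "mhom A P M p" "p ` carrier P = carrier M"
    using uniserial_projective_surj[OF fM(1) M(2,4)] .
  have fP: "fmod P" "right_module A P" using P(1) by (auto simp: fg_modules_iff fmod_def)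
  interpret p: mod_hom A P M p by (intro mod_homI fP fM P)
  have k: "ker P M p \<noteq> {\<zero>\<^bsub>P\<^esub>}"
  proof
    assume "ker P M p = {\<zero>\<^bsub>P\<^esub>}"
    then have "mod_iso A P M p (inv_into (carrier P) p)" using injective_ker_iso[OF fP(2) fM(2) P(4,5)] by blast
    then show False using projective_iso P(2) M(3) by blast
  qed
  then show "\<exists>P p. P \<in> fg_modules A \<and> projective_module A P \<and> uniserial_module A P \<and> mhom A P M p \<and>
      p ` carrier P = carrier M \<and> ker P M p \<noteq> {\<zero>\<^bsub>P\<^esub>}" using P by blast
  obtain Q q where Q: "Q \<in> fg_modules A" "projective_module A Q" "uniserial_module A Q"
    "mhom A Q P q" "q ` carrier Q = ker P M p"
    using uniserial_submodule_cover[OF P(1,3) p.msub_ker k] .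
  show "\<exists>P1 p1 P0 p0. min_proj_presentation A P1 p1 P0 p0 M"
    using uniserial_presentation[OF P(1-3) M(1) P(4,5) k M(4) Q] by blast
qed

text \<open>\<open>V\<close> is minimal above the kernel of \<open>p\<close>, \<open>S\<close> is
  \<open>V\<close> modulo that kernel and \<open>N\<close> is \<open>P\<close> modulo
  \<open>V\<close>. The cover \<open>Q\<close> of \<open>V\<close> also covers \<open>S\<close>;
  hence the three presentations share the maps \<open>r\<close> and \<open>q\<close>, and
  \<open>tau_of_short_exact\<close> applies.\<close>

lemma tau_short_exact_step:
  assumes P: "P \<in> fg_modules A" "projective_module A P" "uniserial_module A P"
    and M: "M \<in> fg_modules A" and p: "mhom A P M p" "p ` carrier P = carrier M" "ker P M p \<noteq> {\<zero>\<^bsub>P\<^esub>}"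
    and nz: "carrier M \<noteq> {\<zero>\<^bsub>M\<^esub>}" and ns: "\<not> simple_module A M"
  shows "\<exists>S N n. S \<in> fg_modules A \<and> simple_module A S \<and> \<not> projective_module A S \<and> N \<in> fg_modules A \<and>
    mhom A P N n \<and> n ` carrier P = carrier N \<and> ker P M p \<subset> ker P N n \<and> carrier N \<noteq> {\<zero>\<^bsub>N\<^esub>} \<and>
    short_exact A S M N \<and> short_exact A (ar_translate K A S) (ar_translate K A M) (ar_translate K A N)"
proof -
  have fP: "fmod P" "right_module A P" and fM: "fmod M" "right_module A M"
    using P(1) M by (auto simp: fg_modules_iff fmod_def)
  interpret p: mod_hom A P M p by (intro mod_homI fP fM p)
  let ?U = "ker P M p"
  have U: "msub A P ?U" by (rule p.msub_ker)
  have UP: "?U \<noteq> carrier P"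
  proof
    assume "?U = carrier P"
    then have "p ` carrier P \<subseteq> {\<zero>\<^bsub>M\<^esub>}" by (auto simp: ker_def)
    then show False using nz p(2) p.N.M.zero_closed by auto
  qed
  let ?C = "\<lambda>V. msub A P V \<and> ?U \<subset> V"
  have "?C (carrier P)" using p.M.msub_carrier UP U by (auto simp: msub_def)
  then obtain V where V: "?C V" and min: "\<And>W. ?C W \<Longrightarrow> W \<subseteq> V \<Longrightarrow> W = V"
    using minimal_msub[OF fP(1), of ?C "carrier P"] by blast
  have Vm: "msub A P V" and UV: "?U \<subseteq> V" "?U \<noteq> V" using V by auto
  have min': "W = ?U \<or> W = V" if "msub A P W" "?U \<subseteq> W" "W \<subseteq> V" for W using min[of W] that by blast
  \<comment> \<open>If \<open>V\<close> were all of \<open>P\<close>, the kernel of \<open>p\<close>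
    would be a maximal submodule and \<open>M\<close> simple.\<close>
  have VP: "V \<noteq> carrier P"
  proof
    assume V: "V = carrier P"
    have "W = ?U \<or> W = carrier P" if "msub A P W" "?U \<subseteq> W" for W
      using min'[OF that] that(1) V by (auto simp: msub_def)
    then show False using ns surj_simple[OF fP(2) fM(2) p(1,2) UP] by blast
  qed
  obtain N n where N: "N \<in> fg_modules A" "mhom A P N n" "n ` carrier P = carrier N" "ker P N n = V"
    using quotient_rep[OF fP(1) Vm] .
  have fN: "fmod N" "right_module A N" using N(1) by (auto simp: fg_modules_iff fmod_def)
  interpret n: mod_hom A P N n by (intro mod_homI fP fN N)
  have nzN: "carrier N \<noteq> {\<zero>\<^bsub>N\<^esub>}"
  proof
    assume "carrier N = {\<zero>\<^bsub>N\<^esub>}"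
    then have "n x = \<zero>\<^bsub>N\<^esub>" if "x \<in> carrier P" for x using n.closed[OF that] by simp
    then show False using N(4) VP by (auto simp: ker_def)
  qed
  have Vnz: "V \<noteq> {\<zero>\<^bsub>P\<^esub>}" using UV p(3) U by (auto simp: msub_def)
  obtain Q q where Q: "Q \<in> fg_modules A" "projective_module A Q" "uniserial_module A Q"
    "mhom A Q P q" "q ` carrier Q = V"
    using uniserial_submodule_cover[OF P(1,3) Vm Vnz] .
  have fQ: "fmod Q" "right_module A Q" using Q(1) by (auto simp: fg_modules_iff fmod_def)
  interpret q: mod_hom A Q P q by (intro mod_homI fP fQ Q)
  have fV: "fmod (on_sub P V)" "right_module A (on_sub P V)"
    using fmod_on_sub[OF fP(1) Vm] by (auto simp: fmod_def)
  have UmV: "msub A (on_sub P V) ?U" using U UV by (simp add: msub_on_sub[OF Vm])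
  obtain S s where S: "S \<in> fg_modules A" "mhom A (on_sub P V) S s" "s ` carrier (on_sub P V) = carrier S"
    "ker (on_sub P V) S s = ?U"
    using quotient_rep[OF fV(1) UmV] .
  have fS: "fmod S" "right_module A S" using S(1) by (auto simp: fg_modules_iff fmod_def)
  interpret s: mod_hom A "on_sub P V" S s by (intro mod_homI fV fS S)
  have simS: "simple_module A S"
  proof (rule surj_simple[OF fV(2) fS(2) S(2,3)])
    show "ker (on_sub P V) S s \<noteq> carrier (on_sub P V)" using S(4) UV by simp
    fix W assume "msub A (on_sub P V) W" "ker (on_sub P V) S s \<subseteq> W"
    then have "msub A P W" "W \<subseteq> V" "?U \<subseteq> W" using S(4) by (simp_all add: msub_on_sub[OF Vm])
    then show "W = ker (on_sub P V) S s \<or> W = carrier (on_sub P V)" using min' S(4) by simp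
  qed
  have nzS: "carrier S \<noteq> {\<zero>\<^bsub>S\<^esub>}" using simS by (simp add: s.N.simple_iff)
  have qV: "mhom A Q (on_sub P V) q" using mhom_on_cod[OF Q(4)] Q(5) by simp
  define t where "t x = s (q x)" for x
  have t: "mhom A Q S t" unfolding t_def using mhom_comp[OF qV S(2)] .
  interpret t: mod_hom A Q S t by (intro mod_homI fQ fS t)
  have "t ` carrier Q = s ` q ` carrier Q" by (simp add: t_def image_image)
  then have ts: "t ` carrier Q = carrier S" using Q(5) S(3) by simp
  have qc: "q x \<in> V" if "x \<in> carrier Q" for x using Q(5) that by blast
  have tker: "x \<in> ker Q S t \<longleftrightarrow> x \<in> carrier Q \<and> q x \<in> ?U" for x
    unfolding S(4)[symmetric] using qc by (auto simp: ker_def t_def)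
  have qW: "q ` ker Q S t = ?U"
  proof
    show "q ` ker Q S t \<subseteq> ?U" using tker by blast
    show "?U \<subseteq> q ` ker Q S t"
    proof
      fix u assume u: "u \<in> ?U"
      then have "u \<in> q ` carrier Q" using UV Q(5) by blast
      then obtain x where "x \<in> carrier Q" "u = q x" by blast
      then show "u \<in> q ` ker Q S t" using u tker by blast
    qed
  qed
  \<comment> \<open>\<open>q\<close> maps the kernel of \<open>t\<close> onto the nonzero kernel of
    \<open>p\<close>. This is what keeps the composition factor \<open>S\<close> from being
    projective.\<close>
  have tnz: "ker Q S t \<noteq> {\<zero>\<^bsub>Q\<^esub>}"
  proof
    assume "ker Q S t = {\<zero>\<^bsub>Q\<^esub>}"
    then have "?U = {\<zero>\<^bsub>P\<^esub>}" using qW q.zero by simp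
    then show False using p(3) by simp
  qed
  have npS: "\<not> projective_module A S"
    by (rule uniserial_not_projective[OF fQ(1) Q(3) fS(1) t ts tnz nzS])
  obtain Q2 r where Q2: "Q2 \<in> fg_modules A" "projective_module A Q2" "uniserial_module A Q2"
    "mhom A Q2 Q r" "r ` carrier Q2 = ker Q S t"
    using uniserial_submodule_cover[OF Q(1,3) t.msub_ker tnz] .
  have fQ2: "fmod Q2" "right_module A Q2" using Q2(1) by (auto simp: fg_modules_iff fmod_def)
  have qr: "mhom A Q2 P (\<lambda>x. q (r x))" using mhom_comp[OF Q2(4) Q(4)] .
  have "(\<lambda>x. q (r x)) ` carrier Q2 = q ` r ` carrier Q2" by (simp add: image_image)
  then have qrs: "(\<lambda>x. q (r x)) ` carrier Q2 = ?U" using Q2(5) qW by simp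
  have Nk: "q ` carrier Q = ker P N n" using Q(5) N(4) by simp
  have Nnz: "ker P N n \<noteq> {\<zero>\<^bsub>P\<^esub>}" using N(4) Vnz by simp
  note presM = uniserial_presentation[OF P M p nz Q2(1-3) qr qrs]
  note presN = uniserial_presentation[OF P N(1-3) Nnz nzN Q(1-4) Nk]
  note presS = uniserial_presentation[OF Q(1-3) S(1) t ts tnz nzS Q2]
  obtain aM bM where tM: "mod_iso A (ar_translate K A M) (tau_of Q2 (\<lambda>x. q (r x)) P) aM bM"
    using ar_translate_spec(2)[OF M presM] unfolding tau_of_restrict by blast
  obtain aN bN where tN: "mod_iso A (ar_translate K A N) (tau_of Q q P) aN bN"
    using ar_translate_spec(2)[OF N(1) presN] unfolding tau_of_restrict by blast
  obtain aS bS where tS: "mod_iso A (ar_translate K A S) (tau_of Q2 r Q) aS bS"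
    using ar_translate_spec(2)[OF S(1) presS] unfolding tau_of_restrict by blast
  have "short_exact A (tau_of Q2 r Q) (tau_of Q2 (\<lambda>x. q (r x)) P) (tau_of Q q P)"
  proof (rule tau_of_short_exact[OF fQ2(1) fQ(2) fP(2) Q2(4) Q(4)])
    \<comment> \<open>The image of \<open>r\<close> is the kernel of \<open>t\<close>, which
      contains that of \<open>q\<close>. A homomorphism killing it therefore factors through
      \<open>q\<close> as a map on \<open>V\<close> that vanishes on the kernel of \<open>p\<close>,
      and such maps extend to \<open>P\<close> by \<open>extend_to_regular\<close>.\<close>
    fix h assume h: "h \<in> module_hom A Q (regular_module A)" "\<And>x. x \<in> carrier Q2 \<Longrightarrow> h (r x) = \<zero>\<^bsub>A\<^esub>"
    have hm: "mod_hom A Q (regular_module A) h" by (intro mod_homI fQ A_regular module_hom_mhom h)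
    have qm: "mod_hom A Q (on_sub P V) q" by (intro mod_homI fQ fV qV)
    have qs: "q ` carrier Q = carrier (on_sub P V)" using Q(5) by simp
    have h0: "h x = \<zero>\<^bsub>A\<^esub>" if "x \<in> ker Q S t" for x
    proof -
      have "x \<in> r ` carrier Q2" using that Q2(5) by simp
      then show ?thesis using h(2) by blast
    qed
    have "ker Q (on_sub P V) q \<subseteq> ker Q (regular_module A) h"
    proof
      fix x assume "x \<in> ker Q (on_sub P V) q"
      then have x: "x \<in> carrier Q" "q x = \<zero>\<^bsub>P\<^esub>" by (simp_all add: ker_def)
      then have "x \<in> ker Q S t" using tker U by (simp add: msub_def)
      then show "x \<in> ker Q (regular_module A) h" using h0 x by (simp add: ker_def)
    qed
    then obtain h' where h': "mhom A (on_sub P V) (regular_module A) h'" "\<And>x. x \<in> carrier Q \<Longrightarrow> h' (q x) = h x"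
      using mhom_factor[OF qm hm qs] by blast
    have h'0: "h' u = \<zero>\<^bsub>A\<^esub>" if "u \<in> ?U" for u
    proof -
      have "u \<in> q ` ker Q S t" using that qW by simp
      then obtain x where "x \<in> ker Q S t" "u = q x" by blast
      then show ?thesis using h0 h'(2)[of x] by (simp add: ker_def)
    qed
    obtain k where k: "mhom A P (regular_module A) k" "\<And>x. x \<in> V \<Longrightarrow> k x = h' x"
      using extend_to_regular[OF P U p(3) Vm UV(1) UP min' h'(1) h'0] by blast
    have "k (q x) = h x" if "x \<in> carrier Q" for x using k(2)[OF qc[OF that]] h'(2)[OF that] by simp
    then show "\<exists>k\<in>module_hom A P (regular_module A). \<forall>x\<in>carrier Q. k (q x) = h x"
      using mhom_restrict[OF fP(2) k(1)] by (intro bexI[of _ "restrict k (carrier P)"]) auto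
  qed
  then have ses: "short_exact A (ar_translate K A S) (ar_translate K A M) (ar_translate K A N)"
    using short_exact_iso mod_iso.sym[OF tS] mod_iso.sym[OF tM] mod_iso.sym[OF tN] by blast
  have pm: "mod_hom A (on_sub P V) M p" by (intro mod_homI fV fM mhom_on_dom[OF p(1) Vm])
  have ks: "ker (on_sub P V) S s \<subseteq> ker (on_sub P V) M p" unfolding S(4) using UV by (auto simp: ker_def)
  obtain a where a: "mhom A S M a" "\<And>x. x \<in> carrier (on_sub P V) \<Longrightarrow> a (s x) = p x"
    using mhom_factor[OF s.mod_hom_axioms pm S(3) ks] by blast
  have kp: "ker P M p \<subseteq> ker P N n" using N(4) UV by simp
  obtain b where b: "mhom A M N b" "\<And>x. x \<in> carrier P \<Longrightarrow> b (p x) = n x"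
    using mhom_factor[OF p.mod_hom_axioms n.mod_hom_axioms p(2) kp] by blast
  interpret a: mod_hom A S M a by (intro mod_homI fS fM a)
  have VP': "x \<in> carrier P" if "x \<in> V" for x using p.M.msub_mem[OF Vm that] .
  have "short_exact A S M N"
  proof (rule short_exactI[OF fS(2) fM(2) a(1) b(1)])
    show "inj_on a (carrier S)"
      unfolding a.inj_iff
    proof
      fix y assume y: "y \<in> ker S M a"
      then have "y \<in> s ` carrier (on_sub P V)" using S(3) by (simp add: ker_def)
      then obtain x where x: "x \<in> V" "y = s x" by auto
      then have "p x = \<zero>\<^bsub>M\<^esub>" using a(2)[of x] y by (simp add: ker_def)
      then have "x \<in> ker (on_sub P V) S s" using x VP' unfolding S(4) by (simp add: ker_def)
      then show "y \<in> {\<zero>\<^bsub>S\<^esub>}" using x by (simp add: ker_def)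
    qed
    have "a ` carrier S = a ` s ` V" using S(3) by simp
    also have "\<dots> = p ` V" using a(2) by (simp add: image_image)
    also have "\<dots> = ker M N b"
    proof
      show "p ` V \<subseteq> ker M N b"
      proof
        fix y assume "y \<in> p ` V"
        then obtain x where x: "x \<in> V" "y = p x" by auto
        then have "x \<in> ker P N n" using N(4) by simp
        then show "y \<in> ker M N b" using x(2) b(2) by (simp add: ker_def)
      qed
      show "ker M N b \<subseteq> p ` V"
      proof
        fix y assume y: "y \<in> ker M N b"
        then have "y \<in> p ` carrier P" using p(2) by (simp add: ker_def)
        then obtain x where x: "x \<in> carrier P" "y = p x" by auto
        then have "x \<in> ker P N n" using b(2) y by (simp add: ker_def)
        then show "y \<in> p ` V" using x N(4) by simp
      qed
    qed
    finally show "a ` carrier S = ker M N b" .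
    have "b ` carrier M = b ` p ` carrier P" using p(2) by simp
    also have "\<dots> = n ` carrier P" using b(2) by (simp add: image_image)
    finally show "b ` carrier M = carrier N" using N(3) by simp
  qed
  moreover have "ker P M p \<subset> ker P N n" using N(4) UV by blast
  ultimately show ?thesis using S(1) simS npS N(1-3) nzN ses by blast
qed

end

section \<open>The Grothendieck group\<close>

definition K0_generators ::
    "('a, 'x) ring_scheme \<Rightarrow> (('a, 'a list) module \<Rightarrow>\<^sub>0 int) set" where
  "K0_generators A = {frag_of M - frag_of L - frag_of N | L M N.
        L \<in> fg_modules A \<and> M \<in> fg_modules A \<and> N \<in> fg_modules A \<and> short_exact A L M N}"

lemma K0_relations_eq: "K0_relations A = generate (free_Abelian_group (fg_modules A)) (K0_generators A)"
  by (simp add: K0_relations_def K0_generators_def)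

lemma K0_generators_subset: "K0_generators A \<subseteq> carrier (free_Abelian_group (fg_modules A))"
proof
  fix g assume "g \<in> K0_generators A"
  then obtain L M N where *: "g = frag_of M - frag_of L - frag_of N" "L \<in> fg_modules A" "M \<in> fg_modules A" "N \<in> fg_modules A"
    by (auto simp: K0_generators_def)
  have "Poly_Mapping.keys g \<subseteq> {M} \<union> {L} \<union> {N}"
    unfolding *(1) using keys_diff[of "frag_of M - frag_of L" "frag_of N"] keys_diff[of "frag_of M" "frag_of L"] by auto
  then show "g \<in> carrier (free_Abelian_group (fg_modules A))" using * by auto
qed

lemma K0_relations_normal: "K0_relations A \<lhd> free_Abelian_group (fg_modules A)"
proof -
  interpret G: comm_group "free_Abelian_group (fg_modules A)" by (rule abelian_free_Abelian_group)
  show ?thesis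
    unfolding K0_relations_eq by (intro G.subgroup_imp_normal G.generate_is_subgroup K0_generators_subset)
qed

lemma K0_comm_group: "comm_group (K0 A)"
proof -
  interpret G: comm_group "free_Abelian_group (fg_modules A)" by (rule abelian_free_Abelian_group)
  show ?thesis
    unfolding K0_def using K0_relations_normal by (intro G.abelian_FactGroup) (rule normal_imp_subgroup)
qed

lemma K0_carrier:
  "carrier (K0 A) = (\<lambda>x. K0_relations A #>\<^bsub>free_Abelian_group (fg_modules A)\<^esub> x) ` carrier (free_Abelian_group (fg_modules A))"
  by (auto simp: K0_def FactGroup_def RCOSETS_def)

lemma K0_class_closed: "M \<in> fg_modules A \<Longrightarrow> K0_class A M \<in> carrier (K0 A)"
  unfolding K0_carrier K0_class_def by (intro imageI) simp

lemma K0_mult: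
  assumes "x \<in> carrier (free_Abelian_group (fg_modules A))" "y \<in> carrier (free_Abelian_group (fg_modules A))"
  shows "(K0_relations A #>\<^bsub>free_Abelian_group (fg_modules A)\<^esub> x) \<otimes>\<^bsub>K0 A\<^esub> (K0_relations A #>\<^bsub>free_Abelian_group (fg_modules A)\<^esub> y)
    = K0_relations A #>\<^bsub>free_Abelian_group (fg_modules A)\<^esub> (x + y)"
  using normal.rcos_sum[OF K0_relations_normal assms] by (simp add: K0_def)

lemma K0_class_additive:
  assumes "short_exact A L M N" "L \<in> fg_modules A" "M \<in> fg_modules A" "N \<in> fg_modules A"
  shows "K0_class A M = K0_class A L \<otimes>\<^bsub>K0 A\<^esub> K0_class A N"
proof -
  let ?G = "free_Abelian_group (fg_modules A)"
  interpret G: comm_group ?G by (rule abelian_free_Abelian_group)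
  interpret R: normal "K0_relations A" ?G by (rule K0_relations_normal)
  have "frag_of M - frag_of L - frag_of N \<in> K0_relations A"
    unfolding K0_relations_eq using assms by (intro generate.incl) (auto simp: K0_generators_def)
  then have "frag_of M \<in> K0_relations A #>\<^bsub>?G\<^esub> (frag_of L + frag_of N)"
    unfolding r_coset_def by (auto intro!: bexI[of _ "frag_of M - frag_of L - frag_of N"])
  moreover have "frag_of L + frag_of N \<in> carrier ?G"
    using G.m_closed[of "frag_of L" "frag_of N"] assms by (simp only: frag_of_in_free_Abelian_group mult_free_Abelian_group)
  ultimately have "K0_relations A #>\<^bsub>?G\<^esub> (frag_of L + frag_of N) = K0_relations A #>\<^bsub>?G\<^esub> frag_of M"
    using G.repr_independence R.subgroup_axioms by blast
  then show ?thesis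
    unfolding K0_class_def using assms by (subst K0_mult) (simp_all only: frag_of_in_free_Abelian_group)
qed

text \<open>Every element is a coset of the free abelian group, so the induction principle of that
  group reduces the equality to the classes of single modules.\<close>

lemma K0_hom_eqI:
  assumes H: "group H" and f: "f \<in> hom (K0 A) H" and g: "g \<in> hom (K0 A) H"
    and eq: "\<And>M. M \<in> fg_modules A \<Longrightarrow> f (K0_class A M) = g (K0_class A M)"
    and z: "z \<in> carrier (K0 A)"
  shows "f z = g z"
proof -
  let ?G = "free_Abelian_group (fg_modules A)"
  let ?c = "\<lambda>x. K0_relations A #>\<^bsub>?G\<^esub> x"
  interpret K: comm_group "K0 A" by (rule K0_comm_group)
  interpret H: group H by (rule H)
  interpret f: group_hom "K0 A" H f by (intro group_hom.intro group_hom_axioms.intro K.group_axioms H f)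
  interpret g: group_hom "K0 A" H g by (intro group_hom.intro group_hom_axioms.intro K.group_axioms H g)
  obtain x where x: "x \<in> carrier ?G" "z = ?c x" using z by (auto simp: K0_carrier)
  have cl: "?c x \<in> carrier (K0 A)" if "Poly_Mapping.keys x \<subseteq> fg_modules A" for x
    using that unfolding K0_carrier by (intro imageI) simp
  have "f (?c x) = g (?c x)"
  proof (rule free_Abelian_group_induct[of x "fg_modules A"])
    show "Poly_Mapping.keys x \<subseteq> fg_modules A" using x(1) by simp
    have "?c 0 \<otimes>\<^bsub>K0 A\<^esub> ?c 0 = ?c 0" using K0_mult[of 0 A 0] by simp
    then have "?c 0 = \<one>\<^bsub>K0 A\<^esub>" using cl[of 0] K.l_cancel_one' by simp
    then show "f (?c 0) = g (?c 0)" by (simp only: f.hom_one g.hom_one)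
  next
    fix x y assume xy: "Poly_Mapping.keys x \<subseteq> fg_modules A" "Poly_Mapping.keys y \<subseteq> fg_modules A"
      "f (?c x) = g (?c x)" "f (?c y) = g (?c y)"
    have k: "Poly_Mapping.keys (x - y) \<subseteq> fg_modules A" using keys_diff[of x y] xy by blast
    have "?c (x - y) \<otimes>\<^bsub>K0 A\<^esub> ?c y = ?c x" using K0_mult[of "x - y" A y] k xy by simp
    then have "?c (x - y) = ?c x \<otimes>\<^bsub>K0 A\<^esub> inv\<^bsub>K0 A\<^esub> ?c y"
      using cl[OF k] cl[OF xy(1)] cl[OF xy(2)] K.inv_solve_right by metis
    then show "f (?c (x - y)) = g (?c (x - y))"
      using cl[OF xy(1)] cl[OF xy(2)] xy(3,4) by simp
  next
    fix M assume "M \<in> fg_modules A"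
    then show "f (?c (frag_of M)) = g (?c (frag_of M))" using eq unfolding K0_class_def by blast
  qed
  then show ?thesis using x by simp
qed

text \<open>Additivity of \<open>w\<close> puts the generating relations into the kernel of the
  homomorphism that the free abelian group supplies.\<close>

lemma K0_universal:
  assumes H: "comm_group H" and w: "\<And>M. M \<in> fg_modules A \<Longrightarrow> w M \<in> carrier H"
    and add: "\<And>L M N. \<lbrakk>L \<in> fg_modules A; M \<in> fg_modules A; N \<in> fg_modules A; short_exact A L M N\<rbrakk>
      \<Longrightarrow> w M = w L \<otimes>\<^bsub>H\<^esub> w N"
  obtains f where "f \<in> hom (K0 A) H" "\<And>M. M \<in> fg_modules A \<Longrightarrow> f (K0_class A M) = w M"
proof -
  let ?G = "free_Abelian_group (fg_modules A)"
  interpret G: comm_group ?G by (rule abelian_free_Abelian_group)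
  interpret H: comm_group H by (rule H)
  have "w ` fg_modules A \<subseteq> carrier H" using w by auto
  then obtain h where h: "h \<in> hom ?G H" "\<And>M. M \<in> fg_modules A \<Longrightarrow> h (frag_of M) = w M"
    using H.free_Abelian_group_universal by blast
  interpret h: group_hom ?G H h by (intro group_hom.intro group_hom_axioms.intro G.group_axioms H.group_axioms h)
  have "g \<in> kernel ?G H h" if g: "g \<in> K0_generators A" for g
  proof -
    obtain L M N where *: "g = frag_of M - frag_of L - frag_of N" "L \<in> fg_modules A" "M \<in> fg_modules A" "N \<in> fg_modules A"
      "short_exact A L M N" using g by (auto simp: K0_generators_def)
    have gc: "g \<in> carrier ?G" using K0_generators_subset g by blast
    have Lc: "frag_of L \<in> carrier ?G" "frag_of N \<in> carrier ?G" using * by (simp_all only: frag_of_in_free_Abelian_group)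
    \<comment> \<open>Written without inverses, so that \<open>h g = \<one>\<close> follows by
      cancellation in \<open>H\<close>.\<close>
    have "frag_of M = g \<otimes>\<^bsub>?G\<^esub> (frag_of L \<otimes>\<^bsub>?G\<^esub> frag_of N)" using * by simp
    then have "h (frag_of M) = h g \<otimes>\<^bsub>H\<^esub> (h (frag_of L) \<otimes>\<^bsub>H\<^esub> h (frag_of N))"
      using h.hom_mult[OF gc G.m_closed[OF Lc]] h.hom_mult[OF Lc] by simp
    then have "w L \<otimes>\<^bsub>H\<^esub> w N = h g \<otimes>\<^bsub>H\<^esub> (w L \<otimes>\<^bsub>H\<^esub> w N)" using h(2) * add[OF *(2-5)] by simp
    then have "h g = \<one>\<^bsub>H\<^esub>" using h.hom_closed[OF gc] w[OF *(2)] w[OF *(4)] H.l_cancel_one'[of "w L \<otimes>\<^bsub>H\<^esub> w N" "h g"]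
        H.r_cancel_one'[of "w L \<otimes>\<^bsub>H\<^esub> w N" "h g"] by simp
    then show ?thesis using gc by (simp add: kernel_def)
  qed
  then have "K0_relations A \<subseteq> kernel ?G H h"
    unfolding K0_relations_eq by (intro G.generate_subgroup_incl h.subgroup_kernel) blast
  then obtain f where f: "f \<in> hom (?G Mod K0_relations A) H" "\<And>x. x \<in> carrier ?G \<Longrightarrow> f (K0_relations A #>\<^bsub>?G\<^esub> x) = h x"
    using h.FactGroup_universal_kernel[OF K0_relations_normal] by blast
  have "f (K0_class A M) = w M" if "M \<in> fg_modules A" for M
    unfolding K0_class_def using f(2)[of "frag_of M"] h(2)[OF that] that by (simp only: frag_of_in_free_Abelian_group)
  then show ?thesis using that f(1) by (simp add: K0_def)
qed

section \<open>Composition series\<close>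

context fdalg
begin

lemma fg_on_sub: "M \<in> fg_modules A \<Longrightarrow> msub A M U \<Longrightarrow> on_sub M U \<in> fg_modules A"
  using fmod_on_sub by (simp add: fg_modules_iff)

lemma fgD: "M \<in> fg_modules A \<Longrightarrow> fmod M" "M \<in> fg_modules A \<Longrightarrow> right_module A M"
  by (simp_all add: fg_modules_iff fmod_def)

lemma simple_quotient_exists:
  assumes M: "M \<in> fg_modules A" "carrier M \<noteq> {\<zero>\<^bsub>M\<^esub>}"
  obtains S k where "S \<in> fg_modules A" "simple_module A S" "mhom A M S k" "k ` carrier M = carrier S"
proof -
  note fM = fgD[OF M(1)]
  interpret right_module A M by (rule fM)
  let ?Q = "\<lambda>U. msub A M U \<and> U \<noteq> carrier M"
  have "?Q {\<zero>\<^bsub>M\<^esub>}" using msub_zero M(2) by auto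
  then obtain U where U: "?Q U" "\<And>V. ?Q V \<Longrightarrow> dm (on_sub M V) \<le> dm (on_sub M U)"
    using maximal_msub[OF fM(1), of ?Q "{\<zero>\<^bsub>M\<^esub>}"] by blast
  then have Um: "msub A M U" by blast
  obtain S k where S: "S \<in> fg_modules A" "mhom A M S k" "k ` carrier M = carrier S" "ker M S k = U"
    using quotient_rep[OF fM(1) Um] .
  have "simple_module A S"
  proof (rule surj_simple[OF fM(2) fgD(2)[OF S(1)] S(2,3)])
    show "ker M S k \<noteq> carrier M" using S(4) U by simp
    fix W assume W: "msub A M W" "ker M S k \<subseteq> W"
    show "W = ker M S k \<or> W = carrier M"
    proof (rule ccontr)
      assume n: "\<not> ?thesis"
      then have "dm (on_sub M W) \<le> dm (on_sub M U)" using U(2)[of W] W(1) by blast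
      moreover have "dm (on_sub M U) < dm (on_sub M W)"
        using dm_on_sub_le(2)[OF fM(1) W(1) Um] W(2) S(4) n by blast
      ultimately show False by simp
    qed
  qed
  then show ?thesis using that S by blast
qed

lemma simple_ker_proper:
  assumes "right_module A M" "right_module A S" "simple_module A S" "mhom A M S k" "k ` carrier M = carrier S"
  shows "ker M S k \<noteq> carrier M"
proof
  interpret S: right_module A S by fact
  assume "ker M S k = carrier M"
  then have "k ` carrier M \<subseteq> {\<zero>\<^bsub>S\<^esub>}" by (auto simp: ker_def)
  then show False using assms(3,5) S.M.zero_closed unfolding S.simple_iff by auto
qed

text \<open>Induction on the dimension that strips a simple quotient from the top; the remaining
  kernel is proper by \<open>simple_ker_proper\<close>.\<close>

lemma fg_induct [consumes 1, case_names zero step]: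
  assumes "M \<in> fg_modules A"
    and zero: "\<And>M. M \<in> fg_modules A \<Longrightarrow> carrier M = {\<zero>\<^bsub>M\<^esub>} \<Longrightarrow> Q M"
    and step: "\<And>M S k. \<lbrakk>M \<in> fg_modules A; S \<in> fg_modules A; simple_module A S; mhom A M S k;
      k ` carrier M = carrier S; Q (on_sub M (ker M S k))\<rbrakk> \<Longrightarrow> Q M"
  shows "Q M"
  using assms(1)
proof (induction M rule: measure_induct_rule[of dm])
  case (less M)
  show ?case
  proof (cases "carrier M = {\<zero>\<^bsub>M\<^esub>}")
    case True
    then show ?thesis using zero less.prems by blast
  next
    case False
    obtain S k where S: "S \<in> fg_modules A" "simple_module A S" "mhom A M S k" "k ` carrier M = carrier S"
      using simple_quotient_exists[OF less.prems False] .
    note fM = fgD[OF less.prems] and fS = fgD[OF S(1)]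
    have km: "msub A M (ker M S k)" using mod_hom.msub_ker[OF mod_homI[OF fM(2) fS(2) S(3)]] .
    have "dm (on_sub M (ker M S k)) < dm M"
      using dm_sub(2)[OF fM(1) km] simple_ker_proper[OF fM(2) fS(2) S(2-4)] by blast
    then show ?thesis using step[OF less.prems S] less.IH fg_on_sub[OF less.prems km] by blast
  qed
qed

end

text \<open>\<open>jh A y H M g\<close>: some composition series of \<open>M\<close> has factors whose values under \<open>y\<close> multiply to \<open>g\<close>.\<close>

inductive jh ::
    "('a, 'x) ring_scheme \<Rightarrow> (('a, 'a list) module \<Rightarrow> 'h) \<Rightarrow> 'h monoid \<Rightarrow> ('a, 'a list) module \<Rightarrow> 'h \<Rightarrow> bool"
  for A :: "('a, 'x) ring_scheme" and y :: "('a, 'a list) module \<Rightarrow> 'h" and H :: "'h monoid" where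
  jh_zero: "\<lbrakk>M \<in> fg_modules A; carrier M = {\<zero>\<^bsub>M\<^esub>}\<rbrakk> \<Longrightarrow> jh A y H M \<one>\<^bsub>H\<^esub>"
| jh_step: "\<lbrakk>M \<in> fg_modules A; S \<in> fg_modules A; simple_module A S; mhom A M S k; k ` carrier M = carrier S;
    jh A y H (on_sub M (ker M S k)) g\<rbrakk> \<Longrightarrow> jh A y H M (g \<otimes>\<^bsub>H\<^esub> y S)"

text \<open>\<open>y\<close> is a function on concrete modules, so its invariance under isomorphism
  has to be demanded: composition factors are unique only up to isomorphism.\<close>

locale simple_values = fdalg K A
  for K :: "('k, 'c) ring_scheme" and A :: "('k, 'a, 'd) module_scheme" +
  fixes y :: "('a, 'a list) module \<Rightarrow> 'h" and H :: "'h monoid"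
  assumes H_comm: "comm_group H"
    and y_closed: "\<lbrakk>S \<in> fg_modules A; simple_module A S\<rbrakk> \<Longrightarrow> y S \<in> carrier H"
    and y_iso: "\<lbrakk>S \<in> fg_modules A; S' \<in> fg_modules A; simple_module A S; module_iso A S S'\<rbrakk> \<Longrightarrow> y S = y S'"
begin

sublocale H: comm_group H by (rule H_comm)

lemma jh_closed: "jh A y H M g \<Longrightarrow> g \<in> carrier H"
  by (induction rule: jh.induct) (auto intro: y_closed)

lemma jh_fg: "jh A y H M g \<Longrightarrow> M \<in> fg_modules A"
  by (induction rule: jh.induct)

lemma jh_exists: "M \<in> fg_modules A \<Longrightarrow> \<exists>g. jh A y H M g"
proof (induction rule: fg_induct)
  case (zero M)
  then have "jh A y H M \<one>\<^bsub>H\<^esub>" by (rule jh_zero)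
  then show ?case by (rule exI)
next
  case (step M S k)
  then obtain g where "jh A y H (on_sub M (ker M S k)) g" by (elim exE)
  with step(1-5) have "jh A y H M (g \<otimes>\<^bsub>H\<^esub> y S)" by (rule jh_step)
  then show ?case by (rule exI)
qed

lemma jh_iso:
  assumes "jh A y H M g" "M' \<in> fg_modules A" "mod_iso A M M' u u'"
  shows "jh A y H M' g"
  using assms
proof (induction arbitrary: M' u u' rule: jh.induct)
  case (jh_zero M)
  interpret mod_iso A M M' u u' by fact
  show ?case using jh.jh_zero[OF jh_zero(3)] jh_zero zero_iff by simp
next
  case (jh_step M S k g)
  interpret mod_iso A M M' u u' by fact
  have S: "right_module A S" using fgD jh_step by blast
  let ?k = "\<lambda>x. k (u' x)"
  have k: "mhom A M' S ?k" using mhom_comp[OF inv.hom jh_step.hyps(4)] .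
  have "?k ` carrier M' = k ` u' ` carrier M'" by (simp add: image_image)
  then have ks: "?k ` carrier M' = carrier S" using mod_iso.surj[OF sym] jh_step.hyps(5) by simp
  have km: "msub A M (ker M S k)" using mod_hom.msub_ker[OF mod_homI[OF M.right_module_axioms S jh_step.hyps(4)]] .
  have km': "msub A M' (ker M' S ?k)" using mod_hom.msub_ker[OF mod_homI[OF N.right_module_axioms S k]] .
  have "mod_iso A (on_sub M (ker M S k)) (on_sub M' (ker M' S ?k)) u u'"
    by (intro mod_iso_on_sub mod_iso_axioms km km') (auto simp: ker_def)
  then have "jh A y H (on_sub M' (ker M' S ?k)) g" using jh_step.IH fg_on_sub[OF jh_step.prems(1) km'] by blast
  then show ?case by (rule jh.jh_step[OF jh_step.prems(1) jh_step.hyps(2,3) k ks])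
qed

text \<open>With equal kernels, each surjection factors through the other, and the two factors are
  mutually inverse.\<close>

lemma surj_same_ker_iso:
  assumes "right_module A M" "right_module A S" "right_module A S'" "mhom A M S k" "mhom A M S' k'"
    "k ` carrier M = carrier S" "k' ` carrier M = carrier S'" "ker M S k = ker M S' k'"
  shows "module_iso A S S'"
proof -
  have k: "mod_hom A M S k" and k': "mod_hom A M S' k'" using assms by (auto intro: mod_homI)
  interpret k: mod_hom A M S k by (rule k)
  interpret k': mod_hom A M S' k' by (rule k')
  obtain h where h: "mhom A S S' h" "\<And>x. x \<in> carrier M \<Longrightarrow> h (k x) = k' x"
    using mhom_factor[OF k k' assms(6)] assms(8) by blast
  obtain h' where h': "mhom A S' S h'" "\<And>x. x \<in> carrier M \<Longrightarrow> h' (k' x) = k x"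
    using mhom_factor[OF k' k assms(7)] assms(8) by blast
  have "h' (h z) = z" if "z \<in> carrier S" for z
  proof -
    have "z \<in> k ` carrier M" using that assms(6) by simp
    then show ?thesis using h(2) h'(2) by auto
  qed
  moreover have "h (h' z) = z" if "z \<in> carrier S'" for z
  proof -
    have "z \<in> k' ` carrier M" using that assms(7) by simp
    then show ?thesis using h(2) h'(2) by auto
  qed
  ultimately have "mod_iso A S S' h h'"
    using assms(2,3) h(1) h'(1) by (intro mod_iso.intro mod_iso_axioms.intro mod_homI) auto
  then show ?thesis by (rule mod_iso.module_iso)
qed

text \<open>Otherwise \<open>k'\<close> kills the kernel of \<open>k\<close>, so that one kernel
  contains the other; both are maximal submodules, which forces them to be equal.\<close>

lemma second_simple_surj:
  assumes "right_module A M" "right_module A S" "right_module A S'" "mhom A M S k" "mhom A M S' k'"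
    "k ` carrier M = carrier S" "k' ` carrier M = carrier S'" "simple_module A S" "simple_module A S'"
    "ker M S k \<noteq> ker M S' k'"
  shows "k' ` ker M S k = carrier S'"
proof (rule ccontr)
  have k: "mod_hom A M S k" and k': "mod_hom A M S' k'" using assms by (auto intro: mod_homI)
  interpret k: mod_hom A M S k by (rule k)
  interpret k': mod_hom A M S' k' by (rule k')
  assume "k' ` ker M S k \<noteq> carrier S'"
  then have "k' ` ker M S k = {\<zero>\<^bsub>S'\<^esub>}"
    using assms(9) k'.msub_image[OF k.msub_ker] unfolding k'.N.simple_iff by blast
  then have sub: "ker M S k \<subseteq> ker M S' k'" by (auto simp: ker_def)
  have "k ` ker M S' k' = {\<zero>\<^bsub>S\<^esub>} \<or> k ` ker M S' k' = carrier S"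
    using assms(8) k.msub_image[OF k'.msub_ker] unfolding k.N.simple_iff by blast
  then show False
  proof
    assume "k ` ker M S' k' = {\<zero>\<^bsub>S\<^esub>}"
    then have "ker M S' k' \<subseteq> ker M S k" by (auto simp: ker_def)
    then show False using sub assms(10) by blast
  next
    assume s: "k ` ker M S' k' = carrier S"
    have "x \<in> ker M S' k'" if x: "x \<in> carrier M" for x
    proof -
      have "k x \<in> k ` ker M S' k'" using x s by simp
      then obtain u where u: "u \<in> ker M S' k'" "k x = k u" by auto
      have uc: "u \<in> carrier M" using u by (simp add: ker_def)
      have "x \<ominus>\<^bsub>M\<^esub> u \<in> ker M S' k'" using k.diff_in_ker[OF x uc u(2)] sub by blast
      then have "(x \<ominus>\<^bsub>M\<^esub> u) \<oplus>\<^bsub>M\<^esub> u \<in> ker M S' k'" using u(1) k'.msub_ker by (simp add: msub_def)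
      then show ?thesis using k.M.diff_add_cancel[OF x uc] by simp
    qed
    then have "ker M S' k' = carrier M" by (auto simp: ker_def)
    then show False using simple_ker_proper[OF assms(1,3,9,5,7)] by blast
  qed
qed

lemma jh_nonzero_cases:
  assumes "jh A y H M g" "carrier M \<noteq> {\<zero>\<^bsub>M\<^esub>}"
  obtains S k g' where "S \<in> fg_modules A" "simple_module A S" "mhom A M S k" "k ` carrier M = carrier S"
    "jh A y H (on_sub M (ker M S k)) g'" "g = g' \<otimes>\<^bsub>H\<^esub> y S"
  using assms(1)
proof (cases rule: jh.cases)
  case jh_zero
  then show ?thesis using assms(2) by blast
next
  case (jh_step S k g')
  then show ?thesis using that by blast
qed

lemma jh_zero_cases:
  assumes "jh A y H M g" "carrier M = {\<zero>\<^bsub>M\<^esub>}" shows "g = \<one>\<^bsub>H\<^esub>"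
  using assms(1)
proof (cases rule: jh.cases)
  case (jh_step S k g')
  have S: "right_module A S" "right_module A M" using fgD jh_step by blast+
  interpret k: mod_hom A M S k by (intro mod_homI S jh_step)
  have "ker M S k = carrier M" using assms(2) k.msub_ker by (auto simp: msub_def)
  then show ?thesis using simple_ker_proper[OF S(2,1)] jh_step by blast
qed

text \<open>The Jordan-Hoelder argument, by induction on the dimension. For different kernels
  \<open>?U\<close> and \<open>?V\<close>, a series of \<open>?U \<inter> ?V\<close> is completed to
  one of \<open>?U\<close> with top factor \<open>T\<close> and to one of \<open>?V\<close> with top
  factor \<open>S\<close>; commutativity of \<open>H\<close> then equates the two products.\<close>

lemma jh_unique: "jh A y H M g \<Longrightarrow> jh A y H M h \<Longrightarrow> g = h"
proof (induction M arbitrary: g h rule: measure_induct_rule[of dm])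
  case (less M)
  have M: "M \<in> fg_modules A" using jh_fg less.prems by blast
  note fM = fgD[OF M]
  show ?case
  proof (cases "carrier M = {\<zero>\<^bsub>M\<^esub>}")
    case True
    then show ?thesis using jh_zero_cases less.prems by metis
  next
    case False
    obtain S k g1 where S: "S \<in> fg_modules A" "simple_module A S" "mhom A M S k" "k ` carrier M = carrier S"
      "jh A y H (on_sub M (ker M S k)) g1" "g = g1 \<otimes>\<^bsub>H\<^esub> y S"
      using jh_nonzero_cases[OF less.prems(1) False] .
    obtain T l h1 where T: "T \<in> fg_modules A" "simple_module A T" "mhom A M T l" "l ` carrier M = carrier T"
      "jh A y H (on_sub M (ker M T l)) h1" "h = h1 \<otimes>\<^bsub>H\<^esub> y T"
      using jh_nonzero_cases[OF less.prems(2) False] .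
    note fS = fgD[OF S(1)] and fT = fgD[OF T(1)]
    interpret k: mod_hom A M S k by (intro mod_homI fM fS S)
    interpret l: mod_hom A M T l by (intro mod_homI fM fT T)
    let ?U = "ker M S k" and ?V = "ker M T l"
    have dU: "dm (on_sub M ?U) < dm M" "dm (on_sub M ?V) < dm M"
      using dm_sub(2)[OF fM(1) k.msub_ker] dm_sub(2)[OF fM(1) l.msub_ker]
        simple_ker_proper[OF fM(2) fS(2) S(2-4)] simple_ker_proper[OF fM(2) fT(2) T(2-4)] by blast+
    note cl = jh_closed[OF S(5)] jh_closed[OF T(5)] y_closed[OF S(1,2)] y_closed[OF T(1,2)]
    show ?thesis
    proof (cases "?U = ?V")
      case True
      then have "g1 = h1" using less.IH[OF dU(1)] S(5) T(5) by simp
      moreover have "y S = y T"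
        using y_iso[OF S(1) T(1) S(2) surj_same_ker_iso[OF fM(2) fS(2) fT(2) S(3) T(3) S(4) T(4) True]] .
      ultimately show ?thesis using S(6) T(6) by simp
    next
      case False
      have "msub A M (?U \<inter> ?V)" using k.M.msub_Int[OF k.msub_ker l.msub_ker] .
      then obtain d where d: "jh A y H (on_sub M (?U \<inter> ?V)) d" using jh_exists fg_on_sub[OF M] by blast
      have lU: "mhom A (on_sub M ?U) T l" and kV: "mhom A (on_sub M ?V) S k"
        using mhom_on_dom[OF T(3) k.msub_ker] mhom_on_dom[OF S(3) l.msub_ker] .
      have lU': "l ` carrier (on_sub M ?U) = carrier T"
        using second_simple_surj[OF fM(2) fS(2) fT(2) S(3) T(3) S(4) T(4) S(2) T(2) False] by simp
      have kV': "k ` carrier (on_sub M ?V) = carrier S"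
        using second_simple_surj[OF fM(2) fT(2) fS(2) T(3) S(3) T(4) S(4) T(2) S(2)] False by simp
      have D: "on_sub (on_sub M ?U) (ker (on_sub M ?U) T l) = on_sub M (?U \<inter> ?V)"
        "on_sub (on_sub M ?V) (ker (on_sub M ?V) S k) = on_sub M (?U \<inter> ?V)"
        by (auto simp: ker_def Int_def intro!: arg_cong[of _ _ "on_sub M"])
      have "jh A y H (on_sub M ?U) (d \<otimes>\<^bsub>H\<^esub> y T)" "jh A y H (on_sub M ?V) (d \<otimes>\<^bsub>H\<^esub> y S)"
        by (rule jh_step[OF fg_on_sub[OF M k.msub_ker] T(1,2) lU lU'], unfold D, rule d)
           (rule jh_step[OF fg_on_sub[OF M l.msub_ker] S(1,2) kV kV'], unfold D, rule d)
      then have "g1 = d \<otimes>\<^bsub>H\<^esub> y T" "h1 = d \<otimes>\<^bsub>H\<^esub> y S" using less.IH dU S(5) T(5) by blast+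
      then show ?thesis using S(6) T(6) cl jh_closed[OF d] by (simp add: H.m_ac)
    qed
  qed
qed

text \<open>The composition series of \<open>N\<close> is pulled back along the surjection from
  \<open>M\<close> step by step, until what remains is a series of \<open>L\<close>.\<close>

lemma jh_additive:
  assumes "jh A y H N v" "short_exact A L M N" "jh A y H L u" "M \<in> fg_modules A"
  shows "jh A y H M (u \<otimes>\<^bsub>H\<^esub> v)"
  using assms(1,2,4)
proof (induction arbitrary: M rule: jh.induct)
  case (jh_zero N)
  note L = fgD[OF jh_fg[OF assms(3)]] and M = fgD[OF jh_zero.prems(2)] and N = fgD[OF jh_zero.hyps(1)]
  obtain f g where fg: "mhom A L M f" "mhom A M N g" "inj_on f (carrier L)"
    "f ` carrier L = ker M N g" "g ` carrier M = carrier N" using short_exactE[OF jh_zero.prems(1)] .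
  have "ker M N g = carrier M" using mhomD(1)[OF fg(2)] jh_zero.hyps(2) by (auto simp: ker_def)
  then have "bij_betw f (carrier L) (carrier M)" using fg(3,4) by (simp add: bij_betw_def)
  then have "jh A y H M u" using jh_iso[OF assms(3) jh_zero.prems(2) mod_isoI[OF L(2) M(2) fg(1)]] by blast
  then show ?case using jh_closed[OF assms(3)] by simp
next
  case (jh_step N S k v)
  note L = fgD[OF jh_fg[OF assms(3)]] and M = fgD[OF jh_step.prems(2)] and N = fgD[OF jh_step.hyps(1)]
    and S = fgD[OF jh_step.hyps(2)]
  obtain f g where fg: "mhom A L M f" "mhom A M N g" "inj_on f (carrier L)"
    "f ` carrier L = ker M N g" "g ` carrier M = carrier N" using short_exactE[OF jh_step.prems(1)] .
  interpret k: mod_hom A N S k by (intro mod_homI N S jh_step.hyps)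
  interpret g: mod_hom A M N g by (intro mod_homI N M fg)
  have kg: "mhom A M S (\<lambda>x. k (g x))" using mhom_comp[OF fg(2) jh_step.hyps(4)] .
  interpret kg: mod_hom A M S "\<lambda>x. k (g x)" by (intro mod_homI S M kg)
  \<comment> \<open>\<open>?W\<close> is the preimage of \<open>?V\<close> under \<open>g\<close>,
    so the sequence restricts to one of \<open>L\<close>, \<open>?W\<close> and \<open>?V\<close>,
    to which the induction hypothesis applies.\<close>
  let ?W = "ker M S (\<lambda>x. k (g x))" and ?V = "ker N S k"
  have Wm: "msub A M ?W" by (rule kg.msub_ker)
  have "(\<lambda>x. k (g x)) ` carrier M = k ` g ` carrier M" by (simp add: image_image)
  then have kgs: "(\<lambda>x. k (g x)) ` carrier M = carrier S" using fg(5) jh_step.hyps(5) by simp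
  have kW: "ker M N g \<subseteq> ?W" by (auto simp: ker_def)
  have gW: "g ` ?W = ?V"
  proof
    show "g ` ?W \<subseteq> ?V" by (auto simp: ker_def)
    show "?V \<subseteq> g ` ?W"
    proof
      fix z assume z: "z \<in> ?V"
      then have "z \<in> g ` carrier M" using fg(5) by (simp add: ker_def)
      then obtain x where x: "x \<in> carrier M" "z = g x" by blast
      then have "x \<in> ?W" using z by (simp add: ker_def)
      then show "z \<in> g ` ?W" using x by blast
    qed
  qed
  have "short_exact A L (on_sub M ?W) (on_sub N ?V)"
  proof (rule short_exactI[of A L "on_sub M ?W" f "on_sub N ?V" g])
    show "right_module A L" "right_module A (on_sub M ?W)" using L g.M.on_sub_module[OF Wm] by auto
    show "mhom A L (on_sub M ?W) f" using mhom_on_cod[OF fg(1)] fg(4) kW by simp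
    show "mhom A (on_sub M ?W) (on_sub N ?V) g" using mhom_on_cod[OF mhom_on_dom[OF fg(2) Wm], of ?V] gW by simp
    show "inj_on f (carrier L)" by (rule fg(3))
    show "f ` carrier L = ker (on_sub M ?W) (on_sub N ?V) g" unfolding fg(4) using kW by (auto simp: ker_def)
    show "g ` carrier (on_sub M ?W) = carrier (on_sub N ?V)" using gW by simp
  qed
  then have "jh A y H (on_sub M ?W) (u \<otimes>\<^bsub>H\<^esub> v)" using jh_step.IH fg_on_sub[OF jh_step.prems(2) Wm] by blast
  then have "jh A y H M ((u \<otimes>\<^bsub>H\<^esub> v) \<otimes>\<^bsub>H\<^esub> y S)"
    by (rule jh.jh_step[OF jh_step.prems(2) jh_step.hyps(2,3) kg kgs])
  then show ?case
    using jh_closed[OF assms(3)] jh_closed[OF jh_step.hyps(6)] y_closed[OF jh_step.hyps(2,3)] by (simp add: H.m_assoc)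
qed

lemma jh_simple:
  assumes "S \<in> fg_modules A" "simple_module A S" shows "jh A y H S (y S)"
proof -
  note fS = fgD[OF assms(1)]
  interpret right_module A S by (rule fS)
  have k: "ker S S (\<lambda>x. x) = {\<zero>\<^bsub>S\<^esub>}" by (auto simp: ker_def)
  have "jh A y H (on_sub S (ker S S (\<lambda>x. x))) \<one>\<^bsub>H\<^esub>"
    unfolding k using fg_on_sub[OF assms(1) msub_zero] by (intro jh_zero) auto
  then have "jh A y H S (\<one>\<^bsub>H\<^esub> \<otimes>\<^bsub>H\<^esub> y S)" using assms by (intro jh_step[of _ _ _ "\<lambda>x. x"] mhom_id) auto
  then show ?thesis using y_closed[OF assms] by simp
qed

text \<open>The existence half of freeness: the product of the values over a composition series is
  independent of the series by \<open>jh_unique\<close> and additive by \<open>jh_additive\<close>,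
  so it descends to the Grothendieck group.\<close>

theorem K0_hom_on_simples:
  obtains f where "f \<in> hom (K0 A) H"
    "\<And>S. \<lbrakk>S \<in> fg_modules A; simple_module A S\<rbrakk> \<Longrightarrow> f (K0_class A S) = y S"
proof -
  define w where "w M = (SOME g. jh A y H M g)" for M
  have w: "jh A y H M (w M)" if "M \<in> fg_modules A" for M
    unfolding w_def using jh_exists[OF that] by (rule someI_ex)
  obtain f where f: "f \<in> hom (K0 A) H" "\<And>M. M \<in> fg_modules A \<Longrightarrow> f (K0_class A M) = w M"
  proof (rule K0_universal[OF H_comm, of A w])
    show "w M \<in> carrier H" if "M \<in> fg_modules A" for M using jh_closed[OF w[OF that]] .
    show "w M = w L \<otimes>\<^bsub>H\<^esub> w N" if "L \<in> fg_modules A" "M \<in> fg_modules A" "N \<in> fg_modules A" "short_exact A L M N" for L M N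
      using jh_unique[OF w[OF that(2)] jh_additive[OF w[OF that(3)] that(4) w[OF that(1)] that(2)]] .
  qed (rule that)
  have "f (K0_class A S) = y S" if "S \<in> fg_modules A" "simple_module A S" for S
    using f(2)[OF that(1)] jh_unique[OF w[OF that(1)] jh_simple[OF that]] by simp
  then show ?thesis using that f(1) by blast
qed

end

section \<open>Classes of zero, isomorphic and simple modules\<close>

context fdalg
begin

text \<open>On a zero module the identity maps form a short exact sequence with three equal terms,
  so the class is idempotent in a group.\<close>

lemma K0_class_zero:
  assumes "M \<in> fg_modules A" "carrier M = {\<zero>\<^bsub>M\<^esub>}" shows "K0_class A M = \<one>\<^bsub>K0 A\<^esub>"
proof -
  interpret K: comm_group "K0 A" by (rule K0_comm_group)
  note fM = fgD[OF assms(1)]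
  have "short_exact A M M M"
    by (rule short_exactI[OF fM(2) fM(2) mhom_id mhom_id]) (use assms(2) in \<open>auto simp: ker_def\<close>)
  then have "K0_class A M = K0_class A M \<otimes>\<^bsub>K0 A\<^esub> K0_class A M" using K0_class_additive assms(1) by blast
  then show ?thesis using K0_class_closed[OF assms(1)] K.l_cancel_one' by metis
qed

lemma ker_short_exact:
  assumes "right_module A M" "right_module A S" "mhom A M S k" "k ` carrier M = carrier S"
  shows "short_exact A (on_sub M (ker M S k)) M S"
proof -
  interpret mod_hom A M S k by (intro mod_homI assms)
  show ?thesis
    by (rule short_exactI[OF M.on_sub_module[OF msub_ker] assms(1) mhom_incl[OF msub_ker] assms(3) _ _ assms(4)]) auto
qed

text \<open>An isomorphism is a short exact sequence with zero as its third term.\<close>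

lemma K0_class_iso:
  assumes "M \<in> fg_modules A" "M' \<in> fg_modules A" "mod_iso A M M' u u'"
  shows "K0_class A M = K0_class A M'"
proof -
  interpret K: comm_group "K0 A" by (rule K0_comm_group)
  interpret mod_iso A M M' u u' by fact
  have Z: "on_sub M' {\<zero>\<^bsub>M'\<^esub>} \<in> fg_modules A" using fg_on_sub[OF assms(2) N.msub_zero] .
  have z: "mhom A M' (on_sub M' {\<zero>\<^bsub>M'\<^esub>}) (\<lambda>x. \<zero>\<^bsub>M'\<^esub>)" by (simp add: mhom_def)
  have "short_exact A M M' (on_sub M' {\<zero>\<^bsub>M'\<^esub>})"
    by (rule short_exactI[OF M.right_module_axioms N.right_module_axioms hom z inj])
      (use surj N.M.zero_closed in \<open>auto simp: ker_def\<close>)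
  then show ?thesis
    using K0_class_additive[OF _ assms(1,2) Z] K0_class_zero[OF Z] K0_class_closed[OF assms(1)] by simp
qed

text \<open>The uniqueness half of freeness: stripping simple quotients expresses every class as a
  product of simple ones. Extensionality settles the values outside the carrier.\<close>

lemma K0_End_eqI:
  assumes f: "f \<in> K0_End A" and g: "g \<in> K0_End A"
    and eq: "\<And>S. \<lbrakk>S \<in> fg_modules A; simple_module A S\<rbrakk> \<Longrightarrow> f (K0_class A S) = g (K0_class A S)"
  shows "f = g"
proof -
  interpret K: comm_group "K0 A" by (rule K0_comm_group)
  have fh: "f \<in> hom (K0 A) (K0 A)" "g \<in> hom (K0 A) (K0 A)" using f g by (auto simp: K0_End_def)
  interpret f: group_hom "K0 A" "K0 A" f by (intro group_hom.intro group_hom_axioms.intro K.group_axioms fh)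
  interpret g: group_hom "K0 A" "K0 A" g by (intro group_hom.intro group_hom_axioms.intro K.group_axioms fh)
  have "f (K0_class A M) = g (K0_class A M)" if "M \<in> fg_modules A" for M
    using that
  proof (induction rule: fg_induct)
    case (zero M)
    show ?case unfolding K0_class_zero[OF zero] by (simp only: f.hom_one g.hom_one)
  next
    case (step M S k)
    note fM = fgD[OF step(1)] and fS = fgD[OF step(2)]
    have km: "on_sub M (ker M S k) \<in> fg_modules A"
      using fg_on_sub[OF step(1) mod_hom.msub_ker[OF mod_homI[OF fM(2) fS(2) step(4)]]] .
    have "K0_class A M = K0_class A (on_sub M (ker M S k)) \<otimes>\<^bsub>K0 A\<^esub> K0_class A S"
      using K0_class_additive[OF ker_short_exact[OF fM(2) fS(2) step(4,5)] km step(1,2)] .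
    then show ?case
      using step(6) eq[OF step(2,3)] K0_class_closed[OF km] K0_class_closed[OF step(2)] by simp
  qed
  then have "f z = g z" if "z \<in> carrier (K0 A)" for z
    using K0_hom_eqI[OF K.group_axioms fh _ that] by blast
  then show ?thesis using f g by (intro extensionalityI[of f "carrier (K0 A)"]) (auto simp: K0_End_def)
qed

lemma K0_End_restrict:
  assumes "f \<in> hom (K0 A) (K0 A)" shows "restrict f (carrier (K0 A)) \<in> K0_End A"
proof -
  interpret K: comm_group "K0 A" by (rule K0_comm_group)
  show ?thesis using assms by (auto simp: K0_End_def hom_def)
qed

lemma min_proj_presentation_hom:
  assumes "M \<in> fg_modules A" "min_proj_presentation A P1 p1 P0 p0 M"
  shows "mhom A P1 P0 p1"
proof -
  have c: "projective_cover A P0 p0 M" "projective_cover A P1 p1 (on_sub P0 (ker P0 M p0))"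
    using assms(2) by (auto simp: min_proj_presentation_def a_kernel_eq_ker)
  note c0 = projective_coverD[OF c(1)] and c1 = projective_coverD[OF c(2)]
  have "msub A P0 (ker P0 M p0)" using mod_hom.msub_ker[OF mod_homI[OF c0(7) fgD(2)[OF assms(1)] c0(3)]] .
  then show ?thesis using mhom_cod_incl[OF c1(3)] by (simp add: msub_def)
qed

lemma projective_module_iso_iff:
  assumes "mod_iso A M N f g" shows "projective_module A M \<longleftrightarrow> projective_module A N"
  using projective_iso[OF assms] projective_iso[OF mod_iso.sym[OF assms]] by blast

end

section \<open>Maps induced by the translation\<close>

context nakayama
begin

lemma simple_fgD:
  assumes "S \<in> fg_modules A" "simple_module A S"
  shows "uniserial_module A S" "carrier S \<noteq> {\<zero>\<^bsub>S\<^esub>}" "indecomposable_module A S"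
proof -
  interpret right_module A S using fgD assms by blast
  show *: "uniserial_module A S" "carrier S \<noteq> {\<zero>\<^bsub>S\<^esub>}"
    using simple_uniserial assms(2) by (auto simp: simple_iff)
  show "indecomposable_module A S" using uniserial_indecomposable[OF *] .
qed

lemma ar_translate_closed:
  assumes "M \<in> fg_modules A" "uniserial_module A M" "\<not> projective_module A M" "carrier M \<noteq> {\<zero>\<^bsub>M\<^esub>}"
  shows "ar_translate K A M \<in> fg_modules A"
proof -
  obtain P1 p1 P0 p0 where "min_proj_presentation A P1 p1 P0 p0 M" using ar_translate_fg(1)[OF assms] by blast
  then show ?thesis using ar_translate_spec(1)[OF assms(1)] by blast
qed

text \<open>The objects that \<open>ar_translate\<close> chooses for isomorphic modules are chosen
  independently, but both are kernels attached to isomorphic presentations. This makes the values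
  prescribed on simple modules invariant under isomorphism.\<close>

lemma ar_translate_class_iso:
  assumes M: "M \<in> fg_modules A" "uniserial_module A M" "\<not> projective_module A M" "carrier M \<noteq> {\<zero>\<^bsub>M\<^esub>}"
    and M': "M' \<in> fg_modules A" and u: "mod_iso A M M' u u'"
  shows "K0_class A (ar_translate K A M) = K0_class A (ar_translate K A M')"
proof -
  interpret mod_iso A M M' u u' by (rule u)
  have nM': "uniserial_module A M'" "\<not> projective_module A M'" "carrier M' \<noteq> {\<zero>\<^bsub>M'\<^esub>}"
    using uniserial_surj[OF M(2) surj] M(3,4) projective_module_iso_iff[OF u] zero_iff by auto
  obtain P1 p1 P0 p0 where p: "min_proj_presentation A P1 p1 P0 p0 M" using ar_translate_fg(1)[OF M] by blast
  obtain P1' p1' P0' p0' where p': "min_proj_presentation A P1' p1' P0' p0' M'"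
    using ar_translate_fg(1)[OF M' nM'] by blast
  obtain a b where t: "mod_iso A (ar_translate K A M) (tau_of P1 p1 P0) a b" using ar_translate_spec(2)[OF M(1) p] by blast
  obtain a' b' where t': "mod_iso A (ar_translate K A M') (tau_of P1' p1' P0') a' b'" using ar_translate_spec(2)[OF M' p'] by blast
  obtain h0 h0' h1 h1' where h: "mod_iso A P0 P0' h0 h0'" "mod_iso A P1 P1' h1 h1'"
    "\<And>x. x \<in> carrier P1 \<Longrightarrow> p1' (h1 x) = h0 (p1 x)"
    using min_proj_presentation_unique[OF p p' fgD(1)[OF M'] u] by blast
  have m: "mhom A P1 P0 p1" "mhom A P1' P0' p1'"
    using min_proj_presentation_hom[OF M(1) p] min_proj_presentation_hom[OF M' p'] .
  note mod_iso_trans[OF t mod_iso_trans[OF tau_of_iso[OF h(1,2) m h(3)] mod_iso.sym[OF t']]]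
  then show ?thesis using K0_class_iso ar_translate_closed[OF M] ar_translate_closed[OF M' nM'] by blast
qed

text \<open>\<open>P\<close> stays fixed while the kernel of \<open>p\<close> grows with each simple
  submodule divided out of \<open>M\<close>, so the dimension of \<open>P\<close> minus that of the
  kernel decreases. The kernel stays nonzero, which keeps \<open>M\<close> and its successive
  quotients from being projective.\<close>

lemma prescribed_tau:
  assumes f: "f \<in> hom (K0 A) (K0 A)"
    and S: "\<And>S. \<lbrakk>S \<in> fg_modules A; simple_module A S; \<not> projective_module A S\<rbrakk> \<Longrightarrow>
      f (K0_class A S) = K0_class A (ar_translate K A S)"
    and P: "P \<in> fg_modules A" "projective_module A P" "uniserial_module A P"
    and M: "M \<in> fg_modules A" and p: "mhom A P M p" "p ` carrier P = carrier M" "ker P M p \<noteq> {\<zero>\<^bsub>P\<^esub>}"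
    and nz: "carrier M \<noteq> {\<zero>\<^bsub>M\<^esub>}"
  shows "f (K0_class A M) = K0_class A (ar_translate K A M)"
  using M p nz
proof (induction "dm P - dm (on_sub P (ker P M p))" arbitrary: M p rule: less_induct)
  case less
  note fP = fgD[OF P(1)] and fM = fgD[OF less.prems(1)]
  have npM: "\<not> projective_module A M" by (rule uniserial_not_projective[OF fP(1) P(3) fM(1) less.prems(2-5)])
  show ?case
  proof (cases "simple_module A M")
    case True
    then show ?thesis using S[OF less.prems(1) _ npM] by blast
  next
    case False
    obtain S N n where N: "S \<in> fg_modules A" "simple_module A S" "\<not> projective_module A S" "N \<in> fg_modules A"
      "mhom A P N n" "n ` carrier P = carrier N" "ker P M p \<subset> ker P N n" "carrier N \<noteq> {\<zero>\<^bsub>N\<^esub>}"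
      "short_exact A S M N" "short_exact A (ar_translate K A S) (ar_translate K A M) (ar_translate K A N)"
      using tau_short_exact_step[OF P less.prems False] by blast
    note fN = fgD[OF N(4)]
    interpret p: mod_hom A P M p by (intro mod_homI fP fM less.prems)
    interpret n: mod_hom A P N n by (intro mod_homI fP fN N)
    have kn: "ker P N n \<noteq> {\<zero>\<^bsub>P\<^esub>}" using N(7) p.msub_ker by (auto simp: msub_def)
    have npN: "\<not> projective_module A N" by (rule uniserial_not_projective[OF fP(1) P(3) fN(1) N(5,6) kn N(8)])
    have "dm (on_sub P (ker P M p)) < dm (on_sub P (ker P N n))"
      using dm_on_sub_le(2)[OF fP(1) n.msub_ker p.msub_ker] N(7) by blast
    moreover have "dm (on_sub P (ker P N n)) \<le> dm P" by (rule dm_sub(1)[OF fP(1) n.msub_ker])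
    ultimately have "dm P - dm (on_sub P (ker P N n)) < dm P - dm (on_sub P (ker P M p))" by linarith
    from less.hyps[OF this N(4-6) kn N(8)]
    have IH: "f (K0_class A N) = K0_class A (ar_translate K A N)" .
    have t: "ar_translate K A S \<in> fg_modules A" "ar_translate K A M \<in> fg_modules A" "ar_translate K A N \<in> fg_modules A"
      using ar_translate_closed[OF N(1) simple_fgD(1)[OF N(1,2)] N(3) simple_fgD(2)[OF N(1,2)]]
        ar_translate_closed[OF less.prems(1) p.uniserial_surj[OF P(3) less.prems(3)] npM less.prems(5)]
        ar_translate_closed[OF N(4) n.uniserial_surj[OF P(3) N(6)] npN N(8)] by blast+
    have "f (K0_class A M) = f (K0_class A S) \<otimes>\<^bsub>K0 A\<^esub> f (K0_class A N)"
      using K0_class_additive[OF N(9,1) less.prems(1) N(4)] hom_mult[OF f K0_class_closed[OF N(1)] K0_class_closed[OF N(4)]]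
      by simp
    also have "\<dots> = K0_class A (ar_translate K A S) \<otimes>\<^bsub>K0 A\<^esub> K0_class A (ar_translate K A N)"
      using IH S[OF N(1-3)] by simp
    also have "\<dots> = K0_class A (ar_translate K A M)" using K0_class_additive[OF N(10) t] by simp
    finally show ?thesis .
  qed
qed

section \<open>Endomorphisms prescribed on the simple modules\<close>

lemma prescribed_tau_map:
  assumes "f \<in> K0_End A" "prescribed_on_simples K A x f"
  shows "tau_map K A f"
  unfolding tau_map_def
proof (intro conjI ballI impI)
  show "f \<in> K0_End A" by fact
  fix M assume M: "M \<in> fg_modules A" "indecomposable_module A M \<and> \<not> projective_module A M"
  have u: "uniserial_module A M" using indecomposable_uniserial[OF fgD(1)[OF M(1)]] M(2) by blast
  have nz: "carrier M \<noteq> {\<zero>\<^bsub>M\<^esub>}" using right_module.indecomposable_iff[OF fgD(2)[OF M(1)]] M(2) by blast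
  obtain P p where P: "P \<in> fg_modules A" "projective_module A P" "uniserial_module A P" "mhom A P M p"
    "p ` carrier P = carrier M" "ker P M p \<noteq> {\<zero>\<^bsub>P\<^esub>}"
    using ar_translate_fg(2)[OF M(1) u _ nz] M(2) by blast
  show "f (K0_class A M) = K0_class A (ar_translate K A M)"
  proof (rule prescribed_tau[OF _ _ P(1-3) M(1) P(4-6) nz])
    show "f \<in> hom (K0 A) (K0 A)" using assms(1) by (simp add: K0_End_def)
    show "f (K0_class A S) = K0_class A (ar_translate K A S)"
      if "S \<in> fg_modules A" "simple_module A S" "\<not> projective_module A S" for S
      using assms(2) that by (simp add: prescribed_on_simples_def)
  qed
qed

lemma prescribed_unique:
  assumes "f \<in> K0_End A" "prescribed_on_simples K A x f" "g \<in> K0_End A" "prescribed_on_simples K A x g"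
  shows "f = g"
proof (rule K0_End_eqI[OF assms(1,3)])
  fix S assume "S \<in> fg_modules A" "simple_module A S"
  then show "f (K0_class A S) = g (K0_class A S)"
    using assms(2,4) by (simp add: prescribed_on_simples_def)
qed

lemma prescribed_exists:
  assumes xc: "\<And>S. \<lbrakk>S \<in> fg_modules A; simple_module A S; projective_module A S\<rbrakk> \<Longrightarrow> x S \<in> carrier (K0 A)"
    and xi: "\<And>S S'. \<lbrakk>S \<in> fg_modules A; S' \<in> fg_modules A; simple_module A S; projective_module A S; module_iso A S S'\<rbrakk>
      \<Longrightarrow> x S = x S'"
  shows "\<exists>f. f \<in> K0_End A \<and> prescribed_on_simples K A x f"
proof -
  define y where "y S = (if projective_module A S then x S else K0_class A (ar_translate K A S))" for S
  have yc: "y S \<in> carrier (K0 A)" if S: "S \<in> fg_modules A" "simple_module A S" for S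
    using xc[OF S] K0_class_closed[OF ar_translate_closed[OF S(1) simple_fgD(1)[OF S] _ simple_fgD(2)[OF S]]]
    by (simp add: y_def)
  have yi: "y S = y S'" if S: "S \<in> fg_modules A" "S' \<in> fg_modules A" "simple_module A S" "module_iso A S S'" for S S'
  proof -
    obtain u u' where u: "mod_iso A S S' u u'"
      using module_iso_mod_iso[OF S(4) fgD(2)[OF S(1)] fgD(2)[OF S(2)]] .
    show ?thesis
      using xi[OF S(1-3) _ S(4)] projective_module_iso_iff[OF u]
        ar_translate_class_iso[OF S(1) simple_fgD(1)[OF S(1,3)] _ simple_fgD(2)[OF S(1,3)] S(2) u]
      by (simp add: y_def)
  qed
  interpret y: simple_values K A y "K0 A"
    using yi by (intro simple_values.intro simple_values_axioms.intro fdalg_axioms K0_comm_group yc)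
  obtain f where f: "f \<in> hom (K0 A) (K0 A)" "\<And>S. \<lbrakk>S \<in> fg_modules A; simple_module A S\<rbrakk> \<Longrightarrow> f (K0_class A S) = y S"
    using y.K0_hom_on_simples by blast
  have "restrict f (carrier (K0 A)) (K0_class A S) = y S" if "S \<in> fg_modules A" "simple_module A S" for S
    using f(2)[OF that] K0_class_closed[OF that(1)] by simp
  then have "prescribed_on_simples K A x (restrict f (carrier (K0 A)))"
    unfolding prescribed_on_simples_def y_def by simp
  then show ?thesis using K0_End_restrict[OF f(1)] by blast
qed

text \<open>A simple module is indecomposable and here never projective, so a \<tau>-map already has
  the prescribed value on it. Uniqueness of \<tau>-maps thus reduces to
  \<open>prescribed_unique\<close>.\<close>

lemma tau_map_prescribed:
  assumes "tau_map K A f" "\<nexists>S. S \<in> fg_modules A \<and> simple_module A S \<and> projective_module A S"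
  shows "prescribed_on_simples K A x f"
  using assms simple_fgD(3) unfolding tau_map_def prescribed_on_simples_def by auto

end

text \<open>The family indexed by isomorphism classes of simple projectives is encoded as a function
  \<open>x\<close> on modules that is invariant under \<open>module_iso\<close> at simple
  projectives; its other values are unconstrained.\<close>

theorem proposition4p7:
  fixes K :: "('k, 'c) ring_scheme" and A :: "('k, 'a, 'd) module_scheme"
  assumes "finite_dim_algebra K A" and "basic_algebra A" and "nakayama_algebra A"
  shows "(\<forall>x.
      (\<forall>S\<in>fg_modules A. simple_module A S \<and> projective_module A S \<longrightarrow> x S \<in> carrier (K0 A)) \<and>
      (\<forall>S\<in>fg_modules A. \<forall>S'\<in>fg_modules A.
        simple_module A S \<and> projective_module A S \<and> module_iso A S S' \<longrightarrow> x S = x S') \<longrightarrow>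
      (\<exists>!\<Phi>. \<Phi> \<in> K0_End A \<and> prescribed_on_simples K A x \<Phi>) \<and>
      (\<forall>\<Phi>\<in>K0_End A. prescribed_on_simples K A x \<Phi> \<longrightarrow> tau_map K A \<Phi>)) \<and>
    ((\<nexists>S. S \<in> fg_modules A \<and> simple_module A S \<and> projective_module A S) \<longrightarrow>
      (\<exists>!\<Phi>. tau_map K A \<Phi>))"
proof -
  interpret nakayama K A
    using assms(1,3) by (intro nakayama.intro fdalg.intro nakayama_axioms.intro)
  show ?thesis
  proof (intro conjI allI impI)
    fix x :: "('a, 'a list) module \<Rightarrow> (('a, 'a list) module \<Rightarrow>\<^sub>0 int) set"
    assume x: "(\<forall>S\<in>fg_modules A. simple_module A S \<and> projective_module A S \<longrightarrow> x S \<in> carrier (K0 A)) \<and>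
      (\<forall>S\<in>fg_modules A. \<forall>S'\<in>fg_modules A.
        simple_module A S \<and> projective_module A S \<and> module_iso A S S' \<longrightarrow> x S = x S')"
    have "\<exists>\<Phi>. \<Phi> \<in> K0_End A \<and> prescribed_on_simples K A x \<Phi>"
      by (rule prescribed_exists) (use x in blast)+
    then show "\<exists>!\<Phi>. \<Phi> \<in> K0_End A \<and> prescribed_on_simples K A x \<Phi>" using prescribed_unique by blast
    show "\<forall>\<Phi>\<in>K0_End A. prescribed_on_simples K A x \<Phi> \<longrightarrow> tau_map K A \<Phi>" using prescribed_tau_map by blast
  next
    assume none: "\<nexists>S. S \<in> fg_modules A \<and> simple_module A S \<and> projective_module A S"
    \<comment> \<open>A placeholder: the prescription consults \<open>?x\<close> only at simple
      projective modules.\<close>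
    let ?x = "\<lambda>_. \<one>\<^bsub>K0 A\<^esub>"
    have "\<exists>\<Phi>. \<Phi> \<in> K0_End A \<and> prescribed_on_simples K A ?x \<Phi>"
      by (rule prescribed_exists) (use none in blast)+
    then obtain \<Phi> where "tau_map K A \<Phi>" using prescribed_tau_map by blast
    moreover have "\<Phi> = \<Psi>" if "tau_map K A \<Phi>" "tau_map K A \<Psi>" for \<Phi> \<Psi>
      using prescribed_unique[of \<Phi> ?x \<Psi>] tau_map_prescribed[OF _ none] that by (simp add: tau_map_def)
    ultimately show "\<exists>!\<Phi>. tau_map K A \<Phi>" by blast
  qed
qed

end
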